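(* Let $\{L_t^x, (x,t)\in\mathbb{R}\times\mathbb{R}_+\}$ denote the local time of (standard, real-valued) Brownian motion. Then for every $p\ge 1$ and every $t\in\mathbb{R}_+$, almost surely, $$\lim_{h\downarrow 0}\int_a^b\left|\frac{L_t^{x+h}-L_t^x}{h^{1/2}}\right|^p dx=\frac{2^{3p/2}}{\sqrt{\pi}}\,\Gamma\!\left(\frac{p+1}{2}\right)\int_a^b|L_t^x|^{p/2}\,dx$$ for all $a<b$ in the extended real line $[-\infty,\infty]$.
   Context: $\mathbb{R}_+=[0,\infty)$. The local time is the jointly continuous version, normalized as the occupation density with respect to Lebesgue measure: $\int_0^t f(B_s)\,ds=\int_{\mathbb{R}} f(x)L_t^x\,dx$ for all bounded Borel $f$ and all $t\ge 0$, where $B$ is Brownian motion with characteristic function $Ee^{i\lambda B_t}=e^{-t\lambda^2/2}$. *)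

theory Defs
  imports "HOL-Probability.Probability"
begin

text \<open>
  Time is the half-line \<open>[0, \<infinity>)\<close>; the values of processes at negative times are
  irrelevant and unconstrained. The second parameter of \<^const>\<open>normal_density\<close> is the
  standard deviation, so \<open>B t\<close> has characteristic function \<open>\<lambda>u. exp (- t * u\<^sup>2 / 2)\<close>.
\<close>

locale brownian_motion = prob_space M for M :: "'w measure" +
  fixes B :: "real \<Rightarrow> 'w \<Rightarrow> real"
  assumes measurable_process: "\<And>t. 0 \<le> t \<Longrightarrow> B t \<in> borel_measurable M"
    and starts_at_zero: "AE \<omega> in M. B 0 \<omega> = 0"
    and independent_increments:
      "\<And>(n::nat) \<tau>. 0 \<le> \<tau> 0 \<Longrightarrow> (\<And>i. i < n \<Longrightarrow> \<tau> i \<le> \<tau> (Suc i)) \<Longrightarrow>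
        indep_vars (\<lambda>_. borel) (\<lambda>i \<omega>. B (\<tau> (Suc i)) \<omega> - B (\<tau> i) \<omega>) {..<n}"
    and gaussian_increments:
      "\<And>s t. 0 \<le> s \<Longrightarrow> s < t \<Longrightarrow>
        distributed M lborel (\<lambda>\<omega>. B t \<omega> - B s \<omega>) (normal_density 0 (sqrt (t - s)))"
    and continuous_paths: "AE \<omega> in M. continuous_on {0..} (\<lambda>t. B t \<omega>)"

text \<open>
  \<open>L x t\<close> is the local time at level \<open>x\<close> and time \<open>t\<close>. The exceptional null set in the
  occupation formula depends neither on \<open>t\<close> nor on \<open>f\<close>. Taking \<open>f\<close> to be constant or the
  indicator of a bounded interval shows that the conventional value \<open>0\<close> of a divergent
  Bochner integral plays no role here.
\<close>

locale brownian_local_time = brownian_motion M B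
  for M :: "'w measure" and B :: "real \<Rightarrow> 'w \<Rightarrow> real" +
  fixes L :: "real \<Rightarrow> real \<Rightarrow> 'w \<Rightarrow> real"
  assumes measurable_local_time: "\<And>x t. 0 \<le> t \<Longrightarrow> L x t \<in> borel_measurable M"
    and jointly_continuous:
      "AE \<omega> in M. continuous_on (UNIV \<times> {0..}) (\<lambda>(x, t). L x t \<omega>)"
    and occupation_density:
      "AE \<omega> in M. \<forall>t\<ge>0. \<forall>f :: real \<Rightarrow> real. f \<in> borel_measurable borel \<longrightarrow> bounded (range f) \<longrightarrow>
        (LBINT s:{0..t}. f (B s \<omega>)) = (LBINT x. f x * L x t \<omega>)"

end

theory Submission
 imports Defs "HOL-Real_Asymp.Real_Asymp"
begin

text \<open>
  Fix \<open>t\<close> and write \<open>Z\<^sub>h x = (L (x + h) t - L x t) / sqrt h\<close>. Locally in space, Brownian local time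
  has quadratic variation \<open>4 * L x t\<close>, so \<open>Z\<^sub>h x\<close> should behave like \<open>2 * sqrt (L x t) * \<xi>\<close> with an
  independent standard Gaussian \<open>\<xi>\<close>, and a law of large numbers in \<open>x\<close> should replace the power
  \<open>\<bar>Z\<^sub>h\<bar> powr p\<close> under the integral by its conditional mean, which is the constant of the theorem times
  \<open>L x t powr (p / 2)\<close>.

  Powers are reduced to characters by writing \<open>\<bar>z\<bar> powr p\<close> as a mixture, over the frequencies
  \<open>\<theta>\<close> with weight \<open>\<theta> powr (- 1 - p)\<close>, of \<open>(1 - cos (\<theta> * z)) ^ m\<close> with \<open>m > p\<close>
  (\<open>power_representation\<close>); applied to \<open>2 * sqrt l * \<xi>\<close> and averaged over \<open>\<xi>\<close> the same mixture
  yields the constant (\<open>gauss_representation\<close>). It remains to show, with rates, that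
  \<open>cos (\<mu> * Z\<^sub>h x) - exp (- 2 * \<mu>\<^sup>2 * L x t)\<close> integrates to almost nothing over a bounded interval.

  This is a second moment estimate, hence a statement about local times at the four points
  \<open>x\<close>, \<open>x + h\<close>, \<open>y\<close>, \<open>y + h\<close>. At an independent exponential time of rate 1/2 the
  resolvent of Brownian motion has the kernel \<open>exp (- \<bar>x - y\<bar>)\<close>, and the Markov property gives a
  Feynman-Kac identity (\<open>Gam_identity\<close>): the expectations of exponentials of local times at finitely many
  points solve a linear system with coefficients from this kernel (\<open>point_system\<close>). In that system a pair of
  opposite weights \<open>i * \<mu> / sqrt h\<close> at \<open>x\<close> and \<open>x + h\<close>, which produces the cosine, acts up to
  \<open>O (sqrt h)\<close> as the single weight \<open>2 * \<mu>\<^sup>2\<close> at \<open>x\<close>, which produces the exponential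
  (\<open>pair_system_compare\<close>). So the covariances are small away from the diagonal (\<open>FF_covariance\<close>), and
  moment bounds for time increments carry the estimate over to a fixed time (\<open>XX_second_moment\<close>).

  Integrating over frequencies bounds the distance in mean between the two sides of the theorem by a power of
  \<open>h\<close> (\<open>rate_defect_L1\<close>), so there is almost sure convergence along \<open>h = 1 / (k + 1) ^ 512\<close> for all
  rational endpoints. Local time is Hoelder continuous in space with every exponent below 1/2
  (\<open>local_time_holder\<close>), which fills in the other values of \<open>h\<close> (\<open>rate_interpolation\<close>). Monotonicity
  in the interval and compact support give all endpoints.
\<close>

section \<open>The resolvent kernel at rate 1/2\<close>

text \<open>Gaussian distribution functions provide antiderivatives, in time, of the exponentially weighted heat kernel.\<close>

lemma std_normal_cdf_has_derivative:
 "DERIV (cdf std_normal_distribution) u :> std_normal_density u"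
proof -
 interpret real_distribution std_normal_distribution
  by (rule real_dist_normal_dist)
 let ?a = "u - 1" and ?b = "u + 1"
 have cont: "continuous_on {?a..?b} std_normal_density"
  unfolding normal_density_def by (intro continuous_intros) auto
 have D: "((\<lambda>v. integral {?a..v} std_normal_density) has_real_derivative std_normal_density u) (at u within {?a..?b})"
  by (rule integral_has_real_derivative[OF cont]) auto
 have at: "at u within {?a..?b} = at u"
  by (rule at_within_interior) auto
 have eq: "cdf std_normal_distribution v = cdf std_normal_distribution ?a + integral {?a..v} std_normal_density"
  if "v \<in> {?a<..<?b}" for v
 proof -
  have "cdf std_normal_distribution v - cdf std_normal_distribution ?a = measure std_normal_distribution {?a<..v}"
   using that by (intro cdf_diff_eq) auto
  also have "\<dots> = (LINT x|std_normal_distribution. indicator {?a<..v} x)"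
   by simp
  also have "\<dots> = (LINT x|lborel. std_normal_density x *\<^sub>R indicator {?a<..v} x)"
   by (subst integral_density) (auto intro: normal_density_nonneg)
  also have "\<dots> = (LINT x:{?a..v}|lborel. std_normal_density x)"
   unfolding set_lebesgue_integral_def
   by (intro integral_cong_AE) (use AE_lborel_singleton[of ?a] in \<open>auto split: split_indicator\<close>)
  also have "\<dots> = integral {?a..v} std_normal_density"
   by (intro set_borel_integral_eq_integral borel_integrable_atLeastAtMost'
    continuous_on_subset[OF cont]) (use that in auto)
  finally show ?thesis by simp
 qed
 have "((\<lambda>v. cdf std_normal_distribution ?a + integral {?a..v} std_normal_density) has_real_derivative std_normal_density u) (at u)"
  using D unfolding at by (auto intro!: derivative_eq_intros)
 then show ?thesis
  by (rule has_field_derivative_transform_within_open[where S="{?a<..<?b}"]) (use eq in auto)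
qed

text \<open>kernel\<close>

text \<open>The integrand has an explicit antiderivative in \<open>s\<close>, a combination of exponentials and Gaussian distribution functions, so the integral follows from its limits at 0 and at infinity.\<close>

lemma resolvent_kernel_pos:
 fixes x :: real
 assumes "0 \<le> x"
 shows "set_integrable lborel {0<..} (\<lambda>s. exp (-s/2) * normal_density 0 (sqrt s) x)"
  and "(LBINT s:{0<..}. exp (-s/2) * normal_density 0 (sqrt s) x) = exp (-x)"
proof -
 interpret real_distribution std_normal_distribution
  by (rule real_dist_normal_dist)
 let ?P = "cdf std_normal_distribution"
 let ?F = "\<lambda>s. exp (-x) * ?P (sqrt s - x / sqrt s) - exp x * ?P (- sqrt s - x / sqrt s)"
 let ?f = "\<lambda>s. exp (-s/2) * normal_density 0 (sqrt s) x"
 have D: "DERIV ?F s :> ?f s" if "0 < s" for s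
 proof -
  define r where "r = sqrt s"
  have r: "0 < r" "s = r\<^sup>2" using that by (auto simp: r_def)
  have ds: "(sqrt has_real_derivative (1 / (2 * r))) (at s)"
   using DERIV_real_sqrt[OF that] by (simp add: r_def field_simps)
  have d1: "((\<lambda>s. sqrt s - x / sqrt s) has_real_derivative (1 / (2 * r) + x / (2 * r^3))) (at s)"
   using r by (auto intro!: derivative_eq_intros ds simp: power2_eq_square power3_eq_cube field_simps)
  have d2: "((\<lambda>s. - sqrt s - x / sqrt s) has_real_derivative (- 1 / (2 * r) + x / (2 * r^3))) (at s)"
   using r by (auto intro!: derivative_eq_intros ds simp: power2_eq_square power3_eq_cube field_simps)
  have "DERIV ?F s :> exp (-x) * (std_normal_density (r - x / r) * (1 / (2 * r) + x / (2 * r^3)))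
    - exp x * (std_normal_density (- r - x / r) * (- 1 / (2 * r) + x / (2 * r^3)))"
   unfolding r_def
   by (intro DERIV_diff DERIV_cmult DERIV_chain2[OF std_normal_cdf_has_derivative]
    d1[unfolded r_def] d2[unfolded r_def])
  also have "exp (-x) * (std_normal_density (r - x / r) * (1 / (2 * r) + x / (2 * r^3)))
    - exp x * (std_normal_density (- r - x / r) * (- 1 / (2 * r) + x / (2 * r^3))) = ?f s"
  proof -
   have e1: "exp (-x) * std_normal_density (r - x / r) = exp (-(r\<^sup>2 + (x/r)\<^sup>2)/2) / sqrt (2 * pi)"
    unfolding normal_density_def
    using r by (simp add: mult_exp_exp) (simp add: power2_eq_square field_simps)
   have e2: "exp x * std_normal_density (- r - x / r) = exp (-(r\<^sup>2 + (x/r)\<^sup>2)/2) / sqrt (2 * pi)"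
    unfolding normal_density_def
    using r by (simp add: mult_exp_exp) (simp add: power2_eq_square field_simps)
   have e3: "?f s = exp (-(r\<^sup>2 + (x/r)\<^sup>2)/2) / sqrt (2 * pi) / r"
    unfolding normal_density_def
    using r by (simp add: mult_exp_exp real_sqrt_mult) (simp add: power2_eq_square field_simps)
   show ?thesis unfolding e3 mult.assoc[symmetric] e1 e2
    using r by (simp add: field_simps)
  qed
  finally show ?thesis .
 qed
 have C: "isCont ?f s" if "0 < s" for s
  unfolding normal_density_def using that by (auto intro!: continuous_intros)
 have B: "(?F \<longlongrightarrow> exp (-x) * 1 - exp x * 0) at_top"
 proof (intro tendsto_intros)
  show "((\<lambda>s. ?P (sqrt s - x / sqrt s)) \<longlongrightarrow> 1) at_top"
   by (rule filterlim_compose[OF cdf_lim_at_top_prob]) real_asymp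
  show "((\<lambda>s. ?P (- sqrt s - x / sqrt s)) \<longlongrightarrow> 0) at_top"
   by (rule filterlim_compose[OF cdf_lim_at_bot]) real_asymp
 qed
 have A: "(?F \<longlongrightarrow> 0) (at_right 0)"
 proof (cases "x = 0")
  case True
  have c: "isCont ?P 0" by (rule DERIV_isCont[OF std_normal_cdf_has_derivative])
  have "((\<lambda>s. ?P (sqrt s)) \<longlongrightarrow> ?P 0) (at_right 0)"
   by (rule isCont_tendsto_compose[OF c]) real_asymp
  moreover have "((\<lambda>s. ?P (-sqrt s)) \<longlongrightarrow> ?P 0) (at_right 0)"
   by (rule isCont_tendsto_compose[OF c]) real_asymp
  ultimately have "((\<lambda>s. ?P (sqrt s) - ?P (- sqrt s)) \<longlongrightarrow> ?P 0 - ?P 0) (at_right 0)"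
   by (rule tendsto_diff)
  then show ?thesis using True by simp
 next
  case False
  then have "0 < x" using assms by simp
  have "(?F \<longlongrightarrow> exp (-x) * 0 - exp x * 0) (at_right 0)"
  proof (intro tendsto_intros)
   show "((\<lambda>s. ?P (sqrt s - x / sqrt s)) \<longlongrightarrow> 0) (at_right 0)"
    by (rule filterlim_compose[OF cdf_lim_at_bot]) (use \<open>0 < x\<close> in real_asymp)
   show "((\<lambda>s. ?P (- sqrt s - x / sqrt s)) \<longlongrightarrow> 0) (at_right 0)"
    by (rule filterlim_compose[OF cdf_lim_at_bot]) (use \<open>0 < x\<close> in real_asymp)
  qed
  then show ?thesis by simp
 qed
 have ein: "einterval 0 \<infinity> = {0::real<..}"
  by (auto simp: einterval_def zero_ereal_def)
 have "set_integrable lborel (einterval 0 \<infinity>) ?f \<and> (LBINT s=0..\<infinity>. ?f s) = exp (-x) - 0"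
  by (intro conjI interval_integral_FTC_nonneg[of 0 \<infinity> ?F ?f])
    (use A B D C in \<open>auto simp: zero_ereal_def ereal_tendsto_simps\<close>)
 then show "set_integrable lborel {0<..} ?f" "(LBINT s:{0<..}. ?f s) = exp (-x)"
  unfolding interval_lebesgue_integral_def ein by auto
qed

text \<open>The rate 1/2 is chosen because it makes the resolvent kernel exactly \<open>exp (- \<bar>x\<bar>)\<close>, with value 1 on the diagonal.\<close>

lemma resolvent_kernel:
 fixes x :: real
 shows "set_integrable lborel {0<..} (\<lambda>s. exp (-s/2) * normal_density 0 (sqrt s) x)"
  and "(LBINT s:{0<..}. exp (-s/2) * normal_density 0 (sqrt s) x) = exp (-\<bar>x\<bar>)"
proof -
 have "normal_density 0 (sqrt s) x = normal_density 0 (sqrt s) \<bar>x\<bar>" for s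
  by (simp add: normal_density_def)
 then show "set_integrable lborel {0<..} (\<lambda>s. exp (-s/2) * normal_density 0 (sqrt s) x)"
  "(LBINT s:{0<..}. exp (-s/2) * normal_density 0 (sqrt s) x) = exp (-\<bar>x\<bar>)"
  using resolvent_kernel_pos[of "\<bar>x\<bar>"] by auto
qed

section \<open>Continuous Brownian motion and the Markov property on a grid\<close>

text \<open>A process with continuous paths is the pointwise limit of its discretisations in time, which are jointly measurable.\<close>

lemma borel_measurable_continuous_process:
 fixes X :: "real \<Rightarrow> 'w \<Rightarrow> 'b::metric_space"
 assumes m: "\<And>s. X s \<in> borel_measurable M"
  and c: "\<And>w. continuous_on UNIV (\<lambda>s. X s w)"
 shows "(\<lambda>(s, w). X s w) \<in> borel_measurable (borel \<Otimes>\<^sub>M M)"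
proof -
 have "(\<lambda>p. X (fst p) (snd p)) \<in> borel_measurable (borel \<Otimes>\<^sub>M M)"
 proof (rule borel_measurable_LIMSEQ_metric)
  fix n :: nat
  have [measurable]: "(\<lambda>p. \<lfloor>real n * fst p\<rfloor>) \<in> measurable (borel \<Otimes>\<^sub>M M) (count_space UNIV)"
   by measurable
  show "(\<lambda>p. X (real_of_int \<lfloor>real n * fst p\<rfloor> / real n) (snd p)) \<in> borel_measurable (borel \<Otimes>\<^sub>M M)"
   by (rule measurable_compose_countable[of "\<lambda>i p. X (real_of_int i / real n) (snd p)" _ _ "\<lambda>p. \<lfloor>real n * fst p\<rfloor>"])
    (auto intro: measurable_compose[OF measurable_snd m])
 next
  fix p :: "real \<times> 'w"
  have "(\<lambda>n. real_of_int \<lfloor>real n * fst p\<rfloor> / real n) \<longlonglongrightarrow> fst p"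
   by real_asymp
  then show "(\<lambda>n. X (real_of_int \<lfloor>real n * fst p\<rfloor> / real n) (snd p)) \<longlonglongrightarrow> X (fst p) (snd p)"
   by (rule continuous_on_tendsto_compose[OF c]) auto
 qed
 then show ?thesis by (simp add: case_prod_beta')
qed

lemma riemann_sum_tendsto:
 fixes \<phi> :: "real \<Rightarrow> complex"
 assumes c: "continuous_on {0..r} \<phi>" and r: "0 \<le> r"
 shows "(\<lambda>n::nat. (\<Sum>i<n. complex_of_real (r / real n) * \<phi> (real i * r / real n))) \<longlonglongrightarrow> (LBINT u:{0..r}. \<phi> u)"
proof -
 have uc: "uniformly_continuous_on {0..r} \<phi>"
  by (rule compact_uniformly_continuous[OF c]) auto
 have eq: "(LBINT u:{0..r}. \<phi> u) = integral {0..r} \<phi>"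
  by (intro set_borel_integral_eq_integral borel_integrable_atLeastAtMost' c)
 have intg: "\<phi> integrable_on {a..b}" if "0 \<le> a" "b \<le> r" for a b
  by (rule integrable_continuous_real[OF continuous_on_subset[OF c]]) (use that in auto)
 have split: "integral {0..real k * r / real n} \<phi> = (\<Sum>i<k. integral {real i * r / real n..real (Suc i) * r / real n} \<phi>)"
  if "k \<le> n" "0 < n" for k n :: nat
  using that
 proof (induction k)
  case (Suc k)
  have "integral {0..real k * r / real n} \<phi> + integral {real k * r / real n..real (Suc k) * r / real n} \<phi>
   = integral {0..real (Suc k) * r / real n} \<phi>"
  proof (rule Henstock_Kurzweil_Integration.integral_combine)
   have "real (Suc k) * r \<le> real n * r" using Suc.prems r by (intro mult_right_mono) auto
   then have "real (Suc k) * r / real n \<le> r" using Suc.prems by (simp add: field_simps)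
   then show "\<phi> integrable_on {0..real (Suc k) * r / real n}" by (intro intg) auto
  qed (use r Suc.prems in \<open>auto intro!: divide_right_mono mult_right_mono\<close>)
  then show ?case using Suc by simp
 qed auto
 show ?thesis unfolding eq
 proof (rule metric_LIMSEQ_I)
  fix e :: real assume e: "0 < e"
  define e' where "e' = e / (r + 1)"
  have e': "0 < e'" "e' * r < e" using e r by (auto simp: e'_def field_simps)
  from uc e'(1) obtain d where d: "0 < d"
   "\<And>x y. x \<in> {0..r} \<Longrightarrow> y \<in> {0..r} \<Longrightarrow> dist x y < d \<Longrightarrow> dist (\<phi> x) (\<phi> y) < e'"
   unfolding uniformly_continuous_on_def by metis
  obtain N :: nat where N: "r / d < real N" using reals_Archimedean2 by blast
  have "dist (\<Sum>i<n. complex_of_real (r / real n) * \<phi> (real i * r / real n)) (integral {0..r} \<phi>) < e"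
   if n: "n \<ge> Suc N" for n
  proof -
   have n0: "0 < n" using n by simp
   have "r / d < real n" using N n by linarith
   then have step: "r / n < d" using d n0 by (simp add: field_simps)
   have cell: "norm (complex_of_real (r / real n) * \<phi> (real i * r / real n) - integral {real i * r / real n..real (Suc i) * r / real n} \<phi>) \<le> e' * (r / n)"
    if i: "i < n" for i
   proof -
    let ?a = "real i * r / real n" and ?b = "real (Suc i) * r / real n"
    have ab: "?b - ?a = r / n" by (simp add: algebra_simps add_divide_distrib)
    have le: "?a \<le> ?b" using ab r n0 by (smt (verit) divide_nonneg_nonneg of_nat_0_le_iff)
    have "real (Suc i) * r \<le> real n * r" using i r by (intro mult_right_mono) auto
    then have br: "?b \<le> r" using n0 by (simp add: field_simps)
    have a0: "0 \<le> ?a" using r by simp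
    have I1: "\<phi> integrable_on {?a..?b}" by (rule intg[OF a0 br])
    have "complex_of_real (r / n) * \<phi> ?a = integral {?a..?b} (\<lambda>_. \<phi> ?a)"
    using le ab by (simp add: scaleR_conv_of_real del: of_nat_Suc)
    then have "complex_of_real (r / n) * \<phi> ?a - integral {?a..?b} \<phi> = integral {?a..?b} (\<lambda>u. \<phi> ?a - \<phi> u)"
    using Henstock_Kurzweil_Integration.integral_diff[OF integrable_const_ivl I1, of "\<phi> ?a"] by (simp only:)
    also have "norm \<dots> \<le> e' * (?b - ?a)"
    proof (rule integral_bound[OF le])
    show "continuous_on {?a..?b} (\<lambda>u. \<phi> ?a - \<phi> u)"
    by (intro continuous_intros continuous_on_subset[OF c]) (use a0 br in auto)
    fix u assume u: "u \<in> {?a..?b}"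
    have "dist (\<phi> ?a) (\<phi> u) < e'"
    using u a0 br le ab step by (intro d(2)) (auto simp: dist_real_def simp del: of_nat_Suc)
    then show "norm (\<phi> ?a - \<phi> u) \<le> e'" by (simp add: dist_norm)
    qed
    finally show ?thesis unfolding ab .
   qed
   have "integral {0..r} \<phi> = (\<Sum>i<n. integral {real i * r / real n..real (Suc i) * r / real n} \<phi>)"
    using split[of n n] n0 by simp
   then have "dist (\<Sum>i<n. complex_of_real (r / real n) * \<phi> (real i * r / real n)) (integral {0..r} \<phi>)
    = norm (\<Sum>i<n. complex_of_real (r / real n) * \<phi> (real i * r / real n) - integral {real i * r / real n..real (Suc i) * r / real n} \<phi>)"
    by (simp add: dist_norm sum_subtractf)
   also have "\<dots> \<le> (\<Sum>i<n. e' * (r / n))"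
    by (rule order_trans[OF norm_sum]) (intro sum_mono cell, simp)
   also have "\<dots> = e' * r" using n0 by simp
   also have "\<dots> < e" by (rule e'(2))
   finally show ?thesis .
  qed
  then show "\<exists>N. \<forall>n\<ge>N. dist (\<Sum>i<n. complex_of_real (r / real n) * \<phi> (real i * r / real n)) (integral {0..r} \<phi>) < e"
   by blast
 qed
qed

lemma distributed_integral_banach:
 fixes g :: "real \<Rightarrow> 'b::{banach, second_countable_topology}"
 assumes D: "distributed M lborel X (\<lambda>x. ennreal (p x))" and g: "g \<in> borel_measurable borel"
  and p: "p \<in> borel_measurable borel" "\<And>x. 0 \<le> p x"
 shows "(LINT w|M. g (X w)) = (LBINT y. p y *\<^sub>R g y)"
proof -
 have X: "X \<in> measurable M lborel" using D by (simp add: distributed_def)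
 have "(LINT w|M. g (X w)) = (LINT y|distr M lborel X. g y)"
  using X g by (subst integral_distr) auto
 also have "distr M lborel X = density lborel (\<lambda>x. ennreal (p x))"
  using D by (rule distributed_distr_eq_density)
 also have "(LINT y|density lborel (\<lambda>x. ennreal (p x)). g y) = (LBINT y. p y *\<^sub>R g y)"
  using p g by (intro integral_density) auto
 finally show ?thesis .
qed

text \<open>Brownian motion with all path properties required everywhere instead of almost everywhere. This removes exceptional sets from the analysis; \<open>regular_version_exists\<close> justifies it.\<close>

locale cont_bm = prob_space M for M :: "'w measure" +
 fixes B :: "real \<Rightarrow> 'w \<Rightarrow> real"
 assumes B_meas: "\<And>s. B s \<in> borel_measurable M"
  and B_zero: "\<And>w. B 0 w = 0"
  and B_indep:
   "\<And>(n::nat) \<tau>. 0 \<le> \<tau> 0 \<Longrightarrow> (\<And>i. i < n \<Longrightarrow> \<tau> i \<le> \<tau> (Suc i)) \<Longrightarrow>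
    indep_vars (\<lambda>_. borel) (\<lambda>i w. B (\<tau> (Suc i)) w - B (\<tau> i) w) {..<n}"
  and B_gauss:
   "\<And>s t. 0 \<le> s \<Longrightarrow> s < t \<Longrightarrow>
    distributed M lborel (\<lambda>w. B t w - B s w) (normal_density 0 (sqrt (t - s)))"
  and B_cont: "\<And>w. continuous_on UNIV (\<lambda>t. B t w)"
begin

lemma B_joint [measurable]: "(\<lambda>(s, w). B s w) \<in> borel_measurable (borel \<Otimes>\<^sub>M M)"
 by (rule borel_measurable_continuous_process[OF B_meas B_cont])

lemma B_joint_compose [measurable]:
 "g \<in> borel_measurable N \<Longrightarrow> h \<in> measurable N M \<Longrightarrow> (\<lambda>x. B (g x) (h x)) \<in> borel_measurable N"
 using measurable_compose[OF measurable_Pair B_joint, of g N h] by simp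

lemma cont_comp_B: "continuous_on UNIV \<phi> \<Longrightarrow> continuous_on S (\<lambda>s. \<phi> (B s w))"
 by (rule continuous_on_compose2[of UNIV \<phi>]) (auto intro: continuous_on_subset[OF B_cont])

text \<open>The additive functional of the path that local time disintegrates: occupation integrals of a complex function.\<close>

definition AF :: "(real \<Rightarrow> complex) \<Rightarrow> real \<Rightarrow> 'w \<Rightarrow> complex" where
 "AF U r w = (LBINT u:{0..r}. U (B u w))"

text \<open>discrete Markov property\<close>

text \<open>The increment after time \<open>r\<close> is independent of the finitely many increments before it, and grid values up to \<open>r\<close> are sums of the latter.\<close>

lemma markov_discrete:
 fixes F :: "(nat \<Rightarrow> real) \<Rightarrow> complex" and f :: "real \<Rightarrow> complex"
 assumes rs: "0 \<le> r" "r < s" and n: "0 < n"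
  and F: "F \<in> borel_measurable (PiM {..n} (\<lambda>_. borel))"
  and f: "f \<in> borel_measurable borel"
  and KF: "\<And>x. norm (F x) \<le> K" and Kf: "\<And>x. norm (f x) \<le> K'"
 shows "(LINT \<omega>|M. F (\<lambda>i\<in>{..n}. B (real i * r / n) \<omega>) * f (B s \<omega>))
  = (LINT \<omega>|M. F (\<lambda>i\<in>{..n}. B (real i * r / n) \<omega>) * (LBINT y. normal_density 0 (sqrt (s - r)) y * f (B r \<omega> + y)))"
proof -
 define \<tau> where "\<tau> i = (if i \<le> n then real i * r / n else s)" for i
 define X where "X i \<omega> = B (\<tau> (Suc i)) \<omega> - B (\<tau> i) \<omega>" for i \<omega>
 define Y where "Y \<omega> = (\<lambda>i\<in>{..<n}. X i \<omega>)" for \<omega>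
 define W where "W \<omega> = (\<lambda>i\<in>{n}. X i \<omega>)" for \<omega>
 define H where "H y = F (\<lambda>i\<in>{..n}. \<Sum>j<i. y j)" for y :: "nat \<Rightarrow> real"
 let ?p = "normal_density 0 (sqrt (s - r))"
 have \<tau>n: "\<tau> n = r" using n by (simp add: \<tau>_def)
 have mono: "\<tau> i \<le> \<tau> (Suc i)" if "i < Suc n" for i
 proof (cases "i = n")
  case True then show ?thesis using rs n by (simp add: \<tau>_def)
 next
  case False
  then show ?thesis using that rs n by (auto simp: \<tau>_def intro!: divide_right_mono mult_right_mono)
 qed
 have ind: "indep_vars (\<lambda>_. borel) X {..<Suc n}"
  unfolding X_def by (rule B_indep) (use mono in \<open>auto simp: \<tau>_def\<close>)
 have ivar: "indep_var (PiM {..<n} (\<lambda>_. borel)) Y (PiM {n} (\<lambda>_. borel)) W"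
  unfolding Y_def W_def by (rule indep_var_restrict[OF ind]) auto
 have Bi: "B (real i * r / n) \<omega> = (\<Sum>j<i. Y \<omega> j)" if "i \<le> n" for i \<omega>
 proof -
  have "(\<Sum>j<i. Y \<omega> j) = (\<Sum>j<i. B (\<tau> (Suc j)) \<omega> - B (\<tau> j) \<omega>)"
   using that by (intro sum.cong) (auto simp: Y_def X_def)
  also have "\<dots> = B (\<tau> i) \<omega> - B (\<tau> 0) \<omega>" by (rule sum_lessThan_telescope)
  also have "\<dots> = B (real i * r / n) \<omega>" using that by (simp add: \<tau>_def B_zero)
  finally show ?thesis by simp
 qed
 have Fe: "F (\<lambda>i\<in>{..n}. B (real i * r / n) \<omega>) = H (Y \<omega>)" for \<omega>
  unfolding H_def by (rule arg_cong[of _ _ F]) (auto simp: fun_eq_iff Bi)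
 have Br: "B r \<omega> = (\<Sum>j<n. Y \<omega> j)" for \<omega> using Bi[of n \<omega>] n by simp
 have Bs: "B s \<omega> = B r \<omega> + W \<omega> n" for \<omega>
  by (simp add: W_def X_def \<tau>n) (simp add: \<tau>_def)
 have HM [measurable]: "H \<in> borel_measurable (PiM {..<n} (\<lambda>_. borel))"
  unfolding H_def by (rule measurable_compose[OF _ F]) (auto intro!: measurable_restrict borel_measurable_sum)
 have SM [measurable]: "(\<lambda>y. \<Sum>j<n. y j :: real) \<in> borel_measurable (PiM {..<n} (\<lambda>_. borel))"
  by (auto intro!: borel_measurable_sum)
 note f[measurable]
 have rY [measurable]: "random_variable (PiM {..<n} (\<lambda>_. borel)) Y"
  and rW [measurable]: "random_variable (PiM {n} (\<lambda>_. borel)) W"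
  and pr: "distr M (PiM {..<n} (\<lambda>_. borel)) Y \<Otimes>\<^sub>M distr M (PiM {n} (\<lambda>_. borel)) W
   = distr M (PiM {..<n} (\<lambda>_. borel) \<Otimes>\<^sub>M PiM {n} (\<lambda>_. borel)) (\<lambda>x. (Y x, W x))"
  using ivar unfolding indep_var_distribution_eq by auto
 interpret DY: prob_space "distr M (PiM {..<n} (\<lambda>_. borel)) Y" by (rule prob_space_distr) simp
 interpret DW: prob_space "distr M (PiM {n} (\<lambda>_. borel)) W" by (rule prob_space_distr) simp
 interpret P: pair_prob_space "distr M (PiM {..<n} (\<lambda>_. borel)) Y" "distr M (PiM {n} (\<lambda>_. borel)) W" ..
 let ?g = "\<lambda>(y, w). H y * f ((\<Sum>j<n. y j) + w n)"
 have gm [measurable]: "?g \<in> borel_measurable (PiM {..<n} (\<lambda>_. borel) \<Otimes>\<^sub>M PiM {n} (\<lambda>_. borel))"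
  by measurable
 have "(LINT \<omega>|M. F (\<lambda>i\<in>{..n}. B (real i * r / n) \<omega>) * f (B s \<omega>)) = (LINT \<omega>|M. ?g (Y \<omega>, W \<omega>))"
  by (simp add: Fe Bs Br)
 also have "\<dots> = (LINT z|(distr M (PiM {..<n} (\<lambda>_. borel)) Y \<Otimes>\<^sub>M distr M (PiM {n} (\<lambda>_. borel)) W). ?g z)"
  unfolding pr by (subst integral_distr) auto
 also have "\<dots> = (LINT y|distr M (PiM {..<n} (\<lambda>_. borel)) Y. LINT w|distr M (PiM {n} (\<lambda>_. borel)) W. ?g (y, w))"
 proof (rule P.integral_fst'[symmetric], rule P.integrable_const_bound)
  show "AE z in (distr M (PiM {..<n} (\<lambda>_. borel)) Y \<Otimes>\<^sub>M distr M (PiM {n} (\<lambda>_. borel)) W). norm (?g z) \<le> K * K'"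
   using KF Kf by (intro AE_I2)
    (auto simp: norm_mult H_def intro!: mult_mono order_trans[OF norm_ge_zero KF])
 qed simp
 also have "\<dots> = (LINT \<omega>|M. LINT w|distr M (PiM {n} (\<lambda>_. borel)) W. ?g (Y \<omega>, w))"
  by (subst integral_distr) auto
 also have "\<dots> = (LINT \<omega>|M. H (Y \<omega>) * (LBINT y. ?p y * f (B r \<omega> + y)))"
 proof (rule Bochner_Integration.integral_cong[OF refl])
  fix \<omega>
  have "(LINT w|distr M (PiM {n} (\<lambda>_. borel)) W. ?g (Y \<omega>, w)) = H (Y \<omega>) * (LINT w|distr M (PiM {n} (\<lambda>_. borel)) W. f (B r \<omega> + w n))"
   by (simp add: Br)
  also have "(LINT w|distr M (PiM {n} (\<lambda>_. borel)) W. f (B r \<omega> + w n)) = (LINT \<omega>'|M. f (B r \<omega> + W \<omega>' n))"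
   by (subst integral_distr) auto
  also have "\<dots> = (LINT \<omega>'|M. f (B r \<omega> + (B s \<omega>' - B r \<omega>')))" by (simp add: Bs)
  also have "\<dots> = (LBINT y. ?p y *\<^sub>R f (B r \<omega> + y))"
   by (rule distributed_integral_banach[OF B_gauss]) (use rs in auto)
  finally show "(LINT w|distr M (PiM {n} (\<lambda>_. borel)) W. ?g (Y \<omega>, w)) = H (Y \<omega>) * (LBINT y. ?p y * f (B r \<omega> + y))"
   by (simp add: scaleR_conv_of_real)
 qed
 finally show ?thesis by (simp add: Fe)
qed

end

section \<open>The Markov property for additive functionals\<close>

lemma (in pair_sigma_finite) Fubini_integral_dominated:
 fixes f :: "'a \<Rightarrow> 'b \<Rightarrow> 'c::{banach, second_countable_topology}" and g :: "'a \<Rightarrow> 'b \<Rightarrow> real"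
 assumes f: "(\<lambda>(x, y). f x y) \<in> borel_measurable (M1 \<Otimes>\<^sub>M M2)"
  and g: "integrable (M1 \<Otimes>\<^sub>M M2) (\<lambda>(x, y). g x y)"
  and le: "\<And>x y. norm (f x y) \<le> g x y"
 shows "(LINT x|M1. LINT y|M2. f x y) = (LINT y|M2. LINT x|M1. f x y)"
proof -
 have "integrable (M1 \<Otimes>\<^sub>M M2) (\<lambda>(x, y). f x y)"
  by (rule Bochner_Integration.integrable_bound[OF g f])
    (use le in \<open>auto intro!: AE_I2 order_trans[OF le] abs_ge_self\<close>)
 then show ?thesis by (rule Fubini_integral[symmetric])
qed

lemma (in pair_sigma_finite) integrable_mult_pair:
 fixes a b :: "_ \<Rightarrow> real"
 assumes a: "integrable M1 a" and b: "integrable M2 b"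
 shows "integrable (M1 \<Otimes>\<^sub>M M2) (\<lambda>(x, y). a x * b y)"
proof -
 have [measurable]: "a \<in> borel_measurable M1" "b \<in> borel_measurable M2" using a b by auto
 have "integrable M1 (\<lambda>x. \<bar>a x\<bar> * (LINT y|M2. \<bar>b y\<bar>))" using a by auto
 then show ?thesis using b
  by (intro Fubini_integrable) (auto simp: abs_mult)
qed

lemma laplace_exp_integrable: "integrable lborel (\<lambda>y::real. exp (- \<bar>y\<bar>))"
 and laplace_exp_integral: "(LBINT y::real. exp (- \<bar>y\<bar>)) = 2"
proof -
 have "(\<integral>\<^sup>+x. ennreal (x ^ 0 * exp (- x)) * indicator {0..} x \<partial>lborel) = real_of_nat (fact 0)"
  by (rule nn_intergal_power_times_exp_Ici)
 then have "has_bochner_integral lborel (\<lambda>x::real. indicator {0..} x *\<^sub>R exp (- \<bar>x\<bar>)) 1"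
  by (intro has_bochner_integral_nn_integral)
    (auto simp: nn_integral_set_ennreal indicator_def if_distrib cong: if_cong intro!: nn_integral_cong elim!: trans[rotated])
 then have "has_bochner_integral lborel (\<lambda>x::real. exp (- \<bar>x\<bar>)) (2 * 1)"
  using has_bochner_integral_even_function[of "\<lambda>x::real. exp (- \<bar>x\<bar>)" 1] by simp
 then show "integrable lborel (\<lambda>y::real. exp (- \<bar>y\<bar>))" "(LBINT y::real. exp (- \<bar>y\<bar>)) = 2"
  by (auto simp: has_bochner_integral_iff)
qed

lemma exp_Ici_integrable:
 fixes c :: real assumes "0 < c"
 shows "integrable lborel (\<lambda>s. indicator {0..} s * exp (- c * s))"
proof -
 have "integrable lborel (\<lambda>s::real. indicator {0..} s * exp (- \<bar>s\<bar>))"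
  using integrable_mult_indicator[OF _ laplace_exp_integrable, of "{0..}"] by simp
 from lborel_integrable_real_affine[OF this, of c 0]
 have "integrable lborel (\<lambda>s. indicator {0..} (c * s) * exp (- \<bar>c * s\<bar>))" using assms by simp
 also have "(\<lambda>s. indicator {0..} (c * s) * exp (- \<bar>c * s\<bar>)) = (\<lambda>s. indicator {0..} s * exp (- c * s))"
  using assms by (auto simp: fun_eq_iff indicator_def zero_le_mult_iff)
 finally show ?thesis .
qed

text \<open>The resolvent of Brownian motion at rate 1/2, of total mass 2.\<close>

definition Gop :: "(real \<Rightarrow> complex) \<Rightarrow> real \<Rightarrow> complex" where
 "Gop f z = (LBINT y. exp (- \<bar>y\<bar>) *\<^sub>R f (z + y))"

lemma Gop_integrable:
 fixes f :: "real \<Rightarrow> complex"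
 assumes f: "f \<in> borel_measurable borel" and K: "\<And>x. norm (f x) \<le> K"
 shows "integrable lborel (\<lambda>y. exp (- \<bar>y\<bar>) *\<^sub>R f (z + y))"
proof (rule Bochner_Integration.integrable_bound)
 show "integrable lborel (\<lambda>y::real. exp (- \<bar>y\<bar>) * K)" using laplace_exp_integrable by auto
 show "AE y in lborel. norm (exp (- \<bar>y\<bar>) *\<^sub>R f (z + y)) \<le> norm (exp (- \<bar>y\<bar>) * K)"
  using K order_trans[OF norm_ge_zero K] by (intro AE_I2) (auto intro!: mult_left_mono simp: abs_mult order_trans[OF K abs_ge_self])
qed (use f in measurable)

lemma Gop_bound:
 assumes f: "f \<in> borel_measurable borel" and K: "\<And>x. norm (f x) \<le> K"
 shows "norm (Gop f z) \<le> 2 * K"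
proof -
 have "norm (Gop f z) \<le> (LBINT y. norm (exp (- \<bar>y\<bar>) *\<^sub>R f (z + y)))"
  unfolding Gop_def by (rule integral_norm_bound)
 also have "\<dots> \<le> (LBINT y. exp (- \<bar>y\<bar>) * K)"
  by (rule integral_mono[OF integrable_norm[OF Gop_integrable[OF f K]]])
    (use laplace_exp_integrable K in \<open>auto intro!: mult_left_mono\<close>)
 also have "\<dots> = 2 * K" by (simp add: laplace_exp_integral)
 finally show ?thesis .
qed

lemma Gop_continuous:
 assumes f: "continuous_on UNIV f" and K: "\<And>x. norm (f x) \<le> K"
 shows "continuous_on UNIV (Gop f)"
proof -
 have fm[measurable]: "f \<in> borel_measurable borel" using f by (rule borel_measurable_continuous_onI)
 have "(Gop f \<circ> u) \<longlonglongrightarrow> Gop f z" if "u \<longlonglongrightarrow> z" for u :: "nat \<Rightarrow> real" and z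
  unfolding Gop_def comp_def
 proof (rule integral_dominated_convergence[where w="\<lambda>y. exp (- \<bar>y\<bar>) * K"])
  show "integrable lborel (\<lambda>y::real. exp (- \<bar>y\<bar>) * K)" using laplace_exp_integrable by auto
  show "AE y in lborel. (\<lambda>i. exp (- \<bar>y\<bar>) *\<^sub>R f (u i + y)) \<longlonglongrightarrow> exp (- \<bar>y\<bar>) *\<^sub>R f (z + y)"
   by (intro AE_I2 tendsto_intros continuous_on_tendsto_compose[OF f] that) auto
 qed (use K in \<open>auto intro!: mult_left_mono\<close>)
 then show ?thesis
  by (simp add: continuous_on_eq_continuous_at continuous_at_sequentially)
qed

context cont_bm begin

lemma AF_cont_in: "continuous_on UNIV U \<Longrightarrow> continuous_on {0..r} (\<lambda>u. U (B u w))"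
 by (rule cont_comp_B)

lemma AF_measurable [measurable (raw)]:
 assumes U: "continuous_on UNIV U" and g: "g \<in> borel_measurable N" and h: "h \<in> measurable N M"
 shows "(\<lambda>x. AF U (g x) (h x)) \<in> borel_measurable N"
proof -
 have [measurable]: "U \<in> borel_measurable borel" using U by (rule borel_measurable_continuous_onI)
 note g[measurable] h[measurable]
 have "(\<lambda>x. LBINT u. (if 0 \<le> u \<and> u \<le> g x then U (B u (h x)) else 0)) \<in> borel_measurable N"
  by (rule lborel.borel_measurable_lebesgue_integral) measurable
 then show ?thesis
  unfolding AF_def set_lebesgue_integral_def indicator_def
  by (simp add: if_distrib[of "\<lambda>a. a *\<^sub>R _"] cong: if_cong)
qed

lemma AF_bound:
 assumes U: "continuous_on UNIV U" and K: "\<And>x. norm (U x) \<le> K" and r: "0 \<le> r"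
 shows "norm (AF U r w) \<le> r * K"
proof -
 have c: "continuous_on {0..r} (\<lambda>u. U (B u w))" by (rule AF_cont_in[OF U])
 have "AF U r w = integral {0..r} (\<lambda>u. U (B u w))"
  unfolding AF_def by (intro set_borel_integral_eq_integral borel_integrable_atLeastAtMost' c)
 also have "norm \<dots> \<le> K * (r - 0)" by (rule integral_bound[OF r c]) (rule K)
 finally show ?thesis by (simp add: mult.commute)
qed

lemma AF_zero [simp]: "AF U 0 w = 0"
 unfolding AF_def set_lebesgue_integral_def
 by (rule integral_eq_zero_AE, rule eventually_mono[OF AE_lborel_singleton[of 0]]) auto

lemma compact_bound:
 fixes \<Phi> :: "complex \<Rightarrow> complex"
 assumes "continuous_on UNIV \<Phi>"
 obtains K where "\<And>z. norm z \<le> R \<Longrightarrow> norm (\<Phi> z) \<le> K"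
proof -
 have "compact (\<Phi> ` cball 0 R)"
  by (intro compact_continuous_image continuous_on_subset[OF assms]) auto
 then have "bounded (\<Phi> ` cball 0 R)" by (rule compact_imp_bounded)
 then obtain K where "\<forall>x\<in>\<Phi> ` cball 0 R. norm x \<le> K" unfolding bounded_iff by blast
 then show thesis by (intro that[of K]) auto
qed

text \<open>Occupation integrals up to time \<open>r\<close> are limits of Riemann sums over a grid, so the discrete Markov property passes to the limit by dominated convergence.\<close>

lemma markov:
 fixes \<Phi> :: "complex \<Rightarrow> complex" and \<psi> f U :: "real \<Rightarrow> complex"
 assumes rs: "0 \<le> r" "r < s"
  and U: "continuous_on UNIV U" and KU: "\<And>x. norm (U x) \<le> KU"
  and \<Phi>: "continuous_on UNIV \<Phi>"
  and \<psi>: "continuous_on UNIV \<psi>" and K\<psi>: "\<And>x. norm (\<psi> x) \<le> K\<psi>"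
  and f: "continuous_on UNIV f" and Kf: "\<And>x. norm (f x) \<le> Kf"
 shows "(LINT \<omega>|M. \<Phi> (AF U r \<omega>) * \<psi> (B r \<omega>) * f (B s \<omega>))
  = (LINT \<omega>|M. \<Phi> (AF U r \<omega>) * \<psi> (B r \<omega>) * (LBINT y. normal_density 0 (sqrt (s - r)) y *\<^sub>R f (B r \<omega> + y)))"
proof -
 have [measurable]: "U \<in> borel_measurable borel" "\<psi> \<in> borel_measurable borel" "f \<in> borel_measurable borel"
  "\<Phi> \<in> borel_measurable borel"
  using U \<psi> f \<Phi> by (auto intro: borel_measurable_continuous_onI)
 obtain K\<Phi> where K\<Phi>: "\<And>z. norm z \<le> r * KU \<Longrightarrow> norm (\<Phi> z) \<le> K\<Phi>"
  using compact_bound[OF \<Phi>] by blast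
 have KU0: "0 \<le> KU" and K\<psi>0: "0 \<le> K\<psi>" using order_trans[OF norm_ge_zero KU] order_trans[OF norm_ge_zero K\<psi>] by auto
 have K\<Phi>0: "0 \<le> K\<Phi>" using K\<Phi>[of 0] rs KU0 by (auto intro: order_trans[OF norm_ge_zero])
 let ?p = "normal_density 0 (sqrt (s - r))"
 define S where "S n x = (\<Sum>i<n. complex_of_real (r / real n) * U (x i))" for n and x :: "nat \<Rightarrow> real"
 define F where "F n x = \<Phi> (S n x) * \<psi> (x n)" for n and x :: "nat \<Rightarrow> real"
 let ?X = "\<lambda>n \<omega>. (\<lambda>i\<in>{..n}. B (real i * r / real n) \<omega>)"
 define Pf where "Pf z = (LBINT y. ?p y *\<^sub>R f (z + y))" for z
 have [measurable]: "Pf \<in> borel_measurable borel" unfolding Pf_def by measurable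
 have pd: "0 < sqrt (s - r)" using rs by simp
 have KPf: "norm (Pf z) \<le> Kf" for z
 proof -
  have ib: "integrable lborel (\<lambda>y. ?p y * Kf)" using integrable_normal_density[OF pd] by auto
  have i: "integrable lborel (\<lambda>y. norm (?p y *\<^sub>R f (z + y)))"
   by (rule Bochner_Integration.integrable_bound[OF ib])
    (use Kf in \<open>auto intro!: AE_I2 mult_left_mono simp: abs_mult normal_density_nonneg order_trans[OF Kf abs_ge_self]\<close>)
  have "norm (Pf z) \<le> (LBINT y. norm (?p y *\<^sub>R f (z + y)))" unfolding Pf_def by (rule integral_norm_bound)
  also have "\<dots> \<le> (LBINT y. ?p y * Kf)"
   by (rule integral_mono[OF i ib]) (use Kf in \<open>auto intro!: mult_left_mono simp: normal_density_nonneg\<close>)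
  also have "\<dots> = Kf" using pd by simp
  finally show ?thesis .
 qed
 have Sb: "norm (S n x) \<le> r * KU" for n x
 proof (cases "n = 0")
  case True then show ?thesis using rs KU0 by (simp add: S_def)
 next
  case False
  have "norm (S n x) \<le> (\<Sum>i<n. (r / real n) * KU)" unfolding S_def
  proof (rule order_trans[OF norm_sum], rule sum_mono)
   fix i show "norm (complex_of_real (r / real n) * U (x i)) \<le> (r / real n) * KU"
    unfolding norm_mult norm_of_real using rs KU by (auto intro!: divide_right_mono mult_left_mono)
  qed
  also have "\<dots> = r * KU" using False by simp
  finally show ?thesis .
 qed
 have Fb: "norm (F n x) \<le> K\<Phi> * K\<psi>" for n x
  unfolding F_def norm_mult using K\<Phi>[OF Sb] K\<psi> K\<Phi>0 by (intro mult_mono) auto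
 have Fm: "F n \<in> borel_measurable (PiM {..n} (\<lambda>_. borel))" for n
  unfolding F_def S_def by measurable
 have lim: "(\<lambda>n. F (Suc n) (?X (Suc n) \<omega>)) \<longlonglongrightarrow> \<Phi> (AF U r \<omega>) * \<psi> (B r \<omega>)" for \<omega>
 proof -
  have e1: "S (Suc n) (?X (Suc n) \<omega>) = (\<Sum>i<Suc n. complex_of_real (r / real (Suc n)) * U (B (real i * r / real (Suc n)) \<omega>))" for n
   unfolding S_def by (intro sum.cong) auto
  have "(\<lambda>n. S (Suc n) (?X (Suc n) \<omega>)) \<longlonglongrightarrow> AF U r \<omega>"
   unfolding e1 AF_def using riemann_sum_tendsto[OF AF_cont_in[OF U] rs(1), of \<omega>] by (rule LIMSEQ_Suc)
  then have "(\<lambda>n. \<Phi> (S (Suc n) (?X (Suc n) \<omega>))) \<longlonglongrightarrow> \<Phi> (AF U r \<omega>)"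
   by (rule continuous_on_tendsto_compose[OF \<Phi>]) auto
  then show ?thesis unfolding F_def
   by (auto intro!: tendsto_intros simp del: of_nat_Suc)
 qed
 have D: "(LINT \<omega>|M. F (Suc n) (?X (Suc n) \<omega>) * f (B s \<omega>)) = (LINT \<omega>|M. F (Suc n) (?X (Suc n) \<omega>) * Pf (B r \<omega>))" for n
  using markov_discrete[where f=f, OF rs zero_less_Suc[of n] Fm _ Fb Kf] unfolding Pf_def
  by (simp add: scaleR_conv_of_real)
 have Xm: "(\<lambda>\<omega>. F n (?X n \<omega>)) \<in> borel_measurable M" for n
  by (rule measurable_compose[OF _ Fm]) (auto intro!: measurable_restrict B_meas)
 have L: "(\<lambda>n. LINT \<omega>|M. F (Suc n) (?X (Suc n) \<omega>) * g (B u \<omega>)) \<longlonglongrightarrow> (LINT \<omega>|M. \<Phi> (AF U r \<omega>) * \<psi> (B r \<omega>) * g (B u \<omega>))"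
  if g[measurable]: "g \<in> borel_measurable borel" and Kg: "\<And>z. norm (g z) \<le> Kf" for g u
 proof (rule integral_dominated_convergence[where w="\<lambda>_. K\<Phi> * K\<psi> * Kf"])
  show "AE \<omega> in M. norm (F (Suc n) (?X (Suc n) \<omega>) * g (B u \<omega>)) \<le> K\<Phi> * K\<psi> * Kf" for n
   using Fb Kg K\<Phi>0 K\<psi>0 by (intro AE_I2) (auto simp: norm_mult intro!: mult_mono)
  show "AE \<omega> in M. (\<lambda>n. F (Suc n) (?X (Suc n) \<omega>) * g (B u \<omega>)) \<longlonglongrightarrow> \<Phi> (AF U r \<omega>) * \<psi> (B r \<omega>) * g (B u \<omega>)"
   by (intro AE_I2 tendsto_mult lim tendsto_const)
  show "(\<lambda>\<omega>. \<Phi> (AF U r \<omega>) * \<psi> (B r \<omega>) * g (B u \<omega>)) \<in> borel_measurable M"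
   using AF_measurable[OF U, of "\<lambda>_. r" M "\<lambda>\<omega>. \<omega>"] B_meas by measurable
  show "(\<lambda>\<omega>. F (Suc n) (?X (Suc n) \<omega>) * g (B u \<omega>)) \<in> borel_measurable M" for n
   using Xm B_meas by measurable
 qed auto
 have "(LINT \<omega>|M. \<Phi> (AF U r \<omega>) * \<psi> (B r \<omega>) * f (B s \<omega>)) = (LINT \<omega>|M. \<Phi> (AF U r \<omega>) * \<psi> (B r \<omega>) * Pf (B r \<omega>))"
  by (rule LIMSEQ_unique[OF L[of f s, unfolded D] L[of Pf r]]) (use Kf KPf in auto)
 then show ?thesis by (simp add: Pf_def)
qed

end

section \<open>A Feynman-Kac identity at an exponential time\<close>

lemma heat_kernel_measurable [measurable (raw)]:
 assumes "g \<in> borel_measurable N" "h \<in> borel_measurable N"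
 shows "(\<lambda>x. normal_density 0 (sqrt (g x)) (h x)) \<in> borel_measurable N"
 unfolding normal_density_def using assms by measurable

context cont_bm begin

text \<open>Integrating the Markov property over \<open>s > r\<close> with weight \<open>exp (- s / 2)\<close> turns the heat kernel into the resolvent kernel.\<close>

lemma resolvent_of_markov:
 fixes Z :: "'w \<Rightarrow> complex" and f :: "real \<Rightarrow> complex"
 assumes r: "0 \<le> r" and Z [measurable]: "Z \<in> borel_measurable M" and KZ: "\<And>w. norm (Z w) \<le> KZ"
  and f: "continuous_on UNIV f" and Kf: "\<And>x. norm (f x) \<le> Kf"
  and mk: "\<And>s. r < s \<Longrightarrow> (LINT w|M. Z w * f (B s w))
   = (LINT w|M. Z w * (LINT y|lborel. normal_density 0 (sqrt (s - r)) y *\<^sub>R f (B r w + y)))"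
 shows "(LBINT s:{r<..}. exp (- (s - r) / 2) *\<^sub>R (LINT w|M. Z w * f (B s w))) = (LINT w|M. Z w * Gop f (B r w))"
proof -
 have [measurable]: "f \<in> borel_measurable borel" using f by (rule borel_measurable_continuous_onI)
 have [measurable]: "B r \<in> borel_measurable M" by (rule B_meas)
 have K0: "0 \<le> KZ" "0 \<le> Kf" using order_trans[OF norm_ge_zero KZ] order_trans[OF norm_ge_zero Kf] by auto
 have KZf: "norm (Z w * f x) \<le> KZ * Kf" for w x
  unfolding norm_mult using KZ Kf K0 by (intro mult_mono) auto
 define h where "h \<tau> y = indicator {0<..} \<tau> * (exp (- \<tau> / 2) * normal_density 0 (sqrt \<tau>) y)" for \<tau> y :: real
 have h0: "0 \<le> h \<tau> y" for \<tau> y unfolding h_def by (simp add: normal_density_nonneg)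
 have hm [measurable]: "(\<lambda>x. h (g x) (k x)) \<in> borel_measurable N"
  if "g \<in> borel_measurable N" "k \<in> borel_measurable N" for g k and N :: "'x measure"
  unfolding h_def using that by measurable
 have h\<tau>: "integrable lborel (\<lambda>\<tau>. h \<tau> y)" "(LINT \<tau>|lborel. h \<tau> y) = exp (- \<bar>y\<bar>)" for y
  using resolvent_kernel[of y] unfolding h_def set_integrable_def set_lebesgue_integral_def by simp_all
 have hy: "integrable lborel (\<lambda>y. h \<tau> y)" "(LINT y|lborel. h \<tau> y) = indicator {0<..} \<tau> * exp (- \<tau> / 2)" for \<tau>
  unfolding h_def by (cases "0 < \<tau>"; simp)+
 interpret LM: pair_sigma_finite "lborel :: real measure" M ..
 have hint: "integrable (lborel \<Otimes>\<^sub>M lborel) (\<lambda>(y, \<tau>). h \<tau> y)"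
 proof (rule lborel_pair.Fubini_integrable)
  show "integrable lborel (\<lambda>y. LINT \<tau>|lborel. norm (case (y, \<tau>) of (y, \<tau>) \<Rightarrow> h \<tau> y))"
   using laplace_exp_integrable h0 by (simp add: h\<tau>)
 qed (use h\<tau> in auto)
 have hint': "integrable (lborel \<Otimes>\<^sub>M lborel) (\<lambda>(\<tau>, y). h \<tau> y * (KZ * Kf))"
  using lborel_pair.integrable_product_swap[OF hint] by (auto simp: case_prod_beta')
 have hyi: "integrable lborel (\<lambda>y. h \<tau> y *\<^sub>R (Z w * f (B r w + y)))" for \<tau> w
  by (rule Bochner_Integration.integrable_bound[of _ "\<lambda>y. h \<tau> y * (KZ * Kf)"])
    (use hy h0 KZf K0 in \<open>auto intro!: AE_I2 mult_left_mono simp del: norm_mult simp: abs_mult\<close>)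
 have shift: "(LBINT s:{r<..}. exp (- (s - r) / 2) *\<^sub>R (LINT w|M. Z w * f (B s w)))
  = (LINT \<tau>|lborel. (indicator {0<..} \<tau> * exp (- \<tau> / 2)) *\<^sub>R (LINT w|M. Z w * f (B (r + \<tau>) w)))"
  unfolding set_lebesgue_integral_def
  by (subst lborel_integral_real_affine[where c=1 and t=r]) (auto simp: indicator_def intro!: Bochner_Integration.integral_cong)
 have A: "(indicator {0<..} \<tau> * exp (- \<tau> / 2)) *\<^sub>R (LINT w|M. Z w * f (B (r + \<tau>) w))
   = (LINT w|M. LINT y|lborel. h \<tau> y *\<^sub>R (Z w * f (B r w + y)))" for \<tau>
 proof (cases "0 < \<tau>")
  case True
  have "(LINT y|lborel. h \<tau> y *\<^sub>R (Z w * f (B r w + y)))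
   = exp (- \<tau> / 2) *\<^sub>R (Z w * (LINT y|lborel. normal_density 0 (sqrt \<tau>) y *\<^sub>R f (B r w + y)))" for w
  proof -
   have "h \<tau> y *\<^sub>R (Z w * f (B r w + y)) = exp (- \<tau> / 2) *\<^sub>R (Z w * (normal_density 0 (sqrt \<tau>) y *\<^sub>R f (B r w + y)))" for y
    using True by (simp add: h_def)
   then show ?thesis by (simp only: integral_scaleR_right integral_mult_right_zero)
  qed
  then show ?thesis using mk[of "r + \<tau>"] True by simp
 qed (simp add: h_def)
 have bd: "norm (LINT y|lborel. h \<tau> y *\<^sub>R (Z w * f (B r w + y))) \<le> (indicator {0..} \<tau> * exp (- (1/2) * \<tau>)) * (KZ * Kf)" for \<tau> w
 proof -
  have "norm (LINT y|lborel. h \<tau> y *\<^sub>R (Z w * f (B r w + y))) \<le> (LINT y|lborel. norm (h \<tau> y *\<^sub>R (Z w * f (B r w + y))))"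
   by (rule integral_norm_bound)
  also have "\<dots> \<le> (LINT y|lborel. h \<tau> y * (KZ * Kf))"
   by (rule integral_mono[OF integrable_norm[OF hyi]])
    (use hy h0 KZf in \<open>auto intro!: mult_left_mono simp del: norm_mult\<close>)
  also have "\<dots> = (indicator {0<..} \<tau> * exp (- \<tau> / 2)) * (KZ * Kf)" using hy by simp
  also have "\<dots> \<le> (indicator {0..} \<tau> * exp (- (1/2) * \<tau>)) * (KZ * Kf)"
   using K0 by (auto split: split_indicator)
  finally show ?thesis .
 qed
 have "(LINT \<tau>|lborel. LINT w|M. LINT y|lborel. h \<tau> y *\<^sub>R (Z w * f (B r w + y)))
  = (LINT w|M. LINT \<tau>|lborel. LINT y|lborel. h \<tau> y *\<^sub>R (Z w * f (B r w + y)))"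
 proof (rule LM.Fubini_integral_dominated[OF _ _ bd])
  show "integrable (lborel \<Otimes>\<^sub>M M) (\<lambda>(\<tau>, w). (indicator {0..} \<tau> * exp (- (1/2) * \<tau>)) * (KZ * Kf))"
   using LM.integrable_mult_pair[OF exp_Ici_integrable[of "1/2"], of "\<lambda>_. KZ * Kf"] by simp
 qed measurable
 also have "\<dots> = (LINT w|M. LINT y|lborel. LINT \<tau>|lborel. h \<tau> y *\<^sub>R (Z w * f (B r w + y)))"
 proof (rule Bochner_Integration.integral_cong[OF refl], rule lborel_pair.Fubini_integral_dominated[OF _ hint'])
  fix w \<tau> y show "norm (h \<tau> y *\<^sub>R (Z w * f (B r w + y))) \<le> h \<tau> y * (KZ * Kf)"
   using h0 KZf by (auto intro!: mult_left_mono simp del: norm_mult)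
 qed measurable
 also have "\<dots> = (LINT w|M. Z w * Gop f (B r w))"
 proof (rule Bochner_Integration.integral_cong[OF refl])
  fix w
  have "(LINT \<tau>|lborel. h \<tau> y *\<^sub>R (Z w * f (B r w + y))) = Z w * (exp (- \<bar>y\<bar>) *\<^sub>R f (B r w + y))" for y
   using h\<tau> by simp
  then show "(LINT y|lborel. LINT \<tau>|lborel. h \<tau> y *\<^sub>R (Z w * f (B r w + y))) = Z w * Gop f (B r w)"
   unfolding Gop_def by (simp only: integral_mult_right_zero)
 qed
 finally show ?thesis unfolding shift A .
qed

text \<open>Expectation of a function of an occupation integral and of the current position, at an exponential time (of total mass 2).\<close>

definition Gam :: "(real \<Rightarrow> complex) \<Rightarrow> (complex \<Rightarrow> complex) \<Rightarrow> (real \<Rightarrow> complex) \<Rightarrow> complex" where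
 "Gam U \<Phi> f = (LBINT s:{0<..}. exp (- s / 2) *\<^sub>R (LINT w|M. \<Phi> (AF U s w) * f (B s w)))"

lemma AF_chain_rule:
 assumes U: "continuous_on UNIV U" and d: "\<And>z. (\<Phi> has_field_derivative \<Phi>' z) (at z)"
  and c: "continuous_on UNIV \<Phi>'" and s: "0 \<le> s"
 shows "(LBINT r:{0..s}. \<Phi>' (AF U r w) * U (B r w)) = \<Phi> (AF U s w) - \<Phi> 0"
proof -
 have eq: "AF U r w = integral {0..r} (\<lambda>u. U (B u w))" for r
  unfolding AF_def by (intro set_borel_integral_eq_integral borel_integrable_atLeastAtMost' AF_cont_in U)
 have v: "((\<lambda>r. AF U r w) has_vector_derivative U (B r w)) (at r within {0..s})" if "r \<in> {0..s}" for r
  unfolding eq by (rule integral_has_vector_derivative[OF AF_cont_in[OF U] that])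
 have cA: "continuous_on {0..s} (\<lambda>r. AF U r w)"
  using has_vector_derivative_continuous[OF v] by (simp add: continuous_on_eq_continuous_within)
 have ci: "continuous_on {0..s} (\<lambda>r. \<Phi>' (AF U r w) * U (B r w))"
  by (intro continuous_intros continuous_on_compose2[OF c cA] AF_cont_in U) auto
 have "((\<lambda>r. \<Phi>' (AF U r w) * U (B r w)) has_integral (\<Phi> (AF U s w) - \<Phi> (AF U 0 w))) {0..s}"
 proof (rule fundamental_theorem_of_calculus[OF s])
  fix r assume r: "r \<in> {0..s}"
  have "((\<Phi> \<circ> (\<lambda>r. AF U r w)) has_vector_derivative U (B r w) * \<Phi>' (AF U r w)) (at r within {0..s})"
   by (rule field_vector_diff_chain_within[OF v[OF r]])
    (rule has_field_derivative_at_within[OF d])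
  then show "((\<lambda>r. \<Phi> (AF U r w)) has_vector_derivative \<Phi>' (AF U r w) * U (B r w)) (at r within {0..s})"
   by (simp add: comp_def mult.commute)
 qed
 moreover have "(LBINT r:{0..s}. \<Phi>' (AF U r w) * U (B r w)) = integral {0..s} (\<lambda>r. \<Phi>' (AF U r w) * U (B r w))"
  by (intro set_borel_integral_eq_integral borel_integrable_atLeastAtMost' ci)
 ultimately show ?thesis by (simp add: integral_unique)
qed

text \<open>The chain rule writes the functional at time \<open>s\<close> as its initial value plus an integral over \<open>r < s\<close>; exchanging the two time integrals and using the Markov property at \<open>r\<close> replaces the function at the end of the path by its resolvent.\<close>

lemma Gam_identity:
 fixes \<Phi> \<Phi>' :: "complex \<Rightarrow> complex" and f U :: "real \<Rightarrow> complex"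
 assumes U: "continuous_on UNIV U" and KU: "\<And>x. norm (U x) \<le> KU"
  and d: "\<And>z. (\<Phi> has_field_derivative \<Phi>' z) (at z)" and c': "continuous_on UNIV \<Phi>'"
  and K: "\<And>s \<omega>. 0 \<le> s \<Longrightarrow> norm (\<Phi>' (AF U s \<omega>)) \<le> K * exp (s / 4)"
  and f: "continuous_on UNIV f" and Kf: "\<And>x. norm (f x) \<le> Kf"
 shows "Gam U \<Phi> f = \<Phi> 0 * Gop f 0 + Gam U \<Phi>' (\<lambda>x. U x * Gop f x)"
proof -
 have c: "continuous_on UNIV \<Phi>"
  using d DERIV_isCont by (auto simp: continuous_on_eq_continuous_at)
 have fm [measurable]: "f \<in> borel_measurable borel" and Um [measurable]: "U \<in> borel_measurable borel"
  and \<Phi>m [measurable]: "\<Phi> \<in> borel_measurable borel" and \<Phi>'m [measurable]: "\<Phi>' \<in> borel_measurable borel"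
  using f U c c' by (auto intro: borel_measurable_continuous_onI)
 have K0: "0 \<le> K" using order_trans[OF norm_ge_zero K[of 0]] by simp
 have KU0: "0 \<le> KU" and Kf0: "0 \<le> Kf" using order_trans[OF norm_ge_zero KU] order_trans[OF norm_ge_zero Kf] by auto
 note AFm [measurable] = AF_measurable[OF U]
 note B_meas [measurable]
 define Z where "Z r \<omega> = \<Phi>' (AF U r \<omega>) * U (B r \<omega>)" for r \<omega>
 define q where "q r s = (LINT \<omega>|M. Z r \<omega> * f (B s \<omega>))" for r s
 define C where "C = K * KU * Kf"
 have C0: "0 \<le> C" using K0 KU0 Kf0 by (simp add: C_def)
 have Zm [measurable]: "(\<lambda>x. Z (g x) (k x)) \<in> borel_measurable N"
  if [measurable]: "g \<in> borel_measurable N" "k \<in> measurable N M" for g k and N :: "'x measure"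
  unfolding Z_def by measurable
 have KZ: "norm (Z r \<omega>) \<le> K * KU * exp (r / 4)" if "0 \<le> r" for r \<omega>
 proof -
  have "norm (\<Phi>' (AF U r \<omega>)) * norm (U (B r \<omega>)) \<le> (K * exp (r / 4)) * KU"
   by (intro mult_mono K KU that) (use K0 in auto)
  then show ?thesis by (simp add: Z_def norm_mult mult_ac)
 qed
 have Zf: "norm (Z r \<omega> * f x) \<le> C * exp (r / 4)" if "0 \<le> r" for r \<omega> x
 proof -
  have "norm (Z r \<omega>) * norm (f x) \<le> (K * KU * exp (r / 4)) * Kf"
   by (intro mult_mono KZ Kf that) (use K0 KU0 in auto)
  then show ?thesis by (simp add: C_def norm_mult mult_ac)
 qed
 have Zfi: "integrable M (\<lambda>\<omega>. Z r \<omega> * f (B s \<omega>))" if "0 \<le> r" for r s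
  by (rule integrable_const_bound[where B="C * exp (r / 4)"]) (use Zf[OF that] in \<open>auto intro!: AE_I2\<close>)
 have qb: "norm (q r s) \<le> C * exp (r / 4)" if "0 \<le> r" for r s
 proof -
  have "norm (q r s) \<le> (LINT \<omega>|M. norm (Z r \<omega> * f (B s \<omega>)))" unfolding q_def by (rule integral_norm_bound)
  also have "\<dots> \<le> (LINT \<omega>|M. C * exp (r / 4))"
   by (rule integral_mono) (use Zfi[OF that] Zf[OF that] in auto)
  finally show ?thesis by (simp add: prob_space)
 qed
 have qm [measurable]: "(\<lambda>x. q (g x) (k x)) \<in> borel_measurable N"
  if [measurable]: "g \<in> borel_measurable N" "k \<in> borel_measurable N" for g k and N :: "'x measure"
  unfolding q_def by measurable
 interpret LM: pair_sigma_finite "lborel :: real measure" M ..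
 let ?e = "\<lambda>s. exp (- s / 2) :: real"

 have first: "(LINT s:{0<..}|lborel. exp (- s / 2) *\<^sub>R (LINT \<omega>|M. 1 * f (B s \<omega>))) = Gop f 0"
 proof -
  have "(LINT s:{0<..}|lborel. exp (- (s - 0) / 2) *\<^sub>R (LINT \<omega>|M. (\<lambda>_. 1) \<omega> * f (B s \<omega>))) = (LINT \<omega>|M. (\<lambda>_. 1) \<omega> * Gop f (B 0 \<omega>))"
  proof (rule resolvent_of_markov[where KZ=1, OF order_refl _ _ f Kf])
   fix s :: real assume "0 < s"
   then show "(LINT \<omega>|M. 1 * f (B s \<omega>)) = (LINT \<omega>|M. 1 * (LINT y|lborel. normal_density 0 (sqrt (s - 0)) y *\<^sub>R f (B 0 \<omega> + y)))"
    using markov[where r=0 and s=s and U="\<lambda>_. 0" and \<Phi>="\<lambda>_. 1" and \<psi>="\<lambda>_. 1" and f=f and KU=0 and K\<psi>=1, OF _ _ _ _ _ _ _ f Kf] by simp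
  qed auto
  then show ?thesis by (simp add: B_zero prob_space)
 qed
 have firsti: "set_integrable lborel {0<..} (\<lambda>s. exp (- s / 2) *\<^sub>R (LINT \<omega>|M. 1 * f (B s \<omega>)))"
  unfolding set_integrable_def
 proof (rule Bochner_Integration.integrable_bound)
  show "integrable lborel (\<lambda>s. (indicator {0..} s * exp (- (1/2) * s)) * Kf)"
   using exp_Ici_integrable[of "1/2"] by auto
  have "norm (LINT \<omega>|M. 1 * f (B s \<omega>)) \<le> Kf" for s
  proof -
   have "norm (LINT \<omega>|M. 1 * f (B s \<omega>)) \<le> (LINT \<omega>|M. norm (1 * f (B s \<omega>)))" by (rule integral_norm_bound)
   also have "\<dots> \<le> (LINT \<omega>|M. Kf)"
    by (rule integral_mono, rule integrable_norm, rule integrable_const_bound[where B=Kf]) (use Kf in auto)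
   finally show ?thesis by (simp add: prob_space)
  qed
  then show "AE s in lborel. norm (indicator {0<..} s *\<^sub>R exp (- s / 2) *\<^sub>R (LINT \<omega>|M. 1 * f (B s \<omega>))) \<le> norm ((indicator {0..} s * exp (- (1/2) * s)) * Kf)"
   using Kf0 by (intro AE_I2) (auto split: split_indicator intro!: mult_left_mono)
 qed measurable

 have inner: "(LINT \<omega>|M. \<Phi> (AF U s \<omega>) * f (B s \<omega>)) = \<Phi> 0 * (LINT \<omega>|M. 1 * f (B s \<omega>)) + (LINT r|lborel. indicator {0..s} r *\<^sub>R q r s)"
  if s: "0 < s" for s
 proof -
  have e: "\<Phi> (AF U s \<omega>) * f (B s \<omega>) = \<Phi> 0 * f (B s \<omega>) + (LINT r|lborel. indicator {0..s} r *\<^sub>R (Z r \<omega> * f (B s \<omega>)))" for \<omega>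
  proof -
   have "(LINT r|lborel. indicator {0..s} r *\<^sub>R (Z r \<omega> * f (B s \<omega>))) = (LINT r|lborel. indicator {0..s} r *\<^sub>R Z r \<omega>) * f (B s \<omega>)"
    by (subst integral_mult_left_zero[symmetric]) (simp add: mult.assoc)
   also have "(LINT r|lborel. indicator {0..s} r *\<^sub>R Z r \<omega>) = \<Phi> (AF U s \<omega>) - \<Phi> 0"
    using AF_chain_rule[OF U d c', of s \<omega>] s unfolding Z_def set_lebesgue_integral_def by simp
   finally show ?thesis by (simp add: algebra_simps)
  qed
  have bd: "norm (indicator {0..s} r *\<^sub>R (Z r \<omega> * f (B s \<omega>))) \<le> indicator {0..s} r * (C * exp (s / 4))" for r \<omega>
  proof (cases "r \<in> {0..s}")
   case True
   then have "norm (Z r \<omega> * f (B s \<omega>)) \<le> C * exp (r / 4)" by (intro Zf) auto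
   also have "\<dots> \<le> C * exp (s / 4)" using True C0 by (intro mult_left_mono) auto
   finally show ?thesis using True by simp
  qed simp
  have gi: "integrable (lborel \<Otimes>\<^sub>M M) (\<lambda>(r, \<omega>). indicator {0..s} r * (C * exp (s / 4)))"
   by (rule LM.integrable_mult_pair[OF integrable_real_indicator])
    (auto simp: emeasure_lborel_Icc_eq)
  have gi': "integrable (lborel \<Otimes>\<^sub>M M) (\<lambda>(r, \<omega>). indicator {0..s} r *\<^sub>R (Z r \<omega> * f (B s \<omega>)))"
   by (rule Bochner_Integration.integrable_bound[OF gi])
    (measurable, use bd in \<open>auto intro!: AE_I2 order_trans[OF bd] abs_ge_self simp del: norm_scaleR\<close>)
  have "(LINT \<omega>|M. \<Phi> (AF U s \<omega>) * f (B s \<omega>)) = (LINT \<omega>|M. \<Phi> 0 * f (B s \<omega>)) + (LINT \<omega>|M. LINT r|lborel. indicator {0..s} r *\<^sub>R (Z r \<omega> * f (B s \<omega>)))"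
   unfolding e
  proof (rule Bochner_Integration.integral_add)
   show "integrable M (\<lambda>\<omega>. \<Phi> 0 * f (B s \<omega>))"
    by (rule integrable_const_bound[where B="norm (\<Phi> 0) * Kf"]) (use Kf in \<open>auto simp: norm_mult intro!: mult_left_mono\<close>)
   show "integrable M (\<lambda>\<omega>. LINT r|lborel. indicator {0..s} r *\<^sub>R (Z r \<omega> * f (B s \<omega>)))"
    by (rule LM.integrable_snd[OF gi'])
  qed
  also have "(LINT \<omega>|M. LINT r|lborel. indicator {0..s} r *\<^sub>R (Z r \<omega> * f (B s \<omega>))) = (LINT r|lborel. LINT \<omega>|M. indicator {0..s} r *\<^sub>R (Z r \<omega> * f (B s \<omega>)))"
   by (rule LM.Fubini_integral[OF gi'])
  also have "\<dots> = (LINT r|lborel. indicator {0..s} r *\<^sub>R q r s)" unfolding q_def by simp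
  finally show ?thesis by simp
 qed
 define w where "w r s = (indicator {0..} r * indicator {r..} s * exp (- s / 2)) *\<^sub>R q r s" for r s :: real
 have wm [measurable]: "(\<lambda>(r, s). w r s) \<in> borel_measurable (borel \<Otimes>\<^sub>M borel)"
 proof -
  have "(\<lambda>(r, s). w r s) = (\<lambda>(r, s). (if 0 \<le> r \<and> r \<le> s then exp (- s / 2) else 0) *\<^sub>R q r s)"
   by (auto simp: w_def fun_eq_iff indicator_def)
  then show ?thesis by simp
 qed
 have wb: "norm (w r s) \<le> (indicator {0..} r * exp (- (1/8) * r)) * (indicator {0..} s * exp (- (1/8) * s) * C)" for r s
 proof (cases "0 \<le> r \<and> r \<le> s")
  case True
  then have "norm (w r s) = exp (- s / 2) * norm (q r s)" by (simp add: w_def)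
  also have "\<dots> \<le> exp (- s / 2) * (C * exp (r / 4))" using True qb by (intro mult_left_mono) auto
  also have "\<dots> = exp (- s / 2 + r / 4) * C" by (simp only: exp_add mult_ac)
  also have "\<dots> \<le> exp (- (1/8) * r + - (1/8) * s) * C" using True C0 by (intro mult_right_mono) auto
  also have "\<dots> = exp (- (1/8) * r) * (exp (- (1/8) * s) * C)" by (simp only: exp_add mult.assoc)
  finally show ?thesis using True by simp
 next
  case False
  have "0 \<le> (indicator {0..} r * exp (- (1/8) * r)) * (indicator {0..} s * exp (- (1/8) * s) * C)"
   using C0 by (intro mult_nonneg_nonneg) auto
  then show ?thesis using False by (auto simp: w_def)
 qed
 have wgi: "integrable (lborel \<Otimes>\<^sub>M lborel) (\<lambda>(r, s). (indicator {0..} r * exp (- (1/8) * r)) * (indicator {0..} s * exp (- (1/8) * s) * C))"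
  by (rule lborel_pair.integrable_mult_pair) (use exp_Ici_integrable[of "1/8"] in auto)
 have wi: "integrable (lborel \<Otimes>\<^sub>M lborel) (\<lambda>(r, s). w r s)"
  by (rule Bochner_Integration.integrable_bound[OF wgi])
    (use wm wb in \<open>auto intro!: AE_I2 order_trans[OF wb] abs_ge_self\<close>)
 have sec: "(LINT s|lborel. LINT r|lborel. w r s) = Gam U \<Phi>' (\<lambda>x. U x * Gop f x)"
 proof -
  have "(LINT s|lborel. LINT r|lborel. w r s) = (LINT r|lborel. LINT s|lborel. w r s)"
   by (rule lborel_pair.Fubini_integral[OF wi])
  also have "\<dots> = (LINT r|lborel. indicator {0<..} r *\<^sub>R exp (- r / 2) *\<^sub>R (LINT \<omega>|M. \<Phi>' (AF U r \<omega>) * (U (B r \<omega>) * Gop f (B r \<omega>))))"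
  proof (rule Bochner_Integration.integral_cong_AE)
   show "AE r in lborel. (LINT s|lborel. w r s) = indicator {0<..} r *\<^sub>R exp (- r / 2) *\<^sub>R (LINT \<omega>|M. \<Phi>' (AF U r \<omega>) * (U (B r \<omega>) * Gop f (B r \<omega>)))"
    using AE_lborel_singleton[of 0]
   proof eventually_elim
    case (elim r)
    show ?case
    proof (cases "0 < r")
    case True
    have "(LINT s|lborel. w r s) = (LINT s|lborel. exp (- r / 2) *\<^sub>R (indicator {r<..} s *\<^sub>R exp (- (s - r) / 2) *\<^sub>R q r s))"
    proof (rule Bochner_Integration.integral_cong_AE)
    show "AE s in lborel. w r s = exp (- r / 2) *\<^sub>R (indicator {r<..} s *\<^sub>R exp (- (s - r) / 2) *\<^sub>R q r s)"
    using AE_lborel_singleton[of r]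
    by eventually_elim (use True in \<open>auto simp: w_def exp_add[symmetric] field_simps split: split_indicator\<close>)
    qed measurable
    also have "\<dots> = exp (- r / 2) *\<^sub>R (LINT s:{r<..}|lborel. exp (- (s - r) / 2) *\<^sub>R (LINT \<omega>|M. Z r \<omega> * f (B s \<omega>)))"
    unfolding set_lebesgue_integral_def q_def by (simp only: integral_scaleR_right)
    also have "(LINT s:{r<..}|lborel. exp (- (s - r) / 2) *\<^sub>R (LINT \<omega>|M. Z r \<omega> * f (B s \<omega>))) = (LINT \<omega>|M. Z r \<omega> * Gop f (B r \<omega>))"
    proof (rule resolvent_of_markov[OF _ _ KZ f Kf])
    fix s assume "r < s"
    then show "(LINT \<omega>|M. Z r \<omega> * f (B s \<omega>)) = (LINT \<omega>|M. Z r \<omega> * (LINT y|lborel. normal_density 0 (sqrt (s - r)) y *\<^sub>R f (B r \<omega> + y)))"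
    unfolding Z_def using True by (intro markov[OF _ _ U KU c' U KU f Kf]) auto
    qed (use True in auto)
    finally show ?thesis using True by (simp add: Z_def mult.assoc)
    qed (use elim in \<open>auto simp: w_def\<close>)
   qed
   have [measurable]: "Gop f \<in> borel_measurable borel"
    by (rule borel_measurable_continuous_onI[OF Gop_continuous[OF f Kf]])
   show "(\<lambda>r. indicator {0<..} r *\<^sub>R exp (- r / 2) *\<^sub>R (LINT \<omega>|M. \<Phi>' (AF U r \<omega>) * (U (B r \<omega>) * Gop f (B r \<omega>)))) \<in> borel_measurable lborel"
    by measurable
  qed measurable
  finally show ?thesis unfolding Gam_def set_lebesgue_integral_def .
 qed
 have "Gam U \<Phi> f = (LINT s|lborel. \<Phi> 0 * (indicator {0<..} s *\<^sub>R exp (- s / 2) *\<^sub>R (LINT \<omega>|M. 1 * f (B s \<omega>))) + (LINT r|lborel. w r s))"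
  unfolding Gam_def set_lebesgue_integral_def
 proof (rule Bochner_Integration.integral_cong_AE)
  show "AE s in lborel. indicator {0<..} s *\<^sub>R exp (- s / 2) *\<^sub>R (LINT \<omega>|M. \<Phi> (AF U s \<omega>) * f (B s \<omega>)) =
   \<Phi> 0 * (indicator {0<..} s *\<^sub>R exp (- s / 2) *\<^sub>R (LINT \<omega>|M. 1 * f (B s \<omega>))) + (LINT r|lborel. w r s)"
   using AE_lborel_singleton[of 0]
  proof eventually_elim
   case (elim s)
   show ?case
   proof (cases "0 < s")
    case True
    have "(LINT r|lborel. w r s) = (LINT r|lborel. exp (- s / 2) *\<^sub>R (indicator {0..s} r *\<^sub>R q r s))"
    by (rule Bochner_Integration.integral_cong) (auto simp: w_def split: split_indicator)
    then have "(LINT r|lborel. w r s) = exp (- s / 2) *\<^sub>R (LINT r|lborel. indicator {0..s} r *\<^sub>R q r s)"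
    by (simp only: integral_scaleR_right)
    then show ?thesis using True by (simp add: inner scaleR_add_right)
   next
    case False
    then have "s < 0" using elim by simp
    then have "w r s = 0" for r by (auto simp: w_def split: split_indicator)
    then show ?thesis using False by simp
   qed
  qed
 qed measurable
 also have "\<dots> = \<Phi> 0 * Gop f 0 + (LINT s|lborel. LINT r|lborel. w r s)"
 proof (subst Bochner_Integration.integral_add)
  show "integrable lborel (\<lambda>s. LINT r|lborel. w r s)" by (rule lborel_pair.integrable_snd[OF wi])
  show "integrable lborel (\<lambda>s. \<Phi> 0 * (indicator {0<..} s *\<^sub>R exp (- s / 2) *\<^sub>R (LINT \<omega>|M. 1 * f (B s \<omega>))))"
   using firsti unfolding set_integrable_def by (rule integrable_mult_right)
 qed (use first in \<open>simp only: set_lebesgue_integral_def integral_mult_right_zero\<close>)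
 finally show ?thesis unfolding sec .
qed

end

section \<open>Tent functions and the resolvent\<close>

text \<open>A continuous approximation of a unit point mass at \<open>x\<close>, of integral 1; occupation integrals of it converge to local time.\<close>

definition tent :: "real \<Rightarrow> real \<Rightarrow> real \<Rightarrow> real" where
 "tent \<epsilon> x z = max 0 (\<epsilon> - \<bar>z - x\<bar>) / \<epsilon>\<^sup>2"

lemma tent_nonneg: "0 \<le> tent \<epsilon> x z"
 by (simp add: tent_def)

lemma tent_le: "0 < \<epsilon> \<Longrightarrow> tent \<epsilon> x z \<le> 1 / \<epsilon>"
 unfolding tent_def power2_eq_square by (simp add: divide_simps)

lemma tent_eq_0: "\<epsilon> \<le> \<bar>z - x\<bar> \<Longrightarrow> tent \<epsilon> x z = 0"
 by (simp add: tent_def)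

lemma tent_continuous: "continuous_on S (tent \<epsilon> x)"
 unfolding tent_def divide_inverse by (intro continuous_intros)

lemma tent_measurable [measurable (raw)]:
 assumes [measurable]: "f \<in> borel_measurable M" shows "(\<lambda>w. tent \<epsilon> x (f w)) \<in> borel_measurable M"
 unfolding tent_def by measurable

lemma tent_shift: "tent \<epsilon> (x + h) (z + h) = tent \<epsilon> x z"
 by (simp add: tent_def)

lemma tent_has_integral:
 assumes e: "0 < \<epsilon>"
 shows "(tent \<epsilon> x has_integral 1) {x - \<epsilon>..x + \<epsilon>}"
proof -
 have 1: "((\<lambda>z. (\<epsilon> + (z - x)) / \<epsilon>\<^sup>2) has_integral ((\<epsilon> + (x - x))\<^sup>2 / (2 * \<epsilon>\<^sup>2) - (\<epsilon> + (x - \<epsilon> - x))\<^sup>2 / (2 * \<epsilon>\<^sup>2))) {x - \<epsilon>..x}"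
  using e by (intro fundamental_theorem_of_calculus)
   (auto simp flip: has_real_derivative_iff_has_vector_derivative intro!: derivative_eq_intros simp: power2_eq_square field_simps)
 have 2: "((\<lambda>z. (\<epsilon> - (z - x)) / \<epsilon>\<^sup>2) has_integral (- (\<epsilon> - (x + \<epsilon> - x))\<^sup>2 / (2 * \<epsilon>\<^sup>2) - (- (\<epsilon> - (x - x))\<^sup>2 / (2 * \<epsilon>\<^sup>2)))) {x..x + \<epsilon>}"
  using e by (intro fundamental_theorem_of_calculus)
   (auto simp flip: has_real_derivative_iff_has_vector_derivative intro!: derivative_eq_intros simp: power2_eq_square field_simps)
 have A1: "(tent \<epsilon> x has_integral (1/2)) {x - \<epsilon>..x}"
  using 1 e by (rule_tac has_integral_eq[OF _ 1[THEN has_integral_eq_rhs]]) (auto simp: tent_def)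
 have A2: "(tent \<epsilon> x has_integral (1/2)) {x..x + \<epsilon>}"
  using 2 e by (rule_tac has_integral_eq[OF _ 2[THEN has_integral_eq_rhs]]) (auto simp: tent_def)
 show ?thesis
  using has_integral_combine[OF _ _ A1 A2] e by simp
qed

lemma tent_integrable: "0 < \<epsilon> \<Longrightarrow> integrable lborel (tent \<epsilon> x)"
 and tent_integral: "0 < \<epsilon> \<Longrightarrow> (LINT z|lborel. tent \<epsilon> x z) = 1"
proof -
 assume e: "0 < \<epsilon>"
 have si: "set_integrable lborel {x - \<epsilon>..x + \<epsilon>} (tent \<epsilon> x)"
  by (rule borel_integrable_atLeastAtMost'[OF tent_continuous])
 have eq: "(\<lambda>z. indicator {x - \<epsilon>..x + \<epsilon>} z *\<^sub>R tent \<epsilon> x z) = tent \<epsilon> x"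
 proof
  fix z show "indicator {x - \<epsilon>..x + \<epsilon>} z *\<^sub>R tent \<epsilon> x z = tent \<epsilon> x z"
   by (cases "\<bar>z - x\<bar> \<le> \<epsilon>") (auto simp: tent_eq_0 abs_le_iff)
 qed
 show "integrable lborel (tent \<epsilon> x)" using si unfolding set_integrable_def eq .
 have "(LINT z:{x - \<epsilon>..x + \<epsilon>}|lborel. tent \<epsilon> x z) = integral {x - \<epsilon>..x + \<epsilon>} (tent \<epsilon> x)"
  by (rule set_borel_integral_eq_integral[OF si])
 also have "\<dots> = 1" using tent_has_integral[OF e] by (rule integral_unique)
 finally show "(LINT z|lborel. tent \<epsilon> x z) = 1" unfolding set_lebesgue_integral_def eq .
qed

lemma tent_mult_integrable:
 fixes k :: "real \<Rightarrow> real"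
 assumes e: "0 < \<epsilon>" and k: "k \<in> borel_measurable borel" "\<And>y. \<bar>k y\<bar> \<le> K"
 shows "integrable lborel (\<lambda>y. tent \<epsilon> x y * k y)"
proof (rule Bochner_Integration.integrable_bound)
 show "integrable lborel (\<lambda>y. tent \<epsilon> x y * K)" using tent_integrable[OF e] by auto
 show "AE y in lborel. norm (tent \<epsilon> x y * k y) \<le> norm (tent \<epsilon> x y * K)"
  using k order_trans[OF abs_ge_zero k(2)]
  by (intro AE_I2) (auto simp: abs_mult intro!: mult_left_mono order_trans[OF k(2) abs_ge_self])
qed (use k in measurable)

lemma tent_average:
 fixes k :: "real \<Rightarrow> real"
 assumes e: "0 < \<epsilon>" and k: "k \<in> borel_measurable borel" "\<And>y. \<bar>k y\<bar> \<le> K"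
  and near: "\<And>y. \<bar>y - x\<bar> < \<epsilon> \<Longrightarrow> \<bar>k y - c\<bar> \<le> \<delta>"
 shows "\<bar>(LINT y|lborel. tent \<epsilon> x y * k y) - c\<bar> \<le> \<delta>"
proof -
 note i = tent_mult_integrable[OF e k, of x] and ti = tent_integrable[OF e, of x]
 have "(LINT y|lborel. tent \<epsilon> x y * k y) - c = (LINT y|lborel. tent \<epsilon> x y * k y) - (LINT y|lborel. tent \<epsilon> x y * c)"
  using tent_integral[OF e] by simp
 also have "\<dots> = (LINT y|lborel. tent \<epsilon> x y * k y - tent \<epsilon> x y * c)"
  using i ti by simp
 also have "\<bar>\<dots>\<bar> \<le> (LINT y|lborel. \<bar>tent \<epsilon> x y * k y - tent \<epsilon> x y * c\<bar>)"
  by (rule integral_abs_bound)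
 also have "\<dots> \<le> (LINT y|lborel. tent \<epsilon> x y * \<delta>)"
 proof (rule integral_mono)
  show "integrable lborel (\<lambda>y. \<bar>tent \<epsilon> x y * k y - tent \<epsilon> x y * c\<bar>)" using i ti by simp
  show "integrable lborel (\<lambda>y. tent \<epsilon> x y * \<delta>)" using ti by simp
  fix y
  have "\<bar>tent \<epsilon> x y * k y - tent \<epsilon> x y * c\<bar> = tent \<epsilon> x y * \<bar>k y - c\<bar>"
   by (simp add: abs_mult tent_nonneg flip: right_diff_distrib)
  also have "\<dots> \<le> tent \<epsilon> x y * \<delta>"
   by (cases "\<bar>y - x\<bar> < \<epsilon>") (auto simp: tent_eq_0 tent_nonneg intro!: mult_left_mono near)
  finally show "\<bar>tent \<epsilon> x y * k y - tent \<epsilon> x y * c\<bar> \<le> tent \<epsilon> x y * \<delta>" .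
 qed
 also have "\<dots> = \<delta>" using tent_integral[OF e] by simp
 finally show ?thesis .
qed

text \<open>dipole\<close>

text \<open>A difference of two shifted tents acts on a function as a difference quotient without the quotient, so a Lipschitz bound is gained.\<close>

lemma tent_dipole:
 fixes k :: "real \<Rightarrow> real"
 assumes e: "0 < \<epsilon>" and k: "k \<in> borel_measurable borel" "\<And>y. \<bar>k y\<bar> \<le> K"
  and lip: "\<And>y. \<bar>k y - k (y + h)\<bar> \<le> c"
 shows "\<bar>LINT y|lborel. (tent \<epsilon> x y - tent \<epsilon> (x + h) y) * k y\<bar> \<le> c"
proof -
 have k': "(\<lambda>y. k (y + h)) \<in> borel_measurable borel" using k by measurable
 have "(LINT y|lborel. tent \<epsilon> (x + h) y * k y) = (LINT y|lborel. tent \<epsilon> x y * k (y + h))"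
  by (subst lborel_integral_real_affine[where c=1 and t=h]) (auto simp: add.commute[of h] tent_shift)
 then have "(LINT y|lborel. (tent \<epsilon> x y - tent \<epsilon> (x + h) y) * k y)
  = (LINT y|lborel. tent \<epsilon> x y * (k y - k (y + h)))"
  using tent_mult_integrable[OF e k] tent_mult_integrable[OF e k' k(2)]
  by (simp add: left_diff_distrib right_diff_distrib)
 also have "\<bar>(LINT y|lborel. tent \<epsilon> x y * (k y - k (y + h))) - 0\<bar> \<le> c"
  by (rule tent_average[OF e, where K=c]) (use k k' lip in auto)
 finally show ?thesis by simp
qed

lemma exp_abs_lipschitz: "\<bar>exp (-\<bar>a\<bar>) - exp (-\<bar>b\<bar>)\<bar> \<le> \<bar>a - b\<bar>" for a b :: real
proof -
 have *: "\<bar>exp (-u) - exp (-v)\<bar> \<le> \<bar>u - v\<bar>" if "0 \<le> u" "u \<le> v" for u v :: real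
 proof -
  have "exp (-u) - exp (-v) = exp (-u) * (1 - exp (-(v - u)))"
   by (simp add: right_diff_distrib flip: exp_add)
  also have "\<dots> \<le> 1 * (v - u)"
  proof (rule mult_mono)
   show "1 - exp (-(v - u)) \<le> v - u"
    unfolding minus_diff_eq using exp_ge_add_one_self[of "u - v"] by linarith
  qed (use that in auto)
  finally show ?thesis using that by simp
 qed
 show ?thesis using *[of "\<bar>a\<bar>" "\<bar>b\<bar>"] *[of "\<bar>b\<bar>" "\<bar>a\<bar>"] by (cases "\<bar>a\<bar> \<le> \<bar>b\<bar>") auto
qed

definition Gr :: "(real \<Rightarrow> real) \<Rightarrow> real \<Rightarrow> real" where
 "Gr f z = (LINT y|lborel. exp (- \<bar>y\<bar>) * f (z + y))"

lemma Gop_of_real: "Gop (\<lambda>x. complex_of_real (f x)) z = complex_of_real (Gr f z)"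
 unfolding Gop_def Gr_def by (simp add: scaleR_conv_of_real flip: of_real_mult)

lemma Gr_alt: "Gr f z = (LINT y|lborel. f y * exp (- \<bar>y - z\<bar>))"
 unfolding Gr_def by (subst lborel_integral_real_affine[where c=1 and t="-z"]) (auto simp: mult.commute)

lemma Gr_bound:
 assumes "f \<in> borel_measurable borel" "\<And>x. \<bar>f x\<bar> \<le> K" shows "\<bar>Gr f z\<bar> \<le> 2 * K"
 using Gop_bound[of "\<lambda>x. complex_of_real (f x)" K z] assms by (simp add: Gop_of_real)

lemma Gr_continuous:
 assumes "continuous_on UNIV f" "\<And>x. \<bar>f x\<bar> \<le> K" shows "continuous_on UNIV (Gr f)"
proof -
 have "continuous_on UNIV (Gop (\<lambda>x. complex_of_real (f x)))"
  using assms by (intro Gop_continuous[where K=K]) (auto intro!: continuous_intros)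
 then have "continuous_on UNIV (\<lambda>z. Re (complex_of_real (Gr f z)))"
  unfolding Gop_of_real by (rule continuous_on_Re)
 then show ?thesis by simp
qed

lemma Gr_const: "Gr (\<lambda>_. c) z = 2 * c"
 unfolding Gr_def by (simp add: laplace_exp_integral)

lemma Gr_tent_approx: assumes e: "0 < \<epsilon>" shows "\<bar>Gr (tent \<epsilon> x) z - exp (-\<bar>z - x\<bar>)\<bar> \<le> \<epsilon>"
 unfolding Gr_alt abs_minus_commute[of z x]
 by (rule tent_average[OF e, where K=1])
   (auto intro!: order_trans[OF exp_abs_lipschitz])

lemma Gr_tent_bounds: assumes e: "0 < \<epsilon>" shows "0 \<le> Gr (tent \<epsilon> x) z" "Gr (tent \<epsilon> x) z \<le> 1"
proof -
 show "0 \<le> Gr (tent \<epsilon> x) z" unfolding Gr_def by (simp add: tent_nonneg)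
 have "\<bar>Gr (tent \<epsilon> x) z - (1/2)\<bar> \<le> 1/2" unfolding Gr_alt
  by (rule tent_average[OF e, where K=1]) (auto simp: abs_le_iff field_simps)
 then show "Gr (tent \<epsilon> x) z \<le> 1" by linarith
qed

lemma Gr_tent_lipschitz: assumes e: "0 < \<epsilon>" shows "\<bar>Gr (tent \<epsilon> x) z - Gr (tent \<epsilon> x) w\<bar> \<le> \<bar>z - w\<bar>"
proof -
 have "Gr (tent \<epsilon> x) z - Gr (tent \<epsilon> x) w = (LINT y|lborel. tent \<epsilon> x y * (exp (- \<bar>y - z\<bar>) - exp (- \<bar>y - w\<bar>)))"
  unfolding Gr_alt using tent_mult_integrable[OF e, of "\<lambda>y. exp (- \<bar>y - z\<bar>)" 1] tent_mult_integrable[OF e, of "\<lambda>y. exp (- \<bar>y - w\<bar>)" 1]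
  by (simp add: right_diff_distrib)
 also have "\<bar>\<dots> - 0\<bar> \<le> \<bar>z - w\<bar>"
  by (rule tent_average[OF e, where K="\<bar>z - w\<bar>"])
    (auto intro!: order_trans[OF exp_abs_lipschitz] simp: abs_minus_commute)
 finally show ?thesis by simp
qed

text \<open>The resolvent smooths a dipole: its potential is of the order of the distance \<open>h\<close> between the two tents, uniformly in their width.\<close>

lemma Gr_dipole:
 assumes e: "0 < \<epsilon>" and h: "0 \<le> h"
  and k: "k \<in> borel_measurable borel" "\<And>y. \<bar>k y\<bar> \<le> K" "\<And>y. \<bar>k y - k (y + h)\<bar> \<le> K * h"
 shows "\<bar>Gr (\<lambda>y. (tent \<epsilon> x y - tent \<epsilon> (x + h) y) * k y) z\<bar> \<le> 2 * K * h"
proof -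
 have [measurable]: "k \<in> borel_measurable borel" by fact
 have K0: "0 \<le> K" using order_trans[OF abs_ge_zero k(2)] .
 have b: "\<bar>k y * exp (- \<bar>y - z\<bar>)\<bar> \<le> K" for y
  using mult_mono[OF k(2)[of y], of "exp (- \<bar>y - z\<bar>)" 1] K0 by (simp add: abs_mult)
 have l: "\<bar>k y * exp (- \<bar>y - z\<bar>) - k (y + h) * exp (- \<bar>y + h - z\<bar>)\<bar> \<le> 2 * K * h" for y
 proof -
  have "k y * exp (- \<bar>y - z\<bar>) - k (y + h) * exp (- \<bar>y + h - z\<bar>)
   = (k y - k (y + h)) * exp (- \<bar>y - z\<bar>) + k (y + h) * (exp (- \<bar>y - z\<bar>) - exp (- \<bar>y + h - z\<bar>))"
   by (simp add: algebra_simps)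
  also have "\<bar>\<dots>\<bar> \<le> (K * h) * 1 + K * h"
  proof (intro order_trans[OF abs_triangle_ineq] add_mono)
   show "\<bar>(k y - k (y + h)) * exp (- \<bar>y - z\<bar>)\<bar> \<le> (K * h) * 1"
    unfolding abs_mult using k(3)[of y] h K0 by (intro mult_mono) auto
   show "\<bar>k (y + h) * (exp (- \<bar>y - z\<bar>) - exp (- \<bar>y + h - z\<bar>))\<bar> \<le> K * h"
    unfolding abs_mult using k(2) h K0 exp_abs_lipschitz[of "y - z" "y + h - z"] by (intro mult_mono) auto
  qed
  finally show ?thesis by simp
 qed
 show ?thesis unfolding Gr_alt mult.assoc
  using tent_dipole[OF e, of "\<lambda>y. k y * exp (- \<bar>y - z\<bar>)" K h "2 * K * h" x] b l by simp
qed

lemma power_le_fact_exp: "0 \<le> x \<Longrightarrow> x ^ k \<le> fact k * exp x" for x :: real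
proof -
 assume x: "0 \<le> x"
 have "sum (\<lambda>n. x ^ n /\<^sub>R fact n) {k} \<le> (\<Sum>n. x ^ n /\<^sub>R fact n)"
  by (rule sum_le_suminf) (use x summable_exp_generic[of x] in auto)
 then show ?thesis by (simp add: exp_def field_simps)
qed

section \<open>Moments of occupation integrals at an exponential time\<close>

context cont_bm begin

definition AR :: "(real \<Rightarrow> real) \<Rightarrow> real \<Rightarrow> 'w \<Rightarrow> real" where
 "AR V r w = (LINT u:{0..r}|lborel. V (B u w))"

lemma AF_of_real: "AF (\<lambda>x. complex_of_real (V x)) r w = complex_of_real (AR V r w)"
 unfolding AF_def AR_def by (rule set_integral_complex_of_real)

lemma AR_measurable [measurable (raw)]:
 assumes V: "continuous_on UNIV V" and g: "g \<in> borel_measurable N" and h: "h \<in> measurable N M"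
 shows "(\<lambda>x. AR V (g x) (h x)) \<in> borel_measurable N"
proof -
 have "(\<lambda>x. Re (AF (\<lambda>x. complex_of_real (V x)) (g x) (h x))) \<in> borel_measurable N"
  by (rule measurable_compose[OF AF_measurable[OF _ g h] borel_measurable_Re])
    (use V in \<open>auto intro!: continuous_intros\<close>)
 then show ?thesis by (simp add: AF_of_real)
qed

lemma AR_bound:
 assumes V: "continuous_on UNIV V" and K: "\<And>x. \<bar>V x\<bar> \<le> K" and r: "0 \<le> r"
 shows "\<bar>AR V r w\<bar> \<le> r * K"
 using AF_bound[of "\<lambda>x. complex_of_real (V x)" K r w] assms
 by (auto simp: AF_of_real intro!: continuous_intros)

lemma AR_nonneg: "(\<And>x. 0 \<le> V x) \<Longrightarrow> 0 \<le> AR V r w"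
 unfolding AR_def set_lebesgue_integral_def by (rule integral_nonneg_AE) auto

lemma AR_integrable: "continuous_on UNIV (V :: real \<Rightarrow> real) \<Longrightarrow> set_integrable lborel {a..b} (\<lambda>u. V (B u w))"
 by (intro borel_integrable_atLeastAtMost' cont_comp_B)

lemma AR_mono:
 assumes V: "continuous_on UNIV V" "\<And>x. 0 \<le> V x" and rs: "r \<le> s" shows "AR V r w \<le> AR V s w"
 unfolding AR_def set_lebesgue_integral_def
 using AR_integrable[OF V(1), of 0 r w] AR_integrable[OF V(1), of 0 s w] V rs
 by (intro integral_mono) (auto simp: set_integrable_def split: split_indicator)

lemma AR_power_bound:
 assumes V: "continuous_on UNIV V" and K: "\<And>x. \<bar>V x\<bar> \<le> K" and r: "0 \<le> s"
 shows "\<bar>AR V s w ^ n\<bar> \<le> ((4 * K) ^ n * fact n) * exp (s / 4)"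
proof -
 have K0: "0 \<le> K" using order_trans[OF abs_ge_zero K] .
 have "\<bar>AR V s w ^ n\<bar> \<le> (s * K) ^ n"
  unfolding power_abs by (intro power_mono AR_bound assms) auto
 also have "\<dots> = (4 * K) ^ n * (s / 4) ^ n"
  unfolding power_mult_distrib[symmetric] by (simp add: mult.commute)
 also have "\<dots> \<le> (4 * K) ^ n * (fact n * exp (s / 4))"
  using K0 r by (intro mult_left_mono power_le_fact_exp) auto
 finally show ?thesis by (simp add: mult_ac)
qed

text \<open>Moments of an occupation integral at an exponential time, weighted by a function of the final position.\<close>

definition MM :: "nat \<Rightarrow> (real \<Rightarrow> real) \<Rightarrow> (real \<Rightarrow> real) \<Rightarrow> real" where
 "MM n V f = (LINT s:{0<..}|lborel. exp (- s / 2) * (LINT w|M. AR V s w ^ n * f (B s w)))"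

lemma Gam_MM: "Gam (\<lambda>x. complex_of_real (V x)) (\<lambda>z. z ^ n) (\<lambda>x. complex_of_real (f x)) = complex_of_real (MM n V f)"
proof -
 have "(LINT w|M. complex_of_real (AR V s w) ^ n * complex_of_real (f (B s w))) = complex_of_real (LINT w|M. AR V s w ^ n * f (B s w))" for s
  unfolding of_real_power[symmetric] of_real_mult[symmetric] by (rule integral_complex_of_real)
 then show ?thesis
  unfolding Gam_def MM_def set_integral_complex_of_real[symmetric] AF_of_real
  by (simp only: scaleR_conv_of_real of_real_mult)
qed

lemma AR_power_integrable:
 assumes V: "continuous_on UNIV V" and KV: "\<And>x. \<bar>V x\<bar> \<le> KV" and s: "0 \<le> s"
  and f: "f \<in> borel_measurable borel" and Kf: "\<And>x. \<bar>f x\<bar> \<le> Kf"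
 shows "integrable M (\<lambda>w. AR V s w ^ n * f (B u w))"
proof (rule integrable_const_bound[where B="((4 * KV) ^ n * fact n) * exp (s / 4) * Kf"])
 note [measurable] = AR_measurable[OF V] f
 show "(\<lambda>w. AR V s w ^ n * f (B u w)) \<in> borel_measurable M" by measurable
 have K0: "0 \<le> KV" "0 \<le> Kf" using order_trans[OF abs_ge_zero KV] order_trans[OF abs_ge_zero Kf] by auto
 show "AE w in M. norm (AR V s w ^ n * f (B u w)) \<le> ((4 * KV) ^ n * fact n) * exp (s / 4) * Kf"
  unfolding real_norm_def abs_mult
  by (intro AE_I2 mult_mono AR_power_bound[OF V KV s] Kf) (use K0 in auto)
qed

lemma MM_integrable:
 assumes V: "continuous_on UNIV V" and KV: "\<And>x. \<bar>V x\<bar> \<le> KV"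
  and f: "f \<in> borel_measurable borel" and Kf: "\<And>x. \<bar>f x\<bar> \<le> Kf"
 shows "set_integrable lborel {0<..} (\<lambda>s. exp (- s / 2) * (LINT w|M. AR V s w ^ n * f (B s w)))"
 unfolding set_integrable_def
proof (rule Bochner_Integration.integrable_bound)
 note [measurable] = AR_measurable[OF V] f
 let ?C = "(4 * KV) ^ n * fact n * Kf"
 have K0: "0 \<le> KV" "0 \<le> Kf" using order_trans[OF abs_ge_zero KV] order_trans[OF abs_ge_zero Kf] by auto
 have C0: "0 \<le> ?C" using K0 by simp
 show "integrable lborel (\<lambda>s. (indicator {0..} s * exp (- (1/4) * s)) * ?C)"
  by (intro integrable_mult_left exp_Ici_integrable) simp
 show "(\<lambda>s. indicator {0<..} s *\<^sub>R (exp (- s / 2) * (LINT w|M. AR V s w ^ n * f (B s w)))) \<in> borel_measurable lborel"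
  by measurable
 have "\<bar>LINT w|M. AR V s w ^ n * f (B s w)\<bar> \<le> ?C * exp (s / 4)" if s: "0 \<le> s" for s
 proof -
  have "\<bar>LINT w|M. AR V s w ^ n * f (B s w)\<bar> \<le> (LINT w|M. \<bar>AR V s w ^ n * f (B s w)\<bar>)" by (rule integral_abs_bound)
  also have "\<dots> \<le> (LINT w|M. ?C * exp (s / 4))"
  proof (rule integral_mono)
   show "integrable M (\<lambda>w. \<bar>AR V s w ^ n * f (B s w)\<bar>)"
    by (rule integrable_abs[OF AR_power_integrable[OF V KV s f Kf]])
   fix w
   have "\<bar>AR V s w ^ n\<bar> * \<bar>f (B s w)\<bar> \<le> (((4 * KV) ^ n * fact n) * exp (s / 4)) * Kf"
    using K0 by (intro mult_mono AR_power_bound[OF V KV s] Kf) auto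
   then show "\<bar>AR V s w ^ n * f (B s w)\<bar> \<le> ?C * exp (s / 4)" by (simp add: abs_mult mult_ac)
  qed auto
  finally show ?thesis by (simp add: prob_space)
 qed
 then have "norm (indicator {0<..} s *\<^sub>R (exp (- s / 2) * (LINT w|M. AR V s w ^ n * f (B s w)))) \<le> norm ((indicator {0..} s * exp (- (1/4) * s)) * ?C)" for s
 proof (cases "0 < s")
  case True
  have "exp (- s / 2) * \<bar>LINT w|M. AR V s w ^ n * f (B s w)\<bar> \<le> exp (- s / 2) * (?C * exp (s / 4))"
   using True by (intro mult_left_mono \<open>\<And>s. 0 \<le> s \<Longrightarrow> _\<close>) auto
  also have "\<dots> = (exp (- s / 2) * exp (s / 4)) * ?C" by (simp only: mult_ac)
  also have "exp (- s / 2) * exp (s / 4) = exp (- (1/4) * s)" unfolding exp_add[symmetric] by simp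
  finally show ?thesis using True C0 K0 by (simp add: abs_mult)
 qed simp
 then show "AE s in lborel. norm (indicator {0<..} s *\<^sub>R (exp (- s / 2) * (LINT w|M. AR V s w ^ n * f (B s w)))) \<le> norm ((indicator {0..} s * exp (- (1/4) * s)) * ?C)"
  by simp
qed

lemma MM_mono:
 assumes V: "continuous_on UNIV V" and KV: "\<And>x. \<bar>V x\<bar> \<le> KV"
  and f: "f \<in> borel_measurable borel" and g: "g \<in> borel_measurable borel" and Kg: "\<And>x. \<bar>g x\<bar> \<le> Kg"
  and le: "\<And>x. \<bar>f x\<bar> \<le> g x" and pos: "\<And>s w. 0 \<le> AR V s w ^ n"
 shows "\<bar>MM n V f\<bar> \<le> MM n V g"
proof -
 have Kf: "\<bar>f x\<bar> \<le> Kg" for x using le[of x] Kg[of x] by linarith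
 have inner: "\<bar>LINT w|M. AR V s w ^ n * f (B s w)\<bar> \<le> (LINT w|M. AR V s w ^ n * g (B s w))" if "0 < s" for s
 proof -
  have s: "0 \<le> s" using that by simp
  have "\<bar>LINT w|M. AR V s w ^ n * f (B s w)\<bar> \<le> (LINT w|M. \<bar>AR V s w ^ n * f (B s w)\<bar>)" by (rule integral_abs_bound)
  also have "\<dots> \<le> (LINT w|M. AR V s w ^ n * g (B s w))"
   using pos le
   by (intro integral_mono integrable_abs AR_power_integrable[OF V KV s f Kf] AR_power_integrable[OF V KV s g Kg])
    (auto simp only: abs_mult abs_of_nonneg intro!: mult_left_mono)
  finally show ?thesis .
 qed
 let ?f = "\<lambda>s. indicator {0<..} s *\<^sub>R (exp (- s / 2) * (LINT w|M. AR V s w ^ n * f (B s w)))"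
 let ?g = "\<lambda>s. indicator {0<..} s *\<^sub>R (exp (- s / 2) * (LINT w|M. AR V s w ^ n * g (B s w)))"
 have "\<bar>MM n V f\<bar> \<le> (LINT s|lborel. \<bar>?f s\<bar>)" unfolding MM_def set_lebesgue_integral_def by (rule integral_abs_bound)
 also have "\<dots> \<le> (LINT s|lborel. ?g s)"
  using inner
  by (intro integral_mono integrable_abs MM_integrable[OF V KV f Kf, of n, unfolded set_integrable_def]
    MM_integrable[OF V KV g Kg, of n, unfolded set_integrable_def])
    (auto simp: abs_mult split: split_indicator)
 finally show ?thesis unfolding MM_def set_lebesgue_integral_def .
qed

lemma MM_cmult: "MM n V (\<lambda>x. c * f x) = c * MM n V f"
proof -
 have "MM n V (\<lambda>x. c * f x) = (LINT s:{0<..}|lborel. c * (exp (- s / 2) * (LINT w|M. AR V s w ^ n * f (B s w))))"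
  unfolding MM_def by (simp add: mult.left_commute[of _ c])
 then show ?thesis unfolding MM_def by simp
qed

lemma MM_0:
 assumes f: "continuous_on UNIV f" and Kf: "\<And>x. \<bar>f x\<bar> \<le> Kf"
 shows "MM 0 V f = Gr f 0"
proof -
 have "Gam (\<lambda>_. 0) (\<lambda>_. 1) (\<lambda>x. complex_of_real (f x)) = 1 * Gop (\<lambda>x. complex_of_real (f x)) 0 + Gam (\<lambda>_. 0) (\<lambda>_. 0) (\<lambda>x. 0 * Gop (\<lambda>x. complex_of_real (f x)) x)"
  by (rule Gam_identity[where KU=0 and K=0 and Kf=Kf])
    (use f Kf in \<open>auto intro!: continuous_intros\<close>)
 then have "Gam (\<lambda>_. 0) (\<lambda>_. 1) (\<lambda>x. complex_of_real (f x)) = complex_of_real (Gr f 0)"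
  by (simp add: Gam_def Gop_of_real)
 moreover have "Gam (\<lambda>_. 0) (\<lambda>_. 1) (\<lambda>x. complex_of_real (f x)) = complex_of_real (MM 0 V f)"
  unfolding Gam_MM[symmetric] Gam_def by simp
 ultimately show ?thesis by simp
qed

text \<open>The Feynman-Kac identity for a monomial lowers the degree by one; iterating it is the Kac moment formula.\<close>

lemma MM_rec:
 assumes V: "continuous_on UNIV V" and KV: "\<And>x. \<bar>V x\<bar> \<le> KV"
  and f: "continuous_on UNIV f" and Kf: "\<And>x. \<bar>f x\<bar> \<le> Kf"
 shows "MM (Suc n) V f = real (Suc n) * MM n V (\<lambda>x. V x * Gr f x)"
proof -
 let ?U = "\<lambda>x. complex_of_real (V x)" and ?f = "\<lambda>x. complex_of_real (f x)"
 have "Gam ?U (\<lambda>z. z ^ Suc n) ?f = 0 ^ Suc n * Gop ?f 0 + Gam ?U (\<lambda>z. of_nat (Suc n) * z ^ n) (\<lambda>x. ?U x * Gop ?f x)"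
 proof (rule Gam_identity[where KU=KV and Kf=Kf and K="real (Suc n) * ((4 * KV) ^ n * fact n)"])
  show "((\<lambda>z. z ^ Suc n) has_field_derivative of_nat (Suc n) * z ^ n) (at z)" for z :: complex
   using DERIV_power[OF DERIV_ident, of "Suc n" z UNIV] by simp
  fix s w assume "0 \<le> (s::real)"
  then have "real (Suc n) * \<bar>AR V s w ^ n\<bar> \<le> real (Suc n) * (((4 * KV) ^ n * fact n) * exp (s / 4))"
   by (intro mult_left_mono AR_power_bound[OF V KV]) auto
  then show "norm (of_nat (Suc n) * AF ?U s w ^ n) \<le> real (Suc n) * ((4 * KV) ^ n * fact n) * exp (s / 4)"
   unfolding AF_of_real norm_mult norm_of_nat of_real_power[symmetric] norm_of_real by (simp only: mult.assoc)
 qed (use V KV f Kf in \<open>auto intro!: continuous_intros\<close>)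
 also have "Gam ?U (\<lambda>z. of_nat (Suc n) * z ^ n) (\<lambda>x. ?U x * Gop ?f x) = Gam ?U (\<lambda>z. z ^ n) (\<lambda>x. complex_of_real (real (Suc n) * (V x * Gr f x)))"
  unfolding Gam_def Gop_of_real of_real_mult of_real_of_nat_eq by (simp only: mult_ac)
 finally have "complex_of_real (MM (Suc n) V f) = complex_of_real (MM n V (\<lambda>x. real (Suc n) * (V x * Gr f x)))"
  by (simp only: Gam_MM power_0_Suc mult_zero_left add_0)
 then show ?thesis by (simp only: of_real_eq_iff MM_cmult)
qed

end

section \<open>Moments of dipoles\<close>

abbreviation dip :: "real \<Rightarrow> real \<Rightarrow> real \<Rightarrow> real \<Rightarrow> real" where
 "dip \<epsilon> x h \<equiv> (\<lambda>z. tent \<epsilon> x z - tent \<epsilon> (x + h) z)"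

lemma dip_continuous: "continuous_on UNIV (dip \<epsilon> x h)"
 by (intro continuous_intros tent_continuous)

lemma dip_bound: "0 < \<epsilon> \<Longrightarrow> \<bar>dip \<epsilon> x h z\<bar> \<le> 1 / \<epsilon>"
 using tent_nonneg[of \<epsilon> x z] tent_nonneg[of \<epsilon> "x + h" z] tent_le[of \<epsilon> x z] tent_le[of \<epsilon> "x + h" z]
 by linarith

lemma dip_abs_le: "\<bar>dip \<epsilon> x h z\<bar> \<le> tent \<epsilon> x z + tent \<epsilon> (x + h) z"
 using tent_nonneg[of \<epsilon> x z] tent_nonneg[of \<epsilon> "x + h" z] by linarith

lemma Gr_add:
 assumes "f \<in> borel_measurable borel" "\<And>x. \<bar>f x\<bar> \<le> K" "g \<in> borel_measurable borel" "\<And>x. \<bar>g x\<bar> \<le> K'"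
 shows "Gr (\<lambda>x. f x + g x) z = Gr f z + Gr g z"
proof -
 have i: "integrable lborel (\<lambda>y. exp (- \<bar>y\<bar>) * f (z + y))"
  if f: "f \<in> borel_measurable borel" and K: "\<And>x. \<bar>f x\<bar> \<le> K" for f :: "real \<Rightarrow> real" and K
 proof (rule Bochner_Integration.integrable_bound)
  show "integrable lborel (\<lambda>y::real. exp (- \<bar>y\<bar>) * K)" using laplace_exp_integrable by auto
  show "AE y in lborel. norm (exp (- \<bar>y\<bar>) * f (z + y)) \<le> norm (exp (- \<bar>y\<bar>) * K)"
   using K by (intro AE_I2) (auto intro!: mult_left_mono simp: abs_mult order_trans[OF K abs_ge_self])
 qed (use f in measurable)
 show ?thesis unfolding Gr_def
  using i[OF assms(1,2)] i[OF assms(3,4)] by (simp add: distrib_left)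
qed

context cont_bm begin

text \<open>Two steps of the moment recursion gain a factor of order \<open>h\<close>: one dipole is spent against the Lipschitz bound for the potential of the other.\<close>

lemma MM_dipole_step:
 fixes x h \<epsilon> c :: real
 defines "V \<equiv> dip \<epsilon> x h" and "S \<equiv> (\<lambda>z. tent \<epsilon> x z + tent \<epsilon> (x + h) z)"
 assumes e: "0 < \<epsilon>" and h: "0 \<le> h" and n: "even n"
  and f: "continuous_on UNIV f" and Kf: "\<And>z. \<bar>f z\<bar> \<le> Kf"
  and Gf: "\<And>z. \<bar>Gr f z\<bar> \<le> 2" "\<And>y. \<bar>Gr f y - Gr f (y + h)\<bar> \<le> 2 * h"
 shows "\<bar>MM (Suc (Suc n)) V f\<bar> \<le> real (Suc (Suc n)) * real (Suc n) * (4 * h) * MM n V S"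
proof -
 have V: "continuous_on UNIV V" and KV: "\<And>z. \<bar>V z\<bar> \<le> 1 / \<epsilon>"
  unfolding V_def using dip_continuous dip_bound[OF e] by auto
 have Gc: "continuous_on UNIV (Gr f)" by (rule Gr_continuous[OF f Kf])
 have c1: "continuous_on UNIV (\<lambda>z. V z * Gr f z)" by (intro continuous_intros V Gc)
 have b1: "\<bar>V z * Gr f z\<bar> \<le> 1 / \<epsilon> * 2" for z
  unfolding abs_mult by (intro mult_mono KV Gf) (use e in auto)
 have eq: "MM (Suc (Suc n)) V f = real (Suc (Suc n)) * (real (Suc n) * MM n V (\<lambda>z. V z * Gr (\<lambda>z. V z * Gr f z) z))"
  using MM_rec[OF V KV f Kf] MM_rec[OF V KV c1 b1] by simp
 have g2: "\<bar>Gr (\<lambda>z. V z * Gr f z) z\<bar> \<le> 2 * 2 * h" for z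
  unfolding V_def by (rule Gr_dipole[OF e h]) (use Gf Gc in \<open>auto intro: borel_measurable_continuous_onI\<close>)
 have Sb: "\<bar>4 * h * S z\<bar> \<le> 4 * h * (2 / \<epsilon>)" for z
  unfolding abs_mult S_def using h tent_le[OF e, of x z] tent_le[OF e, of "x + h" z] tent_nonneg[of \<epsilon> x z] tent_nonneg[of \<epsilon> "x + h" z]
  by (intro mult_mono) auto
 have Vm: "V \<in> borel_measurable borel" using V by (rule borel_measurable_continuous_onI)
 have Gm: "Gr (\<lambda>z. V z * Gr f z) \<in> borel_measurable borel"
  by (rule borel_measurable_continuous_onI[OF Gr_continuous[OF c1 b1]])
 have "\<bar>MM n V (\<lambda>z. V z * Gr (\<lambda>z. V z * Gr f z) z)\<bar> \<le> MM n V (\<lambda>z. 4 * h * S z)"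
 proof (rule MM_mono[OF V KV _ _ Sb])
  fix z
  have "\<bar>V z\<bar> * \<bar>Gr (\<lambda>z. V z * Gr f z) z\<bar> \<le> S z * (2 * 2 * h)"
   unfolding S_def by (intro mult_mono g2 order_trans[OF _ dip_abs_le]) (auto simp: V_def tent_nonneg)
  then show "\<bar>V z * Gr (\<lambda>z. V z * Gr f z) z\<bar> \<le> 4 * h * S z" by (simp add: abs_mult mult_ac)
 qed (use n Vm Gm in \<open>auto simp: S_def zero_le_even_power\<close>)
 also have "\<dots> = 4 * h * MM n V S" by (rule MM_cmult)
 finally have "\<bar>MM n V (\<lambda>z. V z * Gr (\<lambda>z. V z * Gr f z) z)\<bar> \<le> 4 * h * MM n V S" .
 then have "real (Suc (Suc n)) * real (Suc n) * \<bar>MM n V (\<lambda>z. V z * Gr (\<lambda>z. V z * Gr f z) z)\<bar>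
  \<le> real (Suc (Suc n)) * real (Suc n) * (4 * h * MM n V S)"
  by (intro mult_left_mono) auto
 then show ?thesis unfolding eq by (simp add: abs_mult mult_ac del: of_nat_Suc)
qed

lemma MM_dipole_bound:
 fixes x h \<epsilon> :: real
 defines "V \<equiv> dip \<epsilon> x h"
 assumes e: "0 < \<epsilon>" and h: "0 \<le> h"
 shows "MM (2 * m) V (\<lambda>_. 1) \<le> 2 * fact (2 * m) * (4 * h) ^ m"
proof -
 let ?S = "\<lambda>z. tent \<epsilon> x z + tent \<epsilon> (x + h) z"
 have Sc: "continuous_on UNIV ?S" by (intro continuous_intros tent_continuous)
 have Sb: "\<bar>?S z\<bar> \<le> 2 / \<epsilon>" for z
  using tent_le[OF e, of x z] tent_le[OF e, of "x + h" z] tent_nonneg[of \<epsilon> x z] tent_nonneg[of \<epsilon> "x + h" z] by simp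
 have tb: "\<bar>tent \<epsilon> y z\<bar> \<le> 1 / \<epsilon>" for y z using tent_le[OF e, of y z] tent_nonneg[of \<epsilon> y z] by simp
 have GS: "Gr ?S z = Gr (tent \<epsilon> x) z + Gr (tent \<epsilon> (x + h)) z" for z
  by (rule Gr_add[OF _ tb _ tb]) measurable
 have GS1: "\<bar>Gr ?S z\<bar> \<le> 2" for z
  unfolding GS using Gr_tent_bounds[OF e, of x z] Gr_tent_bounds[OF e, of "x + h" z] by linarith
 have GS2: "\<bar>Gr ?S y - Gr ?S (y + h)\<bar> \<le> 2 * h" for y
  unfolding GS using Gr_tent_lipschitz[OF e, of x y "y + h"] Gr_tent_lipschitz[OF e, of "x + h" y "y + h"] h by linarith
 have S: "MM (2 * m) V ?S \<le> 2 * fact (2 * m) * (4 * h) ^ m" for m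
 proof (induction m)
  case 0
  have "MM 0 V ?S = Gr ?S 0" by (rule MM_0[OF Sc Sb])
  then show ?case using GS1[of 0] by simp
 next
  case (Suc m)
  have "MM (2 * Suc m) V ?S \<le> \<bar>MM (Suc (Suc (2 * m))) V ?S\<bar>" by simp
  also have "\<dots> \<le> real (Suc (Suc (2 * m))) * real (Suc (2 * m)) * (4 * h) * MM (2 * m) V ?S"
   unfolding V_def by (rule MM_dipole_step[OF e h _ Sc Sb GS1 GS2]) simp
  also have "\<dots> \<le> real (Suc (Suc (2 * m))) * real (Suc (2 * m)) * (4 * h) * (2 * fact (2 * m) * (4 * h) ^ m)"
   using h by (intro mult_left_mono Suc.IH) auto
  also have "\<dots> = 2 * fact (2 * Suc m) * (4 * h) ^ Suc m"
   by (simp add: mult_ac)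
  finally show ?case .
 qed
 show ?thesis
 proof (cases m)
  case 0
  have "MM 0 V (\<lambda>_. 1) = Gr (\<lambda>_. 1) 0" by (rule MM_0[of _ 1]) auto
  then show ?thesis using 0 by (simp add: Gr_const)
 next
  case (Suc k)
  have "MM (2 * m) V (\<lambda>_. 1) \<le> \<bar>MM (Suc (Suc (2 * k))) V (\<lambda>_. 1)\<bar>" using Suc by simp
  also have "\<dots> \<le> real (Suc (Suc (2 * k))) * real (Suc (2 * k)) * (4 * h) * MM (2 * k) V ?S"
   unfolding V_def by (rule MM_dipole_step[OF e h, where Kf=1]) (use h in \<open>auto simp: Gr_const\<close>)
  also have "\<dots> \<le> real (Suc (Suc (2 * k))) * real (Suc (2 * k)) * (4 * h) * (2 * fact (2 * k) * (4 * h) ^ k)"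
   using h by (intro mult_left_mono S) auto
  also have "\<dots> = 2 * fact (2 * m) * (4 * h) ^ m"
   unfolding Suc by (simp add: mult_ac)
  finally show ?thesis .
 qed
qed

lemma MM_tent_bound:
 assumes e: "0 < \<epsilon>"
 shows "MM n (tent \<epsilon> x) (\<lambda>_. 1) \<le> 2 * fact n"
proof -
 let ?V = "tent \<epsilon> x"
 have V: "continuous_on UNIV ?V" by (rule tent_continuous)
 have KV: "\<bar>?V z\<bar> \<le> 1 / \<epsilon>" for z using tent_le[OF e, of x z] tent_nonneg[of \<epsilon> x z] by simp
 have pos: "0 \<le> AR ?V s w ^ n" for s w n by (intro zero_le_power AR_nonneg tent_nonneg)
 have Vm: "?V \<in> borel_measurable borel" using V by (rule borel_measurable_continuous_onI)
 have Gm: "Gr ?V \<in> borel_measurable borel"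
  by (rule borel_measurable_continuous_onI[OF Gr_continuous[OF V KV]])
 have S: "MM n ?V ?V \<le> fact n" for n
 proof (induction n)
  case 0
  have "MM 0 ?V ?V = Gr ?V 0" by (rule MM_0[OF V KV])
  then show ?case using Gr_tent_bounds[OF e, of x 0] by simp
 next
  case (Suc n)
  have "MM n ?V (\<lambda>z. ?V z * Gr ?V z) \<le> \<bar>MM n ?V (\<lambda>z. ?V z * Gr ?V z)\<bar>" by simp
  also have "\<dots> \<le> MM n ?V ?V"
  proof (rule MM_mono[OF V KV _ Vm KV _ pos])
   fix z show "\<bar>?V z * Gr ?V z\<bar> \<le> ?V z"
    using mult_left_mono[OF Gr_tent_bounds(2)[OF e, of x z] tent_nonneg[of \<epsilon> x z]] Gr_tent_bounds(1)[OF e, of x z] tent_nonneg[of \<epsilon> x z]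
    by (simp add: abs_mult)
  qed (use Vm Gm in auto)
  finally have "MM n ?V (\<lambda>z. ?V z * Gr ?V z) \<le> fact n" using Suc.IH by simp
  then have "real (Suc n) * MM n ?V (\<lambda>z. ?V z * Gr ?V z) \<le> real (Suc n) * fact n" by (intro mult_left_mono) auto
  then show ?case unfolding MM_rec[OF V KV V KV] by simp
 qed
 show ?thesis
 proof (cases n)
  case 0
  have "MM 0 ?V (\<lambda>_. 1) = Gr (\<lambda>_. 1) 0" by (rule MM_0[of _ 1]) auto
  then show ?thesis using 0 by (simp add: Gr_const)
 next
  case (Suc k)
  have "MM (Suc k) ?V (\<lambda>_. 1) = real (Suc k) * MM k ?V (\<lambda>z. ?V z * Gr (\<lambda>_. 1) z)"
   by (rule MM_rec[OF V KV, where Kf=1]) auto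
  also have "\<dots> = real (Suc k) * (2 * MM k ?V ?V)"
   unfolding Gr_const mult.commute[of "tent _ _ _"] MM_cmult by simp
  also have "\<dots> \<le> real (Suc k) * (2 * fact k)" by (intro mult_left_mono S) auto
  finally show ?thesis using Suc by (simp add: mult_ac)
 qed
qed

end

section \<open>Tools for passing to a fixed time\<close>

text \<open>Up to the factor \<open>exp (\<tau> / 2)\<close> the potential up to time \<open>\<tau>\<close> is dominated by the resolvent, whose kernel is Lipschitz.\<close>

lemma heat_kernel_diff_bound:
 shows "(\<integral>\<^sup>+u. ennreal (indicator {0<..\<tau>} u * \<bar>normal_density 0 (sqrt u) a - normal_density 0 (sqrt u) b\<bar>) \<partial>lborel)
   \<le> ennreal (exp (\<tau> / 2) * \<bar>a - b\<bar>)"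
proof -
 have *: "(\<integral>\<^sup>+u. ennreal (indicator {0<..\<tau>} u * \<bar>normal_density 0 (sqrt u) a - normal_density 0 (sqrt u) b\<bar>) \<partial>lborel)
   \<le> ennreal (exp (\<tau> / 2) * \<bar>a - b\<bar>)" if ab: "\<bar>a\<bar> \<le> \<bar>b\<bar>" for a b
 proof -
  let ?d = "\<lambda>u. exp (- u / 2) * normal_density 0 (sqrt u) a - exp (- u / 2) * normal_density 0 (sqrt u) b"
  have le: "normal_density 0 (sqrt u) b \<le> normal_density 0 (sqrt u) a" if "0 < u" for u
  proof -
   have "a\<^sup>2 \<le> b\<^sup>2" using ab by (simp add: abs_le_square_iff)
   then show ?thesis unfolding normal_density_def using that
    by (intro mult_left_mono) (auto intro!: divide_right_mono)
  qed
  have d0: "0 \<le> ?d u" if "0 < u" for u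
   unfolding right_diff_distrib[symmetric] using le[OF that] by simp
  have i: "set_integrable lborel {0<..} ?d"
   by (intro set_integral_diff resolvent_kernel)
  have "(\<integral>\<^sup>+u. ennreal (indicator {0<..\<tau>} u * \<bar>normal_density 0 (sqrt u) a - normal_density 0 (sqrt u) b\<bar>) \<partial>lborel)
   \<le> (\<integral>\<^sup>+u. ennreal (exp (\<tau> / 2) * (indicator {0<..} u *\<^sub>R ?d u)) \<partial>lborel)"
  proof (intro nn_integral_mono ennreal_leI)
   fix u :: real
   show "indicator {0<..\<tau>} u * \<bar>normal_density 0 (sqrt u) a - normal_density 0 (sqrt u) b\<bar> \<le> exp (\<tau> / 2) * (indicator {0<..} u *\<^sub>R ?d u)"
   proof (cases "0 < u \<and> u \<le> \<tau>")
    case True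
    have "normal_density 0 (sqrt u) a - normal_density 0 (sqrt u) b = exp (u / 2) * ?d u"
    unfolding right_diff_distrib[symmetric] by (simp flip: mult.assoc exp_add)
    also have "\<dots> \<le> exp (\<tau> / 2) * ?d u" using True d0[of u] by (intro mult_right_mono) auto
    finally show ?thesis using True le[of u] by simp
   next
    case False
    then show ?thesis using d0[of u] by (auto split: split_indicator)
   qed
  qed
  also have "\<dots> = ennreal (LINT u|lborel. exp (\<tau> / 2) * (indicator {0<..} u *\<^sub>R ?d u))"
   using i d0 unfolding set_integrable_def
   by (intro nn_integral_eq_integral) (auto split: split_indicator intro!: AE_I2 integrable_mult_right)
  also have "(LINT u|lborel. exp (\<tau> / 2) * (indicator {0<..} u *\<^sub>R ?d u)) = exp (\<tau> / 2) * (exp (-\<bar>a\<bar>) - exp (-\<bar>b\<bar>))"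
   using set_integral_diff(2)[OF resolvent_kernel(1)[of a] resolvent_kernel(1)[of b]]
   unfolding set_lebesgue_integral_def resolvent_kernel(2)[unfolded set_lebesgue_integral_def] by simp
  also have "\<dots> \<le> exp (\<tau> / 2) * \<bar>a - b\<bar>"
   using exp_abs_lipschitz[of a b] by (intro mult_left_mono) auto
  finally show ?thesis by (simp add: ennreal_leI)
 qed
 show ?thesis
  using *[of a b] *[of b a] by (cases "\<bar>a\<bar> \<le> \<bar>b\<bar>") (auto simp: abs_minus_commute)
qed

lemma tent_dipole_eq:
 fixes k :: "real \<Rightarrow> real"
 assumes e: "0 < \<epsilon>" and k: "k \<in> borel_measurable borel" "\<And>y. \<bar>k y\<bar> \<le> K"
 shows "(LINT y|lborel. (tent \<epsilon> x y - tent \<epsilon> (x + h) y) * k y) = (LINT y|lborel. tent \<epsilon> x y * (k y - k (y + h)))"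
proof -
 have k': "(\<lambda>y. k (y + h)) \<in> borel_measurable borel" using k by measurable
 have "(LINT y|lborel. tent \<epsilon> (x + h) y * k y) = (LINT y|lborel. tent \<epsilon> x y * k (y + h))"
  by (subst lborel_integral_real_affine[where c=1 and t=h]) (auto simp: add.commute[of h] tent_shift)
 then show ?thesis
  using tent_mult_integrable[OF e k] tent_mult_integrable[OF e k' k(2)]
  by (simp add: left_diff_distrib right_diff_distrib)
qed

lemma normal_density_le: assumes "0 < \<sigma>" shows "normal_density \<mu> \<sigma> x \<le> 1 / (2 * \<sigma>)"
proof -
 have "sqrt (2 * pi * \<sigma>\<^sup>2) = sqrt (2 * pi) * \<sigma>" using assms by (simp add: real_sqrt_mult)
 moreover have "2 \<le> sqrt (2 * pi)" using pi_ge_two by (intro real_le_rsqrt) auto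
 ultimately have "2 * \<sigma> \<le> sqrt (2 * pi * \<sigma>\<^sup>2)" using assms by simp
 then have "1 / sqrt (2 * pi * \<sigma>\<^sup>2) \<le> 1 / (2 * \<sigma>)" using assms by (intro divide_left_mono) auto
 moreover have "normal_density \<mu> \<sigma> x \<le> 1 / sqrt (2 * pi * \<sigma>\<^sup>2) * 1"
  unfolding normal_density_def by (intro mult_left_mono) auto
 ultimately show ?thesis by simp
qed

text \<open>Bounds a function at one time by its exponential average when it does not fall too fast after that time.\<close>

lemma window_lower_bound:
 fixes \<phi> :: "real \<Rightarrow> real"
 assumes i: "set_integrable lborel {0<..} (\<lambda>s. exp (- s / 2) * \<phi> s)"
  and pos: "\<And>s. 0 < s \<Longrightarrow> 0 \<le> \<phi> s" and t: "0 \<le> t" and d: "0 < \<delta>"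
  and a: "\<And>s. t < s \<Longrightarrow> s \<le> t + \<delta> \<Longrightarrow> a \<le> \<phi> s"
 shows "\<delta> * a * exp (- (t + \<delta>) / 2) \<le> (LINT s:{0<..}|lborel. exp (- s / 2) * \<phi> s)"
proof (cases "0 \<le> a")
 case True
 have "\<delta> * a * exp (- (t + \<delta>) / 2) = (LINT s|lborel. indicator {t<..t + \<delta>} s *\<^sub>R (a * exp (- (t + \<delta>) / 2)))"
  using d by simp
 also have "\<dots> \<le> (LINT s|lborel. indicator {0<..} s *\<^sub>R (exp (- s / 2) * \<phi> s))"
 proof (rule integral_mono[OF _ i[unfolded set_integrable_def]])
  fix s
  show "indicator {t<..t + \<delta>} s *\<^sub>R (a * exp (- (t + \<delta>) / 2)) \<le> indicator {0<..} s *\<^sub>R (exp (- s / 2) * \<phi> s)"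
  proof (cases "t < s \<and> s \<le> t + \<delta>")
   case True
   then have "a * exp (- (t + \<delta>) / 2) \<le> \<phi> s * exp (- s / 2)"
    using a[of s] \<open>0 \<le> a\<close> by (intro mult_mono) auto
   then show ?thesis using True t by (simp add: mult.commute)
  qed (use pos in \<open>auto split: split_indicator\<close>)
 qed (use d in \<open>auto simp: emeasure_lborel_Ioc intro!: integrable_real_indicator\<close>)
 finally show ?thesis unfolding set_lebesgue_integral_def .
next
 case False
 have "0 \<le> (LINT s:{0<..}|lborel. exp (- s / 2) * \<phi> s)"
  unfolding set_lebesgue_integral_def by (rule integral_nonneg_AE) (use pos in \<open>auto split: split_indicator\<close>)
 moreover have "\<delta> * a * exp (- (t + \<delta>) / 2) \<le> 0" using False d by (intro mult_nonpos_nonneg mult_nonneg_nonpos) auto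
 ultimately show ?thesis by linarith
qed

lemma inverse_sqrt_time_integral:
 fixes q :: "real \<Rightarrow> real"
 assumes st: "0 \<le> s" "s \<le> t" and q: "q \<in> borel_measurable borel" "\<And>r. \<bar>q r\<bar> \<le> K"
  and le: "\<And>r. 0 < r \<Longrightarrow> q r \<le> c / (2 * sqrt r)" and c: "0 \<le> c"
 shows "(LINT r:{s..t}|lborel. q r) \<le> c * sqrt (t - s)"
proof -
 have i: "set_integrable lborel {s..t} q"
  unfolding set_integrable_def
  by (rule Bochner_Integration.integrable_bound[of _ "\<lambda>r. indicator {s..t} r * K"])
    (use q order_trans[OF abs_ge_zero q(2)] in \<open>auto simp: emeasure_lborel_Icc_eq split: split_indicator intro!: AE_I2 order_trans[OF q(2) abs_ge_self]\<close>)
 have h: "((\<lambda>r. c / (2 * sqrt r)) has_integral (c * sqrt t - c * sqrt s)) {s..t}"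
 proof (rule fundamental_theorem_of_calculus_interior[OF st(2)])
  show "continuous_on {s..t} (\<lambda>r. c * sqrt r)" by (intro continuous_intros)
  fix r assume "r \<in> {s<..<t}"
  then have "0 < r" using st by auto
  then have "((\<lambda>r. c * sqrt r) has_real_derivative c / (2 * sqrt r)) (at r)"
   by (auto intro!: derivative_eq_intros simp: field_simps)
  then show "((\<lambda>r. c * sqrt r) has_vector_derivative c / (2 * sqrt r)) (at r)"
   by (simp add: has_real_derivative_iff_has_vector_derivative)
 qed
 have h': "((\<lambda>r. if r = 0 then K else c / (2 * sqrt r)) has_integral (c * sqrt t - c * sqrt s)) {s..t}"
  by (rule has_integral_spike[OF _ _ h, of "{0}"]) auto
 have "(LINT r:{s..t}|lborel. q r) = integral {s..t} q" by (rule set_borel_integral_eq_integral[OF i])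
 also have "\<dots> \<le> c * sqrt t - c * sqrt s"
 proof (rule has_integral_le[OF integrable_integral[OF set_borel_integral_eq_integral(1)[OF i]] h'])
  fix r assume "r \<in> {s..t}"
  then show "q r \<le> (if r = 0 then K else c / (2 * sqrt r))" using st le[of r] q(2)[of r] by auto
 qed
 also have "\<dots> \<le> c * sqrt (t - s)"
 proof -
  have "sqrt t \<le> sqrt s + sqrt (t - s)" using sqrt_add_le_add_sqrt[of s "t - s"] st by simp
  then have "sqrt t - sqrt s \<le> sqrt (t - s)" by simp
  from mult_left_mono[OF this c] show ?thesis by (simp add: right_diff_distrib)
 qed
 finally show ?thesis .
qed

context cont_bm begin

lemma markov_real:
 fixes V \<psi> f :: "real \<Rightarrow> real"
 assumes rs: "0 \<le> r" "r < s"
  and V: "continuous_on UNIV V" and KV: "\<And>x. \<bar>V x\<bar> \<le> KV"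
  and \<psi>: "continuous_on UNIV \<psi>" and K\<psi>: "\<And>x. \<bar>\<psi> x\<bar> \<le> K\<psi>"
  and f: "continuous_on UNIV f" and Kf: "\<And>x. \<bar>f x\<bar> \<le> Kf"
 shows "(LINT w|M. AR V r w ^ k * \<psi> (B r w) * f (B s w))
  = (LINT w|M. AR V r w ^ k * \<psi> (B r w) * (LINT y|lborel. normal_density 0 (sqrt (s - r)) y * f (B r w + y)))"
proof -
 have "(LINT w|M. (AF (\<lambda>x. complex_of_real (V x)) r w) ^ k * complex_of_real (\<psi> (B r w)) * complex_of_real (f (B s w)))
  = (LINT w|M. (AF (\<lambda>x. complex_of_real (V x)) r w) ^ k * complex_of_real (\<psi> (B r w)) * (LINT y|lborel. normal_density 0 (sqrt (s - r)) y *\<^sub>R complex_of_real (f (B r w + y))))"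
  by (rule markov[OF rs, where KU=KV and K\<psi>=K\<psi> and Kf=Kf])
    (use V KV \<psi> K\<psi> f Kf in \<open>auto intro!: continuous_intros\<close>)
 moreover have "(LINT y|lborel. normal_density 0 (sqrt (s - r)) y *\<^sub>R complex_of_real (f (z + y))) = complex_of_real (LINT y|lborel. normal_density 0 (sqrt (s - r)) y * f (z + y))" for z
  unfolding scaleR_conv_of_real of_real_mult[symmetric] by (rule integral_complex_of_real)
 ultimately show ?thesis
  by (simp only: AF_of_real of_real_power[symmetric] of_real_mult[symmetric] integral_complex_of_real of_real_eq_iff)
qed

lemma expectation_B:
 fixes f :: "real \<Rightarrow> real"
 assumes "0 < r" "f \<in> borel_measurable borel"
 shows "(LINT w|M. f (B r w)) = (LINT y|lborel. normal_density 0 (sqrt r) y * f y)"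
 using distributed_integral[OF B_gauss[of 0 r], of f] assms by (simp add: B_zero normal_density_nonneg)

lemma expectation_tent_le:
 assumes e: "0 < \<epsilon>" and r: "0 < r"
 shows "(LINT w|M. tent \<epsilon> x (B r w)) \<le> 1 / (2 * sqrt r)"
proof -
 have "(LINT w|M. tent \<epsilon> x (B r w)) = (LINT y|lborel. tent \<epsilon> x y * normal_density 0 (sqrt r) y)"
  using expectation_B[OF r, of "tent \<epsilon> x"] by (simp add: mult.commute)
 also have "\<dots> \<le> (LINT y|lborel. tent \<epsilon> x y * (1 / (2 * sqrt r)))"
  using r by (intro integral_mono tent_mult_integrable[OF e, where K="1 / (2 * sqrt r)"] mult_left_mono normal_density_le tent_nonneg)
   (auto simp: normal_density_nonneg normal_density_le)
 also have "\<dots> = 1 / (2 * sqrt r)" using tent_integral[OF e] by simp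
 finally show ?thesis .
qed

lemma AR_diff:
 assumes V: "continuous_on UNIV V" and rt: "0 \<le> r" "r \<le> t"
 shows "AR V t w - AR V r w = (LINT u|lborel. indicator {r<..t} u * V (B u w))"
proof -
 have "AR V t w - AR V r w = (LINT u|lborel. indicator {0..t} u *\<^sub>R V (B u w) - indicator {0..r} u *\<^sub>R V (B u w))"
  unfolding AR_def set_lebesgue_integral_def
  by (rule Bochner_Integration.integral_diff[symmetric]) (use AR_integrable[OF V] in \<open>auto simp: set_integrable_def\<close>)
 also have "\<dots> = (LINT u|lborel. indicator {r<..t} u * V (B u w))"
  by (rule Bochner_Integration.integral_cong) (use rt in \<open>auto split: split_indicator\<close>)
 finally show ?thesis .
qed

text \<open>The Markov property at the left end reduces the increment of the occupation integral of a dipole to a potential over the window, which is of order \<open>h\<close> because heat kernels at distance \<open>h\<close> nearly cancel.\<close>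

lemma potential_window:
 fixes x h \<epsilon> :: real
 defines "V \<equiv> dip \<epsilon> x h"
 assumes e: "0 < \<epsilon>" and h: "0 \<le> h" and rt: "0 \<le> r" "r \<le> t"
  and \<psi>: "continuous_on UNIV \<psi>" and K\<psi>: "\<And>x. \<bar>\<psi> x\<bar> \<le> K\<psi>"
 shows "\<bar>LINT w|M. AR V r w ^ k * \<psi> (B r w) * (AR V t w - AR V r w)\<bar>
  \<le> exp ((t - r) / 2) * h * (LINT w|M. \<bar>AR V r w ^ k * \<psi> (B r w)\<bar>)"
proof -
 have V: "continuous_on UNIV V" and KV: "\<And>z. \<bar>V z\<bar> \<le> 1 / \<epsilon>"
  unfolding V_def using dip_continuous dip_bound[OF e] by auto
 have [measurable]: "V \<in> borel_measurable borel" "\<psi> \<in> borel_measurable borel"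
  using V \<psi> by (auto intro: borel_measurable_continuous_onI)
 note [measurable] = AR_measurable[OF V]
 interpret LM: pair_sigma_finite "lborel :: real measure" M ..
 define W where "W w = AR V r w ^ k * \<psi> (B r w)" for w
 have Wm [measurable]: "W \<in> borel_measurable M" unfolding W_def by measurable
 have Wi: "integrable M W" unfolding W_def by (rule AR_power_integrable[OF V KV rt(1) _ K\<psi>]) simp
 define C where "C = (4 * (1 / \<epsilon>)) ^ k * fact k * exp (r / 4) * K\<psi>"
 have Wb: "\<bar>W w\<bar> \<le> C" for w
  unfolding W_def abs_mult C_def
  by (intro mult_mono AR_power_bound[OF V KV rt(1)] K\<psi>) (use e in auto)
 have C0: "0 \<le> C" using order_trans[OF abs_ge_zero Wb] .
 let ?p = "\<lambda>u. normal_density 0 (sqrt u)"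
 let ?F = "\<lambda>u w y. \<bar>W w\<bar> * (tent \<epsilon> x y * (indicator {0<..t - r} (u - r) * \<bar>?p (u - r) (y - B r w) - ?p (u - r) (y + h - B r w)\<bar>))"
 have gi: "integrable (lborel \<Otimes>\<^sub>M M) (\<lambda>(u, w). indicator {r<..t} u * (C * (1 / \<epsilon>)))"
  by (rule LM.integrable_mult_pair) (use rt in \<open>auto intro!: integrable_real_indicator simp: emeasure_lborel_Ioc\<close>)
 have "(LINT w|M. W w * (AR V t w - AR V r w)) = (LINT w|M. LINT u|lborel. indicator {r<..t} u * (W w * V (B u w)))"
  unfolding AR_diff[OF V rt] by (simp add: mult.left_commute[of _ "W _"])
 also have "\<dots> = (LINT u|lborel. LINT w|M. indicator {r<..t} u * (W w * V (B u w)))"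
 proof (rule LM.Fubini_integral_dominated[symmetric, OF _ gi])
  fix u w
  have "\<bar>W w\<bar> * \<bar>V (B u w)\<bar> \<le> C * (1 / \<epsilon>)" by (intro mult_mono Wb KV) (use C0 in auto)
  then show "norm (indicator {r<..t} u * (W w * V (B u w))) \<le> indicator {r<..t} u * (C * (1 / \<epsilon>))"
   by (auto simp: abs_mult split: split_indicator)
 qed measurable
 finally have eq: "(LINT w|M. W w * (AR V t w - AR V r w)) = (LINT u|lborel. LINT w|M. indicator {r<..t} u * (W w * V (B u w)))" .
 have pt: "ennreal \<bar>LINT w|M. indicator {r<..t} u * (W w * V (B u w))\<bar> \<le> (\<integral>\<^sup>+w. \<integral>\<^sup>+y. ennreal (?F u w y) \<partial>lborel \<partial>M)" for u
 proof (cases "r < u \<and> u \<le> t")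
  case True
  have sp: "0 < sqrt (u - r)" using True by simp
  have Kp: "\<bar>?p (u - r) y\<bar> \<le> 1 / (2 * sqrt (u - r))" for y
   using normal_density_le[OF sp, of 0 y] by (simp add: normal_density_nonneg)
  have P: "(LINT y|lborel. ?p (u - r) y * V (z + y)) = (LINT y|lborel. tent \<epsilon> x y * (?p (u - r) (y - z) - ?p (u - r) (y + h - z)))" for z
  proof -
   have "(LINT y|lborel. ?p (u - r) y * V (z + y)) = (LINT y|lborel. V y * ?p (u - r) (y - z))"
    by (subst lborel_integral_real_affine[where c=1 and t="-z"]) (auto simp: mult.commute)
   also have "\<dots> = (LINT y|lborel. tent \<epsilon> x y * (?p (u - r) (y - z) - ?p (u - r) (y + h - z)))"
    unfolding V_def by (rule tent_dipole_eq[OF e, where K="1 / (2 * sqrt (u - r))"]) (use Kp in auto)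
   finally show ?thesis .
  qed
  have "(LINT w|M. W w * V (B u w)) = (LINT w|M. W w * (LINT y|lborel. tent \<epsilon> x y * (?p (u - r) (y - B r w) - ?p (u - r) (y + h - B r w))))"
   unfolding P[symmetric] W_def
   by (rule markov_real[OF rt(1) _ V KV \<psi> K\<psi> V KV]) (use True in auto)
  then have "ennreal \<bar>LINT w|M. indicator {r<..t} u * (W w * V (B u w))\<bar>
   = ennreal \<bar>LINT w|M. W w * (LINT y|lborel. tent \<epsilon> x y * (?p (u - r) (y - B r w) - ?p (u - r) (y + h - B r w)))\<bar>"
   using True by simp
  also have "\<dots> \<le> (\<integral>\<^sup>+w. ennreal \<bar>W w * (LINT y|lborel. tent \<epsilon> x y * (?p (u - r) (y - B r w) - ?p (u - r) (y + h - B r w)))\<bar> \<partial>M)"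
   using integral_norm_bound_ennreal[of M "\<lambda>w. W w * (LINT y|lborel. tent \<epsilon> x y * (?p (u - r) (y - B r w) - ?p (u - r) (y + h - B r w)))"]
    not_integrable_integral_eq[of M "\<lambda>w. W w * (LINT y|lborel. tent \<epsilon> x y * (?p (u - r) (y - B r w) - ?p (u - r) (y + h - B r w)))"]
   by fastforce
  also have "\<dots> \<le> (\<integral>\<^sup>+w. \<integral>\<^sup>+y. ennreal (?F u w y) \<partial>lborel \<partial>M)"
  proof (rule nn_integral_mono)
   fix w
   let ?k = "\<lambda>y. tent \<epsilon> x y * (?p (u - r) (y - B r w) - ?p (u - r) (y + h - B r w))"
   have "ennreal \<bar>W w * (LINT y|lborel. ?k y)\<bar> = ennreal \<bar>LINT y|lborel. W w * ?k y\<bar>" by simp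
   also have "\<dots> \<le> (\<integral>\<^sup>+y. ennreal \<bar>W w * ?k y\<bar> \<partial>lborel)"
    using integral_norm_bound_ennreal[of lborel "\<lambda>y. W w * ?k y"] not_integrable_integral_eq[of lborel "\<lambda>y. W w * ?k y"]
    by fastforce
   also have "\<dots> = (\<integral>\<^sup>+y. ennreal (?F u w y) \<partial>lborel)"
    using True by (intro nn_integral_cong) (simp add: abs_mult tent_nonneg)
   finally show "ennreal \<bar>W w * (LINT y|lborel. ?k y)\<bar> \<le> (\<integral>\<^sup>+y. ennreal (?F u w y) \<partial>lborel)" .
  qed
  finally show ?thesis .
 qed auto
 have "ennreal \<bar>LINT w|M. W w * (AR V t w - AR V r w)\<bar> \<le> (\<integral>\<^sup>+u. ennreal \<bar>LINT w|M. indicator {r<..t} u * (W w * V (B u w))\<bar> \<partial>lborel)"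
  unfolding eq
  using integral_norm_bound_ennreal[of lborel "\<lambda>u. LINT w|M. indicator {r<..t} u * (W w * V (B u w))"]
   not_integrable_integral_eq[of lborel "\<lambda>u. LINT w|M. indicator {r<..t} u * (W w * V (B u w))"]
  by fastforce
 also have "\<dots> \<le> (\<integral>\<^sup>+u. \<integral>\<^sup>+w. \<integral>\<^sup>+y. ennreal (?F u w y) \<partial>lborel \<partial>M \<partial>lborel)"
  by (intro nn_integral_mono pt)
 also have "\<dots> = (\<integral>\<^sup>+w. \<integral>\<^sup>+u. \<integral>\<^sup>+y. ennreal (?F u w y) \<partial>lborel \<partial>lborel \<partial>M)"
  by (rule LM.Fubini'[symmetric]) measurable
 also have "\<dots> = (\<integral>\<^sup>+w. \<integral>\<^sup>+y. \<integral>\<^sup>+u. ennreal (?F u w y) \<partial>lborel \<partial>lborel \<partial>M)"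
  by (intro nn_integral_cong lborel_pair.Fubini') measurable
 also have "\<dots> \<le> (\<integral>\<^sup>+w. \<integral>\<^sup>+y. ennreal (\<bar>W w\<bar> * (tent \<epsilon> x y * (exp ((t - r) / 2) * h))) \<partial>lborel \<partial>M)"
 proof (intro nn_integral_mono)
  fix w and y :: real
  let ?q = "\<lambda>u. indicator {0<..t - r} u * \<bar>?p u (y - B r w) - ?p u (y + h - B r w)\<bar>"
  have "(\<integral>\<^sup>+u. ennreal (?q (u - r)) \<partial>lborel) = (\<integral>\<^sup>+u. ennreal (?q u) \<partial>lborel)"
   using nn_integral_real_affine[of "\<lambda>u. ennreal (?q u)" 1 "-r"] by simp
  also have "\<dots> \<le> ennreal (exp ((t - r) / 2) * \<bar>(y - B r w) - (y + h - B r w)\<bar>)"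
   by (rule heat_kernel_diff_bound)
  also have "\<bar>(y - B r w) - (y + h - B r w)\<bar> = h" using h by simp
  finally have q: "(\<integral>\<^sup>+u. ennreal (?q (u - r)) \<partial>lborel) \<le> ennreal (exp ((t - r) / 2) * h)" .
  have "(\<integral>\<^sup>+u. ennreal (?F u w y) \<partial>lborel) = (\<integral>\<^sup>+u. ennreal (\<bar>W w\<bar> * tent \<epsilon> x y) * ennreal (?q (u - r)) \<partial>lborel)"
   by (intro nn_integral_cong) (simp only: ennreal_mult'[symmetric] mult_nonneg_nonneg abs_ge_zero tent_nonneg mult.assoc)
  also have "\<dots> = ennreal (\<bar>W w\<bar> * tent \<epsilon> x y) * (\<integral>\<^sup>+u. ennreal (?q (u - r)) \<partial>lborel)"
   by (rule nn_integral_cmult) measurable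
  also have "\<dots> \<le> ennreal (\<bar>W w\<bar> * tent \<epsilon> x y) * ennreal (exp ((t - r) / 2) * h)"
   by (intro mult_left_mono q) auto
  also have "\<dots> = ennreal (\<bar>W w\<bar> * (tent \<epsilon> x y * (exp ((t - r) / 2) * h)))"
   by (simp only: ennreal_mult'[symmetric] mult_nonneg_nonneg abs_ge_zero tent_nonneg mult.assoc)
  finally show "(\<integral>\<^sup>+u. ennreal (?F u w y) \<partial>lborel) \<le> ennreal (\<bar>W w\<bar> * (tent \<epsilon> x y * (exp ((t - r) / 2) * h)))" .
 qed
 also have "\<dots> = (\<integral>\<^sup>+w. ennreal (exp ((t - r) / 2) * h * \<bar>W w\<bar>) \<partial>M)"
 proof (intro nn_integral_cong)
  fix w
  have "(\<integral>\<^sup>+y. ennreal (\<bar>W w\<bar> * (tent \<epsilon> x y * (exp ((t - r) / 2) * h))) \<partial>lborel) = ennreal (LINT y|lborel. \<bar>W w\<bar> * (tent \<epsilon> x y * (exp ((t - r) / 2) * h)))"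
   using tent_integrable[OF e, of x] h by (intro nn_integral_eq_integral) (auto simp: tent_nonneg)
  then show "(\<integral>\<^sup>+y. ennreal (\<bar>W w\<bar> * (tent \<epsilon> x y * (exp ((t - r) / 2) * h))) \<partial>lborel) = ennreal (exp ((t - r) / 2) * h * \<bar>W w\<bar>)"
   using tent_integral[OF e] by (simp add: mult_ac)
 qed
 also have "\<dots> = ennreal (exp ((t - r) / 2) * h * (LINT w|M. \<bar>W w\<bar>))"
  using Wi h by (subst nn_integral_eq_integral) auto
 finally show ?thesis
  using h by (simp add: W_def)
qed

end

section \<open>Moments of occupation integrals at a fixed time\<close>

text \<open>An even power lies above its tangents.\<close>

lemma even_power_tangent:
 fixes a b :: real
 assumes n: "even n" "2 \<le> n"
 shows "a ^ n + real n * a ^ (n - 1) * b \<le> (a + b) ^ n"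
proof (cases "a = 0")
 case True
 then show ?thesis using n by (auto simp: power_0_left zero_le_even_power)
next
 case False
 have "1 + real n * (b / a) \<le> (1 + b / a) ^ n" by (rule Bernoulli_inequality_even[OF n(1)])
 then have "a ^ n * (1 + real n * (b / a)) \<le> a ^ n * (1 + b / a) ^ n"
  using n by (intro mult_left_mono) (auto simp: zero_le_even_power)
 also have "a ^ n * (1 + b / a) ^ n = (a + b) ^ n"
  using False by (simp add: distrib_left flip: power_mult_distrib)
 also have "a ^ n * (1 + real n * (b / a)) = a ^ n + real n * a ^ (n - 1) * b"
  using False n by (cases n) (auto simp: field_simps)
 finally show ?thesis .
qed

lemma power_young:
 fixes c d :: real
 assumes n: "1 \<le> n" and c: "0 \<le> c"
 shows "c * \<bar>d\<bar> ^ (n - 1) \<le> \<bar>d\<bar> ^ n / 2 + (2 * c) ^ n"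
proof (cases "2 * c \<le> \<bar>d\<bar>")
 case True
 have "c * \<bar>d\<bar> ^ (n - 1) \<le> \<bar>d\<bar> / 2 * \<bar>d\<bar> ^ (n - 1)" using True by (intro mult_right_mono) auto
 also have "\<dots> = \<bar>d\<bar> ^ n / 2" using n by (cases n) auto
 finally show ?thesis using c by (simp add: add_increasing2)
next
 case False
 have "c * \<bar>d\<bar> ^ (n - 1) \<le> (2 * c) * (2 * c) ^ (n - 1)"
  using False c by (intro mult_mono power_mono) auto
 also have "\<dots> = (2 * c) ^ n" using n by (cases n) auto
 finally show ?thesis by (simp add: add_increasing)
qed

lemma le_exp_mult_of_mult_exp_le:
 fixes a c K :: real
 assumes "a * exp (- c / 2) \<le> K" shows "a \<le> exp (c / 2) * K"
proof -
 have "a = exp (c / 2) * (a * exp (- c / 2))" by (simp add: exp_minus)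
 also have "\<dots> \<le> exp (c / 2) * K" using assms by (intro mult_left_mono) auto
 finally show ?thesis .
qed

context cont_bm begin

text \<open>Convexity and \<open>potential_window\<close> prevent an even moment from dropping much during a unit of time after \<open>t\<close>, so its value at \<open>t\<close> is controlled by the exponential average bounded in \<open>MM_dipole_bound\<close>.\<close>

lemma AR_even_moment:
 assumes e: "0 < \<epsilon>" and h: "0 \<le> h" and t: "0 \<le> t" and m: "1 \<le> m"
 shows "(LINT w|M. AR (dip \<epsilon> x h) t w ^ (2 * m))
  \<le> 2 * ((8 * real m * h) ^ (2 * m) + exp ((t + 1) / 2) * (2 * fact (2 * m) * (4 * h) ^ m))"
proof -
 let ?V = "dip \<epsilon> x h" and ?n = "2 * m"
 let ?D = "\<lambda>s w. AR ?V s w"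
 have V: "continuous_on UNIV ?V" and KV: "\<And>z. \<bar>?V z\<bar> \<le> 1 / \<epsilon>"
  using dip_continuous dip_bound[OF e] by auto
 have int: "integrable M (\<lambda>w. ?D s w ^ k)" if "0 \<le> s" for s k
  using AR_power_integrable[OF V KV that, of "\<lambda>_. 1" 1 k] by simp
 define a where "a = (LINT w|M. ?D t w ^ ?n) / 2 - (8 * real m * h) ^ ?n"
 have key: "a \<le> (LINT w|M. ?D s w ^ ?n * 1)" if s: "t < s" "s \<le> t + 1" for s
 proof -
  have s0: "0 \<le> s" using s t by simp
  define c where "c = real ?n * (2 * h)"
  have c0: "0 \<le> c" using h by (simp add: c_def)
  have i1: "integrable M (\<lambda>w. ?D t w ^ (?n - 1) * (?D s w - ?D t w))"
  proof (rule integrable_const_bound)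
   note [measurable] = AR_measurable[OF V]
   show "(\<lambda>w. ?D t w ^ (?n - 1) * (?D s w - ?D t w)) \<in> borel_measurable M" by measurable
   have "\<bar>?D s w - ?D t w\<bar> \<le> s * (1 / \<epsilon>) + t * (1 / \<epsilon>)" for w
    using AR_bound[OF V KV s0, of w] AR_bound[OF V KV t, of w] by linarith
   then show "AE w in M. norm (?D t w ^ (?n - 1) * (?D s w - ?D t w)) \<le> (((4 * (1/\<epsilon>)) ^ (?n-1) * fact (?n-1)) * exp (t / 4)) * (s * (1 / \<epsilon>) + t * (1 / \<epsilon>))"
    unfolding real_norm_def abs_mult
    by (intro AE_I2 mult_mono AR_power_bound[OF V KV t]) (use e in auto)
  qed
  have "(LINT w|M. ?D t w ^ ?n + real ?n * (?D t w ^ (?n - 1) * (?D s w - ?D t w))) \<le> (LINT w|M. ?D s w ^ ?n)"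
  proof (rule integral_mono)
   fix w
   show "?D t w ^ ?n + real ?n * (?D t w ^ (?n - 1) * (?D s w - ?D t w)) \<le> ?D s w ^ ?n"
    using even_power_tangent[of ?n "?D t w" "?D s w - ?D t w"] m by (simp add: mult.assoc)
  qed (use int[OF t] int[OF s0] i1 in auto)
  then have A: "(LINT w|M. ?D t w ^ ?n) + real ?n * (LINT w|M. ?D t w ^ (?n - 1) * (?D s w - ?D t w)) \<le> (LINT w|M. ?D s w ^ ?n)"
   using int[OF t] i1 by simp
  have ee: "exp ((s - t) / 2) \<le> 2"
  proof -
   have "exp ((s - t) / 2) \<le> exp (1 / 2)" using s by simp
   also have "\<dots> \<le> 2" using exp_bound_half[of "1/2::real"] by simp
   finally show ?thesis .
  qed
  have "\<bar>LINT w|M. ?D t w ^ (?n - 1) * (?D s w - ?D t w)\<bar> \<le> exp ((s - t) / 2) * h * (LINT w|M. \<bar>?D t w ^ (?n - 1)\<bar>)"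
   using potential_window[OF e h t, of s "\<lambda>_. 1" 1 x "?n - 1"] s by simp
  also have "\<dots> \<le> 2 * h * (LINT w|M. \<bar>?D t w ^ (?n - 1)\<bar>)"
   using ee h by (intro mult_right_mono integral_nonneg_AE) auto
  finally have "real ?n * \<bar>LINT w|M. ?D t w ^ (?n - 1) * (?D s w - ?D t w)\<bar> \<le> real ?n * (2 * h * (LINT w|M. \<bar>?D t w ^ (?n - 1)\<bar>))"
   by (intro mult_left_mono) auto
  also have "\<dots> = (LINT w|M. c * \<bar>?D t w\<bar> ^ (?n - 1))"
   by (simp add: c_def power_abs)
  also have "\<dots> \<le> (LINT w|M. ?D t w ^ ?n / 2 + (2 * c) ^ ?n)"
  proof (rule integral_mono)
   show "integrable M (\<lambda>w. c * \<bar>?D t w\<bar> ^ (?n - 1))"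
    using integrable_abs[OF int[OF t, of "?n - 1"]] by (simp add: power_abs)
   show "integrable M (\<lambda>w. ?D t w ^ ?n / 2 + (2 * c) ^ ?n)" using int[OF t] by auto
   fix w show "c * \<bar>?D t w\<bar> ^ (?n - 1) \<le> ?D t w ^ ?n / 2 + (2 * c) ^ ?n"
    using power_young[of ?n c "?D t w"] c0 m by (simp add: power_even_abs)
  qed
  also have "\<dots> = (LINT w|M. ?D t w ^ ?n) / 2 + (2 * c) ^ ?n"
   using int[OF t] by (simp add: prob_space)
  also have "2 * c = 8 * real m * h" by (simp add: c_def)
  finally have "real ?n * \<bar>LINT w|M. ?D t w ^ (?n - 1) * (?D s w - ?D t w)\<bar> \<le> (LINT w|M. ?D t w ^ ?n) / 2 + (8 * real m * h) ^ ?n" .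
  moreover have "- (real ?n * \<bar>LINT w|M. ?D t w ^ (?n - 1) * (?D s w - ?D t w)\<bar>) \<le> real ?n * (LINT w|M. ?D t w ^ (?n - 1) * (?D s w - ?D t w))"
   unfolding mult_minus_right[symmetric] by (intro mult_left_mono) auto
  ultimately show ?thesis using A unfolding a_def by simp
 qed
 have "1 * a * exp (- (t + 1) / 2) \<le> MM ?n ?V (\<lambda>_. 1)"
  unfolding MM_def
  by (rule window_lower_bound[OF MM_integrable[OF V KV, where Kf=1] _ t _ key])
    (auto intro!: integral_nonneg_AE)
 also have "\<dots> \<le> 2 * fact ?n * (4 * h) ^ m" by (rule MM_dipole_bound[OF e h])
 finally have "a \<le> exp ((t + 1) / 2) * (2 * fact ?n * (4 * h) ^ m)"
  by (intro le_exp_mult_of_mult_exp_le) simp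
 then show ?thesis unfolding a_def by simp
qed

lemma AR_tent_moment:
 assumes e: "0 < \<epsilon>" and t: "0 \<le> t"
 shows "(LINT w|M. AR (tent \<epsilon> x) t w ^ n) \<le> exp ((t + 1) / 2) * (2 * fact n)"
proof -
 let ?V = "tent \<epsilon> x"
 have V: "continuous_on UNIV ?V" by (rule tent_continuous)
 have KV: "\<bar>?V z\<bar> \<le> 1 / \<epsilon>" for z using tent_le[OF e, of x z] tent_nonneg[of \<epsilon> x z] by simp
 have int: "integrable M (\<lambda>w. AR ?V s w ^ k)" if "0 \<le> s" for s k
  using AR_power_integrable[OF V KV that, of "\<lambda>_. 1" 1 k] by simp
 let ?a = "LINT w|M. AR ?V t w ^ n"
 have "1 * ?a * exp (- (t + 1) / 2) \<le> MM n ?V (\<lambda>_. 1)"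
  unfolding MM_def
 proof (rule window_lower_bound[OF MM_integrable[OF V KV, where Kf=1] _ t])
  fix s assume s: "t < s" "s \<le> t + 1"
  have "?a \<le> (LINT w|M. AR ?V s w ^ n)"
   using s t by (intro integral_mono int power_mono AR_mono V AR_nonneg tent_nonneg) auto
  then show "?a \<le> (LINT w|M. AR ?V s w ^ n * 1)" by simp
 qed (auto intro!: integral_nonneg_AE AE_I2 zero_le_power AR_nonneg tent_nonneg)
 also have "\<dots> \<le> 2 * fact n" by (rule MM_tent_bound[OF e])
 finally show ?thesis
  by (intro le_exp_mult_of_mult_exp_le) simp
qed

lemma AR_tent_increment:
 assumes e: "0 < \<epsilon>" and st: "0 \<le> s" "s \<le> t"
 shows "(LINT w|M. AR (tent \<epsilon> x) t w - AR (tent \<epsilon> x) s w) \<le> sqrt (t - s)"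
proof -
 let ?V = "tent \<epsilon> x"
 have V: "continuous_on UNIV ?V" by (rule tent_continuous)
 have KV: "\<bar>?V z\<bar> \<le> 1 / \<epsilon>" for z using tent_le[OF e, of x z] tent_nonneg[of \<epsilon> x z] by simp
 interpret LM: pair_sigma_finite "lborel :: real measure" M ..
 have gi: "integrable (lborel \<Otimes>\<^sub>M M) (\<lambda>(u, w). indicator {s<..t} u * (1 / \<epsilon>))"
  by (rule LM.integrable_mult_pair) (use st in \<open>auto intro!: integrable_real_indicator simp: emeasure_lborel_Ioc\<close>)
 have "(LINT w|M. AR ?V t w - AR ?V s w) = (LINT w|M. LINT u|lborel. indicator {s<..t} u * ?V (B u w))"
  unfolding AR_diff[OF V st] ..
 also have "\<dots> = (LINT u|lborel. LINT w|M. indicator {s<..t} u * ?V (B u w))"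
 proof (rule LM.Fubini_integral_dominated[symmetric, OF _ gi])
  fix u w show "norm (indicator {s<..t} u * ?V (B u w)) \<le> indicator {s<..t} u * (1 / \<epsilon>)"
   using KV[of "B u w"] by (auto simp: abs_mult split: split_indicator)
 qed measurable
 also have "\<dots> = (LINT u:{s..t}|lborel. LINT w|M. ?V (B u w))"
  unfolding set_lebesgue_integral_def
 proof (rule Bochner_Integration.integral_cong_AE)
  show "AE u in lborel. (LINT w|M. indicator {s<..t} u * ?V (B u w)) = indicator {s..t} u *\<^sub>R (LINT w|M. ?V (B u w))"
   using AE_lborel_singleton[of s] by eventually_elim (auto split: split_indicator)
 qed measurable
 also have "\<dots> \<le> 1 * sqrt (t - s)"
 proof (rule inverse_sqrt_time_integral[OF st])
  fix r :: real assume "0 < r" then show "(LINT w|M. ?V (B r w)) \<le> 1 / (2 * sqrt r)" by (rule expectation_tent_le[OF e])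
 next
  fix r
  have i: "integrable M (\<lambda>w. ?V (B r w))"
   by (rule integrable_const_bound[where B="1 / \<epsilon>"]) (use KV B_meas in auto)
  have "(LINT w|M. ?V (B r w)) \<le> (LINT w|M. 1 / \<epsilon>)" using i KV by (intro integral_mono) (auto simp: abs_le_iff)
  moreover have "0 \<le> (LINT w|M. ?V (B r w))" by (intro integral_nonneg_AE) (auto simp: tent_nonneg)
  ultimately show "\<bar>LINT w|M. ?V (B r w)\<bar> \<le> 1 / \<epsilon>" by (simp add: prob_space)
 qed auto
 finally show ?thesis by simp
qed

text \<open>Expanding the square as a double time integral, the later factor is integrated first and gains \<open>h\<close> from the dipole; the earlier one costs the density of Brownian motion, which integrates to the square root of the time difference.\<close>

lemma AR_dipole_increment_square:
 assumes e: "0 < \<epsilon>" and h: "0 \<le> h" and st: "0 \<le> s" "s \<le> t"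
 shows "(LINT w|M. (AR (dip \<epsilon> x h) t w - AR (dip \<epsilon> x h) s w)\<^sup>2) \<le> 4 * exp ((t - s) / 2) * h * sqrt (t - s)"
proof -
 let ?V = "dip \<epsilon> x h"
 let ?D = "\<lambda>s w. AR ?V s w"
 have V: "continuous_on UNIV ?V" and KV: "\<And>z. \<bar>?V z\<bar> \<le> 1 / \<epsilon>"
  using dip_continuous dip_bound[OF e] by auto
 note [measurable] = AR_measurable[OF V]
 interpret LM: pair_sigma_finite "lborel :: real measure" M ..
 have eq: "?D r w = integral {0..r} (\<lambda>u. ?V (B u w))" for r w
  unfolding AR_def by (rule set_borel_integral_eq_integral[OF AR_integrable[OF V]])
 have path: "(?D t w - ?D s w)\<^sup>2 = (LINT r:{s..t}|lborel. 2 * (?V (B r w) * (?D t w - ?D r w)))" for w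
 proof -
  have cB: "continuous_on S (\<lambda>u. ?V (B u w))" for S by (rule cont_comp_B[OF V])
  have v: "((\<lambda>r. ?D r w) has_vector_derivative ?V (B r w)) (at r within {s..t})" if "r \<in> {s..t}" for r
  proof -
   have "((\<lambda>r. ?D r w) has_vector_derivative ?V (B r w)) (at r within {0..t})"
    unfolding eq by (rule integral_has_vector_derivative[OF cB]) (use that st in auto)
   then show ?thesis by (rule has_vector_derivative_within_subset) (use st in auto)
  qed
  have cD: "continuous_on {s..t} (\<lambda>r. ?D r w)"
   using has_vector_derivative_continuous[OF v] by (simp add: continuous_on_eq_continuous_within)
  have ci: "continuous_on {s..t} (\<lambda>r. 2 * (?V (B r w) * (?D t w - ?D r w)))"
   by (intro continuous_intros cB cD)
  have I1: "((\<lambda>r. 2 * (?V (B r w) * (?D t w - ?D r w))) has_integral (- (?D t w - ?D t w)\<^sup>2 - (- (?D t w - ?D s w)\<^sup>2))) {s..t}"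
  proof (rule fundamental_theorem_of_calculus[OF st(2)])
   fix r assume "r \<in> {s..t}"
   from v[OF this] have "((\<lambda>r. ?D r w) has_real_derivative ?V (B r w)) (at r within {s..t})"
    by (simp add: has_real_derivative_iff_has_vector_derivative)
   then have "((\<lambda>r. - (?D t w - ?D r w)\<^sup>2) has_real_derivative 2 * (?V (B r w) * (?D t w - ?D r w))) (at r within {s..t})"
    by (auto intro!: derivative_eq_intros simp del: minus_diff_eq)
   then show "((\<lambda>r. - (?D t w - ?D r w)\<^sup>2) has_vector_derivative 2 * (?V (B r w) * (?D t w - ?D r w))) (at r within {s..t})"
    by (simp add: has_real_derivative_iff_has_vector_derivative)
  qed
  have I2: "(LINT r:{s..t}|lborel. 2 * (?V (B r w) * (?D t w - ?D r w))) = integral {s..t} (\<lambda>r. 2 * (?V (B r w) * (?D t w - ?D r w)))"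
   by (intro set_borel_integral_eq_integral borel_integrable_atLeastAtMost' ci)
  show ?thesis unfolding I2 integral_unique[OF I1] by simp
 qed
 define K where "K = 2 * (1 / \<epsilon> * (t * (1 / \<epsilon>) + t * (1 / \<epsilon>)))"
 have gi: "integrable (lborel \<Otimes>\<^sub>M M) (\<lambda>(r, w). indicator {s..t} r * K)"
  by (rule LM.integrable_mult_pair) (use st in \<open>auto intro!: integrable_real_indicator simp: emeasure_lborel_Icc_eq\<close>)
 have bd: "\<bar>2 * (?V (B r w) * (?D t w - ?D r w))\<bar> \<le> K" if "r \<in> {s..t}" for r w
 proof -
  have r: "0 \<le> r" "r \<le> t" "0 \<le> t" using that st by auto
  have "r * (1 / \<epsilon>) \<le> t * (1 / \<epsilon>)" using r e by (intro mult_right_mono) auto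
  then have "\<bar>?D t w - ?D r w\<bar> \<le> t * (1 / \<epsilon>) + t * (1 / \<epsilon>)"
   using AR_bound[OF V KV r(1), of w] AR_bound[OF V KV r(3), of w] by linarith
  then have "\<bar>?V (B r w)\<bar> * \<bar>?D t w - ?D r w\<bar> \<le> 1 / \<epsilon> * (t * (1 / \<epsilon>) + t * (1 / \<epsilon>))"
   by (intro mult_mono KV) (use e in auto)
  then show ?thesis unfolding K_def abs_mult by simp
 qed
 have "(LINT w|M. (?D t w - ?D s w)\<^sup>2) = (LINT w|M. LINT r|lborel. indicator {s..t} r *\<^sub>R (2 * (?V (B r w) * (?D t w - ?D r w))))"
  unfolding path set_lebesgue_integral_def ..
 also have "\<dots> = (LINT r|lborel. LINT w|M. indicator {s..t} r *\<^sub>R (2 * (?V (B r w) * (?D t w - ?D r w))))"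
 proof (rule LM.Fubini_integral_dominated[symmetric, OF _ gi])
  fix r w show "norm (indicator {s..t} r *\<^sub>R (2 * (?V (B r w) * (?D t w - ?D r w)))) \<le> indicator {s..t} r * K"
   using bd[of r w] by (cases "r \<in> {s..t}") auto
 qed measurable
 also have "\<dots> = (LINT r:{s..t}|lborel. LINT w|M. 2 * (?V (B r w) * (?D t w - ?D r w)))"
  unfolding set_lebesgue_integral_def by simp
 also have "\<dots> \<le> (LINT r:{s..t}|lborel. 2 * (exp ((t - s) / 2) * h * (LINT w|M. \<bar>?V (B r w)\<bar>)))"
 proof (rule set_integral_mono)
  fix r assume r: "r \<in> {s..t}"
  have "(LINT w|M. ?V (B r w) * (?D t w - ?D r w)) \<le> exp ((t - r) / 2) * h * (LINT w|M. \<bar>?V (B r w)\<bar>)"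
   using potential_window[OF e h _ _ V KV, of r t x 0] r st by simp
  also have "\<dots> \<le> exp ((t - s) / 2) * h * (LINT w|M. \<bar>?V (B r w)\<bar>)"
   using r h by (intro mult_right_mono integral_nonneg_AE) auto
  finally show "(LINT w|M. 2 * (?V (B r w) * (?D t w - ?D r w))) \<le> 2 * (exp ((t - s) / 2) * h * (LINT w|M. \<bar>?V (B r w)\<bar>))"
   by simp
 next
  have b: "\<bar>LINT w|M. F w\<bar> \<le> K'" if "F \<in> borel_measurable M" "\<And>w. \<bar>F w\<bar> \<le> K'" for F :: "'w \<Rightarrow> real" and K'
  proof -
   have "integrable M F" by (rule integrable_const_bound[where B=K']) (use that in auto)
   then have "\<bar>LINT w|M. F w\<bar> \<le> (LINT w|M. K')"
    using that by (intro order_trans[OF integral_abs_bound] integral_mono) auto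
   then show ?thesis by (simp add: prob_space)
  qed
  show "set_integrable lborel {s..t} (\<lambda>r. LINT w|M. 2 * (?V (B r w) * (?D t w - ?D r w)))"
   unfolding set_integrable_def
  proof (rule Bochner_Integration.integrable_bound[of _ "\<lambda>r. indicator {s..t} r * K"])
   show "AE r in lborel. norm (indicator {s..t} r *\<^sub>R (LINT w|M. 2 * (?V (B r w) * (?D t w - ?D r w)))) \<le> norm (indicator {s..t} r * K)"
   proof (rule AE_I2)
    fix r show "norm (indicator {s..t} r *\<^sub>R (LINT w|M. 2 * (?V (B r w) * (?D t w - ?D r w)))) \<le> norm (indicator {s..t} r * K)"
    proof (cases "r \<in> {s..t}")
    case True
    have "\<bar>LINT w|M. 2 * (?V (B r w) * (?D t w - ?D r w))\<bar> \<le> K" by (rule b[OF _ bd[OF True]]) measurable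
    then show ?thesis using True by simp
    qed simp
   qed
  qed (measurable, auto simp: emeasure_lborel_Icc_eq)
  show "set_integrable lborel {s..t} (\<lambda>r. 2 * (exp ((t - s) / 2) * h * (LINT w|M. \<bar>?V (B r w)\<bar>)))"
   unfolding set_integrable_def
  proof (rule Bochner_Integration.integrable_bound[of _ "\<lambda>r. indicator {s..t} r * (2 * (exp ((t - s) / 2) * h * (1 / \<epsilon>)))"])
   have "\<bar>LINT w|M. \<bar>?V (B r w)\<bar>\<bar> \<le> 1 / \<epsilon>" for r by (rule b) (use KV in auto)
   then have "2 * (exp ((t - s) / 2) * h * (LINT w|M. \<bar>?V (B r w)\<bar>)) \<le> 2 * (exp ((t - s) / 2) * h * (1 / \<epsilon>))" for r
    using h by (intro mult_left_mono) (auto simp: abs_le_iff)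
   then show "AE r in lborel. norm (indicator {s..t} r *\<^sub>R (2 * (exp ((t - s) / 2) * h * (LINT w|M. \<bar>?V (B r w)\<bar>)))) \<le> norm (indicator {s..t} r * (2 * (exp ((t - s) / 2) * h * (1 / \<epsilon>))))"
    using h e by (intro AE_I2) (auto simp: abs_mult split: split_indicator intro!: mult_left_mono)
  qed (measurable, auto simp: emeasure_lborel_Icc_eq)
 qed
 also have "\<dots> = 2 * exp ((t - s) / 2) * h * (LINT r:{s..t}|lborel. LINT w|M. \<bar>?V (B r w)\<bar>)"
  by simp
 also have "\<dots> \<le> 2 * exp ((t - s) / 2) * h * (2 * sqrt (t - s))"
 proof (intro mult_left_mono inverse_sqrt_time_integral[OF st])
  have iT: "integrable M (\<lambda>w. tent \<epsilon> y (B r w))" for y r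
   by (rule integrable_const_bound[where B="1 / \<epsilon>"]) (use tent_le[OF e] tent_nonneg in auto)
  have iV: "integrable M (\<lambda>w. \<bar>?V (B r w)\<bar>)" for r
   by (rule integrable_const_bound[where B="1 / \<epsilon>"]) (use KV in auto)
  fix r :: real
  show "\<bar>LINT w|M. \<bar>?V (B r w)\<bar>\<bar> \<le> 1 / \<epsilon>"
  proof -
   have "(LINT w|M. \<bar>?V (B r w)\<bar>) \<le> (LINT w|M. 1 / \<epsilon>)" using iV KV by (intro integral_mono) auto
   then show ?thesis by (simp add: prob_space)
  qed
  assume r: "0 < r"
  have "(LINT w|M. \<bar>?V (B r w)\<bar>) \<le> (LINT w|M. tent \<epsilon> x (B r w) + tent \<epsilon> (x + h) (B r w))"
   using iV iT dip_abs_le by (intro integral_mono) auto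
  also have "\<dots> \<le> 1 / (2 * sqrt r) + 1 / (2 * sqrt r)"
   unfolding Bochner_Integration.integral_add[OF iT iT] by (intro add_mono expectation_tent_le[OF e r])
  finally show "(LINT w|M. \<bar>?V (B r w)\<bar>) \<le> 2 / (2 * sqrt r)" by simp
 qed (use h in auto)
 finally show ?thesis by simp
qed

end

section \<open>The linear system for point weights\<close>

lemma Gr_cmult: "Gr (\<lambda>x. c * f x) z = c * Gr f z"
proof -
 have "exp (- \<bar>y\<bar>) * (c * f (z + y)) = c * (exp (- \<bar>y\<bar>) * f (z + y))" for y by simp
 then show ?thesis unfolding Gr_def by (simp only: integral_mult_right_zero)
qed

context cont_bm begin

lemma Gam_integrand_integrable:
 fixes \<Phi> :: "complex \<Rightarrow> complex" and f U :: "real \<Rightarrow> complex"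
 assumes U: "continuous_on UNIV U" and \<Phi>: "\<Phi> \<in> borel_measurable borel"
  and b1: "\<And>s w. 0 \<le> s \<Longrightarrow> norm (\<Phi> (AF U s w)) \<le> 1"
  and f: "f \<in> borel_measurable borel" and Kf: "\<And>x. norm (f x) \<le> Kf"
 shows "0 \<le> s \<Longrightarrow> integrable M (\<lambda>w. \<Phi> (AF U s w) * f (B s w))"
  and "set_integrable lborel {0<..} (\<lambda>s. exp (- s / 2) *\<^sub>R (LINT w|M. \<Phi> (AF U s w) * f (B s w)))"
proof -
 note [measurable] = AF_measurable[OF U] \<Phi> f
 have K0: "0 \<le> Kf" using order_trans[OF norm_ge_zero Kf] .
 have b: "norm (\<Phi> (AF U s w) * f (B s w)) \<le> 1 * Kf" if "0 \<le> s" for s w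
  unfolding norm_mult by (intro mult_mono b1 Kf that) auto
 show i: "integrable M (\<lambda>w. \<Phi> (AF U s w) * f (B s w))" if "0 \<le> s" for s
  by (rule integrable_const_bound[where B="1 * Kf"]) (use b[OF that] in auto)
 have q: "norm (LINT w|M. \<Phi> (AF U s w) * f (B s w)) \<le> Kf" if "0 \<le> s" for s
 proof -
  have "norm (LINT w|M. \<Phi> (AF U s w) * f (B s w)) \<le> (LINT w|M. 1 * Kf)"
   by (intro order_trans[OF integral_norm_bound] integral_mono integrable_norm i that b) auto
  then show ?thesis by (simp add: prob_space)
 qed
 show "set_integrable lborel {0<..} (\<lambda>s. exp (- s / 2) *\<^sub>R (LINT w|M. \<Phi> (AF U s w) * f (B s w)))"
  unfolding set_integrable_def
 proof (rule Bochner_Integration.integrable_bound)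
  show "integrable lborel (\<lambda>s. (indicator {0..} s * exp (- (1/2) * s)) * Kf)"
   by (intro integrable_mult_left exp_Ici_integrable) simp
  show "AE s in lborel. norm (indicator {0<..} s *\<^sub>R exp (- s / 2) *\<^sub>R (LINT w|M. \<Phi> (AF U s w) * f (B s w))) \<le> norm ((indicator {0..} s * exp (- (1/2) * s)) * Kf)"
   using q K0 by (intro AE_I2) (auto split: split_indicator intro!: mult_left_mono)
 qed measurable
qed

lemma Gam_norm_le:
 assumes U: "continuous_on UNIV U" and \<Phi>: "\<Phi> \<in> borel_measurable borel"
  and b1: "\<And>s w. 0 \<le> s \<Longrightarrow> norm (\<Phi> (AF U s w)) \<le> 1"
  and f: "f \<in> borel_measurable borel" and le: "\<And>x. norm (f x) \<le> g x"
  and g: "continuous_on UNIV g" and Kg: "\<And>x. \<bar>g x\<bar> \<le> Kg"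
 shows "norm (Gam U \<Phi> f) \<le> Gr g 0"
proof -
 have gm: "g \<in> borel_measurable borel" using g by (rule borel_measurable_continuous_onI)
 have Kf: "norm (f x) \<le> Kg" for x using le[of x] Kg[of x] by linarith
 note i = Gam_integrand_integrable[OF U \<Phi> b1 f Kf]
 have cV: "continuous_on UNIV (\<lambda>_::real. 0::real)" and KV: "\<And>x::real. \<bar>0::real\<bar> \<le> 0" by auto
 have g0: "0 \<le> g x" for x using order_trans[OF norm_ge_zero le] .
 have inner: "norm (LINT w|M. \<Phi> (AF U s w) * f (B s w)) \<le> (LINT w|M. AR (\<lambda>_. 0) s w ^ 0 * g (B s w))" if s: "0 < s" for s
 proof (intro order_trans[OF integral_norm_bound] integral_mono)
  show "integrable M (\<lambda>w. norm (\<Phi> (AF U s w) * f (B s w)))" using i(1)[of s] s by (intro integrable_norm) auto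
  show "integrable M (\<lambda>w. AR (\<lambda>_. 0) s w ^ 0 * g (B s w))"
   by (rule AR_power_integrable[OF cV KV _ gm Kg]) (use s in auto)
  fix w
  have "norm (\<Phi> (AF U s w)) * norm (f (B s w)) \<le> 1 * g (B s w)"
   using s by (intro mult_mono b1 le) (auto simp: g0)
  then show "norm (\<Phi> (AF U s w) * f (B s w)) \<le> AR (\<lambda>_. 0) s w ^ 0 * g (B s w)" by (simp add: norm_mult)
 qed
 have "norm (Gam U \<Phi> f) \<le> (LINT s|lborel. norm (indicator {0<..} s *\<^sub>R exp (- s / 2) *\<^sub>R (LINT w|M. \<Phi> (AF U s w) * f (B s w))))"
  unfolding Gam_def set_lebesgue_integral_def by (rule integral_norm_bound)
 also have "\<dots> \<le> (LINT s|lborel. indicator {0<..} s *\<^sub>R (exp (- s / 2) * (LINT w|M. AR (\<lambda>_. 0) s w ^ 0 * g (B s w))))"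
 proof (rule integral_mono)
  show "integrable lborel (\<lambda>s. norm (indicator {0<..} s *\<^sub>R exp (- s / 2) *\<^sub>R (LINT w|M. \<Phi> (AF U s w) * f (B s w))))"
   using i(2) unfolding set_integrable_def by (rule integrable_norm)
  show "integrable lborel (\<lambda>s. indicator {0<..} s *\<^sub>R (exp (- s / 2) * (LINT w|M. AR (\<lambda>_. 0) s w ^ 0 * g (B s w))))"
   using MM_integrable[OF cV KV gm Kg, of 0] unfolding set_integrable_def .
 qed (use inner in \<open>auto split: split_indicator\<close>)
 also have "\<dots> = MM 0 (\<lambda>_. 0) g" unfolding MM_def set_lebesgue_integral_def ..
 also have "\<dots> = Gr g 0" by (rule MM_0[OF g Kg])
 finally show ?thesis .
qed

lemma Gam_add:
 assumes U: "continuous_on UNIV U" and \<Phi>: "\<Phi> \<in> borel_measurable borel"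
  and b1: "\<And>s w. 0 \<le> s \<Longrightarrow> norm (\<Phi> (AF U s w)) \<le> 1"
  and f: "f \<in> borel_measurable borel" and Kf: "\<And>x. norm (f x) \<le> Kf"
  and g: "g \<in> borel_measurable borel" and Kg: "\<And>x. norm (g x) \<le> Kg"
 shows "Gam U \<Phi> (\<lambda>x. f x + g x) = Gam U \<Phi> f + Gam U \<Phi> g"
proof -
 note i = Gam_integrand_integrable[OF U \<Phi> b1 f Kf] and j = Gam_integrand_integrable[OF U \<Phi> b1 g Kg]
 have "Gam U \<Phi> (\<lambda>x. f x + g x) = (LINT s:{0<..}|lborel. exp (- s / 2) *\<^sub>R (LINT w|M. \<Phi> (AF U s w) * f (B s w))
  + exp (- s / 2) *\<^sub>R (LINT w|M. \<Phi> (AF U s w) * g (B s w)))"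
  unfolding Gam_def
  by (rule set_lebesgue_integral_cong) (auto simp: distrib_left i(1) j(1) scaleR_add_right)
 then show ?thesis unfolding Gam_def using set_integral_add(2)[OF i(2) j(2)] by simp
qed

lemma Gam_cmult: "Gam U \<Phi> (\<lambda>x. c * f x) = c * Gam U \<Phi> f"
proof -
 have "Gam U \<Phi> (\<lambda>x. c * f x) = (LINT s:{0<..}|lborel. c * (exp (- s / 2) *\<^sub>R (LINT w|M. \<Phi> (AF U s w) * f (B s w))))"
  unfolding Gam_def by (simp add: mult.left_commute[of _ c])
 then show ?thesis unfolding Gam_def by (simp only: set_integral_mult_right)
qed

lemma Gam_sum:
 assumes U: "continuous_on UNIV U" and \<Phi>: "\<Phi> \<in> borel_measurable borel"
  and b1: "\<And>s w. 0 \<le> s \<Longrightarrow> norm (\<Phi> (AF U s w)) \<le> 1"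
  and f: "\<And>i. f i \<in> borel_measurable borel" and Kf: "\<And>i x. norm (f i x) \<le> Kf i"
 shows "Gam U \<Phi> (\<lambda>x. \<Sum>i<n. f i x) = (\<Sum>i<n::nat. Gam U \<Phi> (f i))"
proof (induction n)
 case 0
 show ?case by (simp add: Gam_def)
next
 case (Suc n)
 have "Gam U \<Phi> (\<lambda>x. (\<Sum>i<n. f i x) + f n x) = Gam U \<Phi> (\<lambda>x. \<Sum>i<n. f i x) + Gam U \<Phi> (f n)"
  by (rule Gam_add[OF U \<Phi> b1 _ _ f Kf, where Kf="\<Sum>i<n. Kf i"])
    (use f in \<open>auto intro!: order_trans[OF norm_sum] sum_mono Kf\<close>)
 then show ?case using Suc.IH by simp
qed

text \<open>point system\<close>

text \<open>A finite combination of tents, which approximates point masses of complex weight \<open>v i\<close> at the points \<open>p i\<close>.\<close>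

definition PU :: "nat \<Rightarrow> (nat \<Rightarrow> complex) \<Rightarrow> (nat \<Rightarrow> real) \<Rightarrow> real \<Rightarrow> real \<Rightarrow> complex" where
 "PU n v p \<epsilon> z = (\<Sum>i<n. v i * complex_of_real (tent \<epsilon> (p i) z))"

lemma PU_continuous: "continuous_on UNIV (PU n v p \<epsilon>)"
 unfolding PU_def by (intro continuous_intros tent_continuous)

lemma PU_bound: "0 < \<epsilon> \<Longrightarrow> norm (PU n v p \<epsilon> z) \<le> (\<Sum>i<n. norm (v i) * (1 / \<epsilon>))"
 unfolding PU_def
proof (intro order_trans[OF norm_sum] sum_mono)
 fix i assume "0 < \<epsilon>"
 then have "norm (v i) * tent \<epsilon> (p i) z \<le> norm (v i) * (1 / \<epsilon>)" by (intro mult_left_mono tent_le) auto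
 then show "norm (v i * complex_of_real (tent \<epsilon> (p i) z)) \<le> norm (v i) * (1 / \<epsilon>)"
  by (simp add: norm_mult tent_nonneg)
qed

lemma AF_PU: "AF (PU n v p \<epsilon>) s w = (\<Sum>i<n. v i * complex_of_real (AR (tent \<epsilon> (p i)) s w))"
proof -
 have i: "set_integrable lborel {0..s} (\<lambda>u. v i * complex_of_real (tent \<epsilon> (p i) (B u w)))" for i
  by (intro borel_integrable_atLeastAtMost' continuous_intros cont_comp_B tent_continuous)
 have "AF (PU n v p \<epsilon>) s w = (\<Sum>i<n. LINT u:{0..s}|lborel. v i * complex_of_real (tent \<epsilon> (p i) (B u w)))"
  unfolding AF_def PU_def set_lebesgue_integral_def scaleR_sum_right
  using i by (intro Bochner_Integration.integral_sum) (auto simp: set_integrable_def)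
 then show ?thesis
  unfolding AR_def by (simp add: set_integral_complex_of_real)
qed

lemma exp_AF_PU_le:
 assumes "\<And>i. i < n \<Longrightarrow> 0 \<le> Re (v i)"
 shows "norm (exp (- AF (PU n v p \<epsilon>) s w)) \<le> 1"
proof -
 have "0 \<le> Re (AF (PU n v p \<epsilon>) s w)"
  unfolding AF_PU Re_sum using assms by (intro sum_nonneg) (auto intro!: mult_nonneg_nonneg AR_nonneg tent_nonneg)
 then show ?thesis by simp
qed

text \<open>The Feynman-Kac identity for the exponential, tested against the potentials of the points themselves, closes up to an error of the order of the width of the tents because the potential of a tent is within \<open>\<epsilon>\<close> of the kernel.\<close>

lemma point_system:
 fixes v :: "nat \<Rightarrow> complex" and p :: "nat \<Rightarrow> real" and n :: nat
 assumes e: "0 < \<epsilon>" and v: "\<And>i. i < n \<Longrightarrow> 0 \<le> Re (v i)"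
 defines "\<gamma> \<equiv> \<lambda>j. Gam (PU n v p \<epsilon>) (\<lambda>z. exp (- z)) (\<lambda>z. complex_of_real (tent \<epsilon> (p j) z))"
 shows "norm (\<gamma> j) \<le> 1"
  and "norm (\<gamma> j - (exp (- \<bar>p j\<bar>) - (\<Sum>i<n. v i * \<gamma> i * exp (- \<bar>p i - p j\<bar>)))) \<le> \<epsilon> + (\<Sum>i<n. norm (v i) * (2 * \<epsilon>))"
  and "Gam (PU n v p \<epsilon>) (\<lambda>z. exp (- z)) (\<lambda>_. 1) = 2 - 2 * (\<Sum>i<n. v i * \<gamma> i)"
proof -
 let ?U = "PU n v p \<epsilon>" and ?\<Phi> = "\<lambda>z. exp (- z) :: complex"
 let ?T = "\<lambda>i. tent \<epsilon> (p i)"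
 let ?Tc = "\<lambda>i z. complex_of_real (tent \<epsilon> (p i) z)"
 have U: "continuous_on UNIV ?U" by (rule PU_continuous)
 have \<Phi>m: "?\<Phi> \<in> borel_measurable borel" by measurable
 have b1: "norm (?\<Phi> (AF ?U s w)) \<le> 1" for s w using exp_AF_PU_le[OF v] .
 have Tb: "\<bar>?T i z\<bar> \<le> 1 / \<epsilon>" for i z using tent_le[OF e] tent_nonneg by simp
 have Tc: "continuous_on UNIV (?T i)" for i by (rule tent_continuous)
 have T01: "0 \<le> Gr (?T i) z" "Gr (?T i) z \<le> 1" for i z using Gr_tent_bounds[OF e] by auto
 have Gc: "continuous_on UNIV (Gr (?T i))" for i by (rule Gr_continuous[OF Tc Tb])
 have Gm [measurable]: "Gr (?T i) \<in> borel_measurable borel" for i using Gc by (rule borel_measurable_continuous_onI)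
 have "norm (\<gamma> j) \<le> Gr (?T j) 0" unfolding \<gamma>_def
  by (rule Gam_norm_le[OF U \<Phi>m b1 _ _ Tc Tb]) (auto simp: tent_nonneg)
 from order_trans[OF this T01(2)] show "norm (\<gamma> j) \<le> 1" .
 have ident: "Gam ?U ?\<Phi> (\<lambda>z. complex_of_real (f z)) = complex_of_real (Gr f 0) - (\<Sum>i<n. v i * Gam ?U ?\<Phi> (\<lambda>z. ?Tc i z * complex_of_real (Gr f z)))"
  if f: "continuous_on UNIV f" and Kf: "\<And>z. \<bar>f z\<bar> \<le> Kf" for f Kf
 proof -
  have Gfc: "continuous_on UNIV (Gr f)" by (rule Gr_continuous[OF f Kf])
  have [measurable]: "Gr f \<in> borel_measurable borel" by (rule borel_measurable_continuous_onI[OF Gfc])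
  have Gfb: "\<bar>Gr f z\<bar> \<le> 2 * Kf" for z by (rule Gr_bound[OF _ Kf]) (use f in \<open>auto intro: borel_measurable_continuous_onI\<close>)
  have "Gam ?U ?\<Phi> (\<lambda>z. complex_of_real (f z)) = ?\<Phi> 0 * Gop (\<lambda>z. complex_of_real (f z)) 0
    + Gam ?U (\<lambda>z. - exp (- z)) (\<lambda>z. ?U z * Gop (\<lambda>z. complex_of_real (f z)) z)"
  proof (rule Gam_identity[where KU="\<Sum>i<n. norm (v i) * (1 / \<epsilon>)" and K=1 and Kf=Kf])
   fix s w assume "0 \<le> (s::real)"
   then have "1 \<le> 1 * exp (s / 4)" by simp
   then show "norm (- exp (- AF ?U s w)) \<le> 1 * exp (s / 4)" using b1[of s w] by (simp only: norm_minus_cancel)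
  qed (use U PU_bound[OF e] f Kf in \<open>auto intro!: continuous_intros derivative_eq_intros\<close>)
  also have "Gam ?U (\<lambda>z. - exp (- z)) (\<lambda>z. ?U z * Gop (\<lambda>z. complex_of_real (f z)) z)
   = - Gam ?U ?\<Phi> (\<lambda>z. ?U z * Gop (\<lambda>z. complex_of_real (f z)) z)"
   unfolding Gam_def set_lebesgue_integral_def by simp
  also have "(\<lambda>z. ?U z * Gop (\<lambda>z. complex_of_real (f z)) z) = (\<lambda>z. \<Sum>i<n. v i * (?Tc i z * complex_of_real (Gr f z)))"
   by (simp add: fun_eq_iff PU_def Gop_of_real sum_distrib_right mult.assoc)
  also have "Gam ?U ?\<Phi> \<dots> = (\<Sum>i<n. Gam ?U ?\<Phi> (\<lambda>z. v i * (?Tc i z * complex_of_real (Gr f z))))"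
  proof (rule Gam_sum[OF U \<Phi>m b1, where Kf="\<lambda>i. norm (v i) * (1 / \<epsilon> * (2 * Kf))"])
   fix i z
   have "\<bar>?T i z\<bar> * \<bar>Gr f z\<bar> \<le> 1 / \<epsilon> * (2 * Kf)" by (intro mult_mono Tb Gfb) (use e in auto)
   then show "norm (v i * (?Tc i z * complex_of_real (Gr f z))) \<le> norm (v i) * (1 / \<epsilon> * (2 * Kf))"
    unfolding norm_mult norm_of_real by (intro mult_left_mono) auto
  qed measurable
  also have "\<dots> = (\<Sum>i<n. v i * Gam ?U ?\<Phi> (\<lambda>z. ?Tc i z * complex_of_real (Gr f z)))"
   by (simp only: Gam_cmult)
  finally show ?thesis by (simp add: Gop_of_real)
 qed
 have "Gam ?U ?\<Phi> (\<lambda>z. complex_of_real 1) = complex_of_real (Gr (\<lambda>_. 1) 0) - (\<Sum>i<n. v i * Gam ?U ?\<Phi> (\<lambda>z. ?Tc i z * complex_of_real (Gr (\<lambda>_. 1) z)))"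
  by (rule ident[of _ 1]) auto
 also have "(\<Sum>i<n. v i * Gam ?U ?\<Phi> (\<lambda>z. ?Tc i z * complex_of_real (Gr (\<lambda>_. 1) z))) = (\<Sum>i<n. v i * (2 * \<gamma> i))"
  unfolding \<gamma>_def Gr_const Gam_cmult[symmetric] by (simp add: mult.commute)
 finally show "Gam ?U ?\<Phi> (\<lambda>_. 1) = 2 - 2 * (\<Sum>i<n. v i * \<gamma> i)"
  by (simp add: Gr_const sum_distrib_left mult_ac)
 let ?g = "\<lambda>i. exp (- \<bar>p i - p j\<bar>)"
 have near: "norm (Gam ?U ?\<Phi> (\<lambda>z. ?Tc i z * complex_of_real (Gr (?T j) z)) - ?g i * \<gamma> i) \<le> 2 * \<epsilon>" for i
 proof -
  have bb: "norm (?Tc i z * complex_of_real (Gr (?T j) z - ?g i)) \<le> 2 * \<epsilon> * ?T i z" for z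
  proof (cases "\<bar>z - p i\<bar> < \<epsilon>")
   case True
   have "\<bar>Gr (?T j) z - ?g i\<bar> \<le> 2 * \<epsilon>"
    using Gr_tent_approx[OF e, of "p j" z] exp_abs_lipschitz[of "z - p j" "p i - p j"] True by simp
   then show ?thesis unfolding norm_mult norm_of_real
    using mult_left_mono[of "\<bar>Gr (?T j) z - ?g i\<bar>" "2 * \<epsilon>" "?T i z"] by (simp add: tent_nonneg mult.commute)
  qed (simp add: tent_eq_0)
  have "Gam ?U ?\<Phi> (\<lambda>z. ?Tc i z * complex_of_real (Gr (?T j) z))
   = Gam ?U ?\<Phi> (\<lambda>z. ?Tc i z * complex_of_real (Gr (?T j) z - ?g i) + complex_of_real (?g i) * ?Tc i z)"
   by (simp add: algebra_simps)
  also have "\<dots> = Gam ?U ?\<Phi> (\<lambda>z. ?Tc i z * complex_of_real (Gr (?T j) z - ?g i)) + Gam ?U ?\<Phi> (\<lambda>z. complex_of_real (?g i) * ?Tc i z)"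
  proof (rule Gam_add[OF U \<Phi>m b1, where Kf="2 * \<epsilon> * (1 / \<epsilon>)" and Kg="1 / \<epsilon>"])
   fix z
   have "2 * \<epsilon> * ?T i z \<le> 2 * \<epsilon> * (1 / \<epsilon>)" using e tent_le[OF e, of "p i" z] by (intro mult_left_mono) auto
   then show "norm (?Tc i z * complex_of_real (Gr (?T j) z - ?g i)) \<le> 2 * \<epsilon> * (1 / \<epsilon>)" using bb[of z] by linarith
   have "?g i * \<bar>?T i z\<bar> \<le> 1 * (1 / \<epsilon>)" by (intro mult_mono Tb) auto
   then show "norm (complex_of_real (?g i) * ?Tc i z) \<le> 1 / \<epsilon>" unfolding norm_mult norm_of_real by simp
  qed measurable
  finally have "Gam ?U ?\<Phi> (\<lambda>z. ?Tc i z * complex_of_real (Gr (?T j) z)) - ?g i * \<gamma> i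
   = Gam ?U ?\<Phi> (\<lambda>z. ?Tc i z * complex_of_real (Gr (?T j) z - ?g i))"
   by (simp add: Gam_cmult \<gamma>_def)
  also have "norm \<dots> \<le> Gr (\<lambda>z. 2 * \<epsilon> * ?T i z) 0"
  proof (rule Gam_norm_le[OF U \<Phi>m b1 _ bb])
   show "continuous_on UNIV (\<lambda>z. 2 * \<epsilon> * ?T i z)" by (intro continuous_intros Tc)
   show "\<bar>2 * \<epsilon> * ?T i z\<bar> \<le> 2 * \<epsilon> * (1 / \<epsilon>)" for z
    using e Tb[of i z] unfolding abs_mult[of "2 * \<epsilon>"] by (intro mult_mono) auto
  qed measurable
  also have "\<dots> = 2 * \<epsilon> * Gr (?T i) 0"
   by (rule Gr_cmult)
  also have "\<dots> \<le> 2 * \<epsilon>" using T01(2)[of i 0] e by simp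
  finally show ?thesis .
 qed
 have "\<gamma> j = complex_of_real (Gr (?T j) 0) - (\<Sum>i<n. v i * Gam ?U ?\<Phi> (\<lambda>z. ?Tc i z * complex_of_real (Gr (?T j) z)))"
  unfolding \<gamma>_def by (rule ident[OF Tc Tb])
 then have "\<gamma> j - (exp (- \<bar>p j\<bar>) - (\<Sum>i<n. v i * \<gamma> i * exp (- \<bar>p i - p j\<bar>)))
   = complex_of_real (Gr (?T j) 0 - exp (- \<bar>0 - p j\<bar>)) - (\<Sum>i<n. v i * (Gam ?U ?\<Phi> (\<lambda>z. ?Tc i z * complex_of_real (Gr (?T j) z)) - ?g i * \<gamma> i))"
  by (simp add: right_diff_distrib sum_subtractf algebra_simps)
 also have "norm \<dots> \<le> \<epsilon> + (\<Sum>i<n. norm (v i) * (2 * \<epsilon>))"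
 proof (intro order_trans[OF norm_triangle_ineq4] add_mono)
  show "norm (complex_of_real (Gr (?T j) 0 - exp (- \<bar>0 - p j\<bar>))) \<le> \<epsilon>"
   unfolding norm_of_real by (rule Gr_tent_approx[OF e])
  show "norm (\<Sum>i<n. v i * (Gam ?U ?\<Phi> (\<lambda>z. ?Tc i z * complex_of_real (Gr (?T j) z)) - ?g i * \<gamma> i)) \<le> (\<Sum>i<n. norm (v i) * (2 * \<epsilon>))"
   by (intro order_trans[OF norm_sum] sum_mono) (simp add: norm_mult near mult_left_mono)
 qed
 finally show "norm (\<gamma> j - (exp (- \<bar>p j\<bar>) - (\<Sum>i<n. v i * \<gamma> i * exp (- \<bar>p i - p j\<bar>)))) \<le> \<epsilon> + (\<Sum>i<n. norm (v i) * (2 * \<epsilon>))" .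
qed

end

section \<open>Stability of the four-point system\<close>

lemma norm_mult_le: "norm a \<le> A \<Longrightarrow> norm b \<le> B \<Longrightarrow> norm (a * b) \<le> A * B" for a b :: "'a::real_normed_algebra"
 by (rule norm_mult_ineq[THEN order_trans]) (intro mult_mono, auto intro: order_trans[OF norm_ge_zero])

lemma one_minus_exp_bounds: fixes h :: real assumes "0 \<le> h"
 shows "1 - exp (-h) \<le> h" "0 \<le> 1 - exp (-h)" "h - h\<^sup>2 / 2 \<le> 1 - exp (-h)"
proof -
 show "1 - exp (-h) \<le> h" using exp_ge_add_one_self[of "-h"] by linarith
 show "0 \<le> 1 - exp (-h)" using assms by simp
 have "(\<lambda>h. 1 - exp (-h) - h + h\<^sup>2 / 2) 0 \<le> (\<lambda>h. 1 - exp (-h) - h + h\<^sup>2 / 2) h"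
 proof (rule DERIV_nonneg_imp_nondecreasing[OF assms])
  fix u :: real assume "0 \<le> u" "u \<le> h"
  have "((\<lambda>h. 1 - exp (-h) - h + h\<^sup>2 / 2) has_real_derivative (exp (-u) - 1 + u)) (at u)"
   by (auto intro!: derivative_eq_intros)
  moreover have "0 \<le> exp (-u) - 1 + u" using exp_ge_add_one_self[of "-u"] by linarith
  ultimately show "\<exists>d. ((\<lambda>h. 1 - exp (-h) - h + h\<^sup>2 / 2) has_real_derivative d) (at u) \<and> 0 \<le> d" by blast
 qed
 then show "h - h\<^sup>2 / 2 \<le> 1 - exp (-h)" by simp
qed

text \<open>For points at distance at least \<open>h\<close> the kernel is smooth on the relevant rectangle, so its mixed second difference is quadratic in \<open>h\<close>.\<close>

lemma kernel_second_difference: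
 fixes x y h :: real
 assumes h: "0 \<le> h" "h \<le> \<bar>x - y\<bar>"
 shows "\<bar>exp (-\<bar>y - x\<bar>) - exp (-\<bar>y - (x + h)\<bar>) - exp (-\<bar>y + h - x\<bar>) + exp (-\<bar>y + h - (x + h)\<bar>)\<bar> \<le> h\<^sup>2"
proof -
 have *: "exp (-\<bar>y - x\<bar>) - exp (-\<bar>y - (x + h)\<bar>) - exp (-\<bar>y + h - x\<bar>) + exp (-\<bar>y + h - (x + h)\<bar>)
  = - exp (-(\<bar>x - y\<bar> - h)) * (1 - exp (-h))\<^sup>2"
 proof (cases "y \<le> x")
  case True
  then have "\<bar>y - x\<bar> = (x - y - h) + h" "\<bar>y - (x + h)\<bar> = (x - y - h) + (h + h)" "\<bar>y + h - x\<bar> = x - y - h" "\<bar>y + h - (x + h)\<bar> = (x - y - h) + h" "\<bar>x - y\<bar> - h = x - y - h"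
   using h by auto
  then show ?thesis by (simp only: minus_add_distrib exp_add) (simp add: power2_eq_square algebra_simps)
 next
  case False
  then have "\<bar>y - x\<bar> = (y - x - h) + h" "\<bar>y - (x + h)\<bar> = y - x - h" "\<bar>y + h - x\<bar> = (y - x - h) + (h + h)" "\<bar>y + h - (x + h)\<bar> = (y - x - h) + h" "\<bar>x - y\<bar> - h = y - x - h"
   using h by auto
  then show ?thesis by (simp only: minus_add_distrib exp_add) (simp add: power2_eq_square algebra_simps)
 qed
 have "\<bar>- exp (-(\<bar>x - y\<bar> - h)) * (1 - exp (-h))\<^sup>2\<bar> \<le> 1 * h\<^sup>2"
  unfolding abs_mult using h one_minus_exp_bounds[OF h(1)] by (intro mult_mono) (auto intro!: power_mono)
 then show ?thesis unfolding * by simp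
qed

lemma norm_four_le:
 fixes A B C D :: complex
 assumes "norm A \<le> a" "norm B \<le> b" "norm C \<le> c" "norm D \<le> d"
 shows "norm (A - B + C - D) \<le> a + b + c + d"
 using assms norm_triangle_ineq4[of "A - B + C" D] norm_triangle_ineq[of "A - B" C] norm_triangle_ineq4[of A B]
 by linarith

lemma norm_five_le:
 fixes A B C D E :: complex
 assumes "norm A \<le> a" "norm B \<le> b" "norm C \<le> c" "norm D \<le> d" "norm E \<le> e"
 shows "norm (A - B + C - D - E) \<le> a + b + c + d + e"
 using norm_four_le[OF assms(1-4)] assms(5) norm_triangle_ineq4[of "A - B + C - D" E] by linarith

lemma norm_seven_le:
 fixes A B C D E F G :: complex
 assumes "norm A \<le> a" "norm B \<le> b" "norm C \<le> c" "norm D \<le> d" "norm E \<le> e" "norm F \<le> f" "norm G \<le> g"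
 shows "norm (A - B - C - D - E + F - G) \<le> a + b + c + d + e + f + g"
 using assms norm_triangle_ineq4[of A B] norm_triangle_ineq4[of "A - B" C] norm_triangle_ineq4[of "A - B - C" D]
  norm_triangle_ineq4[of "A - B - C - D" E] norm_triangle_ineq[of "A - B - C - D - E" F]
  norm_triangle_ineq4[of "A - B - C - D - E + F" G]
 by linarith

text \<open>The two ways of placing weights on the points \<open>x\<close> and \<open>x + h\<close> that are to be compared: opposite imaginary weights, which code a character of the normalised increment, and the single real weight \<open>2 * \<mu>\<^sup>2\<close>.\<close>

definition adm :: "real \<Rightarrow> real \<Rightarrow> complex \<Rightarrow> complex \<Rightarrow> bool" where
 "adm \<mu> h a b \<longleftrightarrow> (b = - a \<and> a\<^sup>2 = - complex_of_real (\<mu>\<^sup>2 / h)) \<or> (a = complex_of_real (2 * \<mu>\<^sup>2) \<and> b = 0)"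

lemma adm_norm_le:
 assumes "adm \<mu> (r\<^sup>2) a b" "0 < r" "r \<le> 1" "\<bar>\<mu>\<bar> \<le> N" "2 * \<mu>\<^sup>2 \<le> N"
 shows "norm a \<le> N / r" "norm b \<le> N / r"
proof -
 have N: "N \<le> N / r" "0 \<le> N" using assms by (auto simp: field_simps mult_left_le)
 have "norm a \<le> N / r \<and> norm b \<le> N / r"
 proof (cases "b = - a \<and> a\<^sup>2 = - complex_of_real (\<mu>\<^sup>2 / r\<^sup>2)")
  case True
  then have "(norm a)\<^sup>2 = norm (- complex_of_real (\<mu>\<^sup>2 / r\<^sup>2))" by (metis norm_power)
  then have "(norm a)\<^sup>2 = (\<bar>\<mu>\<bar> / r)\<^sup>2" by (simp add: power_divide norm_power norm_divide)
  then have "norm a = \<bar>\<mu>\<bar> / r" using assms(2) by (simp add: power2_eq_iff_nonneg)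
  then show ?thesis using True assms by (auto simp: divide_right_mono)
 next
  case False
  then have "a = complex_of_real (2 * \<mu>\<^sup>2)" "b = 0" using assms(1) unfolding adm_def by auto
  then have "norm a = 2 * \<mu>\<^sup>2" by (metis abs_of_nonneg norm_of_real zero_le_mult_iff zero_le_numeral zero_le_power2)
  then show ?thesis using assms N \<open>b = 0\<close> by auto
 qed
 then show "norm a \<le> N / r" "norm b \<le> N / r" by auto
qed

text \<open>The linear system for the pairs at \<open>x\<close> and \<open>y\<close>, with \<open>h = r\<^sup>2\<close>; the bound \<open>N\<close> collects the dependence on the frequency.\<close>

locale pair_system =
 fixes \<mu> r N x y :: real and a b c d \<gamma>1 \<gamma>2 \<gamma>3 \<gamma>4 :: complex
 assumes r: "0 < r" "r \<le> 1" and N: "1 \<le> N" "\<bar>\<mu>\<bar> \<le> N" "2 * \<mu>\<^sup>2 \<le> N"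
  and sep: "r\<^sup>2 \<le> \<bar>x - y\<bar>"
  and ab: "adm \<mu> (r\<^sup>2) a b" and cd: "adm \<mu> (r\<^sup>2) c d"
  and g: "norm \<gamma>1 \<le> 1" "norm \<gamma>2 \<le> 1" "norm \<gamma>3 \<le> 1" "norm \<gamma>4 \<le> 1"
  and e1: "norm (\<gamma>1 - (exp (-\<bar>x\<bar>) - (a * \<gamma>1 + b * \<gamma>2 * exp (-r\<^sup>2) + c * \<gamma>3 * exp (-\<bar>y - x\<bar>) + d * \<gamma>4 * exp (-\<bar>y + r\<^sup>2 - x\<bar>)))) \<le> r\<^sup>2"
  and e2: "norm (\<gamma>2 - (exp (-\<bar>x + r\<^sup>2\<bar>) - (a * \<gamma>1 * exp (-r\<^sup>2) + b * \<gamma>2 + c * \<gamma>3 * exp (-\<bar>y - (x + r\<^sup>2)\<bar>) + d * \<gamma>4 * exp (-\<bar>y + r\<^sup>2 - (x + r\<^sup>2)\<bar>)))) \<le> r\<^sup>2"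
  and e3: "norm (\<gamma>3 - (exp (-\<bar>y\<bar>) - (a * \<gamma>1 * exp (-\<bar>x - y\<bar>) + b * \<gamma>2 * exp (-\<bar>x + r\<^sup>2 - y\<bar>) + c * \<gamma>3 + d * \<gamma>4 * exp (-r\<^sup>2)))) \<le> r\<^sup>2"
  and e4: "norm (\<gamma>4 - (exp (-\<bar>y + r\<^sup>2\<bar>) - (a * \<gamma>1 * exp (-\<bar>x - (y + r\<^sup>2)\<bar>) + b * \<gamma>2 * exp (-\<bar>x + r\<^sup>2 - (y + r\<^sup>2)\<bar>) + c * \<gamma>3 * exp (-r\<^sup>2) + d * \<gamma>4))) \<le> r\<^sup>2"
begin

lemma swap: "pair_system \<mu> r N y x c d a b \<gamma>3 \<gamma>4 \<gamma>1 \<gamma>2"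
proof
 show "r\<^sup>2 \<le> \<bar>y - x\<bar>" using sep by (simp add: abs_minus_commute)
 have c: "A + B + C + D = C + D + A + B" for A B C D :: complex by simp
 show "norm (\<gamma>3 - (exp (-\<bar>y\<bar>) - (c * \<gamma>3 + d * \<gamma>4 * exp (-r\<^sup>2) + a * \<gamma>1 * exp (-\<bar>x - y\<bar>) + b * \<gamma>2 * exp (-\<bar>x + r\<^sup>2 - y\<bar>)))) \<le> r\<^sup>2"
  using e3 by (simp only: c[of "c * \<gamma>3"])
 show "norm (\<gamma>4 - (exp (-\<bar>y + r\<^sup>2\<bar>) - (c * \<gamma>3 * exp (-r\<^sup>2) + d * \<gamma>4 + a * \<gamma>1 * exp (-\<bar>x - (y + r\<^sup>2)\<bar>) + b * \<gamma>2 * exp (-\<bar>x + r\<^sup>2 - (y + r\<^sup>2)\<bar>)))) \<le> r\<^sup>2"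
  using e4 by (simp only: c[of "c * \<gamma>3 * exp (-r\<^sup>2)"])
 show "norm (\<gamma>1 - (exp (-\<bar>x\<bar>) - (c * \<gamma>3 * exp (-\<bar>y - x\<bar>) + d * \<gamma>4 * exp (-\<bar>y + r\<^sup>2 - x\<bar>) + a * \<gamma>1 + b * \<gamma>2 * exp (-r\<^sup>2)))) \<le> r\<^sup>2"
  using e1 by (simp only: c[of "c * \<gamma>3 * exp (-\<bar>y - x\<bar>)"])
 show "norm (\<gamma>2 - (exp (-\<bar>x + r\<^sup>2\<bar>) - (c * \<gamma>3 * exp (-\<bar>y - (x + r\<^sup>2)\<bar>) + d * \<gamma>4 * exp (-\<bar>y + r\<^sup>2 - (x + r\<^sup>2)\<bar>) + a * \<gamma>1 * exp (-r\<^sup>2) + b * \<gamma>2))) \<le> r\<^sup>2"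
  using e2 by (simp only: c[of "c * \<gamma>3 * exp (-\<bar>y - (x + r\<^sup>2)\<bar>)"])
qed (fact r N ab cd g)+

lemma rN: "r * r = r\<^sup>2" "r\<^sup>2 \<le> r" "N \<le> N\<^sup>2" "N\<^sup>2 \<le> N ^ 3" "1 \<le> N\<^sup>2" "1 \<le> N ^ 3" "0 \<le> N" "N \<le> N^3"
proof -
 show "r * r = r\<^sup>2" by (simp add: power2_eq_square)
 show "r\<^sup>2 \<le> r" unfolding power2_eq_square using r by (simp add: mult_left_le)
 show "N \<le> N\<^sup>2" "N\<^sup>2 \<le> N ^ 3" "N \<le> N^3"
  using power_increasing[of 1 2 N] power_increasing[of 2 3 N] power_increasing[of 1 3 N] N(1) by simp_all
 show "1 \<le> N\<^sup>2" "1 \<le> N ^ 3" using N(1) by (simp_all add: one_le_power)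
 show "0 \<le> N" using N(1) by simp
qed

lemma vb: "norm a \<le> N / r" "norm b \<le> N / r" "norm c \<le> N / r" "norm d \<le> N / r"
 using adm_norm_le[OF ab r N(2,3)] adm_norm_le[OF cd r N(2,3)] by auto

lemma lip: "\<bar>exp (-\<bar>u\<bar>) - exp (-\<bar>v\<bar>)\<bar> \<le> \<bar>u - v\<bar>" for u v :: real
 by (rule exp_abs_lipschitz)

lemma term_le: "norm v \<le> N / r \<Longrightarrow> norm \<gamma> \<le> 1 \<Longrightarrow> \<bar>s\<bar> \<le> r\<^sup>2 \<Longrightarrow> norm (v * \<gamma> * complex_of_real s) \<le> N * r"
proof -
 assume a: "norm v \<le> N / r" "norm \<gamma> \<le> 1" "\<bar>s\<bar> \<le> r\<^sup>2"
 have "norm (v * \<gamma> * complex_of_real s) \<le> N / r * 1 * r\<^sup>2"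
  by (intro norm_mult_le a) (use a in simp)
 also have "\<dots> = N * r" using r by (simp add: power2_eq_square)
 finally show ?thesis .
qed

text \<open>Subtracting the two equations of a pair shows that the unknown varies by at most the order of \<open>r\<close> across the pair, since the weights are of order \<open>1 / r\<close> while the kernel varies by \<open>r\<^sup>2\<close>.\<close>

lemma crude: "norm (\<gamma>1 - \<gamma>2) \<le> 7 * N * r"
proof -
 let ?E1 = "\<gamma>1 - (exp (-\<bar>x\<bar>) - (a * \<gamma>1 + b * \<gamma>2 * exp (-r\<^sup>2) + c * \<gamma>3 * exp (-\<bar>y - x\<bar>) + d * \<gamma>4 * exp (-\<bar>y + r\<^sup>2 - x\<bar>)))"
 let ?E2 = "\<gamma>2 - (exp (-\<bar>x + r\<^sup>2\<bar>) - (a * \<gamma>1 * exp (-r\<^sup>2) + b * \<gamma>2 + c * \<gamma>3 * exp (-\<bar>y - (x + r\<^sup>2)\<bar>) + d * \<gamma>4 * exp (-\<bar>y + r\<^sup>2 - (x + r\<^sup>2)\<bar>)))"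
 let ?s1 = "1 - exp (-r\<^sup>2)" and ?s2 = "exp (-r\<^sup>2) - 1"
 let ?s3 = "exp (-\<bar>y - x\<bar>) - exp (-\<bar>y - (x + r\<^sup>2)\<bar>)" and ?s4 = "exp (-\<bar>y + r\<^sup>2 - x\<bar>) - exp (-\<bar>y + r\<^sup>2 - (x + r\<^sup>2)\<bar>)"
 let ?s0 = "exp (-\<bar>x\<bar>) - exp (-\<bar>x + r\<^sup>2\<bar>)"
 have eq: "\<gamma>1 - \<gamma>2 = complex_of_real ?s0 - a * \<gamma>1 * complex_of_real ?s1 - b * \<gamma>2 * complex_of_real ?s2 - c * \<gamma>3 * complex_of_real ?s3 - d * \<gamma>4 * complex_of_real ?s4 + ?E1 - ?E2"
  unfolding of_real_diff of_real_1 by algebra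
 have "norm (\<gamma>1 - \<gamma>2) \<le> r\<^sup>2 + N * r + N * r + N * r + N * r + r\<^sup>2 + r\<^sup>2"
  unfolding eq
 proof (rule norm_seven_le[OF _ _ _ _ _ e1 e2])
  have q: "\<bar>1 - exp (-r\<^sup>2)\<bar> \<le> r\<^sup>2"
   using one_minus_exp_bounds(1,2)[of "r\<^sup>2"] by (simp only: abs_of_nonneg zero_le_power2)
  show "norm (complex_of_real ?s0) \<le> r\<^sup>2"
   unfolding norm_of_real using lip[of x "x + r\<^sup>2"] by simp
  show "norm (a * \<gamma>1 * complex_of_real ?s1) \<le> N * r" by (rule term_le[OF vb(1) g(1) q])
  show "norm (b * \<gamma>2 * complex_of_real ?s2) \<le> N * r"
   by (rule term_le[OF vb(2) g(2)]) (use q in \<open>simp only: abs_minus_commute\<close>)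
  show "norm (c * \<gamma>3 * complex_of_real ?s3) \<le> N * r"
   by (rule term_le[OF vb(3) g(3)]) (use lip[of "y - x" "y - (x + r\<^sup>2)"] in simp)
  show "norm (d * \<gamma>4 * complex_of_real ?s4) \<le> N * r"
   by (rule term_le[OF vb(4) g(4)]) (use lip[of "y + r\<^sup>2 - x" "y + r\<^sup>2 - (x + r\<^sup>2)"] in simp)
 qed
 also have "\<dots> \<le> 7 * N * r"
 proof -
  have "1 * r \<le> N * r" using N r by (intro mult_right_mono) auto
  then show ?thesis using rN(2) by linarith
 qed
 finally show ?thesis .
qed

lemma other_pair_flat:
 "norm ((c * \<gamma>3 * exp (-\<bar>y - x\<bar>) + d * \<gamma>4 * exp (-\<bar>y + r\<^sup>2 - x\<bar>))
  - (c * \<gamma>3 * exp (-\<bar>y - (x + r\<^sup>2)\<bar>) + d * \<gamma>4 * exp (-\<bar>y + r\<^sup>2 - (x + r\<^sup>2)\<bar>))) \<le> 8 * N\<^sup>2 * r\<^sup>2"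
proof -
 let ?s3 = "exp (-\<bar>y - x\<bar>) - exp (-\<bar>y - (x + r\<^sup>2)\<bar>)" and ?s4 = "exp (-\<bar>y + r\<^sup>2 - x\<bar>) - exp (-\<bar>y + r\<^sup>2 - (x + r\<^sup>2)\<bar>)"
 have eq: "(c * \<gamma>3 * exp (-\<bar>y - x\<bar>) + d * \<gamma>4 * exp (-\<bar>y + r\<^sup>2 - x\<bar>))
  - (c * \<gamma>3 * exp (-\<bar>y - (x + r\<^sup>2)\<bar>) + d * \<gamma>4 * exp (-\<bar>y + r\<^sup>2 - (x + r\<^sup>2)\<bar>))
  = c * \<gamma>3 * complex_of_real ?s3 + d * \<gamma>4 * complex_of_real ?s4"
  by (simp add: algebra_simps)
 have s3: "\<bar>?s3\<bar> \<le> r\<^sup>2" using lip[of "y - x" "y - (x + r\<^sup>2)"] by simp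
 show ?thesis
 proof (cases "d = - c \<and> c\<^sup>2 = - complex_of_real (\<mu>\<^sup>2 / r\<^sup>2)")
  case True
  have "c * \<gamma>3 * complex_of_real ?s3 + d * \<gamma>4 * complex_of_real ?s4
   = c * (\<gamma>3 - \<gamma>4) * complex_of_real ?s3 + c * \<gamma>4 * complex_of_real (?s3 - ?s4)"
   using True by (simp add: algebra_simps)
  also have "norm \<dots> \<le> N / r * (7 * N * r) * r\<^sup>2 + N / r * 1 * (r\<^sup>2)\<^sup>2"
  proof (intro order_trans[OF norm_triangle_ineq] add_mono norm_mult_le vb g pair_system.crude[OF swap])
   show "norm (complex_of_real ?s3) \<le> r\<^sup>2" unfolding norm_of_real by (rule s3)
   have "?s3 - ?s4 = exp (-\<bar>y - x\<bar>) - exp (-\<bar>y - (x + r\<^sup>2)\<bar>) - exp (-\<bar>y + r\<^sup>2 - x\<bar>) + exp (-\<bar>y + r\<^sup>2 - (x + r\<^sup>2)\<bar>)" by simp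
   then show "norm (complex_of_real (?s3 - ?s4)) \<le> (r\<^sup>2)\<^sup>2"
    unfolding norm_of_real using kernel_second_difference[of "r\<^sup>2" x y] sep by (simp only: zero_le_power2)
  qed
  also have "\<dots> = 7 * N\<^sup>2 * r\<^sup>2 + N * (r * r\<^sup>2)" using r by (simp add: power2_eq_square)
  also have "\<dots> \<le> 7 * N\<^sup>2 * r\<^sup>2 + N\<^sup>2 * r\<^sup>2" using r rN N by (intro add_mono mult_mono) (auto intro: mult_left_le_one_le)
  finally show ?thesis unfolding eq by simp
 next
  case False
  then have cd0: "c = complex_of_real (2 * \<mu>\<^sup>2)" "d = 0" using cd unfolding adm_def by auto
  have "norm c \<le> N" unfolding cd0 norm_of_real using N by simp
  then have "norm (c * \<gamma>3 * complex_of_real ?s3 + d * \<gamma>4 * complex_of_real ?s4) \<le> N * 1 * r\<^sup>2"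
   unfolding cd0(2) mult_zero_left add_0_right
   by (intro norm_mult_le g) (simp_all only: norm_of_real s3)
  also have "\<dots> \<le> 8 * N\<^sup>2 * r\<^sup>2" using rN N by (intro mult_right_mono) auto
  finally show ?thesis unfolding eq .
 qed
qed

text \<open>This is where \<open>2 * \<mu>\<^sup>2\<close> arises: for opposite weights \<open>a\<close>, \<open>- a\<close> the total charge is \<open>a\<close> times the difference of the unknowns, which is again of the form \<open>a\<close> times \<open>r\<^sup>2\<close> times the unknown, and \<open>a\<^sup>2 * r\<^sup>2 = - \<mu>\<^sup>2\<close>. The factor 2 comes from the jump of the derivative of the kernel on the diagonal.\<close>

lemma charge: "norm (a * \<gamma>1 + b * \<gamma>2 - complex_of_real (2 * \<mu>\<^sup>2) * \<gamma>1) \<le> 25 * N ^ 3 * r"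
proof (cases "b = - a \<and> a\<^sup>2 = - complex_of_real (\<mu>\<^sup>2 / r\<^sup>2)")
 case True
 let ?E1 = "\<gamma>1 - (exp (-\<bar>x\<bar>) - (a * \<gamma>1 + b * \<gamma>2 * exp (-r\<^sup>2) + c * \<gamma>3 * exp (-\<bar>y - x\<bar>) + d * \<gamma>4 * exp (-\<bar>y + r\<^sup>2 - x\<bar>)))"
 let ?E2 = "\<gamma>2 - (exp (-\<bar>x + r\<^sup>2\<bar>) - (a * \<gamma>1 * exp (-r\<^sup>2) + b * \<gamma>2 + c * \<gamma>3 * exp (-\<bar>y - (x + r\<^sup>2)\<bar>) + d * \<gamma>4 * exp (-\<bar>y + r\<^sup>2 - (x + r\<^sup>2)\<bar>)))"
 let ?Y = "(c * \<gamma>3 * exp (-\<bar>y - x\<bar>) + d * \<gamma>4 * exp (-\<bar>y + r\<^sup>2 - x\<bar>))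
  - (c * \<gamma>3 * exp (-\<bar>y - (x + r\<^sup>2)\<bar>) + d * \<gamma>4 * exp (-\<bar>y + r\<^sup>2 - (x + r\<^sup>2)\<bar>))"
 let ?s0 = "exp (-\<bar>x\<bar>) - exp (-\<bar>x + r\<^sup>2\<bar>)"
 let ?q = "1 - exp (-r\<^sup>2)"
 define E where "E = complex_of_real ?s0 - ?Y + ?E1 - ?E2"
 have diff: "\<gamma>1 - \<gamma>2 = E - a * complex_of_real ?q * (\<gamma>1 + \<gamma>2)"
  unfolding E_def True[THEN conjunct1] of_real_diff of_real_1 by algebra
 have "norm E \<le> r\<^sup>2 + 8 * N\<^sup>2 * r\<^sup>2 + r\<^sup>2 + r\<^sup>2"
  unfolding E_def
  by (rule norm_four_le[OF _ other_pair_flat e1 e2]) (use lip[of x "x + r\<^sup>2"] in \<open>simp only: norm_of_real, simp\<close>)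
 also have "\<dots> \<le> 11 * N\<^sup>2 * r\<^sup>2" using rN mult_right_mono[OF rN(5), of "r\<^sup>2"] by simp
 finally have En: "norm E \<le> 11 * N\<^sup>2 * r\<^sup>2" .
 have a2: "a * a = - complex_of_real (\<mu>\<^sup>2 / r\<^sup>2)" using True by (simp add: power2_eq_square)
 have "a * \<gamma>1 + b * \<gamma>2 = a * (\<gamma>1 - \<gamma>2)" using True by (simp add: algebra_simps)
 also have "\<dots> = a * E - (a * a) * complex_of_real ?q * (\<gamma>1 + \<gamma>2)" unfolding diff by (simp add: algebra_simps)
 also have "\<dots> = a * E + complex_of_real (\<mu>\<^sup>2 * (?q / r\<^sup>2)) * (\<gamma>1 + \<gamma>2)" unfolding a2 by simp
 also have "\<dots> - complex_of_real (2 * \<mu>\<^sup>2) * \<gamma>1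
   = a * E + complex_of_real (\<mu>\<^sup>2) * complex_of_real (?q / r\<^sup>2 - 1) * (\<gamma>1 + \<gamma>2) + complex_of_real (\<mu>\<^sup>2) * (\<gamma>2 - \<gamma>1)"
  by (simp add: algebra_simps)
 finally have eq: "a * \<gamma>1 + b * \<gamma>2 - complex_of_real (2 * \<mu>\<^sup>2) * \<gamma>1 = \<dots>" by simp
 have k: "\<bar>?q / r\<^sup>2 - 1\<bar> \<le> r\<^sup>2"
 proof -
  have r2: "0 < r\<^sup>2" using r by simp
  have "?q / r\<^sup>2 \<le> 1" using one_minus_exp_bounds[of "r\<^sup>2"] r2 by simp
  moreover have "1 - r\<^sup>2 / 2 \<le> ?q / r\<^sup>2"
  proof -
   have "(1 - r\<^sup>2 / 2) * r\<^sup>2 = r\<^sup>2 - (r\<^sup>2)\<^sup>2 / 2" unfolding power2_eq_square[of "r\<^sup>2"] by (simp only: left_diff_distrib mult_1_left times_divide_eq_left)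
   then show ?thesis unfolding pos_le_divide_eq[OF r2] using one_minus_exp_bounds(3)[of "r\<^sup>2"] r2 by simp
  qed
  ultimately show ?thesis using r2 unfolding abs_le_iff by linarith
 qed
 have m: "norm (complex_of_real (\<mu>\<^sup>2)) \<le> N / 2" unfolding norm_of_real using N by simp
 have "norm (a * \<gamma>1 + b * \<gamma>2 - complex_of_real (2 * \<mu>\<^sup>2) * \<gamma>1) \<le> N / r * (11 * N\<^sup>2 * r\<^sup>2) + N / 2 * r\<^sup>2 * (1 + 1) + N / 2 * (7 * N * r)"
  unfolding eq
  by (intro order_trans[OF norm_triangle_ineq] add_mono norm_mult_le vb En m g crude[unfolded norm_minus_commute[of \<gamma>1]]) (simp only: norm_of_real k)
 also have "\<dots> = 11 * (N ^ 3 * r) + N * r\<^sup>2 + 7 / 2 * (N\<^sup>2 * r)"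
  using r by (simp add: power2_eq_square power3_eq_cube field_simps)
 also have "\<dots> \<le> 11 * (N ^ 3 * r) + N ^ 3 * r + 7 / 2 * (N ^ 3 * r)"
  using rN r by (intro add_mono mult_left_mono mult_mono) auto
 also have "\<dots> \<le> 25 * N ^ 3 * r" using rN r by simp
 finally show ?thesis .
next
 case False
 then have "a = complex_of_real (2 * \<mu>\<^sup>2)" "b = 0" using ab unfolding adm_def by auto
 then show ?thesis using rN r by simp
qed

text \<open>After replacing each pair by its total charge both kinds of weights satisfy the same two-by-two system up to \<open>O r\<close>.\<close>

lemma reduced:
 "norm (\<gamma>1 - (exp (-\<bar>x\<bar>) - complex_of_real (2 * \<mu>\<^sup>2) * \<gamma>1 - complex_of_real (2 * \<mu>\<^sup>2) * \<gamma>3 * exp (-\<bar>x - y\<bar>))) \<le> 53 * N ^ 3 * r"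
proof -
 let ?E1 = "\<gamma>1 - (exp (-\<bar>x\<bar>) - (a * \<gamma>1 + b * \<gamma>2 * exp (-r\<^sup>2) + c * \<gamma>3 * exp (-\<bar>y - x\<bar>) + d * \<gamma>4 * exp (-\<bar>y + r\<^sup>2 - x\<bar>)))"
 let ?m = "complex_of_real (2 * \<mu>\<^sup>2)" and ?g = "complex_of_real (exp (-\<bar>y - x\<bar>))"
 have eq: "\<gamma>1 - (exp (-\<bar>x\<bar>) - ?m * \<gamma>1 - ?m * \<gamma>3 * exp (-\<bar>x - y\<bar>))
  = ?E1 - (a * \<gamma>1 + b * \<gamma>2 - ?m * \<gamma>1) + b * \<gamma>2 * complex_of_real (1 - exp (-r\<^sup>2))
   - (c * \<gamma>3 + d * \<gamma>4 - ?m * \<gamma>3) * ?g - d * \<gamma>4 * complex_of_real (exp (-\<bar>y + r\<^sup>2 - x\<bar>) - exp (-\<bar>y - x\<bar>))"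
  unfolding of_real_diff of_real_1 abs_minus_commute[of y x] by algebra
 have "norm (\<gamma>1 - (exp (-\<bar>x\<bar>) - ?m * \<gamma>1 - ?m * \<gamma>3 * exp (-\<bar>x - y\<bar>))) \<le> r\<^sup>2 + 25 * N ^ 3 * r + N * r + 25 * N ^ 3 * r * 1 + N * r"
  unfolding eq
 proof (rule norm_five_le[OF e1 charge])
  show "norm (b * \<gamma>2 * complex_of_real (1 - exp (-r\<^sup>2))) \<le> N * r"
   by (rule term_le[OF vb(2) g(2)])
    (use one_minus_exp_bounds(1,2)[of "r\<^sup>2"] in \<open>simp only: abs_of_nonneg zero_le_power2\<close>)
  show "norm ((c * \<gamma>3 + d * \<gamma>4 - ?m * \<gamma>3) * ?g) \<le> 25 * N ^ 3 * r * 1"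
   by (rule norm_mult_le[OF pair_system.charge[OF swap]]) simp
  show "norm (d * \<gamma>4 * complex_of_real (exp (-\<bar>y + r\<^sup>2 - x\<bar>) - exp (-\<bar>y - x\<bar>))) \<le> N * r"
   by (rule term_le[OF vb(4) g(4)]) (use lip[of "y + r\<^sup>2 - x" "y - x"] in simp)
 qed
 also have "\<dots> \<le> 53 * N ^ 3 * r"
 proof -
  have "N * r \<le> N ^ 3 * r" "1 * r \<le> N ^ 3 * r" using rN r by (intro mult_right_mono; simp)+
  then show ?thesis using rN(2) by linarith
 qed
 finally show ?thesis .
qed

end

text \<open>The limiting matrix is a nonnegative multiple of a positive semidefinite kernel matrix added to the identity, so inverting it does not enlarge errors by more than a constant.\<close>

lemma real_2x2_stable:
 fixes u w :: complex and m g K :: real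
 assumes m: "0 \<le> m" and g: "0 \<le> g" "g \<le> 1"
  and 1: "norm (u + m * u + m * g * w) \<le> K" and 2: "norm (w + m * w + m * g * u) \<le> K"
 shows "norm (u + w) \<le> 2 * K"
proof -
 have "(u + m * u + m * g * w) + (w + m * w + m * g * u) = complex_of_real (1 + m + m * g) * (u + w)"
  by (simp add: algebra_simps)
 then have "norm (complex_of_real (1 + m + m * g) * (u + w)) \<le> K + K"
  using norm_triangle_ineq[of "u + m * u + m * g * w" "w + m * w + m * g * u"] 1 2 by simp
 then have "(1 + m + m * g) * norm (u + w) \<le> 2 * K" using m g by (simp add: norm_mult del: of_real_add of_real_mult)
 moreover have "1 * norm (u + w) \<le> (1 + m + m * g) * norm (u + w)" using m g by (intro mult_right_mono) auto
 ultimately show ?thesis by simp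
qed

lemma K1: "25 * N ^ 3 * r + 25 * N ^ 3 * r + 25 * N ^ 3 * r + 25 * N ^ 3 * r + N * (2 * (106 * N ^ 3 * r)) = 100 * (N ^ 3 * r) + 212 * ((N * N ^ 3) * r)" for N r :: real
 by algebra

text \<open>Both solutions solve the same stable limiting system up to \<open>O r\<close>, so their total charges agree up to \<open>O r\<close>.\<close>

lemma pair_system_compare:
 assumes s: "pair_system \<mu> r N x y a b c d \<gamma>1 \<gamma>2 \<gamma>3 \<gamma>4"
  and t: "pair_system \<mu> r N x y a' b' c' d' \<delta>1 \<delta>2 \<delta>3 \<delta>4"
 shows "norm ((a * \<gamma>1 + b * \<gamma>2 + c * \<gamma>3 + d * \<gamma>4) - (a' * \<delta>1 + b' * \<delta>2 + c' * \<delta>3 + d' * \<delta>4)) \<le> 312 * N ^ 4 * r"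
proof -
 interpret S: pair_system \<mu> r N x y a b c d \<gamma>1 \<gamma>2 \<gamma>3 \<gamma>4 by (rule s)
 interpret T: pair_system \<mu> r N x y a' b' c' d' \<delta>1 \<delta>2 \<delta>3 \<delta>4 by (rule t)
 let ?m = "2 * \<mu>\<^sup>2" and ?g = "exp (-\<bar>x - y\<bar>)"
 have A: "norm ((\<gamma>1 - \<delta>1) + ?m * (\<gamma>1 - \<delta>1) + ?m * ?g * (\<gamma>3 - \<delta>3)) \<le> 106 * N ^ 3 * r"
 proof -
  have eq: "(\<gamma>1 - \<delta>1) + ?m * (\<gamma>1 - \<delta>1) + ?m * ?g * (\<gamma>3 - \<delta>3) =
   (\<gamma>1 - (exp (-\<bar>x\<bar>) - complex_of_real (2 * \<mu>\<^sup>2) * \<gamma>1 - complex_of_real (2 * \<mu>\<^sup>2) * \<gamma>3 * exp (-\<bar>x - y\<bar>)))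
   - (\<delta>1 - (exp (-\<bar>x\<bar>) - complex_of_real (2 * \<mu>\<^sup>2) * \<delta>1 - complex_of_real (2 * \<mu>\<^sup>2) * \<delta>3 * exp (-\<bar>x - y\<bar>)))"
   unfolding of_real_mult by algebra
  have "norm ((\<gamma>1 - \<delta>1) + ?m * (\<gamma>1 - \<delta>1) + ?m * ?g * (\<gamma>3 - \<delta>3)) \<le> 53 * N ^ 3 * r + 53 * N ^ 3 * r"
   unfolding eq by (intro order_trans[OF norm_triangle_ineq4] add_mono S.reduced T.reduced)
  also have "\<dots> = 106 * N ^ 3 * r" by simp
  finally show ?thesis .
 qed
 have B: "norm ((\<gamma>3 - \<delta>3) + ?m * (\<gamma>3 - \<delta>3) + ?m * ?g * (\<gamma>1 - \<delta>1)) \<le> 106 * N ^ 3 * r"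
 proof -
  have eq: "(\<gamma>3 - \<delta>3) + ?m * (\<gamma>3 - \<delta>3) + ?m * ?g * (\<gamma>1 - \<delta>1) =
   (\<gamma>3 - (exp (-\<bar>y\<bar>) - complex_of_real (2 * \<mu>\<^sup>2) * \<gamma>3 - complex_of_real (2 * \<mu>\<^sup>2) * \<gamma>1 * exp (-\<bar>y - x\<bar>)))
   - (\<delta>3 - (exp (-\<bar>y\<bar>) - complex_of_real (2 * \<mu>\<^sup>2) * \<delta>3 - complex_of_real (2 * \<mu>\<^sup>2) * \<delta>1 * exp (-\<bar>y - x\<bar>)))"
   unfolding of_real_mult abs_minus_commute[of y x] by algebra
  have "norm ((\<gamma>3 - \<delta>3) + ?m * (\<gamma>3 - \<delta>3) + ?m * ?g * (\<gamma>1 - \<delta>1)) \<le> 53 * N ^ 3 * r + 53 * N ^ 3 * r"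
   unfolding eq by (intro order_trans[OF norm_triangle_ineq4] add_mono pair_system.reduced[OF S.swap] pair_system.reduced[OF T.swap])
  also have "\<dots> = 106 * N ^ 3 * r" by simp
  finally show ?thesis .
 qed
 have D: "norm ((\<gamma>1 - \<delta>1) + (\<gamma>3 - \<delta>3)) \<le> 2 * (106 * N ^ 3 * r)"
  by (rule real_2x2_stable[where m="?m" and g="?g", OF _ _ _ A B]) simp_all
 have eq: "(a * \<gamma>1 + b * \<gamma>2 + c * \<gamma>3 + d * \<gamma>4) - (a' * \<delta>1 + b' * \<delta>2 + c' * \<delta>3 + d' * \<delta>4)
  = (a * \<gamma>1 + b * \<gamma>2 - complex_of_real ?m * \<gamma>1) + (c * \<gamma>3 + d * \<gamma>4 - complex_of_real ?m * \<gamma>3)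
   - (a' * \<delta>1 + b' * \<delta>2 - complex_of_real ?m * \<delta>1) - (c' * \<delta>3 + d' * \<delta>4 - complex_of_real ?m * \<delta>3)
   + complex_of_real ?m * ((\<gamma>1 - \<delta>1) + (\<gamma>3 - \<delta>3))"
  by algebra
 have "norm ((a * \<gamma>1 + b * \<gamma>2 + c * \<gamma>3 + d * \<gamma>4) - (a' * \<delta>1 + b' * \<delta>2 + c' * \<delta>3 + d' * \<delta>4)) \<le> 25 * N ^ 3 * r + 25 * N ^ 3 * r + 25 * N ^ 3 * r + 25 * N ^ 3 * r + N * (2 * (106 * N ^ 3 * r))"
 proof -
  have tri: "norm (A + B - C - D + E) \<le> norm A + norm B + norm C + norm D + norm E" for A B C D E :: complex
   using norm_triangle_ineq[of A B] norm_triangle_ineq4[of "A + B" C] norm_triangle_ineq4[of "A + B - C" D]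
    norm_triangle_ineq[of "A + B - C - D" E] by linarith
  have m: "norm (complex_of_real ?m) \<le> N" unfolding norm_of_real using S.N(3) by simp
  show ?thesis unfolding eq
   by (rule order_trans[OF tri],
    rule add_mono[OF add_mono[OF add_mono[OF add_mono[OF S.charge pair_system.charge[OF S.swap]] T.charge]
    pair_system.charge[OF T.swap]] norm_mult_le[OF m D]])
 qed
 also have "\<dots> = 100 * (N ^ 3 * r) + 212 * ((N * N ^ 3) * r)" by (rule K1)
 also have "N * N ^ 3 = N ^ 4" by algebra
 also have "100 * (N ^ 3 * r) + 212 * (N ^ 4 * r) \<le> 312 * N ^ 4 * r"
 proof -
  have "N ^ 3 \<le> N ^ 4" by (rule power_increasing[OF _ S.N(1)]) simp
  then have "N ^ 3 * r \<le> N ^ 4 * r" using S.r by (intro mult_right_mono) auto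
  then show ?thesis by linarith
 qed
 finally show ?thesis .
qed

section \<open>Local time: moments and exponential functionals\<close>

lemma fatou_integral_bound:
 fixes f :: "'a \<Rightarrow> real" and F :: "nat \<Rightarrow> 'a \<Rightarrow> real"
 assumes f: "f \<in> borel_measurable M" and F: "\<And>n. integrable M (F n)" "\<And>n x. 0 \<le> F n x"
  and le: "\<And>n. (LINT x|M. F n x) \<le> C" and lim: "AE x in M. (\<lambda>n. F n x) \<longlonglongrightarrow> f x"
 shows "integrable M f" and "(LINT x|M. f x) \<le> C"
proof -
 have C0: "0 \<le> C" using order_trans[OF integral_nonneg_AE le[of 0]] F(2) by auto
 have f0: "AE x in M. 0 \<le> f x"
  using lim by eventually_elim (rule LIMSEQ_le_const, auto intro: F(2))
 have "(\<integral>\<^sup>+x. ennreal (f x) \<partial>M) = (\<integral>\<^sup>+x. liminf (\<lambda>n. ennreal (F n x)) \<partial>M)"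
 proof (rule nn_integral_cong_AE)
  show "AE x in M. ennreal (f x) = liminf (\<lambda>n. ennreal (F n x))"
   using lim
  proof eventually_elim
   case (elim x)
   then have "(\<lambda>n. ennreal (F n x)) \<longlonglongrightarrow> ennreal (f x)" by (rule tendsto_ennrealI)
   then show ?case by (rule lim_imp_Liminf[OF sequentially_bot, symmetric])
  qed
 qed
 also have "\<dots> \<le> liminf (\<lambda>n. \<integral>\<^sup>+x. ennreal (F n x) \<partial>M)"
  using F(1) by (intro nn_integral_liminf) auto
 also have "\<dots> \<le> liminf (\<lambda>n. ennreal C)"
 proof (rule Liminf_mono, rule always_eventually, rule allI)
  fix n
  have "(\<integral>\<^sup>+x. ennreal (F n x) \<partial>M) = ennreal (LINT x|M. F n x)"
   using F by (intro nn_integral_eq_integral) auto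
  then show "(\<integral>\<^sup>+x. ennreal (F n x) \<partial>M) \<le> ennreal C" using le by (simp add: ennreal_leI)
 qed
 also have "\<dots> = ennreal C" by (simp add: Liminf_const)
 finally have *: "(\<integral>\<^sup>+x. ennreal (f x) \<partial>M) \<le> ennreal C" .
 show i: "integrable M f"
 proof (rule integrableI_bounded[OF f])
  have "(\<integral>\<^sup>+x. ennreal (norm (f x)) \<partial>M) = (\<integral>\<^sup>+x. ennreal (f x) \<partial>M)"
   using f0 by (intro nn_integral_cong_AE) auto
  also have "\<dots> < \<infinity>" using * by (auto simp: less_top intro: le_less_trans)
  finally show "(\<integral>\<^sup>+x. ennreal (norm (f x)) \<partial>M) < \<infinity>" .
 qed
 have "ennreal (LINT x|M. f x) \<le> ennreal C"
  using * nn_integral_eq_integral[OF i f0] by simp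
 then show "(LINT x|M. f x) \<le> C" using C0 by simp
qed

text \<open>Local time is characterised as the limit of occupation integrals of tents; joint continuity and nonnegativity hold everywhere, as for the paths of \<open>B\<close>.\<close>

locale cont_blt = cont_bm M B for M :: "'w measure" and B +
 fixes L :: "real \<Rightarrow> real \<Rightarrow> 'w \<Rightarrow> real"
 assumes L_meas: "\<And>x s. L x s \<in> borel_measurable M"
  and L_cont: "\<And>w. continuous_on UNIV (\<lambda>(x, s). L x s w)"
  and L_nonneg: "\<And>x s w. 0 \<le> L x s w"
  and L_limit: "AE w in M. \<forall>s\<ge>0. \<forall>x. ((\<lambda>\<epsilon>. AR (tent \<epsilon> x) s w) \<longlongrightarrow> L x s w) (at_right 0)"
begin

lemma L_cont_x: "continuous_on UNIV (\<lambda>x. L x s w)"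
proof -
 have "continuous_on UNIV (\<lambda>x::real. (x, s))" by (intro continuous_on_Pair continuous_on_id continuous_on_const)
 from continuous_on_compose2[OF L_cont[of w] this] show ?thesis by simp
qed

lemma L_cont_s: "continuous_on UNIV (\<lambda>s. L x s w)"
proof -
 have "continuous_on UNIV (\<lambda>s::real. (x, s))" by (intro continuous_on_Pair continuous_on_id continuous_on_const)
 from continuous_on_compose2[OF L_cont[of w] this] show ?thesis by simp
qed

lemma L_joint [measurable (raw)]:
 assumes f: "f \<in> borel_measurable N" and g: "g \<in> borel_measurable N" and h: "h \<in> measurable N M"
 shows "(\<lambda>z. L (f z) (g z) (h z)) \<in> borel_measurable N"
proof -
 have 1: "(\<lambda>(s, w). L x s w) \<in> borel_measurable (borel \<Otimes>\<^sub>M M)" for x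
  by (rule borel_measurable_continuous_process[OF L_meas L_cont_s])
 have 2: "(\<lambda>(x, p). (case p of (s, w) \<Rightarrow> L x s w)) \<in> borel_measurable (borel \<Otimes>\<^sub>M (borel \<Otimes>\<^sub>M M))"
  by (rule borel_measurable_continuous_process[OF 1]) (auto simp: L_cont_x split: prod.split)
 show ?thesis
  using measurable_compose[OF measurable_Pair[OF f measurable_Pair[OF g h]] 2] by simp
qed

lemma L_limit_seq:
 "AE w in M. \<forall>s\<ge>0. \<forall>x. (\<lambda>n. AR (tent (1 / real (Suc n)) x) s w) \<longlonglongrightarrow> L x s w"
 using L_limit
proof eventually_elim
 case (elim w)
 have *: "filterlim (\<lambda>n. 1 / real (Suc n)) (at_right 0) sequentially"
  by (rule tendsto_imp_filterlim_at_right) (use LIMSEQ_inverse_real_of_nat in \<open>auto simp: inverse_eq_divide\<close>)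
 show ?case
  using elim filterlim_compose[OF _ *] by blast
qed

lemma AR_dip: "AR (dip \<epsilon> x h) s w = AR (tent \<epsilon> x) s w - AR (tent \<epsilon> (x + h)) s w"
 unfolding AR_def by (rule set_integral_diff(2)) (intro AR_integrable[unfolded comp_def] tent_continuous)+

lemma AR_tent_integrable: "0 < \<epsilon> \<Longrightarrow> 0 \<le> s \<Longrightarrow> integrable M (\<lambda>w. AR (tent \<epsilon> x) s w ^ n)"
 using AR_power_integrable[OF tent_continuous, of \<epsilon> x "1 / \<epsilon>" s "\<lambda>_. 1" 1 n] tent_le[of \<epsilon> x] tent_nonneg[of \<epsilon> x] by simp

lemma AR_dip_integrable: "0 < \<epsilon> \<Longrightarrow> 0 \<le> s \<Longrightarrow> integrable M (\<lambda>w. AR (dip \<epsilon> x h) s w ^ n)"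
 using AR_power_integrable[OF dip_continuous dip_bound, of \<epsilon> s "\<lambda>_. 1" 1 x h n] by simp

text \<open>Fatou transfers the bound for tents, which is uniform in their width.\<close>

lemma L_even_moment:
 assumes t: "0 \<le> t" and h: "0 \<le> h" and m: "1 \<le> m"
 shows "integrable M (\<lambda>w. (L (x + h) t w - L x t w) ^ (2 * m))"
  and "(LINT w|M. (L (x + h) t w - L x t w) ^ (2 * m))
   \<le> 2 * ((8 * real m * h) ^ (2 * m) + exp ((t + 1) / 2) * (2 * fact (2 * m) * (4 * h) ^ m))"
proof -
 let ?F = "\<lambda>n w. AR (dip (1 / real (Suc n)) x h) t w ^ (2 * m)"
 have lim: "AE w in M. (\<lambda>n. ?F n w) \<longlonglongrightarrow> (L (x + h) t w - L x t w) ^ (2 * m)"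
  using L_limit_seq
 proof eventually_elim
  case (elim w)
  have "(\<lambda>n. ?F n w) \<longlonglongrightarrow> (L x t w - L (x + h) t w) ^ (2 * m)"
   unfolding AR_dip using elim t by (intro tendsto_intros) auto
  then show ?case unfolding power_mult[of _ 2 m] power2_commute[of "L x t w"] .
 qed
 have "0 < 1 / real (Suc n)" for n by simp
 note e = this
 show "integrable M (\<lambda>w. (L (x + h) t w - L x t w) ^ (2 * m))"
  by (rule fatou_integral_bound(1)[OF _ AR_dip_integrable[OF e t] _ AR_even_moment[OF e h t m] lim]) (auto simp: power_even_eq)
 show "(LINT w|M. (L (x + h) t w - L x t w) ^ (2 * m))
   \<le> 2 * ((8 * real m * h) ^ (2 * m) + exp ((t + 1) / 2) * (2 * fact (2 * m) * (4 * h) ^ m))"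
  by (rule fatou_integral_bound(2)[OF _ AR_dip_integrable[OF e t] _ AR_even_moment[OF e h t m] lim]) (auto simp: power_even_eq)
qed

lemma L_moment:
 assumes t: "0 \<le> t"
 shows "integrable M (\<lambda>w. L x t w ^ n)" and "(LINT w|M. L x t w ^ n) \<le> exp ((t + 1) / 2) * (2 * fact n)"
proof -
 let ?F = "\<lambda>k w. AR (tent (1 / real (Suc k)) x) t w ^ n"
 have lim: "AE w in M. (\<lambda>k. ?F k w) \<longlonglongrightarrow> L x t w ^ n"
  using L_limit_seq by eventually_elim (use t in \<open>auto intro!: tendsto_intros\<close>)
 have e: "0 < 1 / real (Suc n)" for n by simp
 have p: "0 \<le> ?F k w" for k w by (intro zero_le_power AR_nonneg tent_nonneg)
 show "integrable M (\<lambda>w. L x t w ^ n)"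
  by (rule fatou_integral_bound(1)[OF _ AR_tent_integrable[OF e t] p AR_tent_moment[OF e t] lim]) auto
 show "(LINT w|M. L x t w ^ n) \<le> exp ((t + 1) / 2) * (2 * fact n)"
  by (rule fatou_integral_bound(2)[OF _ AR_tent_integrable[OF e t] p AR_tent_moment[OF e t] lim]) auto
qed

lemma L_time_increment:
 assumes st: "0 \<le> s" "s \<le> t"
 shows "integrable M (\<lambda>w. \<bar>L x t w - L x s w\<bar>)" and "(LINT w|M. \<bar>L x t w - L x s w\<bar>) \<le> sqrt (t - s)"
proof -
 let ?F = "\<lambda>k w. AR (tent (1 / real (Suc k)) x) t w - AR (tent (1 / real (Suc k)) x) s w"
 have p: "0 \<le> ?F k w" for k w using AR_mono[OF tent_continuous tent_nonneg st(2)] by simp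
 have lim: "AE w in M. (\<lambda>k. ?F k w) \<longlonglongrightarrow> \<bar>L x t w - L x s w\<bar>"
  using L_limit_seq
 proof eventually_elim
  case (elim w)
  have "(\<lambda>k. \<bar>?F k w\<bar>) \<longlonglongrightarrow> \<bar>L x t w - L x s w\<bar>"
   using elim st by (intro tendsto_intros) auto
  then show ?case using p by simp
 qed
 have e: "0 < 1 / real (Suc n)" for n by simp
 have t: "0 \<le> t" using st by simp
 have i: "integrable M (?F k)" for k
  using AR_tent_integrable[OF e t, of _ _ 1] AR_tent_integrable[OF e st(1), of _ _ 1] by auto
 show "integrable M (\<lambda>w. \<bar>L x t w - L x s w\<bar>)"
  by (rule fatou_integral_bound(1)[OF _ i p AR_tent_increment[OF e st] lim]) auto
 show "(LINT w|M. \<bar>L x t w - L x s w\<bar>) \<le> sqrt (t - s)"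
  by (rule fatou_integral_bound(2)[OF _ i p AR_tent_increment[OF e st] lim]) auto
qed

lemma L_double_increment:
 assumes st: "0 \<le> s" "s \<le> t" and h: "0 \<le> h"
 shows "integrable M (\<lambda>w. ((L (x + h) t w - L x t w) - (L (x + h) s w - L x s w))\<^sup>2)"
  and "(LINT w|M. ((L (x + h) t w - L x t w) - (L (x + h) s w - L x s w))\<^sup>2) \<le> 4 * exp ((t - s) / 2) * h * sqrt (t - s)"
proof -
 let ?D = "\<lambda>k r w. AR (dip (1 / real (Suc k)) x h) r w"
 let ?F = "\<lambda>k w. (?D k t w - ?D k s w)\<^sup>2"
 have lim: "AE w in M. (\<lambda>k. ?F k w) \<longlonglongrightarrow> ((L (x + h) t w - L x t w) - (L (x + h) s w - L x s w))\<^sup>2"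
  using L_limit_seq
 proof eventually_elim
  case (elim w)
  have "(\<lambda>k. ?F k w) \<longlonglongrightarrow> ((L x t w - L (x + h) t w) - (L x s w - L (x + h) s w))\<^sup>2"
   unfolding AR_dip using elim st by (intro tendsto_intros) auto
  also have "((L x t w - L (x + h) t w) - (L x s w - L (x + h) s w))\<^sup>2 = ((L (x + h) t w - L x t w) - (L (x + h) s w - L x s w))\<^sup>2"
   by (simp add: power2_eq_square algebra_simps)
  finally show ?case .
 qed
 have e: "0 < 1 / real (Suc n)" for n by simp
 have t: "0 \<le> t" using st by simp
 have i: "integrable M (?F k)" for k
 proof (rule integrable_const_bound)
  have "\<bar>?D k t w - ?D k s w\<bar> \<le> t * (1 / (1 / real (Suc k))) + s * (1 / (1 / real (Suc k)))" for w
   using AR_bound[OF dip_continuous dip_bound[OF e] t, of k x h w] AR_bound[OF dip_continuous dip_bound[OF e] st(1), of k x h w] by linarith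
  then have "\<bar>?D k t w - ?D k s w\<bar>\<^sup>2 \<le> (t * (1 / (1 / real (Suc k))) + s * (1 / (1 / real (Suc k))))\<^sup>2" for w
   by (intro power_mono) auto
  then show "AE w in M. norm (?F k w) \<le> (t * (1 / (1 / real (Suc k))) + s * (1 / (1 / real (Suc k))))\<^sup>2"
   by simp
  have [measurable]: "(\<lambda>w. ?D k r w) \<in> borel_measurable M" for r
   by (rule AR_measurable[OF dip_continuous]) auto
  show "?F k \<in> borel_measurable M" by measurable
 qed
 show "integrable M (\<lambda>w. ((L (x + h) t w - L x t w) - (L (x + h) s w - L x s w))\<^sup>2)"
  by (rule fatou_integral_bound(1)[OF _ i _ AR_dipole_increment_square[OF e h st] lim]) auto
 show "(LINT w|M. ((L (x + h) t w - L x t w) - (L (x + h) s w - L x s w))\<^sup>2) \<le> 4 * exp ((t - s) / 2) * h * sqrt (t - s)"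
  by (rule fatou_integral_bound(2)[OF _ i _ AR_dipole_increment_square[OF e h st] lim]) auto
qed

text \<open>The joint Laplace transform of local times at four points, at an exponential time.\<close>

definition Psi :: "(nat \<Rightarrow> complex) \<Rightarrow> (nat \<Rightarrow> real) \<Rightarrow> complex" where
 "Psi v p = (LINT s:{0<..}|lborel. exp (- s / 2) *\<^sub>R (LINT w|M. exp (- (\<Sum>i<4. v i * complex_of_real (L (p i) s w)))))"

lemma Re_nonneg_exp_le: "0 \<le> Re z \<Longrightarrow> norm (exp (- z)) \<le> 1"
 by simp

lemma exp_sum_L_le:
 assumes "\<And>i. i < 4 \<Longrightarrow> 0 \<le> Re (v i)"
 shows "norm (exp (- (\<Sum>i<4::nat. v i * complex_of_real (L (p i) s w)))) \<le> 1"
 by (rule Re_nonneg_exp_le) (use assms in \<open>auto simp: Re_sum intro!: sum_nonneg mult_nonneg_nonneg L_nonneg\<close>)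

lemma norm_expectation_le_1:
 fixes Z :: "'w \<Rightarrow> complex"
 assumes "Z \<in> borel_measurable M" "\<And>w. norm (Z w) \<le> 1"
 shows "norm (LINT w|M. Z w) \<le> 1"
proof -
 have "integrable M Z" by (rule integrable_const_bound[where B=1]) (use assms in auto)
 then have "norm (LINT w|M. Z w) \<le> (LINT w|M. 1)"
  using assms by (intro order_trans[OF integral_norm_bound] integral_mono) auto
 then show ?thesis by (simp add: prob_space)
qed

lemma Gam_tendsto_Psi:
 assumes v: "\<And>i. i < 4 \<Longrightarrow> 0 \<le> Re (v i)"
 shows "(\<lambda>k. Gam (PU 4 v p (1 / real (Suc k))) (\<lambda>z. exp (- z)) (\<lambda>_. 1)) \<longlonglongrightarrow> Psi v p"
 unfolding Gam_def Psi_def set_lebesgue_integral_def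
proof (rule integral_dominated_convergence[where w="\<lambda>s. indicator {0..} s * exp (- (1/2) * s)"])
 let ?U = "\<lambda>k. PU 4 v p (1 / real (Suc k))"
 note [measurable] = AF_measurable[OF PU_continuous]
 show "integrable lborel (\<lambda>s. indicator {0..} s * exp (- (1/2) * s) :: real)" by (rule exp_Ici_integrable) simp
 have b: "norm (exp (- AF (?U k) s \<omega>) * 1) \<le> 1" for k s \<omega> using exp_AF_PU_le[OF v] by simp
 show "AE s in lborel. norm (indicator {0<..} s *\<^sub>R exp (- s / 2) *\<^sub>R (LINT \<omega>|M. exp (- AF (?U k) s \<omega>) * 1)) \<le> indicator {0..} s * exp (- (1/2) * s)" for k
 proof (rule AE_I2)
  fix s
  have "norm (LINT \<omega>|M. exp (- AF (?U k) s \<omega>) * 1) \<le> 1" by (rule norm_expectation_le_1[OF _ b]) measurable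
  then show "norm (indicator {0<..} s *\<^sub>R exp (- s / 2) *\<^sub>R (LINT \<omega>|M. exp (- AF (?U k) s \<omega>) * 1)) \<le> indicator {0..} s * exp (- (1/2) * s)"
   by (auto split: split_indicator simp: mult_left_le)
 qed
 show "AE s in lborel. (\<lambda>k. indicator {0<..} s *\<^sub>R exp (- s / 2) *\<^sub>R (LINT \<omega>|M. exp (- AF (?U k) s \<omega>) * 1))
   \<longlonglongrightarrow> indicator {0<..} s *\<^sub>R exp (- s / 2) *\<^sub>R (LINT \<omega>|M. exp (- (\<Sum>i<4. v i * complex_of_real (L (p i) s \<omega>))))"
 proof (rule AE_I2)
  fix s :: real
  show "(\<lambda>k. indicator {0<..} s *\<^sub>R exp (- s / 2) *\<^sub>R (LINT \<omega>|M. exp (- AF (?U k) s \<omega>) * 1))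
   \<longlonglongrightarrow> indicator {0<..} s *\<^sub>R exp (- s / 2) *\<^sub>R (LINT \<omega>|M. exp (- (\<Sum>i<4. v i * complex_of_real (L (p i) s \<omega>))))"
  proof (cases "0 < s")
   case True
   have "(\<lambda>k. LINT \<omega>|M. exp (- AF (?U k) s \<omega>) * 1) \<longlonglongrightarrow> (LINT \<omega>|M. exp (- (\<Sum>i<4. v i * complex_of_real (L (p i) s \<omega>))))"
   proof (rule integral_dominated_convergence[where w="\<lambda>_. 1"])
    show "AE \<omega> in M. (\<lambda>k. exp (- AF (?U k) s \<omega>) * 1) \<longlonglongrightarrow> exp (- (\<Sum>i<4. v i * complex_of_real (L (p i) s \<omega>)))"
    using L_limit_seq
    proof eventually_elim
    case (elim \<omega>)
    then show ?case unfolding AF_PU mult_1_right using True by (intro tendsto_intros) auto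
    qed
   qed (use b in \<open>auto intro!: borel_measurable_exp\<close>)
   then show ?thesis by (intro tendsto_intros)
  qed simp
 qed
qed (measurable, auto intro!: PU_continuous)

text \<open>The bounds for tents are uniform in the width \<open>\<epsilon>\<close>, whose contribution disappears in the limit.\<close>

lemma Psi_compare:
 assumes r: "0 < r" "r \<le> 1" and N: "1 \<le> N" "\<bar>\<mu>\<bar> \<le> N" "2 * \<mu>\<^sup>2 \<le> N"
  and sep: "r\<^sup>2 \<le> \<bar>x - y\<bar>"
  and v: "adm \<mu> (r\<^sup>2) (v 0) (v 1)" "adm \<mu> (r\<^sup>2) (v 2) (v 3)" "\<And>i. i < 4 \<Longrightarrow> 0 \<le> Re (v i)"
  and w: "adm \<mu> (r\<^sup>2) (w 0) (w 1)" "adm \<mu> (r\<^sup>2) (w 2) (w 3)" "\<And>i. i < 4 \<Longrightarrow> 0 \<le> Re (w i)"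
  and p: "p 0 = x" "p 1 = x + r\<^sup>2" "p 2 = y" "p 3 = y + r\<^sup>2"
 shows "norm (Psi v p - Psi w p) \<le> 624 * N ^ 4 * r"
proof -
 have sum4: "(\<Sum>i<4::nat. f i) = f 0 + f 1 + f 2 + f 3" for f :: "nat \<Rightarrow> complex"
  by (simp add: eval_nat_numeral)
 let ?\<Phi> = "\<lambda>z. exp (- z) :: complex"
 have sys: "\<exists>g. pair_system \<mu> r N x y (v 0) (v 1) (v 2) (v 3) (g 0) (g 1) (g 2) (g 3) \<and>
   Gam (PU 4 v p \<epsilon>) ?\<Phi> (\<lambda>_. 1) = 2 - 2 * (v 0 * g 0 + v 1 * g 1 + v 2 * g 2 + v 3 * g (3::nat))"
  if v: "adm \<mu> (r\<^sup>2) (v 0) (v 1)" "adm \<mu> (r\<^sup>2) (v 2) (v 3)" "\<And>i. i < 4 \<Longrightarrow> 0 \<le> Re (v i)"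
   and e: "0 < \<epsilon>" "\<epsilon> * (1 + 2 * (\<Sum>i<4::nat. norm (v i))) \<le> r\<^sup>2" for v \<epsilon>
 proof (intro exI conjI)
  let ?g = "\<lambda>j. Gam (PU 4 v p \<epsilon>) ?\<Phi> (\<lambda>z. complex_of_real (tent \<epsilon> (p j) z))"
  note ps = point_system[of \<epsilon> 4 v p, OF e(1) v(3)]
  have err: "\<epsilon> + (\<Sum>i<4::nat. norm (v i) * (2 * \<epsilon>)) \<le> r\<^sup>2"
  proof -
   have "(\<Sum>i<4::nat. norm (v i) * (2 * \<epsilon>)) = 2 * \<epsilon> * (\<Sum>i<4::nat. norm (v i))"
    by (simp add: sum_distrib_left mult_ac)
   then show ?thesis using e(2) by (simp add: algebra_simps)
  qed
  note eqs = order_trans[OF ps(2) err, unfolded sum4]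
  show "Gam (PU 4 v p \<epsilon>) ?\<Phi> (\<lambda>_. 1) = 2 - 2 * (v 0 * ?g 0 + v 1 * ?g 1 + v 2 * ?g 2 + v 3 * ?g 3)"
   using ps(3) unfolding sum4 by simp
  show "pair_system \<mu> r N x y (v 0) (v 1) (v 2) (v 3) (?g 0) (?g 1) (?g 2) (?g 3)"
  proof
   show "norm (?g 0 - (exp (-\<bar>x\<bar>) - (v 0 * ?g 0 + v 1 * ?g 1 * exp (-r\<^sup>2) + v 2 * ?g 2 * exp (-\<bar>y - x\<bar>) + v 3 * ?g 3 * exp (-\<bar>y + r\<^sup>2 - x\<bar>)))) \<le> r\<^sup>2"
    using eqs[of 0] by (simp add: p p(2)[unfolded One_nat_def])
   show "norm (?g 1 - (exp (-\<bar>x + r\<^sup>2\<bar>) - (v 0 * ?g 0 * exp (-r\<^sup>2) + v 1 * ?g 1 + v 2 * ?g 2 * exp (-\<bar>y - (x + r\<^sup>2)\<bar>) + v 3 * ?g 3 * exp (-\<bar>y + r\<^sup>2 - (x + r\<^sup>2)\<bar>)))) \<le> r\<^sup>2"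
    using eqs[of 1] by (simp add: p p(2)[unfolded One_nat_def])
   show "norm (?g 2 - (exp (-\<bar>y\<bar>) - (v 0 * ?g 0 * exp (-\<bar>x - y\<bar>) + v 1 * ?g 1 * exp (-\<bar>x + r\<^sup>2 - y\<bar>) + v 2 * ?g 2 + v 3 * ?g 3 * exp (-r\<^sup>2)))) \<le> r\<^sup>2"
    using eqs[of 2] by (simp add: p p(2)[unfolded One_nat_def])
   show "norm (?g 3 - (exp (-\<bar>y + r\<^sup>2\<bar>) - (v 0 * ?g 0 * exp (-\<bar>x - (y + r\<^sup>2)\<bar>) + v 1 * ?g 1 * exp (-\<bar>x + r\<^sup>2 - (y + r\<^sup>2)\<bar>) + v 2 * ?g 2 * exp (-r\<^sup>2) + v 3 * ?g 3))) \<le> r\<^sup>2"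
    using eqs[of 3] by (simp add: p p(2)[unfolded One_nat_def])
   show "norm (?g 0) \<le> 1" using ps(1)[of 0] .
   show "norm (?g 1) \<le> 1" using ps(1)[of 1] .
   show "norm (?g 2) \<le> 1" using ps(1)[of 2] .
   show "norm (?g 3) \<le> 1" using ps(1)[of 3] .
  qed (fact r N sep v)+
 qed
 let ?G = "\<lambda>v k. Gam (PU 4 v p (1 / real (Suc k))) ?\<Phi> (\<lambda>_. 1)"
 have small: "\<forall>\<^sub>F k in sequentially. 1 / real (Suc k) * (1 + 2 * (\<Sum>i<4::nat. norm (u i))) \<le> r\<^sup>2" for u :: "nat \<Rightarrow> complex"
 proof -
  have "(\<lambda>k. 1 / real (Suc k) * (1 + 2 * (\<Sum>i<4::nat. norm (u i)))) \<longlonglongrightarrow> 0 * (1 + 2 * (\<Sum>i<4::nat. norm (u i)))"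
   using LIMSEQ_inverse_real_of_nat by (intro tendsto_intros) (simp add: inverse_eq_divide)
  then have "\<forall>\<^sub>F k in sequentially. 1 / real (Suc k) * (1 + 2 * (\<Sum>i<4::nat. norm (u i))) < r\<^sup>2"
   by (rule order_tendstoD(2)) (use r in simp)
  then show ?thesis by eventually_elim simp
 qed
 have "\<forall>\<^sub>F k in sequentially. norm (?G v k - ?G w k) \<le> 624 * N ^ 4 * r"
  using small[of v] small[of w]
 proof eventually_elim
  case (elim k)
  have e: "0 < 1 / real (Suc k)" by simp
  obtain g where g: "pair_system \<mu> r N x y (v 0) (v 1) (v 2) (v 3) (g 0) (g 1) (g 2) (g 3)"
   "?G v k = 2 - 2 * (v 0 * g 0 + v 1 * g 1 + v 2 * g 2 + v 3 * g (3::nat))"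
   using sys[OF v e elim(1)] by blast
  obtain d where d: "pair_system \<mu> r N x y (w 0) (w 1) (w 2) (w 3) (d 0) (d 1) (d 2) (d 3)"
   "?G w k = 2 - 2 * (w 0 * d 0 + w 1 * d 1 + w 2 * d 2 + w 3 * d (3::nat))"
   using sys[OF w e elim(2)] by blast
  have eq: "?G v k - ?G w k = (-2) * ((v 0 * g 0 + v 1 * g 1 + v 2 * g 2 + v 3 * g 3) - (w 0 * d 0 + w 1 * d 1 + w 2 * d 2 + w 3 * d 3))"
   unfolding g(2) d(2) by algebra
  have "norm (?G v k - ?G w k) \<le> 2 * (312 * N ^ 4 * r)"
   unfolding eq by (rule norm_mult_le[OF _ pair_system_compare[OF g(1) d(1)]]) simp
  then show ?case by simp
 qed
 moreover have "(\<lambda>k. norm (?G v k - ?G w k)) \<longlonglongrightarrow> norm (Psi v p - Psi w p)"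
  by (intro tendsto_intros Gam_tendsto_Psi v w)
 ultimately show ?thesis
  using tendsto_upperbound[of _ _ sequentially] trivial_limit_sequentially by blast
qed

end

section \<open>Decorrelation of the characters\<close>

lemma integral_square_Fubini:
 fixes F :: "'a \<Rightarrow> 'b \<Rightarrow> real"
 assumes P: "finite_measure P" and J: "finite_measure J"
  and F: "(\<lambda>(z, x). F z x) \<in> borel_measurable (P \<Otimes>\<^sub>M J)" and K: "\<And>z x. \<bar>F z x\<bar> \<le> K"
 shows "(LINT z|P. (LINT x|J. F z x)\<^sup>2) = (LINT x|J. LINT y|J. LINT z|P. F z x * F z y)"
proof -
 interpret P: finite_measure P by fact
 interpret J: finite_measure J by fact
 interpret PJ: pair_sigma_finite P J ..
 interpret PJf: finite_measure "P \<Otimes>\<^sub>M J" by (intro finite_measure_pair_measure P J)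
 have K0: "0 \<le> K" using order_trans[OF abs_ge_zero K] .
 have Im: "(\<lambda>z. LINT y|J. F z y) \<in> borel_measurable P"
  by (rule J.borel_measurable_lebesgue_integral[OF F])
 have F': "(\<lambda>p. F (fst p) (snd p)) \<in> borel_measurable (P \<Otimes>\<^sub>M J)"
  using F by (simp add: case_prod_beta')
 define C where "C = K * (K * measure J (space J))"
 have inner: "\<bar>LINT y|J. F z y\<bar> \<le> K * measure J (space J)" if "z \<in> space P" for z
 proof -
  have [measurable]: "F z \<in> borel_measurable J" using measurable_Pair2[OF F that] by simp
  have "integrable J (F z)" by (rule J.integrable_const_bound[where B=K]) (use K in auto)
  then have "\<bar>LINT y|J. F z y\<bar> \<le> (LINT y|J. K)"
   using K by (intro order_trans[OF integral_abs_bound] integral_mono) auto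
  then show ?thesis by (simp add: mult.commute)
 qed
 have "(LINT z|P. (LINT x|J. F z x)\<^sup>2) = (LINT z|P. LINT x|J. F z x * (LINT y|J. F z y))"
  by (simp add: power2_eq_square)
 also have "\<dots> = (LINT x|J. LINT z|P. F z x * (LINT y|J. F z y))"
 proof (rule PJ.Fubini_integral[symmetric])
  show "integrable (P \<Otimes>\<^sub>M J) (\<lambda>(z, x). F z x * (LINT y|J. F z y))"
  proof (rule PJf.integrable_const_bound[where B=C])
   show "(\<lambda>(z, x). F z x * (LINT y|J. F z y)) \<in> borel_measurable (P \<Otimes>\<^sub>M J)"
    unfolding case_prod_beta' by (rule borel_measurable_times[OF F' measurable_compose[OF measurable_fst Im]])
   show "AE p in P \<Otimes>\<^sub>M J. norm (case p of (z, x) \<Rightarrow> F z x * (LINT y|J. F z y)) \<le> C"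
   proof (rule AE_I2)
    fix p assume "p \<in> space (P \<Otimes>\<^sub>M J)"
    then obtain z x where p: "p = (z, x)" "z \<in> space P" by (auto simp: space_pair_measure)
    have "\<bar>F z x\<bar> * \<bar>LINT y|J. F z y\<bar> \<le> K * (K * measure J (space J))"
    by (intro mult_mono K inner p(2)) (use K0 in auto)
    then show "norm (case p of (z, x) \<Rightarrow> F z x * (LINT y|J. F z y)) \<le> C"
    by (simp add: p(1) C_def abs_mult)
   qed
  qed
 qed
 also have "\<dots> = (LINT x|J. LINT y|J. LINT z|P. F z x * F z y)"
 proof (rule Bochner_Integration.integral_cong[OF refl])
  fix x assume x: "x \<in> space J"
  have Fx: "(\<lambda>z. F z x) \<in> borel_measurable P" using measurable_Pair1[OF F x] by simp
  have "(LINT z|P. F z x * (LINT y|J. F z y)) = (LINT z|P. LINT y|J. F z x * F z y)" by simp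
  also have "\<dots> = (LINT y|J. LINT z|P. F z x * F z y)"
  proof (rule PJ.Fubini_integral[symmetric])
   show "integrable (P \<Otimes>\<^sub>M J) (\<lambda>(z, y). F z x * F z y)"
   proof (rule PJf.integrable_const_bound[where B="K * K"])
    show "AE p in P \<Otimes>\<^sub>M J. norm (case p of (z, y) \<Rightarrow> F z x * F z y) \<le> K * K"
    using K K0 by (intro AE_I2) (auto simp: abs_mult intro!: mult_mono)
    show "(\<lambda>(z, y). F z x * F z y) \<in> borel_measurable (P \<Otimes>\<^sub>M J)"
    unfolding case_prod_beta' by (rule borel_measurable_times[OF measurable_compose[OF measurable_fst Fx] F'])
   qed
  qed
  finally show "(LINT z|P. F z x * (LINT y|J. F z y)) = (LINT y|J. LINT z|P. F z x * F z y)" .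
 qed
 finally show ?thesis .
qed

context cont_blt begin

text \<open>The difference between a character of the normalised increment and its conditional expectation under the Gaussian heuristics.\<close>

definition FF :: "real \<Rightarrow> real \<Rightarrow> real \<Rightarrow> real \<Rightarrow> 'w \<Rightarrow> real" where
 "FF \<mu> h s x w = cos (\<mu> * ((L (x + h) s w - L x s w) / sqrt h)) - exp (- 2 * \<mu>\<^sup>2 * L x s w)"

lemma FF_measurable [measurable (raw)]:
 assumes [measurable]: "f \<in> borel_measurable N" "g \<in> borel_measurable N" "k \<in> measurable N M"
 shows "(\<lambda>z. FF \<mu> h (f z) (g z) (k z)) \<in> borel_measurable N"
 unfolding FF_def by measurable

lemma FF_bound: "\<bar>FF \<mu> h s x w\<bar> \<le> 2"
proof -
 have "exp (- 2 * \<mu>\<^sup>2 * L x s w) \<le> 1" using L_nonneg[of x s w] by simp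
 moreover have "0 \<le> exp (- 2 * \<mu>\<^sup>2 * L x s w)" by simp
 ultimately show ?thesis unfolding FF_def
  using cos_le_one[of "\<mu> * ((L (x + h) s w - L x s w) / sqrt h)"] cos_ge_minus_one[of "\<mu> * ((L (x + h) s w - L x s w) / sqrt h)"]
  unfolding abs_le_iff by linarith
qed

definition freq_const :: "real \<Rightarrow> real" where "freq_const \<mu> = 2 * (1 + \<bar>\<mu>\<bar>)\<^sup>2"

lemma freq_const: "1 \<le> freq_const \<mu>" "\<bar>\<mu>\<bar> \<le> freq_const \<mu>" "2 * \<mu>\<^sup>2 \<le> freq_const \<mu>"
proof -
 have e: "freq_const \<mu> = 2 + 4 * \<bar>\<mu>\<bar> + 2 * \<mu>\<^sup>2" unfolding freq_const_def by (simp add: power2_sum)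
 have "0 \<le> \<mu>\<^sup>2" "0 \<le> \<bar>\<mu>\<bar>" by auto
 then show "1 \<le> freq_const \<mu>" "\<bar>\<mu>\<bar> \<le> freq_const \<mu>" "2 * \<mu>\<^sup>2 \<le> freq_const \<mu>"
  unfolding e by linarith+
qed

lemma Psi_integrable:
 assumes v: "\<And>i. i < 4 \<Longrightarrow> 0 \<le> Re (v i)"
 shows "integrable M (\<lambda>w. exp (- (\<Sum>i<4. v i * complex_of_real (L (p i) s w))))"
  and "set_integrable lborel {0<..} (\<lambda>s. exp (- s / 2) *\<^sub>R (LINT w|M. exp (- (\<Sum>i<4::nat. v i * complex_of_real (L (p i) s w)))))"
proof -
 show "integrable M (\<lambda>w. exp (- (\<Sum>i<4. v i * complex_of_real (L (p i) s w))))"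
  by (rule integrable_const_bound[where B=1]) (use exp_sum_L_le[OF v] in auto)
 have "norm (LINT w|M. exp (- (\<Sum>i<4::nat. v i * complex_of_real (L (p i) s w)))) \<le> 1" for s
  by (rule norm_expectation_le_1) (use exp_sum_L_le[OF v] in auto)
 then show "set_integrable lborel {0<..} (\<lambda>s. exp (- s / 2) *\<^sub>R (LINT w|M. exp (- (\<Sum>i<4::nat. v i * complex_of_real (L (p i) s w)))))"
  unfolding set_integrable_def
  by (intro Bochner_Integration.integrable_bound[OF exp_Ici_integrable[of "1/2"]])
    (auto split: split_indicator simp: mult_left_le)
qed

text \<open>The product of the two differences expands into exponentials of local times at four points, where each pair carries one of the two admissible kinds of weights; all these transforms nearly coincide, so the alternating sum is small.\<close>

lemma FF_covariance:
 assumes h: "0 < h" "h \<le> 1" and sep: "h \<le> \<bar>x - y\<bar>"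
 shows "\<bar>LINT s:{0<..}|lborel. exp (- s / 2) * (LINT \<omega>|M. FF \<mu> h s x \<omega> * FF \<mu> h s y \<omega>)\<bar> \<le> 1872 * freq_const \<mu> ^ 4 * sqrt h"
proof -
 define r where "r = sqrt h"
 have r: "0 < r" "r \<le> 1" "r\<^sup>2 = h" using h by (auto simp: r_def)
 define p where "p = (\<lambda>i::nat. if i = 0 then x else if i = 1 then x + h else if i = 2 then y else y + h)"
 have p: "p 0 = x" "p 1 = x + r\<^sup>2" "p 2 = y" "p 3 = y + r\<^sup>2" by (auto simp: p_def r)
 define o1 where "o1 = \<i> * complex_of_real (\<mu> / r)"
 define m where "m = complex_of_real (2 * \<mu>\<^sup>2)"
 define vv where "vv a b c d = (\<lambda>i::nat. if i = 0 then a else if i = 1 then b else if i = 2 then c else (d::complex))" for a b c d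
 have vvs: "vv a b c d 0 = a" "vv a b c d 1 = b" "vv a b c d 2 = c" "vv a b c d 3 = d" for a b c d by (auto simp: vv_def)
 have o2: "o1\<^sup>2 = - complex_of_real (\<mu>\<^sup>2 / r\<^sup>2)" by (simp add: o1_def power_mult_distrib power_divide)
 have adm: "adm \<mu> (r\<^sup>2) o1 (- o1)" "adm \<mu> (r\<^sup>2) (- o1) o1" "adm \<mu> (r\<^sup>2) m 0"
  using o2 by (auto simp: adm_def m_def)
 have re: "0 \<le> Re o1" "0 \<le> Re (- o1)" "0 \<le> Re m" by (auto simp: o1_def m_def)
 have reV: "0 \<le> Re (vv a b c d i)" if "0 \<le> Re a" "0 \<le> Re b" "0 \<le> Re c" "0 \<le> Re d" for a b c d i
  using that by (auto simp: vv_def)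
 let ?ref = "Psi (vv m 0 m 0) p"
 let ?E = "624 * freq_const \<mu> ^ 4 * r"
 have cmp: "norm (Psi (vv a b c d) p - ?ref) \<le> ?E"
  if "adm \<mu> (r\<^sup>2) a b" "adm \<mu> (r\<^sup>2) c d" "0 \<le> Re a" "0 \<le> Re b" "0 \<le> Re c" "0 \<le> Re d" for a b c d
  by (rule Psi_compare[OF r(1,2) freq_const _ _ _ reV _ _ reV p])
    (use that adm re sep in \<open>auto simp: vvs r(3) vvs[unfolded One_nat_def]\<close>)
 let ?S = "\<lambda>v s \<omega>. \<Sum>i<4::nat. v i * complex_of_real (L (p i) s \<omega>)"
 have sum4: "(\<Sum>i<4::nat. f i) = f 0 + f 1 + f 2 + f 3" for f :: "nat \<Rightarrow> complex"
  by (simp add: eval_nat_numeral)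
 define A where "A = vv o1 (- o1) o1 (- o1)"
 define B' where "B' = vv o1 (- o1) (- o1) o1"
 define C where "C = vv o1 (- o1) m 0"
 define D where "D = vv m 0 o1 (- o1)"
 define R where "R = vv m 0 m 0"
 note vdefs = A_def B'_def C_def D_def R_def
 have rV: "0 \<le> Re (A i)" "0 \<le> Re (B' i)" "0 \<le> Re (C i)" "0 \<le> Re (D i)" "0 \<le> Re (R i)" for i
  unfolding vdefs by (auto intro!: reV re)
 define G where "G v s \<omega> = exp (- ?S v s \<omega>)" for v s \<omega>
 have point: "FF \<mu> h s x \<omega> * FF \<mu> h s y \<omega> =
   (Re (G A s \<omega>) + Re (G B' s \<omega>)) / 2 - Re (G C s \<omega>) - Re (G D s \<omega>) + Re (G R s \<omega>)" for s \<omega>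
 proof -
  define u where "u = \<mu> * ((L (x + h) s \<omega> - L x s \<omega>) / sqrt h)"
  define w where "w = \<mu> * ((L (y + h) s \<omega> - L y s \<omega>) / sqrt h)"
  define a where "a = - 2 * \<mu>\<^sup>2 * L x s \<omega>"
  define b where "b = - 2 * \<mu>\<^sup>2 * L y s \<omega>"
  have S: "- ?S A s \<omega> = Complex 0 (u + w)" "- ?S B' s \<omega> = Complex 0 (u - w)"
   "- ?S C s \<omega> = Complex b u" "- ?S D s \<omega> = Complex a w" "- ?S R s \<omega> = Complex (a + b) 0"
   unfolding sum4 vdefs vvs p r(3) o1_def m_def u_def w_def a_def b_def
   by (simp_all add: complex_eq_iff r_def diff_divide_distrib algebra_simps)
  have "Re (G A s \<omega>) = cos (u + w)" "Re (G B' s \<omega>) = cos (u - w)"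
   "Re (G C s \<omega>) = exp b * cos u" "Re (G D s \<omega>) = exp a * cos w"
   "Re (G R s \<omega>) = exp a * exp b"
   unfolding G_def S by (simp_all add: Re_exp exp_add)
  then show ?thesis
   unfolding FF_def u_def[symmetric] w_def[symmetric] a_def[symmetric] b_def[symmetric]
   by (simp add: cos_add cos_diff algebra_simps)
 qed
 have iG: "integrable M (G v s)" if "\<And>i. 0 \<le> Re (v i)" for v s
  unfolding G_def by (rule Psi_integrable(1)) (use that in auto)
 define H where "H v s = (LINT \<omega>|M. G v s \<omega>)" for v s
 have E: "(LINT \<omega>|M. FF \<mu> h s x \<omega> * FF \<mu> h s y \<omega>) =
   (Re (H A s) + Re (H B' s)) / 2 - Re (H C s) - Re (H D s) + Re (H R s)" for s
 proof -
  have i: "integrable M (G A s)" "integrable M (G B' s)" "integrable M (G C s)" "integrable M (G D s)" "integrable M (G R s)"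
   by (rule iG, rule rV)+
  show ?thesis unfolding point H_def
   using i i[THEN integrable_Re] by (simp add: integral_Re)
 qed
 define T where "T v s = exp (- s / 2) *\<^sub>R H v s" for v s
 have T_alt: "T v s = exp (- s / 2) *\<^sub>R (LINT \<omega>|M. exp (- ?S v s \<omega>))" for v s
  by (simp only: T_def H_def G_def)
 have Psi_T: "Psi v p = (LINT s:{0<..}|lborel. T v s)" for v
  unfolding Psi_def T_alt ..
 have iT: "set_integrable lborel {0<..} (T v)" if "\<And>i. 0 \<le> Re (v i)" for v
  unfolding T_alt by (rule Psi_integrable(2)) (use that in auto)
 have i5: "set_integrable lborel {0<..} (T A)" "set_integrable lborel {0<..} (T B')" "set_integrable lborel {0<..} (T C)"
  "set_integrable lborel {0<..} (T D)" "set_integrable lborel {0<..} (T R)"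
  by (rule iT, rule rV)+
 have i2: "set_integrable lborel {0<..} (\<lambda>s. T A s / 2)" "set_integrable lborel {0<..} (\<lambda>s. T B' s / 2)"
  by (intro set_integrable_divide i5)+
 have iAll: "set_integrable lborel {0<..} (\<lambda>s. T A s / 2 + T B' s / 2 - T C s - T D s + T R s)"
  by (intro set_integral_add(1) set_integral_diff(1) i2 i5)
 have reT: "exp (- s / 2) * ((Re (H A s) + Re (H B' s)) / 2 - Re (H C s) - Re (H D s) + Re (H R s)) = Re (T A s / 2 + T B' s / 2 - T C s - T D s + T R s)" for s
  unfolding T_def by (simp add: algebra_simps add_divide_distrib)
 have s1: "(LINT s:{0<..}|lborel. Re (T A s / 2 + T B' s / 2 - T C s - T D s + T R s)) = Re (LINT s:{0<..}|lborel. T A s / 2 + T B' s / 2 - T C s - T D s + T R s)"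
  unfolding set_lebesgue_integral_def
  by (subst integral_Re[symmetric, OF iAll[unfolded set_integrable_def]]) simp
 have s2: "(LINT s:{0<..}|lborel. T A s / 2 + T B' s / 2 - T C s - T D s + T R s) = Psi A p / 2 + Psi B' p / 2 - Psi C p - Psi D p + Psi R p"
  unfolding Psi_T
  using i2 i5
  by (simp only: set_integral_add set_integral_diff set_integral_divide_zero)
 have fin: "(LINT s:{0<..}|lborel. exp (- s / 2) * (LINT \<omega>|M. FF \<mu> h s x \<omega> * FF \<mu> h s y \<omega>))
  = Re (Psi A p / 2 + Psi B' p / 2 - Psi C p - Psi D p + Psi R p)"
  unfolding E reT s1 s2 ..
 have dec_gen: "a / 2 + b / 2 - c - d + e = (a - e) / 2 + (b - e) / 2 - (c - e) - (d - e)" for a b c d e :: complex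
  by (simp add: field_simps)
 note dec = dec_gen[of "Psi A p" "Psi B' p" "Psi C p" "Psi D p" "Psi R p"]
 have cs: "norm (Psi A p - Psi R p) \<le> ?E" "norm (Psi B' p - Psi R p) \<le> ?E" "norm (Psi C p - Psi R p) \<le> ?E" "norm (Psi D p - Psi R p) \<le> ?E"
  unfolding vdefs
  by (rule cmp[OF adm(1) adm(1) re(1,2,1,2)], rule cmp[OF adm(1) adm(2) re(1,2,2,1)],
    rule cmp[OF adm(1) adm(3) re(1,2,3)], simp, rule cmp[OF adm(3) adm(1) re(3) _ re(1,2)], simp)
 have tri: "norm (a / 2 + b / 2 - c - d) \<le> 3 * K"
  if "norm a \<le> K" "norm b \<le> K" "norm c \<le> K" "norm d \<le> K" for a b c d :: complex and K
  using norm_triangle_ineq4[of "a / 2 + b / 2 - c" d] norm_triangle_ineq4[of "a / 2 + b / 2" c]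
   norm_triangle_ineq[of "a / 2" "b / 2"] that by (simp add: norm_divide)
 have "\<bar>Re (Psi A p / 2 + Psi B' p / 2 - Psi C p - Psi D p + Psi R p)\<bar> \<le> 3 * ?E"
  unfolding dec by (rule order_trans[OF abs_Re_le_cmod tri[OF cs]])
 moreover have "3 * (624 * a * b) = 1872 * a * b" for a b :: real by simp
 ultimately show ?thesis unfolding fin r_def by (simp only:)
qed

end

section \<open>Second moments at a fixed time\<close>

text \<open>Lebesgue measure restricted to an interval, as a finite measure to which Fubini applies directly.\<close>

definition Iv :: "real \<Rightarrow> real \<Rightarrow> real measure" where
 "Iv a b = density lborel (\<lambda>x. ennreal (indicator {a..b} x))"

lemma sets_Iv [simp, measurable_cong]: "sets (Iv a b) = sets borel"
 and space_Iv [simp]: "space (Iv a b) = UNIV"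
 by (simp_all add: Iv_def)

lemma Iv_finite: "finite_measure (Iv a b)"
 by (rule finite_measureI) (simp add: Iv_def emeasure_density ennreal_indicator emeasure_lborel_Icc_eq)

lemma Iv_integral:
 fixes f :: "real \<Rightarrow> real"
 assumes "f \<in> borel_measurable borel" shows "(LINT x|Iv a b. f x) = (LINT x:{a..b}|lborel. f x)"
 unfolding Iv_def set_lebesgue_integral_def using assms by (subst integral_density) auto

lemma Iv_measure: "a \<le> b \<Longrightarrow> measure (Iv a b) UNIV = b - a"
proof -
 assume "a \<le> b"
 have "emeasure (Iv a b) UNIV = emeasure lborel {a..b}"
  by (simp add: Iv_def emeasure_density ennreal_indicator)
 then show ?thesis using \<open>a \<le> b\<close> by (simp add: measure_def)
qed

lemma Iv_integrable_bounded:
 fixes f :: "real \<Rightarrow> real"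
 assumes "f \<in> borel_measurable borel" "\<And>x. \<bar>f x\<bar> \<le> K" shows "integrable (Iv a b) f"
proof -
 interpret finite_measure "Iv a b" by (rule Iv_finite)
 show ?thesis by (rule integrable_const_bound[where B=K]) (use assms in auto)
qed

lemma Iv_integral_bound:
 fixes f :: "real \<Rightarrow> real"
 assumes "f \<in> borel_measurable borel" "\<And>x. \<bar>f x\<bar> \<le> K" "a \<le> b" shows "\<bar>LINT x|Iv a b. f x\<bar> \<le> (b - a) * K"
proof -
 interpret finite_measure "Iv a b" by (rule Iv_finite)
 have "\<bar>LINT x|Iv a b. f x\<bar> \<le> (LINT x|Iv a b. K)"
  using assms Iv_integrable_bounded[OF assms(1,2)]
  by (intro order_trans[OF integral_abs_bound] integral_mono) auto
 then show ?thesis by (simp add: Iv_measure assms(3))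
qed

text \<open>Twice the exponential distribution of rate 1/2.\<close>

definition Ex :: "real measure" where
 "Ex = density lborel (\<lambda>s. ennreal (indicator {0<..} s * exp (- s / 2)))"

lemma sets_Ex [simp, measurable_cong]: "sets Ex = sets borel"
 and space_Ex [simp]: "space Ex = UNIV"
 by (simp_all add: Ex_def)

lemma Ex_integral:
 fixes f :: "real \<Rightarrow> real"
 assumes "f \<in> borel_measurable borel" shows "(LINT s|Ex. f s) = (LINT s:{0<..}|lborel. exp (- s / 2) * f s)"
 unfolding Ex_def set_lebesgue_integral_def using assms
 by (subst integral_density) (auto simp: mult.assoc)

lemma Ex_emeasure: "emeasure Ex UNIV = 2"
proof -
 have "has_bochner_integral lborel (\<lambda>s. 1/2 * (indicator {0..} s * exp (- (1/2) * s))) (1::real)"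
 proof -
  have "((\<lambda>s::real. exp (- (1/2) * s)) has_integral (exp (- (1/2) * 0) / (1/2))) {0..}"
   by (rule has_integral_exp_minus_to_infinity) simp
  then have hi: "((\<lambda>s::real. exp (- (1/2) * s)) has_integral 2) {0..}" by simp
  have si: "set_integrable lborel {0::real..} (\<lambda>s. exp (- (1/2) * s))"
   using exp_Ici_integrable[of "1/2"] by (simp add: set_integrable_def)
  have "(LINT s:{0::real..}|lborel. exp (- (1/2) * s)) = integral {0..} (\<lambda>s. exp (- (1/2) * s))"
   by (rule set_borel_integral_eq_integral[OF si])
  also have "\<dots> = 2" using hi by (rule integral_unique)
  finally show ?thesis using exp_Ici_integrable[of "1/2"]
   by (auto simp: has_bochner_integral_iff set_lebesgue_integral_def)
 qed
 then have I: "(LINT s|lborel. indicator {0..} s * exp (- (1/2) * s) :: real) = 2"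
  by (auto simp: has_bochner_integral_iff)
 have "emeasure Ex UNIV = (\<integral>\<^sup>+s. ennreal (indicator {0<..} s * exp (- s / 2)) \<partial>lborel)"
  by (simp add: Ex_def emeasure_density)
 also have "\<dots> = (\<integral>\<^sup>+s. ennreal (indicator {0..} s * exp (- (1/2) * s)) \<partial>lborel)"
  by (rule nn_integral_cong_AE, rule eventually_mono[OF AE_lborel_singleton[of 0]]) (auto split: split_indicator)
 also have "\<dots> = ennreal (LINT s|lborel. indicator {0..} s * exp (- (1/2) * s))"
  using exp_Ici_integrable[of "1/2"] by (intro nn_integral_eq_integral) auto
 finally show ?thesis unfolding I by simp
qed

lemma Ex_finite: "finite_measure Ex"
 by (rule finite_measureI) (simp add: Ex_emeasure)

lemma abs_cos_diff_le: "\<bar>cos u - cos w\<bar> \<le> \<bar>u - w\<bar>" for u w :: real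
proof -
 have "\<bar>cos u - cos w\<bar> = 2 * \<bar>sin ((u + w) / 2)\<bar> * \<bar>sin ((w - u) / 2)\<bar>"
  by (simp add: cos_diff_cos abs_mult)
 also have "\<dots> \<le> 2 * 1 * \<bar>(w - u) / 2\<bar>"
  by (intro mult_mono abs_sin_x_le_abs_x) auto
 finally show ?thesis by simp
qed

lemma (in prob_space) expectation_abs_le_of_square:
 fixes Y :: "'a \<Rightarrow> real"
 assumes i: "integrable M (\<lambda>x. (Y x)\<^sup>2)" and m: "Y \<in> borel_measurable M"
  and s: "0 < \<sigma>" and le: "(LINT x|M. (Y x)\<^sup>2) \<le> \<sigma>\<^sup>2"
 shows "integrable M (\<lambda>x. \<bar>Y x\<bar>)" "(LINT x|M. \<bar>Y x\<bar>) \<le> \<sigma>"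
proof -
 have pt: "\<bar>Y x\<bar> \<le> (\<sigma> + (Y x)\<^sup>2 / \<sigma>) / 2" for x
 proof -
  have "2 * \<sigma> * \<bar>Y x\<bar> \<le> \<sigma>\<^sup>2 + (Y x)\<^sup>2" using sum_squares_bound[of \<sigma> "\<bar>Y x\<bar>"] by simp
  then show ?thesis using s by (simp add: field_simps power2_eq_square)
 qed
 have i2: "integrable M (\<lambda>x. (\<sigma> + (Y x)\<^sup>2 / \<sigma>) / 2)" using i by auto
 show i3: "integrable M (\<lambda>x. \<bar>Y x\<bar>)"
 proof (rule Bochner_Integration.integrable_bound[OF i2])
  show "AE x in M. norm \<bar>Y x\<bar> \<le> norm ((\<sigma> + (Y x)\<^sup>2 / \<sigma>) / 2)"
   unfolding real_norm_def abs_abs by (intro AE_I2 order_trans[OF pt abs_ge_self])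
 qed (use m in measurable)
 have "(LINT x|M. \<bar>Y x\<bar>) \<le> (LINT x|M. (\<sigma> + (Y x)\<^sup>2 / \<sigma>) / 2)" by (rule integral_mono[OF i3 i2 pt])
 also have "\<dots> = (\<sigma> + (LINT x|M. (Y x)\<^sup>2) / \<sigma>) / 2" using i by (simp add: prob_space)
 also have "\<dots> \<le> (\<sigma> + \<sigma>\<^sup>2 / \<sigma>) / 2" using le s by (intro divide_right_mono add_left_mono) auto
 also have "\<dots> = \<sigma>" using s by (simp add: power2_eq_square)
 finally show "(LINT x|M. \<bar>Y x\<bar>) \<le> \<sigma>" .
qed

context cont_blt begin

text \<open>The spatial average whose variance has to be small.\<close>

definition XX :: "real \<Rightarrow> real \<Rightarrow> real \<Rightarrow> real \<Rightarrow> real \<Rightarrow> 'w \<Rightarrow> real" where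
 "XX \<mu> h s a b w = (LINT x|Iv a b. FF \<mu> h s x w)"

lemma XX_measurable [measurable (raw)]:
 assumes [measurable]: "f \<in> borel_measurable N" "g \<in> borel_measurable N" "k \<in> measurable N M"
 shows "(\<lambda>z. XX \<mu> h (f z) a b (k z)) \<in> borel_measurable N"
proof -
 interpret finite_measure "Iv a b" by (rule Iv_finite)
 show ?thesis unfolding XX_def by measurable
qed

lemma FF_x_measurable: "(\<lambda>x. FF \<mu> h s x w) \<in> borel_measurable borel"
proof -
 have m: "(\<lambda>x. L x s w) \<in> borel_measurable borel" by (rule borel_measurable_continuous_onI[OF L_cont_x])
 have m': "(\<lambda>x. L (x + h) s w) \<in> borel_measurable borel" by (rule measurable_compose[OF _ m]) simp
 show ?thesis unfolding FF_def using m m' by simp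
qed

lemma XX_bound: "a \<le> b \<Longrightarrow> \<bar>XX \<mu> h s a b w\<bar> \<le> (b - a) * 2"
 unfolding XX_def by (rule Iv_integral_bound[OF FF_x_measurable FF_bound])

text \<open>The square is a double integral of covariances: off the diagonal these are of order \<open>sqrt h\<close>, and the strip around the diagonal has area of order \<open>h\<close>.\<close>

lemma XX_time_average:
 assumes h: "0 < h" "h \<le> 1" and ab: "a \<le> b"
 shows "(LINT s:{0<..}|lborel. exp (- s / 2) * (LINT \<omega>|M. (XX \<mu> h s a b \<omega>)\<^sup>2))
  \<le> (1872 * (b - a)\<^sup>2 + 16 * (b - a)) * (freq_const \<mu> ^ 4 * sqrt h)"
proof -
 let ?F = "freq_const \<mu> ^ 4"
 have F1: "1 \<le> ?F" using freq_const(1)[of \<mu>] by (rule one_le_power)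
 have hs: "h \<le> ?F * sqrt h"
 proof -
  have "h = sqrt h * sqrt h" using h by simp
  also have "\<dots> \<le> 1 * sqrt h" using h by (intro mult_right_mono) auto
  also have "\<dots> \<le> ?F * sqrt h" using F1 h by (intro mult_right_mono) auto
  finally show ?thesis .
 qed
 interpret E: finite_measure Ex by (rule Ex_finite)
 interpret J: finite_measure "Iv a b" by (rule Iv_finite)
 interpret EM: pair_sigma_finite Ex M ..
 have fEM: "finite_measure (Ex \<Otimes>\<^sub>M M)"
  by (intro finite_measure_pair_measure Ex_finite finite_measure_axioms)
 interpret EMf: finite_measure "Ex \<Otimes>\<^sub>M M" by (rule fEM)
 have mass: "measure (Ex \<Otimes>\<^sub>M M) (space (Ex \<Otimes>\<^sub>M M)) = 2"
 proof -
  have "emeasure (Ex \<Otimes>\<^sub>M M) (space Ex \<times> space M) = emeasure Ex (space Ex) * emeasure M (space M)"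
   by (rule emeasure_pair_measure_Times) auto
  then show ?thesis by (simp add: measure_def space_pair_measure Ex_emeasure emeasure_space_1)
 qed
 have split: "(LINT z|(Ex \<Otimes>\<^sub>M M). G (fst z) (snd z)) = (LINT s:{0<..}|lborel. exp (- s / 2) * (LINT \<omega>|M. G s \<omega>))"
  if G: "(\<lambda>(s, \<omega>). G s \<omega>) \<in> borel_measurable (borel \<Otimes>\<^sub>M M)" and K: "\<And>s \<omega>. \<bar>G s \<omega>\<bar> \<le> K" for G K
 proof -
  have Gm: "(\<lambda>z. G (fst z) (snd z)) \<in> borel_measurable (Ex \<Otimes>\<^sub>M M)"
   using G by (simp add: case_prod_beta' cong: measurable_cong_sets)
  have "integrable (Ex \<Otimes>\<^sub>M M) (\<lambda>z. G (fst z) (snd z))"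
   by (rule EMf.integrable_const_bound[where B=K]) (use K Gm in auto)
  from EM.integral_fst'[OF this]
  have "(LINT z|(Ex \<Otimes>\<^sub>M M). G (fst z) (snd z)) = (LINT s|Ex. LINT \<omega>|M. G s \<omega>)" by simp
  also have "\<dots> = (LINT s:{0<..}|lborel. exp (- s / 2) * (LINT \<omega>|M. G s \<omega>))"
   by (rule Ex_integral, rule borel_measurable_lebesgue_integral[OF G])
  finally show ?thesis .
 qed
 define Q where "Q x y = (LINT z|(Ex \<Otimes>\<^sub>M M). FF \<mu> h (fst z) x (snd z) * FF \<mu> h (fst z) y (snd z))" for x y
 have FFF: "\<bar>FF \<mu> h s x \<omega> * FF \<mu> h s y \<omega>\<bar> \<le> 4" for s x y \<omega>
  using mult_mono[OF FF_bound[of \<mu> h s x \<omega>] FF_bound[of \<mu> h s y \<omega>]] by (simp add: abs_mult)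
 have Qm [measurable]: "(\<lambda>w. Q (f w) (g w)) \<in> borel_measurable N"
  if [measurable]: "f \<in> borel_measurable N" "g \<in> borel_measurable N" for f g and N :: "real measure"
  unfolding Q_def by measurable
 have Q8: "\<bar>Q x y\<bar> \<le> 8" for x y
 proof -
  have "integrable (Ex \<Otimes>\<^sub>M M) (\<lambda>z. FF \<mu> h (fst z) x (snd z) * FF \<mu> h (fst z) y (snd z))"
   by (rule EMf.integrable_const_bound[where B=4]) (use FFF in auto)
  then have "\<bar>Q x y\<bar> \<le> (LINT z|(Ex \<Otimes>\<^sub>M M). 4)"
   unfolding Q_def using FFF by (intro order_trans[OF integral_abs_bound] integral_mono) auto
  then show ?thesis using mass by simp
 qed
 have Qeq: "Q x y = (LINT s:{0<..}|lborel. exp (- s / 2) * (LINT \<omega>|M. FF \<mu> h s x \<omega> * FF \<mu> h s y \<omega>))" for x y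
  unfolding Q_def by (rule split[of "\<lambda>s \<omega>. FF \<mu> h s x \<omega> * FF \<mu> h s y \<omega>" 4]) (use FFF in auto)
 let ?D = "1872 * ?F * sqrt h"
 have D0: "0 \<le> ?D" using F1 h by simp
 have Qb: "Q x y \<le> ?D + 8 * indicator {x - h..x + h} y" for x y
 proof (cases "h \<le> \<bar>x - y\<bar>")
  case True
  have "Q x y \<le> ?D" using FF_covariance[OF h True, of \<mu>] unfolding Qeq by linarith
  then show ?thesis by (auto split: split_indicator)
 next
  case False
  then have "y \<in> {x - h..x + h}" by auto
  then have "indicator {x - h..x + h} y = (1::real)" by simp
  then show ?thesis using Q8[of x y] D0 by linarith
 qed
 have "(LINT s:{0<..}|lborel. exp (- s / 2) * (LINT \<omega>|M. (XX \<mu> h s a b \<omega>)\<^sup>2))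
  = (LINT z|(Ex \<Otimes>\<^sub>M M). (XX \<mu> h (fst z) a b (snd z))\<^sup>2)"
 proof (rule split[symmetric])
  fix s \<omega> show "\<bar>(XX \<mu> h s a b \<omega>)\<^sup>2\<bar> \<le> ((b - a) * 2)\<^sup>2"
   using power_mono[OF XX_bound[OF ab, of \<mu> h s \<omega>], of 2] by simp
 qed measurable
 also have "\<dots> = (LINT x|Iv a b. LINT y|Iv a b. Q x y)"
  unfolding XX_def Q_def
  by (rule integral_square_Fubini[OF fEM Iv_finite _ FF_bound]) measurable
 also have "\<dots> \<le> (LINT x|Iv a b. (b - a) * ?D + 16 * h)"
 proof (rule integral_mono)
  have "\<bar>LINT y|Iv a b. Q x y\<bar> \<le> (b - a) * 8" for x
   by (rule Iv_integral_bound[OF _ Q8 ab]) measurable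
  then show "integrable (Iv a b) (\<lambda>x. LINT y|Iv a b. Q x y)"
   by (intro Iv_integrable_bounded) (auto simp: Q_def)
  fix x
  have im: "integrable (Iv a b) (indicator {x - h..x + h} :: real \<Rightarrow> real)"
   by (rule Iv_integrable_bounded[where K=1]) auto
  have "(LINT y|Iv a b. Q x y) \<le> (LINT y|Iv a b. ?D + 8 * indicator {x - h..x + h} y)"
   using Qb im by (intro integral_mono Iv_integrable_bounded[OF _ Q8]) auto
  also have "\<dots> = (b - a) * ?D + 8 * (LINT y|Iv a b. indicator {x - h..x + h} y)"
   using im by (simp add: Iv_measure[OF ab])
  also have "(LINT y|Iv a b. indicator {x - h..x + h} y) \<le> (2 * h :: real)"
  proof -
   have "(LINT y|Iv a b. indicator {x - h..x + h} y :: real) = (LINT y:{a..b}|lborel. indicator {x - h..x + h} y)"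
    by (rule Iv_integral) auto
   also have "\<dots> \<le> (LINT y|lborel. indicator {x - h..x + h} y)"
    unfolding set_lebesgue_integral_def
    by (rule integral_mono_AE') (auto intro!: integrable_real_indicator AE_I2 split: split_indicator simp: emeasure_lborel_Icc_eq)
   also have "\<dots> = 2 * h" using h by simp
   finally show ?thesis .
  qed
  finally show "(LINT y|Iv a b. Q x y) \<le> (b - a) * ?D + 16 * h" by simp
 qed simp
 also have "\<dots> = (b - a) * ((b - a) * ?D + 16 * h)" by (simp add: Iv_measure[OF ab])
 also have "\<dots> \<le> (b - a) * ((b - a) * ?D + 16 * (?F * sqrt h))"
  using ab hs by (intro mult_left_mono add_left_mono) auto
 also have "\<dots> = (1872 * (b - a)\<^sup>2 + 16 * (b - a)) * (?F * sqrt h)"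
  unfolding power2_eq_square by algebra
 finally show ?thesis .
qed

lemma FF_time_increment:
 assumes h: "0 < h" "h \<le> 1" and st: "0 \<le> t" "t < s" "s \<le> t + 1"
 shows "(LINT \<omega>|M. \<bar>FF \<mu> h s x \<omega> - FF \<mu> h t x \<omega>\<bar>) \<le> 4 * freq_const \<mu> * (s - t) powr (1/4)"
proof -
 let ?D = "\<lambda>\<omega>. (L (x + h) s \<omega> - L x s \<omega>) - (L (x + h) t \<omega> - L x t \<omega>)"
 define \<tau> where "\<tau> = s - t"
 have \<tau>: "0 < \<tau>" "\<tau> \<le> 1" using st by (auto simp: \<tau>_def)
 have st': "0 \<le> t" "t \<le> s" using st by auto
 have h0: "0 \<le> h" using h by simp
 have root: "sqrt \<tau> = \<tau> powr (1/4) * \<tau> powr (1/4)" using \<tau> by (simp add: powr_half_sqrt flip: powr_add)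
 have p1: "\<tau> powr (1/4) \<le> 1" "0 \<le> \<tau> powr (1/4)" using \<tau> by (auto intro!: powr_le1)
 have s14: "sqrt \<tau> \<le> \<tau> powr (1/4)" unfolding root using p1 mult_left_le[of "\<tau> powr (1/4)" "\<tau> powr (1/4)"] by simp
 have ee: "exp (\<tau> / 2) \<le> 2"
 proof -
  have "exp (\<tau> / 2) \<le> exp (1 / 2)" using \<tau> by simp
  also have "\<dots> \<le> 2" using exp_bound_half[of "1/2::real"] by simp
  finally show ?thesis .
 qed
 have sig: "0 < 3 * sqrt h * \<tau> powr (1/4)" using h \<tau> by simp
 have le: "(LINT \<omega>|M. (?D \<omega>)\<^sup>2) \<le> (3 * sqrt h * \<tau> powr (1/4))\<^sup>2"
 proof -
  have "(LINT \<omega>|M. (?D \<omega>)\<^sup>2) \<le> 4 * exp (\<tau> / 2) * h * sqrt \<tau>"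
   unfolding \<tau>_def by (rule L_double_increment(2)[OF st' h0])
  also have "\<dots> \<le> 4 * 2 * h * sqrt \<tau>" using ee h \<tau> by (intro mult_right_mono mult_left_mono) auto
  also have "\<dots> \<le> 9 * (h * sqrt \<tau>)" using h \<tau> by simp
  also have "\<dots> = (3 * sqrt h * \<tau> powr (1/4))\<^sup>2"
   unfolding root using h by (simp add: power_mult_distrib power2_eq_square)
  finally show ?thesis .
 qed
 have Dm: "?D \<in> borel_measurable M" by (intro borel_measurable_diff L_meas)
 note D1 = expectation_abs_le_of_square[OF L_double_increment(1)[OF st' h0] Dm sig le]
 note L1 = L_time_increment[OF st', of x]
 have pt: "\<bar>FF \<mu> h s x \<omega> - FF \<mu> h t x \<omega>\<bar> \<le> (\<bar>\<mu>\<bar> / sqrt h) * \<bar>?D \<omega>\<bar> + 2 * \<mu>\<^sup>2 * \<bar>L x s \<omega> - L x t \<omega>\<bar>" for \<omega>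
 proof -
  let ?u = "\<mu> * ((L (x + h) s \<omega> - L x s \<omega>) / sqrt h)" and ?w = "\<mu> * ((L (x + h) t \<omega> - L x t \<omega>) / sqrt h)"
  let ?a = "2 * \<mu>\<^sup>2 * L x s \<omega>" and ?b = "2 * \<mu>\<^sup>2 * L x t \<omega>"
  have c: "\<bar>cos ?u - cos ?w\<bar> \<le> (\<bar>\<mu>\<bar> / sqrt h) * \<bar>?D \<omega>\<bar>"
  proof -
   have "?u - ?w = (\<mu> / sqrt h) * ?D \<omega>" by (simp add: algebra_simps diff_divide_distrib add_divide_distrib)
   then have "\<bar>?u - ?w\<bar> = (\<bar>\<mu>\<bar> / sqrt h) * \<bar>?D \<omega>\<bar>" using h by (simp add: abs_mult)
   then show ?thesis using abs_cos_diff_le[of ?u ?w] by simp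
  qed
  have ab0: "0 \<le> ?a" "0 \<le> ?b" using L_nonneg by auto
  have "\<bar>exp (- ?a) - exp (- ?b)\<bar> \<le> \<bar>?a - ?b\<bar>"
   using exp_abs_lipschitz[of ?a ?b] ab0 by (simp only: abs_of_nonneg)
  also have "\<bar>?a - ?b\<bar> = 2 * \<mu>\<^sup>2 * \<bar>L x s \<omega> - L x t \<omega>\<bar>"
   by (simp add: abs_mult flip: right_diff_distrib)
  finally have e: "\<bar>exp (- ?a) - exp (- ?b)\<bar> \<le> 2 * \<mu>\<^sup>2 * \<bar>L x s \<omega> - L x t \<omega>\<bar>" .
  have "FF \<mu> h s x \<omega> - FF \<mu> h t x \<omega> = (cos ?u - cos ?w) - (exp (- ?a) - exp (- ?b))"
   unfolding FF_def by (simp only: mult_minus_left)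
  then show ?thesis using c e by linarith
 qed
 have "(LINT \<omega>|M. \<bar>FF \<mu> h s x \<omega> - FF \<mu> h t x \<omega>\<bar>) \<le> (LINT \<omega>|M. (\<bar>\<mu>\<bar> / sqrt h) * \<bar>?D \<omega>\<bar> + 2 * \<mu>\<^sup>2 * \<bar>L x s \<omega> - L x t \<omega>\<bar>)"
 proof (rule integral_mono[OF _ _ pt])
  have "\<bar>FF \<mu> h s x \<omega> - FF \<mu> h t x \<omega>\<bar> \<le> 4" for \<omega>
   using FF_bound[of \<mu> h s x \<omega>] FF_bound[of \<mu> h t x \<omega>] by linarith
  then show "integrable M (\<lambda>\<omega>. \<bar>FF \<mu> h s x \<omega> - FF \<mu> h t x \<omega>\<bar>)"
   by (intro integrable_const_bound[where B=4]) auto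
  show "integrable M (\<lambda>\<omega>. (\<bar>\<mu>\<bar> / sqrt h) * \<bar>?D \<omega>\<bar> + 2 * \<mu>\<^sup>2 * \<bar>L x s \<omega> - L x t \<omega>\<bar>)"
   by (intro Bochner_Integration.integrable_add integrable_mult_right D1(1) L1(1))
 qed
 also have "\<dots> = (\<bar>\<mu>\<bar> / sqrt h) * (LINT \<omega>|M. \<bar>?D \<omega>\<bar>) + 2 * \<mu>\<^sup>2 * (LINT \<omega>|M. \<bar>L x s \<omega> - L x t \<omega>\<bar>)"
  using D1(1) L1(1) by simp
 also have "\<dots> \<le> (\<bar>\<mu>\<bar> / sqrt h) * (3 * sqrt h * \<tau> powr (1/4)) + 2 * \<mu>\<^sup>2 * \<tau> powr (1/4)"
  using D1(2) L1(2) s14 h unfolding \<tau>_def[symmetric] by (intro add_mono mult_left_mono) auto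
 also have "\<dots> = (3 * \<bar>\<mu>\<bar> + 2 * \<mu>\<^sup>2) * \<tau> powr (1/4)" using h by (simp add: field_simps)
 also have "\<dots> \<le> (4 * freq_const \<mu>) * \<tau> powr (1/4)"
  using freq_const[of \<mu>] p1 by (intro mult_right_mono) auto
 finally show ?thesis by (simp add: \<tau>_def)
qed

lemma XX_time_increment:
 assumes h: "0 < h" "h \<le> 1" and st: "0 \<le> t" "t < s" "s \<le> t + 1" and ab: "a \<le> b"
 shows "(LINT w|M. (XX \<mu> h t a b w)\<^sup>2) \<le> (LINT w|M. (XX \<mu> h s a b w)\<^sup>2) + 16 * (b - a)\<^sup>2 * freq_const \<mu> * (s - t) powr (1/4)"
proof -
 interpret J: finite_measure "Iv a b" by (rule Iv_finite)
 interpret MJ: pair_sigma_finite M "Iv a b" ..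
 interpret MJf: finite_measure "M \<Otimes>\<^sub>M Iv a b" by (intro finite_measure_pair_measure Iv_finite finite_measure_axioms)
 let ?c = "4 * freq_const \<mu> * (s - t) powr (1/4)"
 let ?d = "\<lambda>w x. \<bar>FF \<mu> h s x w - FF \<mu> h t x w\<bar>"
 have d4: "?d w x \<le> 4" for w x using FF_bound[of \<mu> h s x w] FF_bound[of \<mu> h t x w] by linarith
 have iX: "integrable M (\<lambda>w. (XX \<mu> h r a b w)\<^sup>2)" for r
 proof (rule integrable_const_bound[where B="((b - a) * 2)\<^sup>2"])
  show "AE w in M. norm ((XX \<mu> h r a b w)\<^sup>2) \<le> ((b - a) * 2)\<^sup>2"
   using power_mono[OF XX_bound[OF ab], of _ _ _ _ 2] by (intro AE_I2) simp
 qed measurable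
 have dm [measurable]: "(\<lambda>(w, x). ?d w x) \<in> borel_measurable (M \<Otimes>\<^sub>M Iv a b)" by measurable
 have di: "integrable (M \<Otimes>\<^sub>M Iv a b) (\<lambda>(w, x). ?d w x)"
  by (rule MJf.integrable_const_bound[where B=4]) (use d4 in auto)
 have id: "integrable M (\<lambda>w. LINT x|Iv a b. ?d w x)"
  using MJ.integrable_fst'[OF di] by simp
 have pt: "(XX \<mu> h t a b w)\<^sup>2 - (XX \<mu> h s a b w)\<^sup>2 \<le> 4 * (b - a) * (LINT x|Iv a b. ?d w x)" for w
 proof -
  have iF: "integrable (Iv a b) (\<lambda>x. FF \<mu> h r x w)" for r
   by (rule Iv_integrable_bounded[OF FF_x_measurable FF_bound])
  have "\<bar>XX \<mu> h t a b w - XX \<mu> h s a b w\<bar> \<le> (LINT x|Iv a b. ?d w x)"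
   unfolding XX_def Bochner_Integration.integral_diff[OF iF iF, symmetric]
   by (rule order_trans[OF integral_abs_bound]) (simp add: abs_minus_commute)
  moreover have "\<bar>XX \<mu> h t a b w + XX \<mu> h s a b w\<bar> \<le> 4 * (b - a)"
   using XX_bound[OF ab, of \<mu> h t w] XX_bound[OF ab, of \<mu> h s w] by linarith
  ultimately have "\<bar>XX \<mu> h t a b w + XX \<mu> h s a b w\<bar> * \<bar>XX \<mu> h t a b w - XX \<mu> h s a b w\<bar> \<le> 4 * (b - a) * (LINT x|Iv a b. ?d w x)"
   using ab by (intro mult_mono) auto
  moreover have "(XX \<mu> h t a b w)\<^sup>2 - (XX \<mu> h s a b w)\<^sup>2 \<le> \<bar>XX \<mu> h t a b w + XX \<mu> h s a b w\<bar> * \<bar>XX \<mu> h t a b w - XX \<mu> h s a b w\<bar>"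
   unfolding abs_mult[symmetric] by (rule order_trans[OF _ abs_ge_self]) (simp add: power2_eq_square algebra_simps)
  ultimately show ?thesis by linarith
 qed
 have "(LINT w|M. (XX \<mu> h t a b w)\<^sup>2) - (LINT w|M. (XX \<mu> h s a b w)\<^sup>2) \<le> (LINT w|M. 4 * (b - a) * (LINT x|Iv a b. ?d w x))"
  unfolding Bochner_Integration.integral_diff[OF iX iX, symmetric]
  by (rule integral_mono[OF _ _ pt]) (use iX id in auto)
 also have "\<dots> = 4 * (b - a) * (LINT x|Iv a b. LINT w|M. ?d w x)"
  using MJ.Fubini_integral[OF di] by simp
 also have "(LINT x|Iv a b. LINT w|M. ?d w x) \<le> (LINT x|Iv a b. ?c)"
 proof (rule integral_mono)
  show "integrable (Iv a b) (\<lambda>x. LINT w|M. ?d w x)"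
   using MJ.integrable_snd[OF di] by simp
  show "(LINT w|M. ?d w x) \<le> ?c" for x by (rule FF_time_increment[OF h st])
 qed simp
 also have "(LINT x|Iv a b. ?c) = (b - a) * ?c" by (simp add: Iv_measure[OF ab])
 finally have "(LINT w|M. (XX \<mu> h t a b w)\<^sup>2) - (LINT w|M. (XX \<mu> h s a b w)\<^sup>2) \<le> 4 * (b - a) * ((b - a) * ?c)"
  using ab by (simp add: mult_left_mono)
 also have "4 * (b - a) * ((b - a) * ?c) = 16 * (b - a)\<^sup>2 * freq_const \<mu> * (s - t) powr (1/4)"
  unfolding power2_eq_square by algebra
 finally show ?thesis by simp
qed

text \<open>A fixed time is compared with an average over a window of length \<open>h powr (1/4)\<close> to its right. Continuity in time makes the comparison cheap, and the window average is bounded by the exponential one divided by the length.\<close>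

lemma XX_second_moment:
 assumes h: "0 < h" "h \<le> 1" and t: "0 \<le> t" and ab: "a \<le> b"
 shows "(LINT w|M. (XX \<mu> h t a b w)\<^sup>2) \<le>
  (exp ((t + 1) / 2) * (1872 * (b - a)\<^sup>2 + 16 * (b - a)) + 16 * (b - a)\<^sup>2) * (freq_const \<mu> ^ 4 * h powr (1/16))"
proof -
 define \<delta> where "\<delta> = h powr (1/4)"
 have \<delta>: "0 < \<delta>" "\<delta> \<le> 1" using h by (auto simp: \<delta>_def intro!: powr_le1)
 let ?F = "freq_const \<mu>"
 let ?C = "1872 * (b - a)\<^sup>2 + 16 * (b - a)"
 have C0: "0 \<le> ?C" using ab by simp
 have F1: "1 \<le> ?F" by (rule freq_const)
 have F4: "?F \<le> ?F ^ 4" using power_increasing[of 1 4 ?F] F1 by simp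
 let ?e = "\<lambda>s. LINT w|M. (XX \<mu> h s a b w)\<^sup>2"
 define A where "A = ?e t - 16 * (b - a)\<^sup>2 * ?F * \<delta> powr (1/4)"
 have ib: "(XX \<mu> h s a b w)\<^sup>2 \<le> ((b - a) * 2)\<^sup>2" for s w
  using power_mono[OF XX_bound[OF ab, of \<mu> h s w], of 2] by simp
 have eb: "\<bar>?e s\<bar> \<le> ((b - a) * 2)\<^sup>2" for s
 proof -
  have i: "integrable M (\<lambda>w. (XX \<mu> h s a b w)\<^sup>2)"
   by (rule integrable_const_bound[where B="((b - a) * 2)\<^sup>2"]) (use ib in auto)
  have "?e s \<le> (LINT w|M. ((b - a) * 2)\<^sup>2)" by (rule integral_mono[OF i _ ib]) simp
  then show ?thesis by (simp add: prob_space)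
 qed
 have "\<delta> * A * exp (- (t + \<delta>) / 2) \<le> (LINT s:{0<..}|lborel. exp (- s / 2) * ?e s)"
 proof (rule window_lower_bound[OF _ _ t \<delta>(1)])
  have em [measurable]: "?e \<in> borel_measurable borel" by measurable
  show "set_integrable lborel {0<..} (\<lambda>s. exp (- s / 2) * ?e s)"
   unfolding set_integrable_def
  proof (rule Bochner_Integration.integrable_bound)
   show "integrable lborel (\<lambda>s. (indicator {0..} s * exp (- (1/2) * s)) * ((b - a) * 2)\<^sup>2)"
    by (intro integrable_mult_left exp_Ici_integrable) simp
   have "exp (- s / 2) * \<bar>?e s\<bar> \<le> exp (- s / 2) * ((b - a) * 2)\<^sup>2" for s
    by (intro mult_left_mono eb) auto
   then show "AE s in lborel. norm (indicator {0<..} s *\<^sub>R (exp (- s / 2) * ?e s)) \<le> norm ((indicator {0..} s * exp (- (1/2) * s)) * ((b - a) * 2)\<^sup>2)"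
    by (intro AE_I2) (auto simp: abs_mult split: split_indicator)
  qed measurable
  fix s assume s: "t < s" "s \<le> t + \<delta>"
  have "(s - t) powr (1/4) \<le> \<delta> powr (1/4)" using s by (intro powr_mono2) auto
  then have "16 * (b - a)\<^sup>2 * ?F * (s - t) powr (1/4) \<le> 16 * (b - a)\<^sup>2 * ?F * \<delta> powr (1/4)"
   using F1 by (intro mult_left_mono) auto
  moreover have "?e t \<le> ?e s + 16 * (b - a)\<^sup>2 * ?F * (s - t) powr (1/4)"
   by (rule XX_time_increment[OF h t s(1) _ ab]) (use s \<delta> in linarith)
  ultimately show "A \<le> ?e s" unfolding A_def by linarith
 qed (auto intro: integral_nonneg_AE)
 also have "\<dots> \<le> ?C * (?F ^ 4 * sqrt h)" by (rule XX_time_average[OF h ab])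
 finally have "\<delta> * A \<le> exp ((t + \<delta>) / 2) * (?C * (?F ^ 4 * sqrt h))"
  by (rule le_exp_mult_of_mult_exp_le)
 also have "\<dots> \<le> exp ((t + 1) / 2) * (?C * (?F ^ 4 * sqrt h))"
  using \<delta> C0 F1 h by (intro mult_right_mono mult_nonneg_nonneg) auto
 also have "sqrt h = \<delta> * h powr (1/4)"
  unfolding \<delta>_def using h by (simp add: powr_half_sqrt flip: powr_add)
 also have "exp ((t + 1) / 2) * (?C * (?F ^ 4 * (\<delta> * h powr (1/4)))) = \<delta> * (exp ((t + 1) / 2) * ?C * (?F ^ 4 * h powr (1/4)))"
  by (simp only: mult_ac)
 finally have "A \<le> exp ((t + 1) / 2) * ?C * (?F ^ 4 * h powr (1/4))" using \<delta>(1) by simp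
 also have "\<dots> \<le> exp ((t + 1) / 2) * ?C * (?F ^ 4 * h powr (1/16))"
  using h C0 F1 by (intro mult_left_mono powr_mono') auto
 finally have 1: "A \<le> exp ((t + 1) / 2) * ?C * (?F ^ 4 * h powr (1/16))" .
 have "\<delta> powr (1/4) = h powr (1/16)" unfolding \<delta>_def by (simp add: powr_powr)
 then have "16 * (b - a)\<^sup>2 * ?F * \<delta> powr (1/4) \<le> 16 * (b - a)\<^sup>2 * (?F ^ 4 * h powr (1/16))"
  using F4 by (simp add: mult.assoc mult_left_mono mult_right_mono)
 with 1 have "?e t \<le> exp ((t + 1) / 2) * ?C * (?F ^ 4 * h powr (1/16)) + 16 * (b - a)\<^sup>2 * (?F ^ 4 * h powr (1/16))"
  unfolding A_def by linarith
 then show ?thesis by (simp only: distrib_right)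
qed

end

section \<open>Powers as mixtures of cosines\<close>

lemma one_minus_cos_le: "1 - cos z \<le> z\<^sup>2" "0 \<le> 1 - cos z" "1 - cos z \<le> 2" for z :: real
proof -
 have "1 - cos z = 2 * (sin (z / 2))\<^sup>2" using cos_double_sin[of "z / 2"] by simp
 also have "\<dots> \<le> 2 * \<bar>z / 2\<bar>\<^sup>2"
  using abs_sin_x_le_abs_x[of "z / 2"] by (subst power2_abs[of "sin (z / 2)", symmetric]) (intro mult_left_mono power_mono; simp)
 also have "\<dots> \<le> z\<^sup>2" by (simp add: power2_eq_square)
 finally show "1 - cos z \<le> z\<^sup>2" .
 show "0 \<le> 1 - cos z" "1 - cos z \<le> 2" using cos_le_one[of z] cos_ge_minus_one[of z] by linarith+
qed

lemma one_minus_cos_power_bounds: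
 fixes z :: real
 shows "0 \<le> (1 - cos z) ^ m" "(1 - cos z) ^ m \<le> 2 ^ m" "(1 - cos z) ^ m \<le> z ^ (2 * m)"
 using one_minus_cos_le[of z] by (auto simp: power_mult intro!: power_mono)

text \<open>Products of cosines are sums of cosines; only finiteness of the expansion matters.\<close>

lemma one_minus_cos_power_trig:
 "\<exists>xs. \<forall>z::real. (1 - cos z) ^ m = (\<Sum>(q, \<kappa>)\<leftarrow>xs. q * cos (\<kappa> * z))"
proof (induction m)
 case 0
 show ?case by (rule exI[of _ "[(1, 0)]"]) simp
next
 case (Suc m)
 then obtain xs where xs: "\<And>z::real. (1 - cos z) ^ m = (\<Sum>(q, \<kappa>)\<leftarrow>xs. q * cos (\<kappa> * z))" by blast
 define ys where "ys = xs @ map (\<lambda>(q, \<kappa>). (- q / 2, \<kappa> + 1)) xs @ map (\<lambda>(q, \<kappa>). (- q / 2, \<kappa> - 1)) xs"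
 have "(1 - cos z) * (\<Sum>(q, \<kappa>)\<leftarrow>xs. q * cos (\<kappa> * z)) = (\<Sum>(q, \<kappa>)\<leftarrow>ys. q * cos (\<kappa> * z))" for z :: real
 proof -
  have split: "(1 - cos z) * (\<Sum>(q, \<kappa>)\<leftarrow>xs. q * cos (\<kappa> * z)) = (\<Sum>(q, \<kappa>)\<leftarrow>xs. q * cos (\<kappa> * z))
   + (\<Sum>(q, \<kappa>)\<leftarrow>xs. - q / 2 * cos ((\<kappa> + 1) * z)) + (\<Sum>(q, \<kappa>)\<leftarrow>xs. - q / 2 * cos ((\<kappa> - 1) * z))" for xs
  proof (induction xs)
   case (Cons a xs)
   obtain q \<kappa> where a: "a = (q, \<kappa>)" by (cases a)
   have "cos z * cos (\<kappa> * z) = (cos (\<kappa> * z + z) + cos (\<kappa> * z - z)) / 2"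
    by (simp add: cos_add cos_diff mult.commute)
   then have "cos z * cos (\<kappa> * z) = (cos ((\<kappa> + 1) * z) + cos ((\<kappa> - 1) * z)) / 2"
    by (simp only: distrib_right left_diff_distrib mult_1)
   then have "(1 - cos z) * (q * cos (\<kappa> * z)) = q * cos (\<kappa> * z) + - q / 2 * cos ((\<kappa> + 1) * z) + - q / 2 * cos ((\<kappa> - 1) * z)"
    by algebra
   with Cons.IH show ?case unfolding a by (simp only: list.map sum_list.Cons prod.case distrib_left)
  qed simp
  show ?thesis unfolding split ys_def by (simp add: comp_def split_def)
 qed
 then show ?case by (intro exI[of _ ys]) (simp only: power_Suc xs, simp)
qed

text \<open>The density of the mixture, homogeneous of degree \<open>- 1 - p\<close>; scaling it produces the power \<open>p\<close>.\<close>

definition wgt :: "real \<Rightarrow> real \<Rightarrow> real" where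
 "wgt p \<theta> = indicator {0<..} \<theta> * \<theta> powr (- 1 - p)"

lemma wgt_nonneg: "0 \<le> wgt p \<theta>" by (simp add: wgt_def)

lemma wgt_measurable [measurable]: "wgt p \<in> borel_measurable borel"
 unfolding wgt_def by measurable

lemma powr_tail_finite:
 fixes s e :: real
 assumes s: "-1 < s" and e: "e < -1"
 shows "(\<integral>\<^sup>+\<theta>. ennreal (indicator {0<..} \<theta> * (if \<theta> \<le> 1 then \<theta> powr s else \<theta> powr e)) \<partial>lborel) < \<infinity>"
proof -
 have 1: "(\<integral>\<^sup>+\<theta>. ennreal (\<theta> powr s) * indicator {0..1} \<theta> \<partial>lborel) = ennreal (1 powr (s + 1) / (s + 1))"
  by (rule nn_integral_has_integral_lebesgue'[OF _ has_integral_powr_from_0[OF s]]) auto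
 have 2: "(\<integral>\<^sup>+\<theta>. ennreal (\<theta> powr e) * indicator {1..} \<theta> \<partial>lborel) = ennreal (-(1 powr (e + 1)) / (e + 1))"
  by (rule nn_integral_has_integral_lebesgue'[OF _ has_integral_powr_to_inf[OF e]]) auto
 have le: "ennreal (indicator {0<..} \<theta> * (if \<theta> \<le> 1 then \<theta> powr s else \<theta> powr e))
  \<le> ennreal (\<theta> powr s) * indicator {0..1} \<theta> + ennreal (\<theta> powr e) * indicator {1..} \<theta>" for \<theta> :: real
 proof (cases "0 < \<theta>")
  case True
  show ?thesis
  proof (cases "\<theta> \<le> 1")
   case True
   with \<open>0 < \<theta>\<close> show ?thesis by (simp add: indicator_def)
  next
   case False
   with \<open>0 < \<theta>\<close> show ?thesis by (simp add: indicator_def)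
  qed
 qed simp
 have L: "(\<integral>\<^sup>+\<theta>. ennreal (indicator {0<..} \<theta> * (if \<theta> \<le> 1 then \<theta> powr s else \<theta> powr e)) \<partial>lborel)
  \<le> (\<integral>\<^sup>+\<theta>. ennreal (\<theta> powr s) * indicator {0..1} \<theta> + ennreal (\<theta> powr e) * indicator {1..} \<theta> \<partial>lborel)"
  by (rule nn_integral_mono) (rule le)
 have E: "(\<integral>\<^sup>+\<theta>. ennreal (\<theta> powr s) * indicator {0..1} \<theta> + ennreal (\<theta> powr e) * indicator {1..} \<theta> \<partial>lborel)
  = ennreal (1 powr (s + 1) / (s + 1)) + ennreal (-(1 powr (e + 1)) / (e + 1))"
  unfolding 1[symmetric] 2[symmetric] by (rule nn_integral_add) measurable
 have F: "ennreal (1 powr (s + 1) / (s + 1)) + ennreal (-(1 powr (e + 1)) / (e + 1)) < \<infinity>"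
  by simp
 show ?thesis by (rule order_le_less_trans[OF L]) (unfold E, rule F)
qed

text \<open>The exponent \<open>m > p\<close> makes the mixture converge at frequency 0, and positivity of \<open>p\<close> at infinity.\<close>

locale power_rep =
 fixes p :: real and m :: nat
 assumes p: "1 \<le> p" and m: "p < real m"
begin

definition CJ :: real where
 "CJ = enn2real (\<integral>\<^sup>+\<theta>. ennreal (wgt p \<theta> * (1 - cos \<theta>) ^ m) \<partial>lborel)"

lemma CJ_finite: "(\<integral>\<^sup>+\<theta>. ennreal (wgt p \<theta> * (1 - cos \<theta>) ^ m) \<partial>lborel) < \<infinity>"
proof -
 let ?f = "\<lambda>\<theta>::real. indicator {0<..} \<theta> * (if \<theta> \<le> 1 then \<theta> powr (2 * real m - 1 - p) else \<theta> powr (- 1 - p))"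
 have "(\<integral>\<^sup>+\<theta>. ennreal (wgt p \<theta> * (1 - cos \<theta>) ^ m) \<partial>lborel) \<le> (\<integral>\<^sup>+\<theta>. ennreal (2 ^ m) * ennreal (?f \<theta>) \<partial>lborel)"
 proof (rule nn_integral_mono)
  fix \<theta> :: real
  have "wgt p \<theta> * (1 - cos \<theta>) ^ m \<le> 2 ^ m * ?f \<theta>"
  proof (cases "0 < \<theta>")
   case True
   show ?thesis
   proof (cases "\<theta> \<le> 1")
    case le: True
    have "\<theta> powr (-1 - p) * (1 - cos \<theta>) ^ m \<le> \<theta> powr (-1 - p) * \<theta> ^ (2 * m)"
    by (intro mult_left_mono one_minus_cos_power_bounds) auto
    also have "\<dots> = \<theta> powr (2 * real m - 1 - p)"
    proof -
    have "\<theta> ^ (2 * m) = \<theta> powr (2 * real m)" using powr_realpow[OF True, of "2 * m"] by simp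
    moreover have "- 1 - p + 2 * real m = 2 * real m - 1 - p" by simp
    ultimately show ?thesis by (simp only: powr_add[symmetric])
    qed
    also have "\<dots> \<le> 2 ^ m * \<theta> powr (2 * real m - 1 - p)"
    using mult_right_mono[of 1 "2 ^ m" "\<theta> powr (2 * real m - 1 - p)"] by simp
    finally show ?thesis using True le by (simp add: wgt_def)
   next
    case False
    have "\<theta> powr (-1 - p) * (1 - cos \<theta>) ^ m \<le> \<theta> powr (-1 - p) * 2 ^ m"
    by (intro mult_left_mono one_minus_cos_power_bounds) auto
    then show ?thesis using True False by (simp add: wgt_def mult.commute)
   qed
  qed (simp add: wgt_def)
  from ennreal_leI[OF this] show "ennreal (wgt p \<theta> * (1 - cos \<theta>) ^ m) \<le> ennreal (2 ^ m) * ennreal (?f \<theta>)"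
   by (simp only: ennreal_mult' zero_le_power zero_le_numeral)
 qed
 also have "\<dots> = ennreal (2 ^ m) * (\<integral>\<^sup>+\<theta>. ennreal (?f \<theta>) \<partial>lborel)" by (rule nn_integral_cmult) measurable
 also have "\<dots> < \<infinity>"
  unfolding infinity_ennreal_def by (subst ennreal_mult_less_top, rule disjI2, rule disjI2, rule conjI, rule ennreal_less_top)
    (rule powr_tail_finite[of "2 * real m - 1 - p" "- 1 - p", unfolded infinity_ennreal_def]; use p m in linarith)
 finally show ?thesis .
qed

lemma CJ_eq: "(\<integral>\<^sup>+\<theta>. ennreal (wgt p \<theta> * (1 - cos \<theta>) ^ m) \<partial>lborel) = ennreal CJ"
 unfolding CJ_def by (rule ennreal_enn2real[symmetric]) (use CJ_finite in \<open>simp only: infinity_ennreal_def\<close>)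

lemma CJ_pos: "0 < CJ"
proof -
 have "(\<integral>\<^sup>+\<theta>. ennreal ((1 - cos 1) ^ m * 2 powr (- 1 - p)) * indicator {1..2::real} \<theta> \<partial>lborel) \<le> ennreal CJ"
  unfolding CJ_eq[symmetric]
 proof (rule nn_integral_mono)
  fix \<theta> :: real
  show "ennreal ((1 - cos 1) ^ m * 2 powr (- 1 - p)) * indicator {1..2} \<theta> \<le> ennreal (wgt p \<theta> * (1 - cos \<theta>) ^ m)"
  proof (cases "\<theta> \<in> {1..2}")
   case True
   have "cos \<theta> \<le> cos 1" using True pi_ge_two by (intro cos_monotone_0_pi_le) auto
   then have "(1 - cos 1) ^ m \<le> (1 - cos \<theta>) ^ m" using cos_le_one[of "1::real"] by (intro power_mono) auto
   moreover have "2 powr (- 1 - p) \<le> \<theta> powr (- 1 - p)" using True p by (intro powr_mono2') auto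
   ultimately have "(1 - cos 1) ^ m * 2 powr (- 1 - p) \<le> (1 - cos \<theta>) ^ m * \<theta> powr (- 1 - p)"
    by (intro mult_mono) (auto simp: one_minus_cos_power_bounds)
   then show ?thesis using True by (simp add: wgt_def mult.commute ennreal_leI)
  qed simp
 qed
 then have "ennreal ((1 - cos 1) ^ m * 2 powr (- 1 - p)) * emeasure lborel {1..2::real} \<le> ennreal CJ"
  by (simp only: nn_integral_cmult_indicator sets_lborel atLeastAtMost_borel)
 then have "ennreal ((1 - cos 1) ^ m * 2 powr (- 1 - p)) \<le> ennreal CJ"
  by (simp only: emeasure_lborel_Icc) simp
 moreover have "0 < (1 - cos (1::real)) ^ m * 2 powr (- 1 - p)"
 proof -
  have "cos (1::real) < cos 0" using pi_ge_two by (intro cos_monotone_0_pi) auto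
  then show ?thesis by simp
 qed
 ultimately have "(1 - cos 1) ^ m * 2 powr (- 1 - p) \<le> CJ"
  using CJ_def by (simp add: ennreal_le_iff)
 with \<open>0 < (1 - cos (1::real)) ^ m * 2 powr (- 1 - p)\<close> show ?thesis by linarith
qed

text \<open>Substituting \<open>\<theta> / \<bar>z\<bar>\<close> for \<open>\<theta>\<close> extracts \<open>\<bar>z\<bar> powr p\<close> by homogeneity.\<close>

lemma power_representation:
 "(\<integral>\<^sup>+\<theta>. ennreal (wgt p \<theta> * (1 - cos (\<theta> * z)) ^ m) \<partial>lborel) = ennreal (CJ * \<bar>z\<bar> powr p)"
proof (cases "z = 0")
 case True
 have "m \<noteq> 0" using p m by (intro notI) simp
 then show ?thesis using True by (simp add: power_0_left)
next
 case False
 then have z: "0 < \<bar>z\<bar>" by simp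
 have c: "cos (\<theta> * z) = cos (\<bar>z\<bar> * \<theta>)" for \<theta> by (simp add: abs_if mult.commute)
 have "ennreal CJ = (\<integral>\<^sup>+\<theta>. ennreal (wgt p \<theta> * (1 - cos \<theta>) ^ m) \<partial>lborel)" by (rule CJ_eq[symmetric])
 also have "\<dots> = ennreal \<bar>z\<bar> * (\<integral>\<^sup>+\<theta>. ennreal (wgt p (0 + \<bar>z\<bar> * \<theta>) * (1 - cos (0 + \<bar>z\<bar> * \<theta>)) ^ m) \<partial>lborel)"
  using nn_integral_real_affine[of "\<lambda>\<theta>. ennreal (wgt p \<theta> * (1 - cos \<theta>) ^ m)" "\<bar>z\<bar>" 0] z by simp
 also have "\<dots> = (\<integral>\<^sup>+\<theta>. ennreal \<bar>z\<bar> * ennreal (wgt p (0 + \<bar>z\<bar> * \<theta>) * (1 - cos (0 + \<bar>z\<bar> * \<theta>)) ^ m) \<partial>lborel)"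
  by (rule nn_integral_cmult[symmetric]) measurable
 also have "\<dots> = (\<integral>\<^sup>+\<theta>. ennreal (\<bar>z\<bar> powr (- p)) * ennreal (wgt p \<theta> * (1 - cos (\<theta> * z)) ^ m) \<partial>lborel)"
 proof (rule nn_integral_cong)
  fix \<theta> :: real
  have "\<bar>z\<bar> * wgt p (\<bar>z\<bar> * \<theta>) = \<bar>z\<bar> powr (- p) * wgt p \<theta>"
  proof (cases "0 < \<theta>")
   case True
   have "\<bar>z\<bar> * (\<bar>z\<bar> powr (- 1 - p)) = \<bar>z\<bar> powr 1 * \<bar>z\<bar> powr (- 1 - p)" using z by simp
   also have "\<dots> = \<bar>z\<bar> powr (- p)" unfolding powr_add[symmetric] by simp
   finally show ?thesis using True z by (simp add: wgt_def powr_mult zero_less_mult_iff)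
  qed (use z in \<open>simp add: wgt_def zero_less_mult_iff\<close>)
  then have "\<bar>z\<bar> * (wgt p (0 + \<bar>z\<bar> * \<theta>) * (1 - cos (0 + \<bar>z\<bar> * \<theta>)) ^ m) = \<bar>z\<bar> powr (- p) * (wgt p \<theta> * (1 - cos (\<theta> * z)) ^ m)"
   unfolding add_0 c[of \<theta>] mult.assoc[symmetric] by (rule arg_cong)
  then show "ennreal \<bar>z\<bar> * ennreal (wgt p (0 + \<bar>z\<bar> * \<theta>) * (1 - cos (0 + \<bar>z\<bar> * \<theta>)) ^ m)
   = ennreal (\<bar>z\<bar> powr (- p)) * ennreal (wgt p \<theta> * (1 - cos (\<theta> * z)) ^ m)"
   by (simp only: ennreal_mult'[symmetric] abs_ge_zero powr_ge_zero)
 qed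
 also have "\<dots> = ennreal (\<bar>z\<bar> powr (- p)) * (\<integral>\<^sup>+\<theta>. ennreal (wgt p \<theta> * (1 - cos (\<theta> * z)) ^ m) \<partial>lborel)"
  by (rule nn_integral_cmult) measurable
 finally have "ennreal (\<bar>z\<bar> powr p) * ennreal CJ = ennreal (\<bar>z\<bar> powr p) * (ennreal (\<bar>z\<bar> powr (- p)) * (\<integral>\<^sup>+\<theta>. ennreal (wgt p \<theta> * (1 - cos (\<theta> * z)) ^ m) \<partial>lborel))"
  by (rule arg_cong)
 also have "\<dots> = (\<integral>\<^sup>+\<theta>. ennreal (wgt p \<theta> * (1 - cos (\<theta> * z)) ^ m) \<partial>lborel)"
 proof -
  have "ennreal (\<bar>z\<bar> powr p) * ennreal (\<bar>z\<bar> powr (- p)) = 1"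
   using False by (simp add: ennreal_mult'[symmetric] powr_add[symmetric])
  then show ?thesis by (simp add: mult.assoc[symmetric])
 qed
 finally show ?thesis by (simp add: ennreal_mult'' mult.commute)
qed

end

lemma gauss_cos: "(LINT \<xi>|std_normal_distribution. cos (s * \<xi>)) = exp (- (s\<^sup>2) / 2)"
proof -
 interpret real_distribution std_normal_distribution by (rule real_dist_normal_dist)
 have i: "integrable std_normal_distribution (\<lambda>\<xi>. iexp (s * \<xi>))"
  by (rule integrable_const_bound[where B=1]) auto
 have "complex_of_real (exp (- (s\<^sup>2) / 2)) = (LINT \<xi>|std_normal_distribution. iexp (s * \<xi>))"
  using char_std_normal_distribution unfolding char_def by metis
 then have "exp (- (s\<^sup>2) / 2) = Re (LINT \<xi>|std_normal_distribution. iexp (s * \<xi>))"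
  by (metis Re_complex_of_real)
 also have "\<dots> = (LINT \<xi>|std_normal_distribution. Re (iexp (s * \<xi>)))"
  by (rule integral_Re[OF i, symmetric])
 also have "\<dots> = (LINT \<xi>|std_normal_distribution. cos (s * \<xi>))" by (simp add: Re_exp)
 finally show ?thesis by simp
qed

lemma gauss_trig_sum:
 "(\<Sum>(q, \<kappa>)\<leftarrow>xs. q * exp (- ((\<kappa> * c)\<^sup>2) / 2)) = (LINT \<xi>|std_normal_distribution. (\<Sum>(q, \<kappa>)\<leftarrow>xs. q * cos (\<kappa> * (c * \<xi>))))"
proof -
 interpret real_distribution std_normal_distribution by (rule real_dist_normal_dist)
 have i: "integrable std_normal_distribution (\<lambda>\<xi>. cos (s * \<xi>))" for s
  by (rule integrable_const_bound[where B=1]) auto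
 have "integrable std_normal_distribution (\<lambda>\<xi>. (\<Sum>(q, \<kappa>)\<leftarrow>xs. q * cos (\<kappa> * (c * \<xi>)))) \<and>
  (\<Sum>(q, \<kappa>)\<leftarrow>xs. q * exp (- ((\<kappa> * c)\<^sup>2) / 2)) = (LINT \<xi>|std_normal_distribution. (\<Sum>(q, \<kappa>)\<leftarrow>xs. q * cos (\<kappa> * (c * \<xi>))))"
 proof (induction xs)
  case (Cons a xs)
  obtain q \<kappa> where a: "a = (q, \<kappa>)" by (cases a)
  have j: "integrable std_normal_distribution (\<lambda>\<xi>. q * cos (\<kappa> * (c * \<xi>)))"
   using i[of "\<kappa> * c"] by (simp add: mult.assoc)
  have "(LINT \<xi>|std_normal_distribution. q * cos (\<kappa> * (c * \<xi>))) = q * exp (- ((\<kappa> * c)\<^sup>2) / 2)"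
   using gauss_cos[of "\<kappa> * c"] by (simp add: mult.assoc)
  then show ?case using Cons j unfolding a list.map sum_list.Cons prod.case by (simp only: Bochner_Integration.integral_add Bochner_Integration.integrable_add)
 qed simp
 then show ?thesis by simp
qed

text \<open>The Gamma integral under the substitution \<open>u = x\<^sup>2 / 2\<close>.\<close>

lemma gauss_abs_moment:
 fixes p :: real assumes p: "0 < p"
 shows "(\<integral>\<^sup>+\<xi>. ennreal (\<bar>\<xi>\<bar> powr p) \<partial>std_normal_distribution) = ennreal (2 powr (p / 2) * Gamma ((p + 1) / 2) / sqrt pi)"
proof -
 let ?s = "(p + 1) / 2"
 have s: "0 < ?s" using p by simp
 let ?f = "\<lambda>u::real. u powr (?s - 1) / exp u"
 have ein: "einterval 0 \<infinity> = {0::real<..}" by (auto simp: einterval_def zero_ereal_def)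
 have hi: "(?f has_integral Gamma ?s) {0..}" by (rule Gamma_integral_real[OF s])
 have nG: "(\<integral>\<^sup>+t. ennreal (?f t) * indicator {0..} t \<partial>lborel) = ennreal (Gamma ?s)"
  by (rule nn_integral_has_integral_lebesgue'[OF _ hi]) auto
 have G0: "0 < Gamma ?s" using s by (rule Gamma_real_pos)
 have fb: "has_bochner_integral lborel (\<lambda>t. ?f t * indicator {0..} t) (Gamma ?s)"
 proof (rule has_bochner_integral_nn_integral)
  show "(\<integral>\<^sup>+t. ennreal (?f t * indicator {0..} t) \<partial>lborel) = ennreal (Gamma ?s)"
   unfolding nG[symmetric] by (intro nn_integral_cong) (auto split: split_indicator)
 qed (use G0 in auto)
 have fb': "has_bochner_integral lborel (\<lambda>t. indicator {0<..} t *\<^sub>R ?f t) (Gamma ?s)"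
  by (rule has_bochner_integral_cong_AE[THEN iffD1, OF _ _ _ fb])
    (measurable, rule eventually_mono[OF AE_lborel_singleton[of 0]], auto split: split_indicator)
 \<comment> \<open>The substitution x = sqrt (2 * u) turns the Gamma integral into the Gaussian moment.\<close>
 let ?h = "\<lambda>x::real. x powr p / exp (x\<^sup>2 / 2)"
 let ?w = "\<lambda>u::real. sqrt (2 * u)"
 have hw: "?h (?w u) * (1 / ?w u) = 2 powr ((p - 1) / 2) * ?f u" if u: "0 < u" for u
 proof -
  have e: "?s - 1 = (p - 1) / 2" by (simp add: field_simps)
  have "?w u powr p / ?w u = ?w u powr (p - 1)" using u by (simp add: powr_diff)
  also have "\<dots> = (2 * u) powr (1 / 2 * (p - 1))" using u by (simp only: powr_half_sqrt[symmetric] powr_powr)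
  also have "\<dots> = 2 powr ((p - 1) / 2) * u powr ((p - 1) / 2)" using u by (simp add: powr_mult)
  finally show ?thesis using u unfolding e by (simp add: field_simps)
 qed
 have fw: "set_integrable lborel (einterval 0 \<infinity>) (\<lambda>u. 2 powr ((p - 1) / 2) * ?f u)"
  by (intro set_integrable_mult_right) (use fb' in \<open>simp add: set_integrable_def ein has_bochner_integral_iff\<close>)
 have fhw: "set_integrable lborel (einterval 0 \<infinity>) (\<lambda>u. ?h (?w u) * (1 / ?w u))"
  by (rule set_integrable_cong[THEN iffD2, OF refl refl _ fw]) (rule hw, simp add: ein)
 have A: "((ereal \<circ> ?w \<circ> real_of_ereal) \<longlongrightarrow> 0) (at_right 0)"
 proof -
  have "(?w \<longlongrightarrow> 0) (at_right 0)" by real_asymp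
  then have "((\<lambda>x::real. ereal (?w x)) \<longlongrightarrow> ereal 0) (at_right 0)" by (rule tendsto_ereal)
  then show ?thesis unfolding zero_ereal_def ereal_tendsto_simps by (simp add: comp_def)
 qed
 have B: "((ereal \<circ> ?w \<circ> real_of_ereal) \<longlongrightarrow> \<infinity>) (at_left \<infinity>)"
 proof -
  have "filterlim ?w at_top at_top" by real_asymp
  then show ?thesis unfolding ereal_tendsto_simps by (simp add: comp_def)
 qed
 have d: "DERIV ?w x :> 1 / ?w x" if "0 < x" for x using that by (auto intro!: derivative_eq_intros simp: field_simps)
 have T: "set_integrable lborel (einterval 0 \<infinity>) ?h \<and> (LBINT u=0..\<infinity>. ?h u) = (LBINT x=0..\<infinity>. (?h (?w x) * (1 / ?w x)))"
 proof -
  have 1: "DERIV ?w x :> 1 / ?w x" if "0 < ereal x" "ereal x < \<infinity>" for x using d that by simp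
  have 2: "isCont ?h (?w x)" if "0 < ereal x" "ereal x < \<infinity>" for x using that by (auto intro!: continuous_intros)
  have 3: "isCont (\<lambda>x. 1 / ?w x) x" if "0 < ereal x" "ereal x < \<infinity>" for x using that by (auto intro!: continuous_intros)
  have 4: "0 \<le> ?h (?w x)" if "0 < ereal x" "ereal x < \<infinity>" for x by simp
  have 5: "0 \<le> 1 / ?w x" if "0 \<le> ereal x" "ereal x \<le> \<infinity>" for x using that by simp
  have 0: "(0::ereal) < \<infinity>" by simp
  show ?thesis
   using interval_integral_substitution_nonneg[where f="?h" and g="?w" and g'="\<lambda>x. 1 / ?w x", OF 0 1 2 3 4 5 A B fhw] by blast
 qed
 have v: "(LBINT x=0..\<infinity>. (?h (?w x) * (1 / ?w x))) = 2 powr ((p - 1) / 2) * Gamma ?s"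
 proof -
  have "(LBINT x=0..\<infinity>. (?h (?w x) * (1 / ?w x))) = (LBINT x:{0<..}. 2 powr ((p - 1) / 2) * ?f x)"
   unfolding interval_lebesgue_integral_def ein
   by (subst if_P, simp) (rule set_lebesgue_integral_cong, simp, rule allI, rule impI, rule hw, simp)
  also have "\<dots> = 2 powr ((p - 1) / 2) * Gamma ?s"
   unfolding set_integral_mult_right using fb' by (simp add: set_lebesgue_integral_def has_bochner_integral_iff)
  finally show ?thesis .
 qed
 have hb: "has_bochner_integral lborel (\<lambda>x. indicator {0<..} x *\<^sub>R ?h x) (2 powr ((p - 1) / 2) * Gamma ?s)"
  using T v by (simp add: interval_lebesgue_integral_def set_lebesgue_integral_def ein has_bochner_integral_iff set_integrable_def)
 define k where "k = 2 powr ((p - 1) / 2) / sqrt (2 * pi)"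
 have pt: "std_normal_density x * \<bar>x\<bar> powr p = 1 / sqrt (2 * pi) * ?h x" if x: "0 < x" for x
  using x by (simp add: std_normal_density_def exp_minus field_simps)
 have hb2: "has_bochner_integral lborel (\<lambda>x. indicator {0<..} x *\<^sub>R (std_normal_density x * \<bar>x\<bar> powr p)) (k * Gamma ?s)"
 proof -
  have "has_bochner_integral lborel (\<lambda>x. 1 / sqrt (2 * pi) * (indicator {0<..} x *\<^sub>R ?h x)) (1 / sqrt (2 * pi) * (2 powr ((p - 1) / 2) * Gamma ?s))"
   by (rule has_bochner_integral_mult_right) (rule hb)
  moreover have "(\<lambda>x. 1 / sqrt (2 * pi) * (indicator {0<..} x *\<^sub>R ?h x)) = (\<lambda>x. indicator {0<..} x *\<^sub>R (std_normal_density x * \<bar>x\<bar> powr p))"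
   using pt by (auto simp: fun_eq_iff split: split_indicator)
  ultimately show ?thesis by (simp add: k_def)
 qed
 have hb3: "has_bochner_integral lborel (\<lambda>x. indicator {0..} x *\<^sub>R (std_normal_density x * \<bar>x\<bar> powr p)) (k * Gamma ?s)"
  by (rule has_bochner_integral_cong_AE[THEN iffD1, OF _ _ _ hb2])
    (measurable, rule eventually_mono[OF AE_lborel_singleton[of 0]], auto split: split_indicator)
 have hb4: "has_bochner_integral lborel (\<lambda>x. std_normal_density x * \<bar>x\<bar> powr p) (2 * (k * Gamma ?s))"
  using has_bochner_integral_even_function[OF hb3] by (simp add: std_normal_density_def)
 have "(\<integral>\<^sup>+\<xi>. ennreal (\<bar>\<xi>\<bar> powr p) \<partial>std_normal_distribution) = (\<integral>\<^sup>+x. ennreal (std_normal_density x * \<bar>x\<bar> powr p) \<partial>lborel)"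
  by (subst nn_integral_density) (auto simp: ennreal_mult')
 also have "\<dots> = ennreal (2 * (k * Gamma ?s))"
  using hb4 by (subst nn_integral_eq_integral) (auto simp: has_bochner_integral_iff)
 also have "2 * (k * Gamma ?s) = 2 powr (p / 2) * Gamma ?s / sqrt pi"
 proof -
  have "2 * 2 powr ((p - 1) / 2) = 2 powr (p / 2) * sqrt 2"
  proof -
   have "2 * 2 powr ((p - 1) / 2) = 2 powr (1 + (p - 1) / 2)" by (simp add: powr_add)
   also have "1 + (p - 1) / 2 = p / 2 + 1 / 2" by (simp add: field_simps)
   finally show ?thesis by (simp add: powr_add powr_half_sqrt)
  qed
  then show ?thesis unfolding k_def real_sqrt_mult by (simp add: field_simps)
 qed
 finally show ?thesis .
qed

text \<open>The Gaussian mean of \<open>(1 - cos) ^ m\<close> at scale \<open>s\<close>, which the spatial average of the power at one frequency approaches.\<close>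

definition gauss_cos_power :: "nat \<Rightarrow> real \<Rightarrow> real" where
 "gauss_cos_power m s = (LINT \<xi>|std_normal_distribution. (1 - cos (s * \<xi>)) ^ m)"

lemma gauss_cos_power_integrable:
 "integrable std_normal_distribution (\<lambda>\<xi>. (1 - cos (s * \<xi>)) ^ m)"
proof -
 interpret real_distribution std_normal_distribution by (rule real_dist_normal_dist)
 show ?thesis by (rule integrable_const_bound[where B="2 ^ m"]) (rule AE_I2, simp only: real_norm_def abs_of_nonneg[OF one_minus_cos_power_bounds(1)] one_minus_cos_power_bounds(2), measurable)
qed

lemma gauss_cos_power_nonneg: "0 \<le> gauss_cos_power m s"
 unfolding gauss_cos_power_def by (rule Bochner_Integration.integral_nonneg) (rule one_minus_cos_power_bounds)

lemma gauss_cos_power_le: "gauss_cos_power m s \<le> 2 ^ m"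
proof -
 interpret real_distribution std_normal_distribution by (rule real_dist_normal_dist)
 have "gauss_cos_power m s \<le> (LINT \<xi>|std_normal_distribution. 2 ^ m)"
  unfolding gauss_cos_power_def by (rule integral_mono[OF gauss_cos_power_integrable]) (auto simp: one_minus_cos_power_bounds)
 then show ?thesis using prob_space by simp
qed

lemma gauss_cos_power_le_power:
 "gauss_cos_power m s \<le> s ^ (2 * m) * fact (2 * m)"
proof -
 have i: "integrable std_normal_distribution (\<lambda>\<xi>. \<xi> ^ (2 * m))"
  by (subst integrable_density) (auto intro!: integrable_std_normal_moment)
 have e: "(LINT \<xi>|std_normal_distribution. \<xi> ^ (2 * m)) = fact (2 * m) / (2 ^ m * fact m)"
  by (subst integral_density) (auto intro: integral_std_normal_moment_even)
 have "gauss_cos_power m s \<le> (LINT \<xi>|std_normal_distribution. s ^ (2 * m) * \<xi> ^ (2 * m))"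
  unfolding gauss_cos_power_def
  by (rule integral_mono[OF gauss_cos_power_integrable integrable_mult_right[OF i]])
    (simp only: power_mult_distrib[symmetric] one_minus_cos_power_bounds)
 also have "\<dots> = s ^ (2 * m) * (fact (2 * m) / (2 ^ m * fact m))" unfolding integral_mult_right_zero e ..
 also have "\<dots> \<le> s ^ (2 * m) * fact (2 * m)"
 proof (rule mult_left_mono)
  have "1 * 1 \<le> (2::real) ^ m * fact m" by (rule mult_mono) auto
  then show "fact (2 * m) / (2 ^ m * fact m) \<le> (fact (2 * m) :: real)"
   using frac_le[of "fact (2 * m)" "fact (2 * m)" 1 "2 ^ m * fact m :: real"] by simp
 qed simp
 finally show ?thesis .
qed

text \<open>Tonelli exchanges the Gaussian mean with the mixture, leaving an absolute moment of the Gaussian.\<close>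

lemma (in power_rep) gauss_representation:
 assumes c: "0 \<le> c"
 shows "(\<integral>\<^sup>+\<theta>. ennreal (wgt p \<theta> * gauss_cos_power m (\<theta> * c)) \<partial>lborel)
  = ennreal (CJ * (c powr p * (2 powr (p / 2) * Gamma ((p + 1) / 2) / sqrt pi)))"
proof -
 interpret real_distribution std_normal_distribution by (rule real_dist_normal_dist)
 interpret P: pair_sigma_finite lborel std_normal_distribution ..
 have "(\<integral>\<^sup>+\<theta>. ennreal (wgt p \<theta> * gauss_cos_power m (\<theta> * c)) \<partial>lborel)
  = (\<integral>\<^sup>+\<theta>. \<integral>\<^sup>+\<xi>. ennreal (wgt p \<theta> * (1 - cos (\<theta> * (c * \<xi>))) ^ m) \<partial>std_normal_distribution \<partial>lborel)"
 proof (rule nn_integral_cong)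
  fix \<theta> :: real
  have "ennreal (gauss_cos_power m (\<theta> * c)) = (\<integral>\<^sup>+\<xi>. ennreal ((1 - cos (\<theta> * c * \<xi>)) ^ m) \<partial>std_normal_distribution)"
   unfolding gauss_cos_power_def
   by (rule nn_integral_eq_integral[symmetric, OF gauss_cos_power_integrable]) (auto simp: one_minus_cos_power_bounds)
  then show "ennreal (wgt p \<theta> * gauss_cos_power m (\<theta> * c)) = (\<integral>\<^sup>+\<xi>. ennreal (wgt p \<theta> * (1 - cos (\<theta> * (c * \<xi>))) ^ m) \<partial>std_normal_distribution)"
   by (simp add: ennreal_mult' wgt_nonneg nn_integral_cmult mult.assoc)
 qed
 also have "\<dots> = (\<integral>\<^sup>+\<xi>. \<integral>\<^sup>+\<theta>. ennreal (wgt p \<theta> * (1 - cos (\<theta> * (c * \<xi>))) ^ m) \<partial>lborel \<partial>std_normal_distribution)"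
  by (rule P.Fubini'[symmetric]) measurable
 also have "\<dots> = (\<integral>\<^sup>+\<xi>. ennreal (CJ * c powr p) * ennreal (\<bar>\<xi>\<bar> powr p) \<partial>std_normal_distribution)"
 proof (rule nn_integral_cong)
  fix \<xi> :: real
  have "\<bar>c * \<xi>\<bar> powr p = c powr p * \<bar>\<xi>\<bar> powr p" using c by (simp add: abs_mult powr_mult)
  then show "(\<integral>\<^sup>+\<theta>. ennreal (wgt p \<theta> * (1 - cos (\<theta> * (c * \<xi>))) ^ m) \<partial>lborel) = ennreal (CJ * c powr p) * ennreal (\<bar>\<xi>\<bar> powr p)"
   unfolding power_representation by (simp add: ennreal_mult''[symmetric] mult.assoc)
 qed
 also have "\<dots> = ennreal (CJ * c powr p) * ennreal (2 powr (p / 2) * Gamma ((p + 1) / 2) / sqrt pi)"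
  using gauss_abs_moment[of p] p by (subst nn_integral_cmult) auto
 also have "\<dots> = ennreal (CJ * (c powr p * (2 powr (p / 2) * Gamma ((p + 1) / 2) / sqrt pi)))"
  using CJ_pos by (subst ennreal_mult'[symmetric]) (simp_all add: mult.assoc)
 finally show ?thesis .
qed

text \<open>The same finite expansion serves the cosine and, by the Gaussian characteristic function, its mean; frequency by frequency the difference is the one controlled by \<open>XX_second_moment\<close>.\<close>

lemma trig_expansion:
 obtains n :: nat and q \<kappa> :: "nat \<Rightarrow> real" where
  "\<And>z. (1 - cos z) ^ m = (\<Sum>i<n. q i * cos (\<kappa> i * z))"
  "\<And>s. gauss_cos_power m s = (\<Sum>i<n. q i * exp (- ((\<kappa> i * s)\<^sup>2) / 2))"
proof -
 obtain xs where xs: "\<And>z::real. (1 - cos z) ^ m = (\<Sum>(q, \<kappa>)\<leftarrow>xs. q * cos (\<kappa> * z))"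
  using one_minus_cos_power_trig[of m] by blast
 have g: "gauss_cos_power m s = (\<Sum>i<length xs. fst (xs ! i) * exp (- ((snd (xs ! i) * s)\<^sup>2) / 2))" for s
  unfolding gauss_cos_power_def xs gauss_trig_sum[symmetric] unfolding sum_list_sum_nth lessThan_atLeast0 by (intro sum.cong) (auto simp: split_def)
 have c: "(1 - cos z) ^ m = (\<Sum>i<length xs. fst (xs ! i) * cos (snd (xs ! i) * z))" for z :: real
  unfolding xs sum_list_sum_nth lessThan_atLeast0 by (intro sum.cong) (auto simp: split_def)
 show ?thesis by (rule that[OF c g])
qed

section \<open>Convergence in mean with a rate\<close>

lemma gauss_cos_power_continuous: "continuous_on UNIV (gauss_cos_power m)"
proof -
 obtain n :: nat and q \<kappa> :: "nat \<Rightarrow> real" where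
  e: "\<And>s. gauss_cos_power m s = (\<Sum>i<n. q i * exp (- ((\<kappa> i * s)\<^sup>2) / 2))"
  using trig_expansion[of m] by metis
 show ?thesis unfolding e[abs_def] by (intro continuous_intros) auto
qed

lemma gauss_cos_power_measurable [measurable]: "gauss_cos_power m \<in> borel_measurable borel"
 by (rule borel_measurable_continuous_onI[OF gauss_cos_power_continuous])

text \<open>Tonelli's theorem for an integral that is written partly as a Bochner integral.\<close>

lemma nn_integral_weight_swap:
 fixes f :: "real \<Rightarrow> 'x \<Rightarrow> real" and w :: "real \<Rightarrow> real"
 assumes N: "sigma_finite_measure N"
  and f [measurable]: "(\<lambda>(\<theta>, x). f \<theta> x) \<in> borel_measurable (lborel \<Otimes>\<^sub>M N)"
  and w [measurable]: "w \<in> borel_measurable borel" "\<And>\<theta>. 0 \<le> w \<theta>"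
  and f0: "\<And>\<theta> x. 0 \<le> f \<theta> x" and fi: "\<And>\<theta>. integrable N (f \<theta>)"
  and g: "\<And>x. (\<integral>\<^sup>+\<theta>. ennreal (w \<theta> * f \<theta> x) \<partial>lborel) = ennreal (g x)" "integrable N g" "\<And>x. 0 \<le> g x"
 shows "(\<integral>\<^sup>+\<theta>. ennreal (w \<theta> * (LINT x|N. f \<theta> x)) \<partial>lborel) = ennreal (LINT x|N. g x)"
proof -
 interpret N: sigma_finite_measure N by (rule N)
 interpret P: pair_sigma_finite lborel N ..
 have "(\<integral>\<^sup>+\<theta>. ennreal (w \<theta> * (LINT x|N. f \<theta> x)) \<partial>lborel) = (\<integral>\<^sup>+\<theta>. \<integral>\<^sup>+x. ennreal (w \<theta> * f \<theta> x) \<partial>N \<partial>lborel)"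
 proof (rule nn_integral_cong)
  fix \<theta>
  have "(\<integral>\<^sup>+x. ennreal (w \<theta> * f \<theta> x) \<partial>N) = ennreal (LINT x|N. w \<theta> * f \<theta> x)"
   by (rule nn_integral_eq_integral[OF integrable_mult_right[OF fi]]) (simp add: w f0)
  then show "ennreal (w \<theta> * (LINT x|N. f \<theta> x)) = (\<integral>\<^sup>+x. ennreal (w \<theta> * f \<theta> x) \<partial>N)" by simp
 qed
 also have "\<dots> = (\<integral>\<^sup>+x. \<integral>\<^sup>+\<theta>. ennreal (w \<theta> * f \<theta> x) \<partial>lborel \<partial>N)"
  by (rule P.Fubini'[symmetric]) measurable
 also have "\<dots> = ennreal (LINT x|N. g x)"
  unfolding g by (rule nn_integral_eq_integral) (auto intro: g)
 finally show ?thesis .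
qed

lemma nn_integral_weight_diff:
 fixes u v w :: "real \<Rightarrow> real"
 assumes [measurable]: "u \<in> borel_measurable borel" "v \<in> borel_measurable borel" "w \<in> borel_measurable borel"
  and w: "\<And>\<theta>. 0 \<le> w \<theta>" and u0: "\<And>\<theta>. 0 \<le> u \<theta>" and v0: "\<And>\<theta>. 0 \<le> v \<theta>"
  and u: "(\<integral>\<^sup>+\<theta>. ennreal (w \<theta> * u \<theta>) \<partial>lborel) = ennreal x" "0 \<le> x"
  and v: "(\<integral>\<^sup>+\<theta>. ennreal (w \<theta> * v \<theta>) \<partial>lborel) = ennreal y" "0 \<le> y"
 shows "ennreal \<bar>x - y\<bar> \<le> (\<integral>\<^sup>+\<theta>. ennreal (w \<theta> * \<bar>u \<theta> - v \<theta>\<bar>) \<partial>lborel)"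
proof -
 let ?D = "\<integral>\<^sup>+\<theta>. ennreal (w \<theta> * \<bar>u \<theta> - v \<theta>\<bar>) \<partial>lborel"
 have le: "(\<integral>\<^sup>+\<theta>. ennreal (w \<theta> * f \<theta>) \<partial>lborel) \<le> (\<integral>\<^sup>+\<theta>. ennreal (w \<theta> * g \<theta>) \<partial>lborel) + ?D"
  if [measurable]: "f \<in> borel_measurable borel" "g \<in> borel_measurable borel" and g0: "\<And>\<theta>. 0 \<le> g \<theta>"
   and d: "\<And>\<theta>. f \<theta> \<le> g \<theta> + \<bar>u \<theta> - v \<theta>\<bar>" for f g
 proof -
  have "(\<integral>\<^sup>+\<theta>. ennreal (w \<theta> * f \<theta>) \<partial>lborel) \<le> (\<integral>\<^sup>+\<theta>. ennreal (w \<theta> * g \<theta>) + ennreal (w \<theta> * \<bar>u \<theta> - v \<theta>\<bar>) \<partial>lborel)"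
  proof (rule nn_integral_mono)
   fix \<theta>
   have "w \<theta> * f \<theta> \<le> w \<theta> * g \<theta> + w \<theta> * \<bar>u \<theta> - v \<theta>\<bar>"
    using mult_left_mono[OF d w] by (simp only: distrib_left)
   then have "ennreal (w \<theta> * f \<theta>) \<le> ennreal (w \<theta> * g \<theta> + w \<theta> * \<bar>u \<theta> - v \<theta>\<bar>)" by (rule ennreal_leI)
   then show "ennreal (w \<theta> * f \<theta>) \<le> ennreal (w \<theta> * g \<theta>) + ennreal (w \<theta> * \<bar>u \<theta> - v \<theta>\<bar>)"
    using w g0 by (simp add: ennreal_plus)
  qed
  then show ?thesis by (simp add: nn_integral_add)
 qed
 have 1: "ennreal x \<le> ennreal y + ?D" unfolding u(1)[symmetric] v(1)[symmetric] by (rule le) (auto simp: v0)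
 have 2: "ennreal y \<le> ennreal x + ?D" unfolding u(1)[symmetric] v(1)[symmetric] by (rule le) (auto simp: u0)
 show ?thesis
 proof (cases "x \<le> y")
  case True
  have "ennreal (y - x) \<le> ?D" using ennreal_minus_mono[OF 2 order_refl, of "ennreal x"] True u(2)
   by (simp add: ennreal_minus)
  then show ?thesis using True by (simp add: abs_if)
 next
  case False
  have "ennreal (x - y) \<le> ?D" using ennreal_minus_mono[OF 1 order_refl, of "ennreal y"] False v(2)
   by (simp add: ennreal_minus)
  then show ?thesis using False by (simp add: abs_if)
 qed
qed

text \<open>Interpolation of two bounds. The exponent 1/8 on the decaying bound is small enough to keep the weights integrable at infinity, where that bound grows like the fourth power of the frequency, and at 0 because \<open>7 * m / 4 > p\<close>.\<close>

lemma le_geometric_mean: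
 fixes x A B :: ennreal and u v :: real
 assumes "0 \<le> u" "0 \<le> v" "x \<le> ennreal u" "x \<le> ennreal v"
 shows "x \<le> ennreal (u powr (7/8) * v powr (1/8))"
proof -
 obtain r where r: "x = ennreal r" "0 \<le> r" using assms(3) by (cases x) (auto simp: top_unique)
 then have le: "r \<le> u" "r \<le> v" using assms by auto
 have "r = r powr (7/8) * r powr (1/8)" using r(2) by (simp add: powr_add[symmetric])
 also have "\<dots> \<le> u powr (7/8) * v powr (1/8)" using le r(2) by (intro mult_mono powr_mono2) auto
 finally show ?thesis unfolding r(1) by (rule ennreal_leI)
qed

text \<open>The \<open>p\<close>-th absolute moment of a Gaussian variable of variance 4.\<close>

definition bm_const :: "real \<Rightarrow> real" where
 "bm_const p = 2 powr (3 * p / 2) / sqrt pi * Gamma ((p + 1) / 2)"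

locale local_time_power = cont_blt M B L + power_rep p m
 for M :: "'w measure" and B L p m +
 fixes t a b :: real
 assumes t: "0 \<le> t" and ab: "a \<le> b"
begin

definition rate :: "real \<Rightarrow> real \<Rightarrow> 'w \<Rightarrow> real" where
 "rate h x w = (L (x + h) t w - L x t w) / sqrt h"

lemma rate_measurable [measurable (raw)]:
 assumes [measurable]: "f \<in> borel_measurable N" "k \<in> measurable N M"
 shows "(\<lambda>z. rate h (f z) (k z)) \<in> borel_measurable N"
 unfolding rate_def by measurable

lemma rate_continuous: "continuous_on UNIV (\<lambda>x. rate h x w)"
 unfolding rate_def
 by (cases "h = 0") (auto intro!: continuous_intros continuous_on_compose2[OF L_cont_x])

lemma Iv_integrable_continuous:
 fixes f :: "real \<Rightarrow> real"
 assumes "continuous_on UNIV f" shows "integrable (Iv a b) f"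
proof -
 have [measurable]: "f \<in> borel_measurable borel" by (rule borel_measurable_continuous_onI[OF assms])
 have "set_integrable lborel {a..b} f"
  by (rule borel_integrable_atLeastAtMost') (rule continuous_on_subset[OF assms], simp)
 then show ?thesis
  unfolding Iv_def set_integrable_def by (subst integrable_density) auto
qed

definition rate_defect :: "real \<Rightarrow> 'w \<Rightarrow> real" where
 "rate_defect h w = (LINT x|Iv a b. \<bar>rate h x w\<bar> powr p) - bm_const p * (LINT x|Iv a b. L x t w powr (p / 2))"

text \<open>The contribution of one frequency to the difference \<open>rate_defect\<close>.\<close>

definition freq_defect :: "real \<Rightarrow> real \<Rightarrow> 'w \<Rightarrow> real" where
 "freq_defect h \<theta> w = (LINT x|Iv a b. (1 - cos (\<theta> * rate h x w)) ^ m - gauss_cos_power m (\<theta> * (2 * sqrt (L x t w))))"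

lemma continuous_terms:
 "continuous_on UNIV (\<lambda>x. (1 - cos (\<theta> * rate h x w)) ^ m)"
 "continuous_on UNIV (\<lambda>x. gauss_cos_power m (\<theta> * (2 * sqrt (L x t w))))"
 "continuous_on UNIV (\<lambda>x. \<bar>rate h x w\<bar> powr p)"
 "continuous_on UNIV (\<lambda>x. L x t w powr (p / 2))"
 using p by (auto intro!: continuous_intros rate_continuous L_cont_x L_nonneg continuous_on_compose2[OF gauss_cos_power_continuous[of m]] continuous_on_powr')

text \<open>Both terms of the defect are mixtures with the same positive weights, so their distance is at most the mixture of the distances.\<close>

lemma rate_defect_le:
 "ennreal (CJ * \<bar>rate_defect h w\<bar>) \<le> (\<integral>\<^sup>+\<theta>. ennreal (wgt p \<theta> * \<bar>freq_defect h \<theta> w\<bar>) \<partial>lborel)"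
proof -
 interpret I: finite_measure "Iv a b" by (rule Iv_finite)
 have sI: "sigma_finite_measure (Iv a b)" by unfold_locales
 have [measurable]: "(\<lambda>x. L x t w) \<in> borel_measurable borel" by (rule borel_measurable_continuous_onI[OF L_cont_x])
 have [measurable]: "(\<lambda>x. rate h x w) \<in> borel_measurable borel" by (rule borel_measurable_continuous_onI[OF rate_continuous])
 let ?u = "\<lambda>\<theta>. LINT x|Iv a b. (1 - cos (\<theta> * rate h x w)) ^ m"
 let ?v = "\<lambda>\<theta>. LINT x|Iv a b. gauss_cos_power m (\<theta> * (2 * sqrt (L x t w)))"
 let ?X = "LINT x|Iv a b. CJ * \<bar>rate h x w\<bar> powr p"
 let ?Y = "LINT x|Iv a b. CJ * (bm_const p * L x t w powr (p / 2))"
 have C0: "0 \<le> bm_const p" using p unfolding bm_const_def by (intro mult_nonneg_nonneg divide_nonneg_nonneg less_imp_le[OF Gamma_real_pos]) auto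
 have X: "(\<integral>\<^sup>+\<theta>. ennreal (wgt p \<theta> * ?u \<theta>) \<partial>lborel) = ennreal ?X"
 proof (rule nn_integral_weight_swap[OF sI])
  show "(\<integral>\<^sup>+\<theta>. ennreal (wgt p \<theta> * (1 - cos (\<theta> * rate h x w)) ^ m) \<partial>lborel) = ennreal (CJ * \<bar>rate h x w\<bar> powr p)" for x
   by (rule power_representation)
 qed (use CJ_pos in \<open>auto simp: wgt_nonneg one_minus_cos_power_bounds intro!: Iv_integrable_continuous continuous_terms integrable_mult_right\<close>)
 have Y: "(\<integral>\<^sup>+\<theta>. ennreal (wgt p \<theta> * ?v \<theta>) \<partial>lborel) = ennreal ?Y"
 proof (rule nn_integral_weight_swap[OF sI])
  fix x
  have "(2 * sqrt (L x t w)) powr p = 2 powr p * L x t w powr (p / 2)"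
   using L_nonneg[of x t w] by (simp add: powr_mult powr_powr flip: powr_half_sqrt)
  moreover have "2 powr p * 2 powr (p / 2) = (2::real) powr (3 * p / 2)"
   unfolding powr_add[symmetric] by (simp add: field_simps)
  ultimately have "(2 * sqrt (L x t w)) powr p * (2 powr (p / 2) * Gamma ((p + 1) / 2) / sqrt pi) = bm_const p * L x t w powr (p / 2)"
   unfolding bm_const_def by (simp add: field_simps)
  then show "(\<integral>\<^sup>+\<theta>. ennreal (wgt p \<theta> * gauss_cos_power m (\<theta> * (2 * sqrt (L x t w)))) \<partial>lborel) = ennreal (CJ * (bm_const p * L x t w powr (p / 2)))"
   using gauss_representation[of "2 * sqrt (L x t w)"] L_nonneg[of x t w] by simp
 qed (use CJ_pos C0 in \<open>auto simp: wgt_nonneg gauss_cos_power_nonneg intro!: Iv_integrable_continuous continuous_terms integrable_mult_right\<close>)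
 have um: "?u \<in> borel_measurable borel" "?v \<in> borel_measurable borel"
  by measurable
 have "ennreal \<bar>?X - ?Y\<bar> \<le> (\<integral>\<^sup>+\<theta>. ennreal (wgt p \<theta> * \<bar>?u \<theta> - ?v \<theta>\<bar>) \<partial>lborel)"
  by (rule nn_integral_weight_diff[OF um wgt_measurable wgt_nonneg _ _ X _ Y])
    (use CJ_pos C0 in \<open>auto intro!: integral_nonneg simp: one_minus_cos_power_bounds gauss_cos_power_nonneg\<close>)
 moreover have "?u \<theta> - ?v \<theta> = freq_defect h \<theta> w" for \<theta>
  unfolding freq_defect_def
  by (rule Bochner_Integration.integral_diff[symmetric]) (intro Iv_integrable_continuous continuous_terms)+
 moreover have "?X - ?Y = CJ * rate_defect h w"
  unfolding rate_defect_def by (simp add: right_diff_distrib)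
 ultimately show ?thesis using CJ_pos by (simp add: abs_mult)
qed

lemma freq_defect_measurable [measurable (raw)]:
 assumes [measurable]: "f \<in> borel_measurable N" "k \<in> measurable N M"
 shows "(\<lambda>z. freq_defect h (f z) (k z)) \<in> borel_measurable N"
proof -
 interpret I: finite_measure "Iv a b" by (rule Iv_finite)
 show ?thesis unfolding freq_defect_def by measurable
qed

lemma rate_defect_measurable [measurable]: "rate_defect h \<in> borel_measurable M"
proof -
 interpret I: finite_measure "Iv a b" by (rule Iv_finite)
 show ?thesis unfolding rate_defect_def by measurable
qed

lemma freq_integrand_continuous:
 "continuous_on UNIV (\<lambda>x. (1 - cos (\<theta> * rate h x w)) ^ m - gauss_cos_power m (\<theta> * (2 * sqrt (L x t w))))"
 by (intro continuous_on_diff continuous_terms)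

lemma freq_defect_bound: "\<bar>freq_defect h \<theta> w\<bar> \<le> (b - a) * 2 ^ m"
 unfolding freq_defect_def
proof (rule Iv_integral_bound[OF borel_measurable_continuous_onI[OF freq_integrand_continuous] _ ab])
 fix x
 show "\<bar>(1 - cos (\<theta> * rate h x w)) ^ m - gauss_cos_power m (\<theta> * (2 * sqrt (L x t w)))\<bar> \<le> 2 ^ m"
  using one_minus_cos_power_bounds[of "\<theta> * rate h x w" m] gauss_cos_power_nonneg[of m "\<theta> * (2 * sqrt (L x t w))"]
   gauss_cos_power_le[of m "\<theta> * (2 * sqrt (L x t w))"] by linarith
qed

lemma emeasure_Iv: "emeasure (Iv a b) UNIV = ennreal (b - a)"
 using finite_measure.emeasure_eq_measure[OF Iv_finite[of a b], of UNIV] unfolding Iv_measure[OF ab] .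

lemma freq_defect_trivial: "(\<integral>\<^sup>+w. ennreal \<bar>freq_defect h \<theta> w\<bar> \<partial>M) \<le> ennreal ((b - a) * 2 ^ m)"
proof -
 have "(\<integral>\<^sup>+w. ennreal \<bar>freq_defect h \<theta> w\<bar> \<partial>M) \<le> (\<integral>\<^sup>+w. ennreal ((b - a) * 2 ^ m) \<partial>M)"
  by (rule nn_integral_mono) (rule ennreal_leI, rule freq_defect_bound)
 then show ?thesis by (simp add: emeasure_space_1)
qed

definition rate_moment_bound :: real where
 "rate_moment_bound = 2 * ((8 * real m) ^ (2 * m) + exp ((t + 1) / 2) * (2 * fact (2 * m) * 4 ^ m))"

lemma m_pos: "1 \<le> m" using p m by (cases m) auto

lemma rate_moment:
 assumes h: "0 < h" "h \<le> 1"
 shows "integrable M (\<lambda>w. rate h x w ^ (2 * m))" "(LINT w|M. rate h x w ^ (2 * m)) \<le> rate_moment_bound"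
proof -
 have e: "rate h x w ^ (2 * m) = (L (x + h) t w - L x t w) ^ (2 * m) / h ^ m" for w
 proof -
  have "sqrt h ^ (2 * m) = h ^ m" using h by (simp add: power_mult)
  then show ?thesis unfolding rate_def power_divide by (rule arg_cong)
 qed
 have E: "integrable M (\<lambda>w. (L (x + h) t w - L x t w) ^ (2 * m))"
  "(LINT w|M. (L (x + h) t w - L x t w) ^ (2 * m)) \<le> 2 * ((8 * real m * h) ^ (2 * m) + exp ((t + 1) / 2) * (2 * fact (2 * m) * (4 * h) ^ m))"
  using L_even_moment[OF t less_imp_le[OF h(1)] m_pos] by auto
 show "integrable M (\<lambda>w. rate h x w ^ (2 * m))" unfolding e by (intro integrable_divide E(1))
 have hm: "0 < h ^ m" using h by simp
 have "(8 * real m * h) ^ (2 * m) = (8 * real m) ^ (2 * m) * (h ^ m * h ^ m)"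
  by (simp only: power_mult_distrib) (simp add: mult_2 power_add)
 also have "\<dots> \<le> (8 * real m) ^ (2 * m) * (h ^ m * 1)"
  using h by (intro mult_left_mono power_le_one) auto
 finally have 1: "(8 * real m * h) ^ (2 * m) \<le> (8 * real m) ^ (2 * m) * h ^ m" by simp
 have 2: "exp ((t + 1) / 2) * (2 * fact (2 * m) * (4 * h) ^ m) = exp ((t + 1) / 2) * (2 * fact (2 * m) * 4 ^ m) * h ^ m"
  unfolding power_mult_distrib by (simp only: mult.assoc)
 have "(LINT w|M. (L (x + h) t w - L x t w) ^ (2 * m)) \<le> rate_moment_bound * h ^ m"
  using order_trans[OF E(2)] 1 unfolding 2 rate_moment_bound_def by (simp only: distrib_right distrib_left mult.assoc)
 then show "(LINT w|M. rate h x w ^ (2 * m)) \<le> rate_moment_bound"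
  unfolding e integral_divide_zero using hm by (simp only: pos_divide_le_eq)
qed

definition low_freq_const :: real where
 "low_freq_const = (b - a) * (rate_moment_bound + 4 ^ m * fact (2 * m) * (exp ((t + 1) / 2) * (2 * fact m)))"

text \<open>At low frequencies cancellation is not needed: \<open>1 - cos\<close> is quadratic, and moments of the normalised increments are bounded uniformly in \<open>h\<close>.\<close>

lemma freq_defect_low:
 assumes h: "0 < h" "h \<le> 1"
 shows "(\<integral>\<^sup>+w. ennreal \<bar>freq_defect h \<theta> w\<bar> \<partial>M) \<le> ennreal (low_freq_const * \<theta> ^ (2 * m))"
proof -
 interpret I: finite_measure "Iv a b" by (rule Iv_finite)
 interpret P: pair_sigma_finite "Iv a b" M ..
 define c :: real where "c = 4 ^ m * fact (2 * m)"
 define T where "T = rate_moment_bound + c * (exp ((t + 1) / 2) * (2 * fact m))"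
 let ?G = "\<lambda>x w. \<theta> ^ (2 * m) * (rate h x w ^ (2 * m) + c * L x t w ^ m)"
 let ?d = "\<lambda>x w. (1 - cos (\<theta> * rate h x w)) ^ m - gauss_cos_power m (\<theta> * (2 * sqrt (L x t w)))"
 have c0: "0 \<le> c" unfolding c_def by simp
 have t0: "0 \<le> \<theta> ^ (2 * m)" unfolding power_mult by simp
 have pt: "\<bar>?d x w\<bar> \<le> ?G x w" for x w
 proof -
  have u: "(1 - cos (\<theta> * rate h x w)) ^ m \<le> \<theta> ^ (2 * m) * rate h x w ^ (2 * m)"
   using one_minus_cos_power_bounds(3)[of "\<theta> * rate h x w" m] by (simp only: power_mult_distrib)
  have "(2 * sqrt (L x t w)) ^ (2 * m) = 4 ^ m * L x t w ^ m"
   unfolding power_mult using L_nonneg[of x t w] by (simp add: power_mult_distrib)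
  then have v: "gauss_cos_power m (\<theta> * (2 * sqrt (L x t w))) \<le> \<theta> ^ (2 * m) * (c * L x t w ^ m)"
   using gauss_cos_power_le_power[of m "\<theta> * (2 * sqrt (L x t w))"] unfolding c_def power_mult_distrib[of \<theta>]
   by (simp only: mult_ac)
  have "0 \<le> \<theta> ^ (2 * m) * rate h x w ^ (2 * m)" "0 \<le> \<theta> ^ (2 * m) * (c * L x t w ^ m)"
   using t0 c0 L_nonneg[of x t w] by (auto intro!: mult_nonneg_nonneg simp: power_mult)
  then show ?thesis
   using u v one_minus_cos_power_bounds(1)[of "\<theta> * rate h x w" m] gauss_cos_power_nonneg[of m "\<theta> * (2 * sqrt (L x t w))"]
   unfolding distrib_left by linarith
 qed
 have "(\<integral>\<^sup>+w. ennreal \<bar>freq_defect h \<theta> w\<bar> \<partial>M) \<le> (\<integral>\<^sup>+w. \<integral>\<^sup>+x. ennreal (?G x w) \<partial>Iv a b \<partial>M)"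
 proof (rule nn_integral_mono)
  fix w
  have "ennreal (norm (LINT x|Iv a b. ?d x w)) \<le> (\<integral>\<^sup>+x. ennreal (norm (?d x w)) \<partial>Iv a b)"
   by (rule integral_norm_bound_ennreal[OF Iv_integrable_continuous[OF freq_integrand_continuous]])
  also have "\<dots> \<le> (\<integral>\<^sup>+x. ennreal (?G x w) \<partial>Iv a b)"
   by (rule nn_integral_mono) (rule ennreal_leI, simp only: real_norm_def pt)
  finally show "ennreal \<bar>freq_defect h \<theta> w\<bar> \<le> (\<integral>\<^sup>+x. ennreal (?G x w) \<partial>Iv a b)"
   unfolding freq_defect_def by (simp only: real_norm_def)
 qed
 moreover have "(\<integral>\<^sup>+w. \<integral>\<^sup>+x. ennreal (?G x w) \<partial>Iv a b \<partial>M) = (\<integral>\<^sup>+x. \<integral>\<^sup>+w. ennreal (?G x w) \<partial>M \<partial>Iv a b)"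
  by (rule P.Fubini') measurable
 moreover have "(\<integral>\<^sup>+x. \<integral>\<^sup>+w. ennreal (?G x w) \<partial>M \<partial>Iv a b) \<le> (\<integral>\<^sup>+x. ennreal (\<theta> ^ (2 * m) * T) \<partial>Iv a b)"
 proof (rule nn_integral_mono)
  fix x
  have i: "integrable M (\<lambda>w. c * L x t w ^ m)" by (intro integrable_mult_right L_moment(1)[OF t])
  have "(\<integral>\<^sup>+w. ennreal (?G x w) \<partial>M) = ennreal (LINT w|M. ?G x w)"
  proof (rule nn_integral_eq_integral)
   show "integrable M (?G x)" by (intro integrable_mult_right Bochner_Integration.integrable_add rate_moment(1)[OF h] i)
   show "AE w in M. 0 \<le> ?G x w" using order_trans[OF abs_ge_zero pt] by simp
  qed
  also have "(LINT w|M. ?G x w) = \<theta> ^ (2 * m) * ((LINT w|M. rate h x w ^ (2 * m)) + c * (LINT w|M. L x t w ^ m))"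
   unfolding integral_mult_right_zero Bochner_Integration.integral_add[OF rate_moment(1)[OF h] i] ..
  also have "ennreal \<dots> \<le> ennreal (\<theta> ^ (2 * m) * T)"
   unfolding T_def by (intro ennreal_leI mult_left_mono t0 add_mono rate_moment(2)[OF h] c0 L_moment(2)[OF t])
  finally show "(\<integral>\<^sup>+w. ennreal (?G x w) \<partial>M) \<le> ennreal (\<theta> ^ (2 * m) * T)" .
 qed
 moreover have "(\<integral>\<^sup>+x. ennreal (\<theta> ^ (2 * m) * T) \<partial>Iv a b) = ennreal (low_freq_const * \<theta> ^ (2 * m))"
 proof -
  have "(b - a) * (\<theta> ^ (2 * m) * T) = low_freq_const * \<theta> ^ (2 * m)"
   unfolding low_freq_const_def T_def c_def by (simp only: mult_ac)
  moreover have "(\<integral>\<^sup>+x. ennreal (\<theta> ^ (2 * m) * T) \<partial>Iv a b) = ennreal (b - a) * ennreal (\<theta> ^ (2 * m) * T)"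
   by (simp add: emeasure_Iv mult.commute)
  moreover have "ennreal (b - a) * ennreal (\<theta> ^ (2 * m) * T) = ennreal ((b - a) * (\<theta> ^ (2 * m) * T))"
   by (rule ennreal_mult'[symmetric]) (use ab in simp)
  ultimately show ?thesis by (simp only:)
 qed
 ultimately show ?thesis by order
qed

text \<open>Cancellation: the trigonometric expansion reduces to finitely many averages with small second moment. The growth in the frequency is polynomial.\<close>

lemma freq_defect_high:
 obtains K where "0 \<le> K" "\<And>h \<theta>. 0 < h \<Longrightarrow> h \<le> 1 \<Longrightarrow> 0 \<le> \<theta> \<Longrightarrow>
  (\<integral>\<^sup>+w. ennreal \<bar>freq_defect h \<theta> w\<bar> \<partial>M) \<le> ennreal (K * (1 + \<theta>) ^ 4 * h powr (1/32))"
proof (rule trig_expansion[of m])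
 fix n :: nat and q \<kappa> :: "nat \<Rightarrow> real"
 assume c: "\<And>z. (1 - cos z) ^ m = (\<Sum>i<n. q i * cos (\<kappa> i * z))"
  and g: "\<And>s. gauss_cos_power m s = (\<Sum>i<n. q i * exp (- ((\<kappa> i * s)\<^sup>2) / 2))"
 define K2 where "K2 = (exp ((t + 1) / 2) * (1872 * (b - a)\<^sup>2 + 16 * (b - a)) + 16 * (b - a)\<^sup>2) + 1"
 have K2: "1 \<le> K2" unfolding K2_def using ab by simp
 define K where "K = (\<Sum>i<n. \<bar>q i\<bar> * (sqrt K2 * (4 * (1 + \<bar>\<kappa> i\<bar>) ^ 4)))"
 have K0: "0 \<le> K" unfolding K_def using K2 by (intro sum_nonneg mult_nonneg_nonneg) auto
 show ?thesis
 proof (rule that[OF K0])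
  fix h \<theta> :: real assume h: "0 < h" "h \<le> 1" and th: "0 \<le> \<theta>"
  have fd: "freq_defect h \<theta> w = (\<Sum>i<n. q i * XX (\<kappa> i * \<theta>) h t a b w)" for w
  proof -
   have e: "(1 - cos (\<theta> * rate h x w)) ^ m - gauss_cos_power m (\<theta> * (2 * sqrt (L x t w))) = (\<Sum>i<n. q i * FF (\<kappa> i * \<theta>) h t x w)" for x
   proof -
    have "- ((\<kappa> i * (\<theta> * (2 * sqrt (L x t w))))\<^sup>2) / 2 = - 2 * (\<kappa> i * \<theta>)\<^sup>2 * L x t w" for i
    using L_nonneg[of x t w] by (simp add: power_mult_distrib)
    then show ?thesis
    unfolding c g FF_def rate_def right_diff_distrib sum_subtractf by (simp only: mult.assoc)
   qed
   have "integrable (Iv a b) (\<lambda>x. q i * FF (\<kappa> i * \<theta>) h t x w)" for i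
    by (intro integrable_mult_right Iv_integrable_bounded[OF FF_x_measurable FF_bound])
   then show ?thesis unfolding freq_defect_def e XX_def
    by (subst Bochner_Integration.integral_sum) simp_all
  qed
  define \<sigma> where "\<sigma> i = sqrt K2 * (freq_const (\<kappa> i * \<theta>))\<^sup>2 * h powr (1/32)" for i
  have X: "integrable M (\<lambda>w. \<bar>XX (\<kappa> i * \<theta>) h t a b w\<bar>)" "(LINT w|M. \<bar>XX (\<kappa> i * \<theta>) h t a b w\<bar>) \<le> \<sigma> i" for i
  proof -
   have fc: "1 \<le> freq_const (\<kappa> i * \<theta>)" by (rule freq_const)
   have s0: "0 < \<sigma> i" unfolding \<sigma>_def using fc K2 h by simp
   have s2: "(\<sigma> i)\<^sup>2 = K2 * (freq_const (\<kappa> i * \<theta>) ^ 4 * h powr (1/16))"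
   proof -
    have "(h powr (1/32))\<^sup>2 = h powr (1/16)" using h by (simp add: powr_power)
    moreover have "((freq_const (\<kappa> i * \<theta>))\<^sup>2)\<^sup>2 = freq_const (\<kappa> i * \<theta>) ^ 4" by simp
    ultimately show ?thesis unfolding \<sigma>_def power_mult_distrib using K2 by (simp add: mult.assoc)
   qed
   have le: "(LINT w|M. (XX (\<kappa> i * \<theta>) h t a b w)\<^sup>2) \<le> (\<sigma> i)\<^sup>2"
    unfolding s2 by (rule order_trans[OF XX_second_moment[OF h t ab]])
    (rule mult_right_mono, use fc in \<open>simp_all add: K2_def\<close>)
   have i2: "integrable M (\<lambda>w. (XX (\<kappa> i * \<theta>) h t a b w)\<^sup>2)"
   proof (rule integrable_const_bound[where B="((b - a) * 2)\<^sup>2"])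
    show "AE w in M. norm ((XX (\<kappa> i * \<theta>) h t a b w)\<^sup>2) \<le> ((b - a) * 2)\<^sup>2"
    using power_mono[OF XX_bound[OF ab], of _ _ _ _ 2] by (intro AE_I2) simp
   qed measurable
   have xm: "XX (\<kappa> i * \<theta>) h t a b \<in> borel_measurable M" by measurable
   show "integrable M (\<lambda>w. \<bar>XX (\<kappa> i * \<theta>) h t a b w\<bar>)" "(LINT w|M. \<bar>XX (\<kappa> i * \<theta>) h t a b w\<bar>) \<le> \<sigma> i"
    by (rule expectation_abs_le_of_square[OF i2 xm s0 le])+
  qed
  have I: "integrable M (\<lambda>w. \<Sum>i<n. \<bar>q i\<bar> * \<bar>XX (\<kappa> i * \<theta>) h t a b w\<bar>)"
   by (intro Bochner_Integration.integrable_sum integrable_mult_right X(1))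
  have "(\<integral>\<^sup>+w. ennreal \<bar>freq_defect h \<theta> w\<bar> \<partial>M) \<le> (\<integral>\<^sup>+w. ennreal (\<Sum>i<n. \<bar>q i\<bar> * \<bar>XX (\<kappa> i * \<theta>) h t a b w\<bar>) \<partial>M)"
   unfolding fd abs_mult[symmetric] by (intro nn_integral_mono ennreal_leI sum_abs)
  also have "\<dots> = ennreal (LINT w|M. (\<Sum>i<n. \<bar>q i\<bar> * \<bar>XX (\<kappa> i * \<theta>) h t a b w\<bar>))"
   by (rule nn_integral_eq_integral[OF I]) (auto intro!: sum_nonneg)
  also have "\<dots> = ennreal (\<Sum>i<n. \<bar>q i\<bar> * (LINT w|M. \<bar>XX (\<kappa> i * \<theta>) h t a b w\<bar>))"
   by (subst Bochner_Integration.integral_sum) (simp_all add: X(1))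
  also have "\<dots> \<le> ennreal (K * (1 + \<theta>) ^ 4 * h powr (1/32))"
  proof (rule ennreal_leI)
   have "\<bar>q i\<bar> * (LINT w|M. \<bar>XX (\<kappa> i * \<theta>) h t a b w\<bar>) \<le> \<bar>q i\<bar> * (sqrt K2 * (4 * (1 + \<bar>\<kappa> i\<bar>) ^ 4)) * ((1 + \<theta>) ^ 4 * h powr (1/32))" for i
   proof -
    have "\<bar>\<kappa> i * \<theta>\<bar> = \<bar>\<kappa> i\<bar> * \<theta>" using th by (simp add: abs_mult)
    then have "1 + \<bar>\<kappa> i * \<theta>\<bar> \<le> (1 + \<bar>\<kappa> i\<bar>) * (1 + \<theta>)" using th by (simp add: distrib_left distrib_right)
    then have "(1 + \<bar>\<kappa> i * \<theta>\<bar>) ^ 4 \<le> (1 + \<bar>\<kappa> i\<bar>) ^ 4 * (1 + \<theta>) ^ 4"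
    unfolding power_mult_distrib[symmetric] by (intro power_mono) auto
    moreover have "(freq_const (\<kappa> i * \<theta>))\<^sup>2 = 4 * (1 + \<bar>\<kappa> i * \<theta>\<bar>) ^ 4"
    unfolding freq_const_def power_mult_distrib by simp
    ultimately have "(freq_const (\<kappa> i * \<theta>))\<^sup>2 \<le> 4 * (1 + \<bar>\<kappa> i\<bar>) ^ 4 * (1 + \<theta>) ^ 4" by linarith
    then have "\<sigma> i \<le> sqrt K2 * (4 * (1 + \<bar>\<kappa> i\<bar>) ^ 4 * (1 + \<theta>) ^ 4) * h powr (1/32)"
    unfolding \<sigma>_def using K2 by (intro mult_right_mono mult_left_mono) auto
    from mult_left_mono[OF order_trans[OF X(2) this], of "\<bar>q i\<bar>"] show ?thesis by (simp only: mult.assoc abs_ge_zero simp_thms)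
   qed
   then show "(\<Sum>i<n. \<bar>q i\<bar> * (LINT w|M. \<bar>XX (\<kappa> i * \<theta>) h t a b w\<bar>)) \<le> K * (1 + \<theta>) ^ 4 * h powr (1/32)"
   proof -
    assume "\<And>i. \<bar>q i\<bar> * (LINT w|M. \<bar>XX (\<kappa> i * \<theta>) h t a b w\<bar>) \<le> \<bar>q i\<bar> * (sqrt K2 * (4 * (1 + \<bar>\<kappa> i\<bar>) ^ 4)) * ((1 + \<theta>) ^ 4 * h powr (1/32))"
    then have "(\<Sum>i<n. \<bar>q i\<bar> * (LINT w|M. \<bar>XX (\<kappa> i * \<theta>) h t a b w\<bar>))
    \<le> (\<Sum>i<n. \<bar>q i\<bar> * (sqrt K2 * (4 * (1 + \<bar>\<kappa> i\<bar>) ^ 4)) * ((1 + \<theta>) ^ 4 * h powr (1/32)))"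
    by (intro sum_mono)
    also have "\<dots> = K * ((1 + \<theta>) ^ 4 * h powr (1/32))" unfolding K_def by (rule sum_distrib_right[symmetric])
    finally show ?thesis by (simp only: mult.assoc)
   qed
  qed
  finally show "(\<integral>\<^sup>+w. ennreal \<bar>freq_defect h \<theta> w\<bar> \<partial>M) \<le> ennreal (K * (1 + \<theta>) ^ 4 * h powr (1/32))" .
 qed
qed

text \<open>The bound at low frequencies, the trivial bound and the decaying bound are interpolated so that the mixture over all frequencies converges and a power of \<open>h\<close> remains.\<close>

lemma rate_defect_L1:
 obtains K where "0 \<le> K" "\<And>h. 0 < h \<Longrightarrow> h \<le> 1 \<Longrightarrow> (\<integral>\<^sup>+w. ennreal \<bar>rate_defect h w\<bar> \<partial>M) \<le> ennreal (K * h powr (1/256))"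
proof -
 obtain K3 where K3: "0 \<le> K3" "\<And>h \<theta>. 0 < h \<Longrightarrow> h \<le> 1 \<Longrightarrow> 0 \<le> \<theta> \<Longrightarrow>
  (\<integral>\<^sup>+w. ennreal \<bar>freq_defect h \<theta> w\<bar> \<partial>M) \<le> ennreal (K3 * (1 + \<theta>) ^ 4 * h powr (1/32))"
  using freq_defect_high by blast
 define K where "K = \<bar>low_freq_const\<bar> + (b - a) * 2 ^ m + 16 * K3"
 have "0 \<le> (b - a) * 2 ^ m" using ab by simp
 then have K: "0 \<le> K" "low_freq_const \<le> K" "(b - a) * 2 ^ m \<le> K" "16 * K3 \<le> K" unfolding K_def using K3(1) by linarith+
 have KK: "K powr (7/8) * K powr (1/8) = K" using K(1) by (simp add: powr_add[symmetric])
 define g :: "real \<Rightarrow> real" where "g \<theta> = indicator {0<..} \<theta> * (if \<theta> \<le> 1 then \<theta> powr (7 * real m / 4 - 1 - p) else \<theta> powr (- 1 / 2 - p))" for \<theta>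
 have gfin: "(\<integral>\<^sup>+\<theta>. ennreal (g \<theta>) \<partial>lborel) < \<infinity>"
  unfolding g_def by (rule powr_tail_finite) (use p m in linarith)+
 define G where "G = enn2real (\<integral>\<^sup>+\<theta>. ennreal (g \<theta>) \<partial>lborel)"
 have G: "(\<integral>\<^sup>+\<theta>. ennreal (g \<theta>) \<partial>lborel) = ennreal G"
  unfolding G_def by (rule ennreal_enn2real[symmetric]) (use gfin in \<open>simp only: infinity_ennreal_def\<close>)
 have G0: "0 \<le> G" unfolding G_def by simp
 have gm [measurable]: "g \<in> borel_measurable borel" unfolding g_def by measurable
 interpret P: pair_sigma_finite lborel M ..
 show ?thesis
 proof (rule that)
  show "0 \<le> (1 / CJ) * (K * G)" using CJ_pos K(1) G0 by simp
  fix h :: real assume h: "0 < h" "h \<le> 1"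
  let ?E = "\<lambda>\<theta>. \<integral>\<^sup>+w. ennreal \<bar>freq_defect h \<theta> w\<bar> \<partial>M"
  have hp: "(h powr (1/32)) powr (1/8) = h powr (1/256)" unfolding powr_powr by simp
  have main: "(\<integral>\<^sup>+w. ennreal (wgt p \<theta> * \<bar>freq_defect h \<theta> w\<bar>) \<partial>M) \<le> ennreal (K * h powr (1/256)) * ennreal (g \<theta>)" for \<theta>
  proof (cases "0 < \<theta>")
   case False
   then show ?thesis by (simp add: wgt_def)
  next
   case pos: True
   have split: "(\<integral>\<^sup>+w. ennreal (wgt p \<theta> * \<bar>freq_defect h \<theta> w\<bar>) \<partial>M) = ennreal (wgt p \<theta>) * ?E \<theta>"
    unfolding ennreal_mult'[OF wgt_nonneg] by (rule nn_integral_cmult) measurable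
   have "?E \<theta> \<le> ennreal (K * h powr (1/256) * (if \<theta> \<le> 1 then \<theta> powr (7 * real m / 4) else \<theta> powr (1/2)))"
   proof (cases "\<theta> \<le> 1")
    case True
    have A: "?E \<theta> \<le> ennreal (K * \<theta> powr (2 * real m))"
    proof (rule order_trans[OF freq_defect_low[OF h]], rule ennreal_leI)
    have "\<theta> ^ (2 * m) = \<theta> powr (2 * real m)" using powr_realpow[OF pos, of "2 * m"] by simp
    then show "low_freq_const * \<theta> ^ (2 * m) \<le> K * \<theta> powr (2 * real m)" using K(2) by (simp add: mult_right_mono)
    qed
    have B: "?E \<theta> \<le> ennreal (K * h powr (1/32))"
    proof (rule order_trans[OF K3(2)[OF h less_imp_le[OF pos]]], rule ennreal_leI, rule mult_right_mono)
    have "(1 + \<theta>) ^ 4 \<le> 2 ^ 4" using True pos by (intro power_mono) auto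
    then have "K3 * (1 + \<theta>) ^ 4 \<le> K3 * 16" using K3(1) by (intro mult_left_mono) auto
    then show "K3 * (1 + \<theta>) ^ 4 \<le> K" using K(4) by linarith
    qed simp
    have e: "(K * \<theta> powr (2 * real m)) powr (7/8) * (K * h powr (1/32)) powr (1/8) = K * h powr (1/256) * \<theta> powr (7 * real m / 4)"
    proof -
    have "(\<theta> powr (2 * real m)) powr (7/8) = \<theta> powr (7 * real m / 4)" unfolding powr_powr by simp
    then have "(K * \<theta> powr (2 * real m)) powr (7/8) * (K * h powr (1/32)) powr (1/8) = (K powr (7/8) * \<theta> powr (7 * real m / 4)) * (K powr (1/8) * h powr (1/256))"
    using K(1) hp by (simp only: powr_mult powr_ge_zero)
    also have "\<dots> = (K powr (7/8) * K powr (1/8)) * h powr (1/256) * \<theta> powr (7 * real m / 4)" by (simp only: mult_ac)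
    finally show ?thesis unfolding KK .
    qed
    show ?thesis using le_geometric_mean[OF _ _ A B] K(1) True by (simp only: e mult_nonneg_nonneg powr_ge_zero if_True)
   next
    case False
    have A: "?E \<theta> \<le> ennreal K" by (rule order_trans[OF freq_defect_trivial]) (rule ennreal_leI, rule K(3))
    have B: "?E \<theta> \<le> ennreal (K * \<theta> powr 4 * h powr (1/32))"
    proof (rule order_trans[OF K3(2)[OF h less_imp_le[OF pos]]], rule ennreal_leI, rule mult_right_mono)
    have "(1 + \<theta>) ^ 4 \<le> (2 * \<theta>) ^ 4" using False pos by (intro power_mono) auto
    also have "(2 * \<theta>) ^ 4 = 16 * \<theta> powr 4" using pos by (simp add: power_mult_distrib powr_numeral)
    finally have "K3 * (1 + \<theta>) ^ 4 \<le> K3 * (16 * \<theta> powr 4)" using K3(1) by (intro mult_left_mono) auto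
    also have "\<dots> \<le> K * \<theta> powr 4" using mult_right_mono[OF K(4), of "\<theta> powr 4"] by (simp add: mult_ac)
    finally show "K3 * (1 + \<theta>) ^ 4 \<le> K * \<theta> powr 4" .
    qed simp
    have e: "K powr (7/8) * (K * \<theta> powr 4 * h powr (1/32)) powr (1/8) = K * h powr (1/256) * \<theta> powr (1/2)"
    proof -
    have "(\<theta> powr 4) powr (1/8) = \<theta> powr (1/2)" unfolding powr_powr by simp
    then have "K powr (7/8) * (K * \<theta> powr 4 * h powr (1/32)) powr (1/8) = K powr (7/8) * (K powr (1/8) * \<theta> powr (1/2) * h powr (1/256))"
    using K(1) hp by (simp only: powr_mult powr_ge_zero mult_nonneg_nonneg)
    also have "\<dots> = (K powr (7/8) * K powr (1/8)) * h powr (1/256) * \<theta> powr (1/2)" by (simp only: mult_ac)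
    finally show ?thesis unfolding KK .
    qed
    show ?thesis using le_geometric_mean[OF _ _ A B] K(1) False by (simp only: e mult_nonneg_nonneg powr_ge_zero if_False)
   qed
   from mult_left_mono[OF this, of "ennreal (wgt p \<theta>)"]
   have "ennreal (wgt p \<theta>) * ?E \<theta> \<le> ennreal (wgt p \<theta> * (K * h powr (1/256) * (if \<theta> \<le> 1 then \<theta> powr (7 * real m / 4) else \<theta> powr (1/2))))"
    unfolding ennreal_mult'[OF wgt_nonneg, symmetric] by simp
   moreover have "wgt p \<theta> * (K * h powr (1/256) * (if \<theta> \<le> 1 then \<theta> powr (7 * real m / 4) else \<theta> powr (1/2))) = K * h powr (1/256) * g \<theta>"
   proof -
    have x: "- 1 - p + 7 * real m / 4 = 7 * real m / 4 - 1 - p" "- 1 - p + 1 / 2 = - 1 / 2 - p" by simp_all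
    have "\<theta> powr (- 1 - p) * (if \<theta> \<le> 1 then \<theta> powr (7 * real m / 4) else \<theta> powr (1/2)) = (if \<theta> \<le> 1 then \<theta> powr (7 * real m / 4 - 1 - p) else \<theta> powr (- 1 / 2 - p))"
    unfolding if_distrib[of "\<lambda>v. \<theta> powr (- 1 - p) * v"] powr_add[symmetric] x ..
    moreover have i1: "indicator {0<..} \<theta> = (1::real)" using pos by simp
    moreover have "wgt p \<theta> * (K * h powr (1/256) * (if \<theta> \<le> 1 then \<theta> powr (7 * real m / 4) else \<theta> powr (1/2)))
    = K * h powr (1/256) * (\<theta> powr (- 1 - p) * (if \<theta> \<le> 1 then \<theta> powr (7 * real m / 4) else \<theta> powr (1/2)))"
    unfolding wgt_def i1 by (simp only: mult_1_left mult_ac)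
    ultimately show ?thesis unfolding g_def by (simp only: mult_1_left)
   qed
   ultimately show ?thesis unfolding split using K(1) by (simp only: ennreal_mult' mult_nonneg_nonneg powr_ge_zero)
  qed
  have "(\<integral>\<^sup>+w. ennreal (CJ * \<bar>rate_defect h w\<bar>) \<partial>M) \<le> (\<integral>\<^sup>+w. \<integral>\<^sup>+\<theta>. ennreal (wgt p \<theta> * \<bar>freq_defect h \<theta> w\<bar>) \<partial>lborel \<partial>M)"
   by (rule nn_integral_mono) (rule rate_defect_le)
  also have "\<dots> = (\<integral>\<^sup>+\<theta>. \<integral>\<^sup>+w. ennreal (wgt p \<theta> * \<bar>freq_defect h \<theta> w\<bar>) \<partial>M \<partial>lborel)"
   by (rule P.Fubini') measurable
  also have "\<dots> \<le> (\<integral>\<^sup>+\<theta>. ennreal (K * h powr (1/256)) * ennreal (g \<theta>) \<partial>lborel)"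
   by (rule nn_integral_mono) (rule main)
  also have "\<dots> = ennreal (K * h powr (1/256)) * ennreal G"
   unfolding G[symmetric] by (rule nn_integral_cmult) measurable
  finally have fin: "(\<integral>\<^sup>+w. ennreal (CJ * \<bar>rate_defect h w\<bar>) \<partial>M) \<le> ennreal (K * h powr (1/256)) * ennreal G" .
  have "(\<integral>\<^sup>+w. ennreal \<bar>rate_defect h w\<bar> \<partial>M) = (\<integral>\<^sup>+w. ennreal (1 / CJ) * ennreal (CJ * \<bar>rate_defect h w\<bar>) \<partial>M)"
   using CJ_pos by (intro nn_integral_cong) (simp add: ennreal_mult'[symmetric])
  also have "\<dots> = ennreal (1 / CJ) * (\<integral>\<^sup>+w. ennreal (CJ * \<bar>rate_defect h w\<bar>) \<partial>M)"
   by (rule nn_integral_cmult) measurable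
  also have "\<dots> \<le> ennreal (1 / CJ) * (ennreal (K * h powr (1/256)) * ennreal G)"
   by (rule mult_left_mono[OF fin]) simp
  also have "\<dots> = ennreal ((1 / CJ) * ((K * h powr (1/256)) * G))"
   using CJ_pos K(1) by (simp only: ennreal_mult' mult_nonneg_nonneg powr_ge_zero divide_nonneg_pos zero_le_one)
  also have "(1 / CJ) * ((K * h powr (1/256)) * G) = (1 / CJ) * (K * G) * h powr (1/256)" by (simp only: mult_ac)
  finally show "(\<integral>\<^sup>+w. ennreal \<bar>rate_defect h w\<bar> \<partial>M) \<le> ennreal ((1 / CJ) * (K * G) * h powr (1/256))" .
 qed
qed

end

section \<open>Deterministic continuity and interpolation\<close>

text \<open>Chaining along dyadic approximations: the increments over neighbouring dyadic points of each
 level control a continuous function at every point.\<close>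

lemma dyadic_chaining:
 fixes f :: "real \<Rightarrow> real" and r C :: real
 assumes cont: "continuous_on UNIV f" and r: "0 < r" "r < 1" and C: "0 \<le> C"
  and inc: "\<And>(k::nat) (j::int). \<bar>f (real_of_int (j + 1) / 2 ^ k) - f (real_of_int j / 2 ^ k)\<bar> \<le> C * r ^ k"
  and xy: "\<bar>x - y\<bar> \<le> 1 / 2 ^ k"
 shows "\<bar>f x - f y\<bar> \<le> C * (1 + 2 / (1 - r)) * r ^ k"
proof -
 define D :: "nat \<Rightarrow> real \<Rightarrow> int" where "D k x = \<lfloor>x * 2 ^ k\<rfloor>" for k x
 let ?d = "\<lambda>k x. real_of_int (D k x) / 2 ^ k"
 have step: "\<bar>f (?d (Suc k) x) - f (?d k x)\<bar> \<le> C * r ^ k" for k x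
 proof -
  have b: "real_of_int (D k x) \<le> x * 2 ^ k" "x * 2 ^ k < real_of_int (D k x) + 1" unfolding D_def by linarith+
  have "D (Suc k) x = 2 * D k x \<or> D (Suc k) x = 2 * D k x + 1"
  proof -
   have e: "x * 2 ^ Suc k = 2 * (x * 2 ^ k)" by simp
   have "2 * D k x \<le> D (Suc k) x" "D (Suc k) x < 2 * D k x + 2" using b unfolding D_def[of "Suc k"] e by linarith+
   then show ?thesis by linarith
  qed
  moreover have "real_of_int (2 * D k x) / 2 ^ Suc k = ?d k x" by simp
  moreover have "C * r ^ Suc k \<le> C * r ^ k" using r C by (intro mult_left_mono power_decreasing) auto
  moreover have "0 \<le> C * r ^ k" using r C by simp
  ultimately show ?thesis using inc[of "2 * D k x" "Suc k"] by auto
 qed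
 have tele: "\<bar>f (?d (k + n) x) - f (?d k x)\<bar> \<le> C * r ^ k * ((1 - r ^ n) / (1 - r))" for n k x
 proof (induction n)
  case (Suc n)
  have "\<bar>f (?d (k + Suc n) x) - f (?d k x)\<bar> \<le> C * r ^ (k + n) + C * r ^ k * ((1 - r ^ n) / (1 - r))"
   using step[of "k + n" x] Suc by (simp only: add_Suc_right)
  also have "\<dots> = C * r ^ k * ((1 - r ^ Suc n) / (1 - r))"
   using r by (simp add: power_add field_simps)
  finally show ?case .
 qed simp
 have lim: "\<bar>f x - f (?d k x)\<bar> \<le> C * r ^ k * (1 / (1 - r))" for k x
 proof (rule tendsto_upperbound[where F=sequentially])
  have "(\<lambda>n. ?d (k + n) x) \<longlonglongrightarrow> x"
  proof (rule tendsto_sandwich[where f="\<lambda>n. x - (1/2) ^ n" and h="\<lambda>_. x"])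
   have "x - (1/2) ^ n \<le> ?d (k + n) x \<and> ?d (k + n) x \<le> x" for n
   proof -
    have "real_of_int (D (k + n) x) \<le> x * 2 ^ (k + n)" "x * 2 ^ (k + n) - 1 \<le> real_of_int (D (k + n) x)" unfolding D_def by linarith+
    then have "?d (k + n) x \<le> x * 2 ^ (k + n) / 2 ^ (k + n)" "(x * 2 ^ (k + n) - 1) / 2 ^ (k + n) \<le> ?d (k + n) x"
    by (intro divide_right_mono; simp)+
    then have "?d (k + n) x \<le> x" "x - 1 / 2 ^ (k + n) \<le> ?d (k + n) x" by (simp_all add: diff_divide_distrib)
    moreover have "1 / 2 ^ (k + n) \<le> (1 / 2 ^ n :: real)" by (intro divide_left_mono power_increasing) auto
    ultimately show ?thesis by (simp add: power_one_over)
   qed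
   then show "eventually (\<lambda>n. x - (1/2) ^ n \<le> ?d (k + n) x) sequentially" "eventually (\<lambda>n. ?d (k + n) x \<le> x) sequentially" by auto
   have "(\<lambda>n. x - (1/2) ^ n) \<longlonglongrightarrow> x - 0" by (intro tendsto_diff tendsto_const LIMSEQ_power_zero) simp
   then show "(\<lambda>n. x - (1/2) ^ n) \<longlonglongrightarrow> x" by simp
  qed simp
  then have "(\<lambda>n. f (?d (k + n) x)) \<longlonglongrightarrow> f x"
   by (rule continuous_on_tendsto_compose[OF cont]) auto
  then show "(\<lambda>n. \<bar>f (?d (k + n) x) - f (?d k x)\<bar>) \<longlonglongrightarrow> \<bar>f x - f (?d k x)\<bar>" by (intro tendsto_intros)
  have "(1 - r ^ n) / (1 - r) \<le> 1 / (1 - r)" for n using r by (intro divide_right_mono) auto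
  then have "C * r ^ k * ((1 - r ^ n) / (1 - r)) \<le> C * r ^ k * (1 / (1 - r))" for n using r C by (intro mult_left_mono) auto
  with tele[of k _ x] show "eventually (\<lambda>n. \<bar>f (?d (k + n) x) - f (?d k x)\<bar> \<le> C * r ^ k * (1 / (1 - r))) sequentially"
   by (intro always_eventually allI) (meson order_trans)
 qed simp
 have "\<bar>f (?d k x) - f (?d k y)\<bar> \<le> C * r ^ k"
 proof -
  have "\<bar>x * 2 ^ k - y * 2 ^ k\<bar> = \<bar>x - y\<bar> * 2 ^ k" unfolding left_diff_distrib[symmetric] abs_mult by simp
  also have "\<dots> \<le> 1 / 2 ^ k * 2 ^ k" by (rule mult_right_mono[OF xy]) simp
  finally have "\<bar>x * 2 ^ k - y * 2 ^ k\<bar> \<le> 1" by simp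
  then have "\<bar>D k x - D k y\<bar> \<le> 1" unfolding D_def by linarith
  then have "D k x = D k y \<or> D k x = D k y + 1 \<or> D k y = D k x + 1" by linarith
  then consider "D k x = D k y" | "D k x = D k y + 1" | "D k y = D k x + 1" by blast
  then show ?thesis
  proof cases
   case 1
   then show ?thesis using r C by simp
  next
   case 2
   show ?thesis using inc[of "D k y" k] unfolding 2 .
  next
   case 3
   show ?thesis using inc[of "D k x" k] unfolding 3 by (subst abs_minus_commute)
  qed
 qed
 with lim[of x k] lim[of y k] have "\<bar>f x - f y\<bar> \<le> C * r ^ k * (1 / (1 - r)) + C * r ^ k + C * r ^ k * (1 / (1 - r))" by linarith
 also have "\<dots> = C * (1 + 2 / (1 - r)) * r ^ k" by (simp add: algebra_simps add_divide_distrib)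
 finally show ?thesis .
qed

text \<open>The level of chaining is matched to the distance of the points.\<close>

lemma dyadic_holder:
 fixes f :: "real \<Rightarrow> real" and \<gamma> C :: real
 assumes cont: "continuous_on UNIV f" and g: "0 < \<gamma>" and C: "0 \<le> C"
  and inc: "\<And>(k::nat) (j::int). \<bar>f (real_of_int (j + 1) / 2 ^ k) - f (real_of_int j / 2 ^ k)\<bar> \<le> C * (2 powr - \<gamma>) ^ k"
 obtains K where "0 \<le> K" "\<And>x y. \<bar>x - y\<bar> \<le> 1 \<Longrightarrow> \<bar>f x - f y\<bar> \<le> K * \<bar>x - y\<bar> powr \<gamma>"
proof -
 define r where "r = 2 powr - \<gamma>"
 have r: "0 < r" "r < 1" unfolding r_def using g by (auto simp: powr_less_one)
 define K where "K = C * (1 + 2 / (1 - r)) / r"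
 have K0: "0 \<le> K" unfolding K_def using C r by simp
 show ?thesis
 proof (rule that[OF K0])
  fix x y :: real assume xy: "\<bar>x - y\<bar> \<le> 1"
  show "\<bar>f x - f y\<bar> \<le> K * \<bar>x - y\<bar> powr \<gamma>"
  proof (cases "x = y")
   case False
   define u where "u = \<bar>x - y\<bar>"
   have u: "0 < u" "u \<le> 1" using False xy unfolding u_def by auto
   define k where "k = nat \<lfloor>log 2 (1 / u)\<rfloor>"
   have l0: "0 \<le> log 2 (1 / u)" using u by simp
   then have kk: "real k \<le> log 2 (1 / u)" "log 2 (1 / u) < real k + 1" unfolding k_def by linarith+
   have "2 ^ k \<le> 1 / u" using kk(1) u by (simp add: le_log_iff powr_realpow)
   then have 1: "u \<le> 1 / 2 ^ k" using u by (simp add: field_simps)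
   have "1 / u < 2 powr (real k + 1)" using kk(2) u by (simp add: log_less_iff)
   then have "1 < u * 2 powr (real k + 1)" using u by (simp add: pos_divide_less_eq mult.commute)
   then have 2: "2 powr - (real k + 1) < u" unfolding powr_minus_divide by (subst pos_divide_less_eq) (simp, assumption)
   have "r ^ Suc k = r powr real (Suc k)" using r(1) by (simp only: powr_realpow)
   also have "\<dots> = 2 powr (- \<gamma> * real (Suc k))" unfolding r_def powr_powr ..
   also have "- \<gamma> * real (Suc k) = - (real k + 1) * \<gamma>" by (simp add: algebra_simps)
   also have "2 powr (- (real k + 1) * \<gamma>) = (2 powr - (real k + 1)) powr \<gamma>" unfolding powr_powr ..
   also have "\<dots> \<le> u powr \<gamma>" using 2 g by (intro powr_mono2) auto
   finally have 3: "r ^ k \<le> u powr \<gamma> / r" using r by (simp add: field_simps)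
   have "\<bar>f x - f y\<bar> \<le> C * (1 + 2 / (1 - r)) * r ^ k"
    by (rule dyadic_chaining[OF cont r C _ 1[unfolded u_def]]) (rule inc[folded r_def])
   also have "\<dots> \<le> C * (1 + 2 / (1 - r)) * (u powr \<gamma> / r)" using 3 C r by (intro mult_left_mono) auto
   finally show ?thesis unfolding K_def u_def by simp
  qed simp
 qed
qed

lemma powr_diff_bound:
 fixes a b m p :: real
 assumes p: "1 \<le> p" and a: "0 \<le> a" "a \<le> m" and b: "0 \<le> b" "b \<le> m"
 shows "\<bar>a powr p - b powr p\<bar> \<le> p * m powr (p - 1) * \<bar>a - b\<bar>"
proof -
 have *: "b powr p - a powr p \<le> p * m powr (p - 1) * (b - a)" if ab: "0 \<le> a" "a < b" "b \<le> m" for a b :: real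
 proof -
  have c: "continuous_on {a..b} (\<lambda>x. x powr p)" using p ab by (intro continuous_on_powr' continuous_intros) auto
  have d: "((\<lambda>x. x powr p) has_real_derivative p * x powr (p - 1)) (at x)" if "a < x" for x
   using that ab by (auto intro!: has_real_derivative_powr)
  obtain l z where z: "a < z" "z < b" "((\<lambda>x. x powr p) has_real_derivative l) (at z)" "b powr p - a powr p = (b - a) * l"
   using MVT[OF ab(2) c] d real_differentiable_def by metis
  have l: "l = p * z powr (p - 1)" by (rule DERIV_unique[OF z(3) d[OF z(1)]])
  have "z powr (p - 1) \<le> m powr (p - 1)" using z ab p by (intro powr_mono2) auto
  then have "(b - a) * (p * z powr (p - 1)) \<le> (b - a) * (p * m powr (p - 1))" using p ab by (intro mult_left_mono) auto
  then show ?thesis unfolding z(4) l by (simp only: mult_ac)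
 qed
 have mono: "x powr p \<le> y powr p" if "0 \<le> x" "x \<le> y" for x y :: real using that p by (intro powr_mono2) auto
 consider "a = b" | "a < b" | "b < a" by linarith
 then show ?thesis
 proof cases
  case 2
  then show ?thesis using *[of a b] mono[of a b] a b by (simp add: abs_if)
 next
  case 3
  then show ?thesis using *[of b a] mono[of b a] a b by (simp add: abs_if)
 qed simp
qed

lemma bernoulli_upper:
 fixes x :: real assumes "0 \<le> x" "x \<le> 1" shows "(1 + x) ^ n \<le> 1 + (2 ^ n - 1) * x"
proof (induction n)
 case (Suc n)
 have "(1 + x) ^ Suc n \<le> (1 + x) * (1 + (2 ^ n - 1) * x)" using Suc assms by (simp add: mult_left_mono)
 also have "\<dots> = 1 + 2 ^ n * x + (2 ^ n - 1) * (x * x)" by (simp add: algebra_simps)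
 also have "\<dots> \<le> 1 + 2 ^ n * x + (2 ^ n - 1) * (x * 1)"
  using assms by (intro add_left_mono mult_left_mono) (auto simp: one_le_power)
 also have "\<dots> = 1 + (2 ^ Suc n - 1) * x" by (simp add: algebra_simps)
 finally show ?case .
qed simp

text \<open>Neighbouring members of a polynomially decaying sequence of lags are so close that a Hoelder
 exponent slightly below 1/2 controls the normalised increments between them.\<close>

text \<open>Consecutive lags \<open>1 / (n + 1) ^ N\<close> have a ratio close to 1. A Hoelder exponent \<open>1/2 - \<epsilon>\<close> loses only \<open>h powr (- \<epsilon>)\<close> in the size of the normalised increment, and the gain from the ratio wins when \<open>N * p * \<epsilon>\<close> is small.\<close>

lemma rate_interpolation:
 fixes f :: "real \<Rightarrow> real" and K \<epsilon> p :: real and N :: nat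
 assumes p: "1 \<le> p" and K: "0 \<le> K" and e: "0 < \<epsilon>" "\<epsilon> \<le> 1/4" and N: "1 \<le> N" "real N * p * \<epsilon> < 1/4"
  and hol: "\<And>x y. \<bar>x - y\<bar> \<le> 1 \<Longrightarrow> \<bar>f x - f y\<bar> \<le> K * \<bar>x - y\<bar> powr (1/2 - \<epsilon>)"
 obtains \<nu> :: "real \<Rightarrow> nat" and \<kappa> :: "real \<Rightarrow> real" where
  "filterlim \<nu> at_top (at_right 0)" "(\<kappa> \<longlongrightarrow> 0) (at_right 0)"
  "\<And>h x. 0 < h \<Longrightarrow> h \<le> 1 \<Longrightarrow>
   \<bar>\<bar>(f (x + h) - f x) / sqrt h\<bar> powr p - \<bar>(f (x + 1 / (real (\<nu> h) + 1) ^ N) - f x) / sqrt (1 / (real (\<nu> h) + 1) ^ N)\<bar> powr p\<bar> \<le> \<kappa> h"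
proof -
 define q where "q h = h powr (- 1 / real N)" for h :: real
 define \<nu> where "\<nu> h = nat \<lfloor>q h\<rfloor> - 1" for h
 define c :: real where "c = 2 ^ Suc N"
 define \<kappa> where "\<kappa> h = p * K powr p * (q h powr (real N * \<epsilon> * p) * (c / q h + (c / q h) powr (1/2 - \<epsilon>)))" for h
 have c0: "0 < c" unfolding c_def by simp
 have qtop: "filterlim q at_top (at_right 0)"
  unfolding q_def using N(1) by real_asymp
 have nu: "filterlim \<nu> at_top (at_right 0)"
  unfolding filterlim_at_top
 proof
  fix Z :: nat
  have "eventually (\<lambda>h. real Z + 2 \<le> q h) (at_right 0)" using qtop unfolding filterlim_at_top by blast
  then show "eventually (\<lambda>h. Z \<le> \<nu> h) (at_right 0)"
   by (rule eventually_mono) (unfold \<nu>_def, linarith)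
 qed
 have kap: "(\<kappa> \<longlongrightarrow> 0) (at_right 0)"
 proof -
  define A where "A = real N * \<epsilon> * p"
  have A: "A < 1/4" using N(2) unfolding A_def by (simp add: mult_ac)
  have 1: "((\<lambda>x. x powr (A - 1)) \<longlongrightarrow> 0) at_top" "((\<lambda>x. x powr (A - (1/2 - \<epsilon>))) \<longlongrightarrow> 0) at_top"
   using A e by (auto intro!: tendsto_neg_powr filterlim_ident)
  have "((\<lambda>x. p * K powr p * (c * x powr (A - 1) + c powr (1/2 - \<epsilon>) * x powr (A - (1/2 - \<epsilon>)))) \<longlongrightarrow> p * K powr p * (c * 0 + c powr (1/2 - \<epsilon>) * 0)) at_top"
   by (intro tendsto_intros 1)
  then have "((\<lambda>h. p * K powr p * (c * q h powr (A - 1) + c powr (1/2 - \<epsilon>) * q h powr (A - (1/2 - \<epsilon>)))) \<longlongrightarrow> 0) (at_right 0)"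
   by (intro filterlim_compose[OF _ qtop]) simp
  moreover have "eventually (\<lambda>h::real. p * K powr p * (c * q h powr (A - 1) + c powr (1/2 - \<epsilon>) * q h powr (A - (1/2 - \<epsilon>))) = \<kappa> h) (at_right 0)"
  proof -
   have "eventually (\<lambda>h::real. 0 < h) (at_right 0)" by (rule eventually_at_right_less)
   then show ?thesis
   proof eventually_elim
    case (elim h)
    then have qp: "0 < q h" unfolding q_def by simp
    have "q h powr A * (c / q h) = c * q h powr (A - 1)" using qp by (simp add: powr_diff)
    moreover have "q h powr A * (c / q h) powr (1/2 - \<epsilon>) = c powr (1/2 - \<epsilon>) * q h powr (A - (1/2 - \<epsilon>))"
    using qp c0 by (simp add: powr_diff[of _ A] powr_divide)
    ultimately show ?case unfolding \<kappa>_def A_def[symmetric] distrib_left by simp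
   qed
  qed
  ultimately show ?thesis by (rule Lim_transform_eventually)
 qed
 show ?thesis
 proof (rule that[OF nu kap])
  fix h x :: real assume h: "0 < h" "h \<le> 1"
  define g where "g = 1 / (real (\<nu> h) + 1) ^ N"
  define \<delta> where "\<delta> = g / h - 1"
  have qp: "1 \<le> q h"
  proof -
   have "1 powr (- 1 / real N) \<le> h powr (- 1 / real N)" using h N by (intro powr_mono2') auto
   then show ?thesis unfolding q_def by simp
  qed
  have nuq: "real (\<nu> h) + 1 \<le> q h" "q h < real (\<nu> h) + 2" using qp unfolding \<nu>_def by linarith+
  have qN: "q h ^ N = 1 / h"
  proof -
   have "q h ^ N = q h powr real N" using qp by (simp add: powr_realpow)
   also have "\<dots> = h powr (- 1)" unfolding q_def powr_powr using N by simp
   finally show ?thesis using h by (simp add: powr_minus_divide)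
  qed
  have "(real (\<nu> h) + 1) ^ N \<le> q h ^ N" using nuq by (intro power_mono) auto
  then have gh: "h \<le> g" unfolding g_def qN using h by (simp add: field_simps)
  have g1: "g \<le> 1" unfolding g_def by (simp add: one_le_power)
  have d0: "0 \<le> \<delta>" unfolding \<delta>_def using gh h by (simp add: field_simps)
  have ghd: "g - h = h * \<delta>" unfolding \<delta>_def using h by (simp add: field_simps)
  have dc: "\<delta> \<le> c / q h"
  proof -
   have "g / h = (q h / (real (\<nu> h) + 1)) ^ N" unfolding g_def power_divide qN by simp
   also have "\<dots> \<le> (1 + 1 / (real (\<nu> h) + 1)) ^ N"
   proof (rule power_mono)
    have "q h / (real (\<nu> h) + 1) \<le> (real (\<nu> h) + 2) / (real (\<nu> h) + 1)"
    using nuq by (intro divide_right_mono) auto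
    also have "\<dots> = 1 + 1 / (real (\<nu> h) + 1)" by (simp add: divide_simps)
    finally show "q h / (real (\<nu> h) + 1) \<le> 1 + 1 / (real (\<nu> h) + 1)" .
   qed (use qp in simp)
   also have "\<dots> \<le> 1 + (2 ^ N - 1) * (1 / (real (\<nu> h) + 1))" by (rule bernoulli_upper) auto
   finally have "\<delta> \<le> (2 ^ N - 1) * (1 / (real (\<nu> h) + 1))" unfolding \<delta>_def by linarith
   also have "\<dots> \<le> 2 ^ N * (2 / q h)"
    using nuq qp by (intro mult_mono) (auto simp: field_simps)
   finally show ?thesis unfolding c_def by (simp add: mult.commute)
  qed
  let ?z = "\<lambda>h. (f (x + h) - f x) / sqrt h"
  define Z where "Z = K * h powr (- \<epsilon>)"
  have Z0: "0 \<le> Z" unfolding Z_def using K by simp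
  have zb: "\<bar>?z s\<bar> \<le> K * s powr (- \<epsilon>)" if s: "0 < s" "s \<le> 1" for s
  proof -
   have "\<bar>f (x + s) - f x\<bar> \<le> K * s powr (1/2 - \<epsilon>)" using hol[of "x + s" x] s by simp
   also have "s powr (1/2 - \<epsilon>) = sqrt s * s powr (- \<epsilon>)" using s by (simp add: powr_add[symmetric] powr_half_sqrt[symmetric])
   finally show ?thesis using s by (simp add: field_simps)
  qed
  have zh: "\<bar>?z h\<bar> \<le> Z" unfolding Z_def by (rule zb[OF h])
  have "g powr (- \<epsilon>) \<le> h powr (- \<epsilon>)" using gh h e by (intro powr_mono2') auto
  then have zg: "\<bar>?z g\<bar> \<le> Z" using zb[of g] gh g1 h K unfolding Z_def by (meson mult_left_mono order_trans less_le_trans)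
  have zd: "\<bar>?z h - ?z g\<bar> \<le> Z * (\<delta> + \<delta> powr (1/2 - \<epsilon>))"
  proof -
   have sq: "0 < sqrt h" "sqrt h \<le> sqrt g" using h gh by auto
   have e1: "?z h - ?z g = ?z h * (1 - sqrt h / sqrt g) + (f (x + h) - f (x + g)) / sqrt g"
    using sq by (simp add: field_simps)
   have a1: "\<bar>?z h * (1 - sqrt h / sqrt g)\<bar> \<le> Z * \<delta>"
   proof -
    have "sqrt h / sqrt g = sqrt (h / g)" by (simp add: real_sqrt_divide)
    moreover have "h / g \<le> sqrt (h / g)"
    using gh h by (intro real_le_rsqrt) (auto simp: power2_eq_square field_simps mult_left_le)
    moreover have "1 - h / g \<le> \<delta>"
    proof -
    have "1 - h / g = h * \<delta> / g" unfolding ghd[symmetric] using h gh by (simp add: field_simps)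
    also have "\<dots> \<le> \<delta>" using h gh d0 by (simp add: field_simps mult_left_mono mult_right_mono)
    finally show ?thesis .
    qed
    moreover have "sqrt h / sqrt g \<le> 1" using sq by simp
    ultimately have "\<bar>1 - sqrt h / sqrt g\<bar> \<le> \<delta>" by linarith
    then show ?thesis unfolding abs_mult using zh Z0 by (intro mult_mono) auto
   qed
   have a2: "\<bar>(f (x + h) - f (x + g)) / sqrt g\<bar> \<le> Z * \<delta> powr (1/2 - \<epsilon>)"
   proof -
    have "\<bar>f (x + h) - f (x + g)\<bar> \<le> K * (h * \<delta>) powr (1/2 - \<epsilon>)"
    using hol[of "x + h" "x + g"] gh g1 h ghd by (simp add: abs_minus_commute)
    also have "\<dots> = K * (h powr (- \<epsilon>) * sqrt h * \<delta> powr (1/2 - \<epsilon>))"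
    using h d0 by (simp add: powr_mult powr_add[symmetric] powr_half_sqrt[symmetric])
    finally have "\<bar>f (x + h) - f (x + g)\<bar> \<le> Z * \<delta> powr (1/2 - \<epsilon>) * sqrt h" unfolding Z_def by (simp only: mult_ac)
    also have "\<dots> \<le> Z * \<delta> powr (1/2 - \<epsilon>) * sqrt g" using Z0 sq by (intro mult_left_mono) auto
    finally show ?thesis using sq by (simp add: abs_divide pos_divide_le_eq)
   qed
   show ?thesis unfolding e1 distrib_left by (rule order_trans[OF abs_triangle_ineq add_mono[OF a1 a2]])
  qed
  have "\<bar>\<bar>?z h\<bar> powr p - \<bar>?z g\<bar> powr p\<bar> \<le> p * Z powr (p - 1) * \<bar>\<bar>?z h\<bar> - \<bar>?z g\<bar>\<bar>"
   by (rule powr_diff_bound[OF p]) (use zh zg in auto)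
  also have "\<dots> \<le> p * Z powr (p - 1) * (Z * (\<delta> + \<delta> powr (1/2 - \<epsilon>)))"
   by (rule mult_left_mono[OF order_trans[OF abs_triangle_ineq3 zd]]) (use p in simp)
  also have "\<dots> = p * Z powr p * (\<delta> + \<delta> powr (1/2 - \<epsilon>))"
  proof -
   have "Z powr (p - 1) * Z = Z powr p" using Z0 by (cases "Z = 0") (auto simp: powr_diff)
   then show ?thesis by (metis mult.assoc)
  qed
  also have "\<dots> \<le> p * Z powr p * (c / q h + (c / q h) powr (1/2 - \<epsilon>))"
   using p dc d0 e by (intro mult_left_mono add_mono powr_mono2) auto
  also have "\<dots> = \<kappa> h"
  proof -
   have "h powr (- \<epsilon>) = q h powr (real N * \<epsilon>)" unfolding q_def powr_powr using N by simp
   then have "Z powr p = K powr p * q h powr (real N * \<epsilon> * p)" unfolding Z_def using K by (simp add: powr_mult powr_powr)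
   then show ?thesis unfolding \<kappa>_def by simp
  qed
  finally show "\<bar>\<bar>?z h\<bar> powr p - \<bar>(f (x + 1 / (real (\<nu> h) + 1) ^ N) - f x) / sqrt (1 / (real (\<nu> h) + 1) ^ N)\<bar> powr p\<bar> \<le> \<kappa> h"
   unfolding g_def .
 qed
qed

lemma set_integrable_continuous_real:
 fixes g :: "real \<Rightarrow> real"
 assumes "continuous_on UNIV g" shows "set_integrable lborel {a..b} g"
 by (rule borel_integrable_atLeastAtMost') (rule continuous_on_subset[OF assms], simp)

lemma set_integral_mono_interval:
 fixes g :: "real \<Rightarrow> real"
 assumes g: "continuous_on UNIV g" "\<And>x. 0 \<le> g x" and s: "c \<le> a" "b \<le> d"
 shows "(LINT x:{a..b}|lborel. g x) \<le> (LINT x:{c..d}|lborel. g x)"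
 unfolding set_lebesgue_integral_def
 by (rule integral_mono) (use set_integrable_continuous_real[OF g(1)] g(2) s in \<open>auto simp: set_integrable_def indicator_def\<close>)

lemma set_integral_enlarge:
 fixes g :: "real \<Rightarrow> real"
 assumes g: "continuous_on UNIV g" "\<And>x. 0 \<le> g x" and s: "c \<le> a" "a \<le> b" "b \<le> d"
  and M: "\<And>x. x \<in> {c..d} \<Longrightarrow> g x \<le> K"
 shows "(LINT x:{c..d}|lborel. g x) \<le> (LINT x:{a..b}|lborel. g x) + K * ((a - c) + (d - b))"
proof -
 note si = set_integrable_continuous_real[OF g(1), unfolded set_integrable_def]
 have iv: "integrable lborel (\<lambda>x. K * indicator {u..v::real} x)" for u v
  by (intro integrable_mult_right integrable_real_indicator) (auto simp: emeasure_lborel_Icc_eq)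
 have "(LINT x|lborel. indicator {c..d} x *\<^sub>R g x) \<le> (LINT x|lborel. indicator {a..b} x *\<^sub>R g x + (K * indicator {c..a} x + K * indicator {b..d} x))"
 proof (rule integral_mono[OF si])
  fix x
  have "0 \<le> K" if "x \<in> {c..d}" using order_trans[OF g(2) M[OF that]] .
  then show "indicator {c..d} x *\<^sub>R g x \<le> indicator {a..b} x *\<^sub>R g x + (K * indicator {c..a} x + K * indicator {b..d} x)"
   using M[of x] g(2)[of x] s by (auto simp: indicator_def)
 qed (intro Bochner_Integration.integrable_add si iv)
 also have "\<dots> = (LINT x|lborel. indicator {a..b} x *\<^sub>R g x) + ((LINT x|lborel. K * indicator {c..a} x) + (LINT x|lborel. K * indicator {b..d} x))"
  by (simp only: Bochner_Integration.integral_add[OF si Bochner_Integration.integrable_add[OF iv iv]] Bochner_Integration.integral_add[OF iv iv])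
 also have "\<dots> = (LINT x|lborel. indicator {a..b} x *\<^sub>R g x) + K * ((a - c) + (d - b))"
  using s by (simp add: distrib_left)
 finally show ?thesis unfolding set_lebesgue_integral_def .
qed

text \<open>Integrals of nonnegative functions increase with the interval, so rational intervals just inside and just outside squeeze the given one.\<close>

lemma interval_limit_from_rationals:
 fixes f :: "'i \<Rightarrow> real \<Rightarrow> real" and g :: "real \<Rightarrow> real"
 assumes f: "\<And>h. continuous_on UNIV (f h)" "\<And>h x. 0 \<le> f h x"
  and g: "continuous_on UNIV g" "\<And>x. 0 \<le> g x"
  and lim: "\<And>a b. a \<in> \<rat> \<Longrightarrow> b \<in> \<rat> \<Longrightarrow> a \<le> b \<Longrightarrow> ((\<lambda>h. LINT x:{a..b}|lborel. f h x) \<longlongrightarrow> (LINT x:{a..b}|lborel. g x)) F"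
 shows "((\<lambda>h. LINT x:{a..b}|lborel. f h x) \<longlongrightarrow> (LINT x:{a..b}|lborel. g x)) F"
proof (cases "a < b")
 case False
 have "(LINT x:{a..b}|lborel. k x) = 0" for k :: "real \<Rightarrow> real"
 proof (cases "a = b")
  case True
  have "AE x in lborel. indicator {a..b} x *\<^sub>R k x = 0"
   using AE_lborel_singleton[of a] by eventually_elim (auto simp: True)
  then show ?thesis unfolding set_lebesgue_integral_def by (rule integral_eq_zero_AE)
 qed (use False in \<open>simp add: set_lebesgue_integral_def\<close>)
 then show ?thesis by simp
next
 case ab: True
 obtain K where K: "0 < K" "\<And>x. x \<in> {a - 1..b + 1} \<Longrightarrow> g x \<le> K"
 proof -
  have "compact (g ` {a - 1..b + 1})" by (intro compact_continuous_image continuous_on_subset[OF g(1)]) auto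
  then have "bounded (g ` {a - 1..b + 1})" by (rule compact_imp_bounded)
  then obtain K where B: "\<forall>x\<in>{a - 1..b + 1}. \<bar>g x\<bar> \<le> K" unfolding bounded_iff by auto
  have "g x \<le> \<bar>K\<bar> + 1" if "x \<in> {a - 1..b + 1}" for x using bspec[OF B that] by linarith
  then show ?thesis by (intro that[of "\<bar>K\<bar> + 1"]) auto
 qed
 let ?I = "\<lambda>k a b. LINT x:{a..b}|lborel. k x"
 show ?thesis
 proof (rule tendstoI)
  fix e :: real assume e: "0 < e"
  define \<delta> where "\<delta> = min 1 (min ((b - a) / 2) (e / (4 * K)))"
  have d: "0 < \<delta>" "\<delta> \<le> 1" "\<delta> \<le> (b - a) / 2" "\<delta> \<le> e / (4 * K)"
  proof -
   have "0 < e / (4 * K)" "0 < (b - a) / 2" using e K(1) ab by simp_all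
   then show "0 < \<delta>" unfolding \<delta>_def by (simp only: min_less_iff_conj zero_less_one simp_thms)
   show "\<delta> \<le> 1" unfolding \<delta>_def by (rule min.cobounded1)
   show "\<delta> \<le> (b - a) / 2" unfolding \<delta>_def by (rule min.coboundedI2[OF min.cobounded1])
   show "\<delta> \<le> e / (4 * K)" unfolding \<delta>_def by (rule min.coboundedI2[OF min.cobounded2])
  qed
  have Kd: "K * (\<delta> + \<delta>) \<le> e / 2" using mult_left_mono[OF d(4), of "2 * K"] K(1) by (simp add: field_simps)
  obtain a1 where a1: "a1 \<in> \<rat>" "a - \<delta> < a1" "a1 < a" using Rats_dense_in_real[of "a - \<delta>" a] d by auto
  obtain a2 where a2: "a2 \<in> \<rat>" "a < a2" "a2 < a + \<delta>" using Rats_dense_in_real[of a "a + \<delta>"] d by auto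
  obtain b1 where b1: "b1 \<in> \<rat>" "b - \<delta> < b1" "b1 < b" using Rats_dense_in_real[of "b - \<delta>" b] d by auto
  obtain b2 where b2: "b2 \<in> \<rat>" "b < b2" "b2 < b + \<delta>" using Rats_dense_in_real[of b "b + \<delta>"] d by auto
  have le: "a2 \<le> b1" using a2 b1 d(3) by (simp add: field_simps)
  have out: "?I g a1 b2 \<le> ?I g a b + e / 2"
  proof -
   have "?I g a1 b2 \<le> ?I g a b + K * ((a - a1) + (b2 - b))"
    by (rule set_integral_enlarge[OF g]) (use a1 b2 ab d K(2) in auto)
   also have "K * ((a - a1) + (b2 - b)) \<le> K * (\<delta> + \<delta>)" using a1 b2 K(1) by (intro mult_left_mono) auto
   finally show ?thesis using Kd by linarith
  qed
  have inn: "?I g a b \<le> ?I g a2 b1 + e / 2"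
  proof -
   have "?I g a b \<le> ?I g a2 b1 + K * ((a2 - a) + (b - b1))"
    by (rule set_integral_enlarge[OF g]) (use a2 b1 ab le d K(2) in auto)
   also have "K * ((a2 - a) + (b - b1)) \<le> K * (\<delta> + \<delta>)" using a2 b1 K(1) by (intro mult_left_mono) auto
   finally show ?thesis using Kd by linarith
  qed
  have ev1: "eventually (\<lambda>h. dist (?I (f h) a1 b2) (?I g a1 b2) < e / 2) F"
   by (rule tendstoD[OF lim[OF a1(1) b2(1)]]) (use a1 b2 ab e in auto)
  have ev2: "eventually (\<lambda>h. dist (?I (f h) a2 b1) (?I g a2 b1) < e / 2) F"
   by (rule tendstoD[OF lim[OF a2(1) b1(1) le]]) (use e in auto)
  from ev1 ev2 show "eventually (\<lambda>h. dist (?I (f h) a b) (?I g a b) < e) F"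
  proof eventually_elim
   case (elim h)
   have "?I (f h) a b \<le> ?I (f h) a1 b2" by (rule set_integral_mono_interval[OF f]) (use a1 b2 in auto)
   moreover have "?I (f h) a2 b1 \<le> ?I (f h) a b" by (rule set_integral_mono_interval[OF f]) (use a2 b1 in auto)
   ultimately show ?case using elim out inn unfolding dist_real_def by linarith
  qed
 qed
qed

lemma interval_lebesgue_integral_clip:
 fixes k :: "real \<Rightarrow> real" and a b :: ereal and N :: real
 assumes ab: "a < b" and N: "0 \<le> N" and k: "\<And>x. N \<le> \<bar>x\<bar> \<Longrightarrow> k x = 0"
  and km [measurable]: "k \<in> borel_measurable borel"
 shows "(LBINT x=a..b. k x) = (LINT x:{real_of_ereal (max a (- N))..real_of_ereal (min b N)}|lborel. k x)"
proof -
 obtain u where u: "max a (ereal (- N)) = ereal u \<or> max a (ereal (- N)) = \<infinity>" "u = real_of_ereal (max a (ereal (- N)))"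
  by (cases a) (auto simp: max_def)
 have a1: "max a (ereal (- N)) = ereal u" using u ab by (cases a; cases b) (auto simp: max_def split: if_splits)
 obtain v where v: "min b (ereal N) = ereal v" "v = real_of_ereal (min b (ereal N))"
  using ab by (cases a; cases b) (auto simp: min_def)
 have "(LBINT x=a..b. k x) = (LINT x|lborel. indicator (einterval a b) x *\<^sub>R k x)"
  using ab by (simp add: interval_lebesgue_integral_def set_lebesgue_integral_def)
 also have "\<dots> = (LINT x|lborel. indicator {u..v} x *\<^sub>R k x)"
 proof (rule Bochner_Integration.integral_cong_AE)
  have "AE x in lborel. x \<noteq> u \<and> x \<noteq> v" using AE_lborel_singleton[of u] AE_lborel_singleton[of v] by eventually_elim simp
  then show "AE x in lborel. indicator (einterval a b) x *\<^sub>R k x = indicator {u..v} x *\<^sub>R k x"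
  proof eventually_elim
   case (elim x)
   show ?case
   proof (cases "\<bar>x\<bar> < N")
    case True
    have "a < ereal x \<longleftrightarrow> u \<le> x"
    proof -
    have "a < ereal x \<longleftrightarrow> max a (ereal (- N)) < ereal x" using True by auto
    also have "\<dots> \<longleftrightarrow> u < x" unfolding a1 by simp
    finally show ?thesis using elim by auto
    qed
    moreover have "ereal x < b \<longleftrightarrow> x \<le> v"
    proof -
    have "ereal x < b \<longleftrightarrow> ereal x < min b (ereal N)" using True by auto
    also have "\<dots> \<longleftrightarrow> x < v" unfolding v(1) by simp
    finally show ?thesis using elim by auto
    qed
    ultimately show ?thesis by (simp add: indicator_def einterval_def)
   next
    case False
    then show ?thesis using k[of x] by simp
   qed
  qed
 qed measurable
 finally show ?thesis unfolding set_lebesgue_integral_def u(2) v(2) by simp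
qed

section \<open>Almost sure convergence\<close>

text \<open>Summable expectations force an almost surely finite sum.\<close>

lemma AE_suminf_finite:
 fixes f :: "nat \<Rightarrow> 'a \<Rightarrow> ennreal"
 assumes f: "\<And>k. f k \<in> borel_measurable M" "\<And>k. (\<integral>\<^sup>+w. f k w \<partial>M) \<le> ennreal (c k)"
  and c: "summable c" "\<And>k. 0 \<le> c k"
 shows "AE w in M. (\<Sum>k. f k w) \<noteq> \<top>"
proof -
 have "(\<integral>\<^sup>+w. (\<Sum>k. f k w) \<partial>M) = (\<Sum>k. \<integral>\<^sup>+w. f k w \<partial>M)" by (rule nn_integral_suminf[OF f(1)])
 also have "\<dots> \<le> (\<Sum>k. ennreal (c k))" by (intro suminf_le f(2)) auto
 also have "\<dots> = ennreal (\<Sum>k. c k)" by (rule suminf_ennreal2[OF c(2) c(1)])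
 finally have "(\<integral>\<^sup>+w. (\<Sum>k. f k w) \<partial>M) \<noteq> \<infinity>" by (auto simp: top_unique)
 then show ?thesis using nn_integral_PInf_AE[of "\<lambda>w. \<Sum>k. f k w" M] f(1) by auto
qed

context cont_blt begin

text \<open>A path is bounded up to time \<open>t\<close>, and occupation integrals of tents away from its range vanish.\<close>

lemma local_time_compact_support:
 assumes t: "0 \<le> t"
 shows "AE w in M. \<exists>R::nat. \<forall>x. real R \<le> \<bar>x\<bar> \<longrightarrow> L x t w = 0"
 using L_limit
proof eventually_elim
 case (elim w)
 have "compact ((\<lambda>s. B s w) ` {0..t})" by (intro compact_continuous_image continuous_on_subset[OF B_cont]) auto
 then have "bounded ((\<lambda>s. B s w) ` {0..t})" by (rule compact_imp_bounded)
 then obtain K where K: "\<forall>s\<in>{0..t}. \<bar>B s w\<bar> \<le> K" unfolding bounded_iff by auto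
 show ?case
 proof (intro exI allI impI)
  fix x :: real assume x: "real (nat \<lceil>K\<rceil> + 1) \<le> \<bar>x\<bar>"
  have z: "AR (tent \<epsilon> x) t w = 0" if "0 < \<epsilon>" "\<epsilon> < 1" for \<epsilon>
  proof -
   have "tent \<epsilon> x (B s w) = 0" if "s \<in> {0..t}" for s
   proof (rule tent_eq_0)
    have "\<bar>B s w\<bar> \<le> K" using K that by blast
    then show "\<epsilon> \<le> \<bar>B s w - x\<bar>" using x \<open>\<epsilon> < 1\<close> by linarith
   qed
   then have "AR (tent \<epsilon> x) t w = (LINT s:{0..t}|lborel. 0)"
    unfolding AR_def by (intro set_lebesgue_integral_cong) auto
   then show ?thesis by (simp add: set_lebesgue_integral_def)
  qed
  have "eventually (\<lambda>\<epsilon>::real. \<epsilon> \<in> {0<..<1}) (at_right 0)" by (rule eventually_at_right_real) simp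
  then have "eventually (\<lambda>\<epsilon>. AR (tent \<epsilon> x) t w = 0) (at_right 0)" by eventually_elim (auto intro: z)
  then have "((\<lambda>\<epsilon>. AR (tent \<epsilon> x) t w) \<longlongrightarrow> 0) (at_right 0)" by (rule tendsto_eventually)
  moreover have "((\<lambda>\<epsilon>. AR (tent \<epsilon> x) t w) \<longlongrightarrow> L x t w) (at_right 0)" using elim t by blast
  ultimately show "L x t w = 0" using tendsto_unique trivial_limit_at_right_real by blast
 qed
qed

text \<open>The moments of order \<open>2 * n\<close> of all dyadic increments are summed, with weights, into one
 integrable random variable; its finiteness bounds every increment at once.\<close>

lemma dyadic_increments_bounded:
 fixes R n :: nat
 assumes t: "0 \<le> t" and n: "2 \<le> n"
 shows "AE w in M. \<exists>C\<ge>0. \<forall>k::nat. \<forall>j\<in>{- int R * 2 ^ k..int R * 2 ^ k}.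
  \<bar>L (real_of_int (j + 1) / 2 ^ k) t w - L (real_of_int j / 2 ^ k) t w\<bar> \<le> C * (2 powr - (1/2 - 1 / real n)) ^ k"
proof -
 interpret P: local_time_power M B L 1 n t 0 0
  by unfold_locales (use t n in auto)
 define J where "J k = {- int R * 2 ^ k..int R * 2 ^ k}" for k :: nat
 define v where "v k j w = P.rate (1 / 2 ^ k) (real_of_int j / 2 ^ k) w ^ (2 * n)" for k :: nat and j w
 define f where "f k w = (\<Sum>j\<in>J k. ennreal (v k j w * (1/4) ^ k))" for k w
 have v0: "0 \<le> v k j w" for k j w unfolding v_def power_mult by simp
 have vm [measurable]: "v k j \<in> borel_measurable M" for k j unfolding v_def by measurable
 have fin: "finite (J k)" for k unfolding J_def by simp
 have A0: "0 \<le> P.rate_moment_bound" unfolding P.rate_moment_bound_def by simp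
 have "AE w in M. (\<Sum>k. f k w) \<noteq> \<top>"
 proof (rule AE_suminf_finite[where c="\<lambda>k. (2 * real R + 1) * P.rate_moment_bound * (1/2) ^ k"])
  show "f k \<in> borel_measurable M" for k unfolding f_def by measurable
  show "summable (\<lambda>k. (2 * real R + 1) * P.rate_moment_bound * (1/2) ^ k)" by (intro summable_mult summable_geometric) simp
  show "0 \<le> (2 * real R + 1) * P.rate_moment_bound * (1/2) ^ k" for k using A0 by simp
  fix k
  have one: "(\<integral>\<^sup>+w. ennreal (v k j w * (1/4) ^ k) \<partial>M) \<le> ennreal (P.rate_moment_bound * (1/4) ^ k)" for j
  proof -
   have h: "0 < 1 / (2::real) ^ k" "1 / (2::real) ^ k \<le> 1" by (simp_all add: one_le_power)
   have i: "integrable M (v k j)" unfolding v_def by (rule P.rate_moment(1)[OF h])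
   have "(\<integral>\<^sup>+w. ennreal (v k j w * (1/4) ^ k) \<partial>M) = ennreal (LINT w|M. v k j w * (1/4) ^ k)"
    by (rule nn_integral_eq_integral[OF integrable_mult_left[OF i]]) (intro AE_I2 mult_nonneg_nonneg v0, simp)
   also have "\<dots> = ennreal ((LINT w|M. v k j w) * (1/4) ^ k)" unfolding integral_mult_left_zero ..
   also have "\<dots> \<le> ennreal (P.rate_moment_bound * (1/4) ^ k)"
    using P.rate_moment(2)[OF h] unfolding v_def by (intro ennreal_leI mult_right_mono) auto
   finally show ?thesis .
  qed
  have "(\<integral>\<^sup>+w. f k w \<partial>M) = (\<Sum>j\<in>J k. \<integral>\<^sup>+w. ennreal (v k j w * (1/4) ^ k) \<partial>M)"
   unfolding f_def by (rule nn_integral_sum) measurable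
  also have "\<dots> \<le> (\<Sum>j\<in>J k. ennreal (P.rate_moment_bound * (1/4) ^ k))" by (rule sum_mono) (rule one)
  also have "\<dots> = ennreal (\<Sum>j\<in>J k. P.rate_moment_bound * (1/4) ^ k)" using A0 by (intro sum_ennreal) simp
  also have "\<dots> \<le> ennreal ((2 * real R + 1) * P.rate_moment_bound * (1/2) ^ k)"
  proof (rule ennreal_leI)
   have "real (card (J k)) = 2 * real R * 2 ^ k + 1"
   proof -
    have "int (card (J k)) = 2 * int R * 2 ^ k + 1" unfolding J_def by simp
    then have "real_of_int (int (card (J k))) = real_of_int (2 * int R * 2 ^ k + 1)" by (rule arg_cong)
    then show ?thesis by simp
   qed
   also have "\<dots> \<le> (2 * real R + 1) * 2 ^ k" by (simp add: distrib_right one_le_power)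
   finally have "real (card (J k)) * (P.rate_moment_bound * (1/4) ^ k) \<le> (2 * real R + 1) * 2 ^ k * (P.rate_moment_bound * (1/4) ^ k)"
    using A0 by (intro mult_right_mono) auto
   also have "\<dots> = (2 * real R + 1) * P.rate_moment_bound * (2 ^ k * (1/4) ^ k)" by (simp only: mult_ac)
   also have "2 ^ k * (1/4) ^ k = ((1/2) ^ k :: real)" unfolding power_mult_distrib[symmetric] by simp
   finally show "(\<Sum>j\<in>J k. P.rate_moment_bound * (1/4) ^ k) \<le> (2 * real R + 1) * P.rate_moment_bound * (1/2) ^ k" by simp
  qed
  finally show "(\<integral>\<^sup>+w. f k w \<partial>M) \<le> ennreal ((2 * real R + 1) * P.rate_moment_bound * (1/2) ^ k)" .
 qed
 then show ?thesis
 proof eventually_elim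
  case (elim w)
  define S where "S = enn2real (\<Sum>k. f k w)"
  have S: "(\<Sum>k. f k w) = ennreal S" unfolding S_def using elim by (simp add: less_top)
  have S0: "0 \<le> S" unfolding S_def by simp
  show ?case
  proof (intro exI[of _ "S powr (1 / (2 * real n))"] conjI allI ballI)
   show "0 \<le> S powr (1 / (2 * real n))" by simp
   fix k :: nat and j assume j: "j \<in> {- int R * 2 ^ k..int R * 2 ^ k}"
   let ?r = "P.rate (1 / 2 ^ k) (real_of_int j / 2 ^ k) w"
   have "ennreal (v k j w * (1/4) ^ k) \<le> f k w"
    unfolding f_def by (rule member_le_sum) (use j fin in \<open>auto simp: J_def\<close>)
   also have "\<dots> \<le> (\<Sum>k. f k w)" using sum_le_suminf[of "\<lambda>k. f k w" "{k}"] by simp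
   finally have "v k j w * (1/4) ^ k \<le> S" unfolding S using S0 by simp
   then have vb: "\<bar>?r\<bar> ^ (2 * n) \<le> S * 4 ^ k"
    unfolding v_def by (simp add: power_one_over field_simps power_even_abs)
   have "\<bar>?r\<bar> = (\<bar>?r\<bar> ^ (2 * n)) powr (1 / (2 * real n))"
   proof (cases "?r = 0")
    case False
    then have "\<bar>?r\<bar> ^ (2 * n) = \<bar>?r\<bar> powr (2 * real n)" using powr_realpow[of "\<bar>?r\<bar>" "2 * n"] by simp
    then show ?thesis using n False by (simp add: powr_powr)
   qed (use n in simp)
   also have "\<dots> \<le> (S * 4 ^ k) powr (1 / (2 * real n))" using vb by (intro powr_mono2) auto
   also have "\<dots> = S powr (1 / (2 * real n)) * (2 powr (1 / real n)) ^ k"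
   proof -
    have "(4 ^ k) powr (1 / (2 * real n)) = (2 powr (1 / real n)) ^ (k::nat)"
    proof -
    have "(4::real) ^ k = 2 powr (2 * real k)" by (simp add: powr_realpow[symmetric] powr_powr[symmetric])
    then have "(4 ^ k) powr (1 / (2 * real n)) = 2 powr (real k / real n)" by (simp add: powr_powr)
    also have "\<dots> = (2 powr (1 / real n)) powr real k" by (simp add: powr_powr)
    finally show ?thesis by (simp add: powr_realpow)
    qed
    then show ?thesis using S0 by (simp add: powr_mult)
   qed
   finally have rb: "\<bar>?r\<bar> \<le> S powr (1 / (2 * real n)) * (2 powr (1 / real n)) ^ k" .
   have sh: "sqrt (1 / 2 ^ k) = (2 powr (- (1/2))) ^ k"
   proof -
    have "2 powr (- (1/2)) = 1 / sqrt 2" by (simp add: powr_minus_divide powr_half_sqrt)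
    then show ?thesis by (simp add: real_sqrt_divide real_sqrt_power power_one_over)
   qed
   have pt: "real_of_int j / 2 ^ k + 1 / 2 ^ k = real_of_int (j + 1) / 2 ^ k" by (simp add: add_divide_distrib)
   have "L (real_of_int (j + 1) / 2 ^ k) t w - L (real_of_int j / 2 ^ k) t w = ?r * sqrt (1 / 2 ^ k)"
    unfolding P.rate_def pt by simp
   then have "\<bar>L (real_of_int (j + 1) / 2 ^ k) t w - L (real_of_int j / 2 ^ k) t w\<bar> = \<bar>?r\<bar> * (2 powr (- (1/2))) ^ k"
    unfolding sh by (simp add: abs_mult)
   also have "\<dots> \<le> (S powr (1 / (2 * real n)) * (2 powr (1 / real n)) ^ k) * (2 powr (- (1/2))) ^ k"
    by (rule mult_right_mono[OF rb]) simp
   also have "\<dots> = S powr (1 / (2 * real n)) * (2 powr - (1/2 - 1 / real n)) ^ k"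
   proof -
    have "2 powr (1 / real n) * 2 powr (- (1/2)) = 2 powr - (1/2 - 1 / real n)" unfolding powr_add[symmetric] by simp
    then show ?thesis by (simp only: mult.assoc power_mult_distrib[symmetric])
   qed
   finally show "\<bar>L (real_of_int (j + 1) / 2 ^ k) t w - L (real_of_int j / 2 ^ k) t w\<bar>
    \<le> S powr (1 / (2 * real n)) * (2 powr - (1/2 - 1 / real n)) ^ k" .
  qed
 qed
qed

text \<open>Moments of all even orders give every exponent below 1/2. Outside the support dyadic increments vanish, so the bounds hold on the whole line.\<close>

lemma local_time_holder:
 assumes t: "0 \<le> t" and n: "3 \<le> n"
 shows "AE w in M. \<exists>(R::nat) K. (\<forall>x. real R \<le> \<bar>x\<bar> \<longrightarrow> L x t w = 0) \<and> 0 \<le> K \<and>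
  (\<forall>x y. \<bar>x - y\<bar> \<le> 1 \<longrightarrow> \<bar>L x t w - L y t w\<bar> \<le> K * \<bar>x - y\<bar> powr (1/2 - 1 / real n))"
proof -
 have n2: "2 \<le> n" using n by simp
 have "AE w in M. \<forall>R::nat. \<exists>C\<ge>0. \<forall>k::nat. \<forall>j\<in>{- int R * 2 ^ k..int R * 2 ^ k}.
  \<bar>L (real_of_int (j + 1) / 2 ^ k) t w - L (real_of_int j / 2 ^ k) t w\<bar> \<le> C * (2 powr - (1/2 - 1 / real n)) ^ k"
  unfolding AE_all_countable by (intro allI dyadic_increments_bounded[OF t n2])
 with local_time_compact_support[OF t] show ?thesis
 proof eventually_elim
  case (elim w)
  then obtain R :: nat where R: "\<And>x. real R \<le> \<bar>x\<bar> \<Longrightarrow> L x t w = 0" by blast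
  obtain C where C: "0 \<le> C" "\<forall>k::nat. \<forall>j\<in>{- int R * 2 ^ k..int R * 2 ^ k}.
   \<bar>L (real_of_int (j + 1) / 2 ^ k) t w - L (real_of_int j / 2 ^ k) t w\<bar> \<le> C * (2 powr - (1/2 - 1 / real n)) ^ k"
   using elim(2) by blast
  have inc: "\<bar>L (real_of_int (j + 1) / 2 ^ k) t w - L (real_of_int j / 2 ^ k) t w\<bar> \<le> C * (2 powr - (1/2 - 1 / real n)) ^ k" for k :: nat and j :: int
  proof (cases "j \<in> {- int R * 2 ^ k..int R * 2 ^ k}")
   case True
   then show ?thesis using C(2) by blast
  next
   case False
   then consider "j + 1 \<le> - int R * 2 ^ k" | "int R * 2 ^ k \<le> j" by fastforce
   then have "real R \<le> \<bar>real_of_int (j + 1) / 2 ^ k\<bar> \<and> real R \<le> \<bar>real_of_int j / 2 ^ k\<bar>"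
   proof cases
    case 1
    have "real_of_int (j + 1) \<le> real_of_int (- int R * 2 ^ k)" using 1 by (simp only: of_int_le_iff)
    then have "real_of_int (j + 1) \<le> - (real R * 2 ^ k)" by simp
    moreover from this have "real_of_int j \<le> - (real R * 2 ^ k)" by simp
    ultimately have "real R * 2 ^ k \<le> \<bar>real_of_int (j + 1)\<bar>" "real R * 2 ^ k \<le> \<bar>real_of_int j\<bar>" by linarith+
    then show ?thesis by (simp add: abs_divide pos_le_divide_eq del: of_int_add)
   next
    case 2
    have "real_of_int (int R * 2 ^ k) \<le> real_of_int j" using 2 by (simp only: of_int_le_iff)
    then have "real R * 2 ^ k \<le> real_of_int j" by simp
    moreover have "(0::real) \<le> real R * 2 ^ k" by simp
    ultimately have "real R * 2 ^ k \<le> \<bar>real_of_int (j + 1)\<bar>" "real R * 2 ^ k \<le> \<bar>real_of_int j\<bar>" unfolding of_int_add of_int_1 by linarith+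
    then show ?thesis by (simp add: abs_divide pos_le_divide_eq del: of_int_add)
   qed
   then show ?thesis using R C(1) by simp
  qed
  have g: "0 < 1/2 - 1 / real n" using n by (simp add: field_simps)
  obtain K where "0 \<le> K" "\<And>x y. \<bar>x - y\<bar> \<le> 1 \<Longrightarrow> \<bar>L x t w - L y t w\<bar> \<le> K * \<bar>x - y\<bar> powr (1/2 - 1 / real n)"
   using dyadic_holder[OF L_cont_x g C(1) inc] by blast
  then show ?case using R by blast
 qed
qed

text \<open>The exponent 512 turns the rate \<open>h powr (1/256)\<close> into the summable \<open>1 / (k + 1)\<^sup>2\<close>.\<close>

lemma rate_sequence_limit:
 assumes t: "0 \<le> t" and p: "1 \<le> p" and ab: "a \<le> b"
 shows "AE w in M. (\<lambda>k. LINT x:{a..b}|lborel. \<bar>(L (x + 1 / (real k + 1) ^ 512) t w - L x t w) / sqrt (1 / (real k + 1) ^ 512)\<bar> powr p)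
  \<longlonglongrightarrow> bm_const p * (LINT x:{a..b}|lborel. L x t w powr (p / 2))"
proof -
 define h where "h k = 1 / (real k + 1) ^ 512" for k :: nat
 have h: "0 < h k" "h k \<le> 1" for k unfolding h_def by (simp_all add: one_le_power)
 interpret P: local_time_power M B L p "nat \<lceil>p\<rceil> + 1" t a b
  by unfold_locales (use t p ab in linarith)+
 obtain K where K: "0 \<le> K" "\<And>h. 0 < h \<Longrightarrow> h \<le> 1 \<Longrightarrow> (\<integral>\<^sup>+w. ennreal \<bar>P.rate_defect h w\<bar> \<partial>M) \<le> ennreal (K * h powr (1/256))"
  using P.rate_defect_L1 by blast
 have hp: "h k powr (1/256) = 1 / (real (Suc k)) ^ 2" for k
 proof -
  have e: "(real k + 1) ^ 512 = (real k + 1) powr 512" by (simp add: powr_numeral)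
  have "((real k + 1) powr 512) powr (1/256) = (real k + 1) powr 2" unfolding powr_powr by simp
  then show ?thesis unfolding h_def e by (simp add: powr_divide powr_numeral add.commute)
 qed
 have "AE w in M. (\<Sum>k. ennreal \<bar>P.rate_defect (h k) w\<bar>) \<noteq> \<top>"
 proof (rule AE_suminf_finite[where c="\<lambda>k. K * (1 / (real (Suc k)) ^ 2)"])
  show "(\<integral>\<^sup>+w. ennreal \<bar>P.rate_defect (h k) w\<bar> \<partial>M) \<le> ennreal (K * (1 / (real (Suc k)) ^ 2))" for k
   using K(2)[OF h] unfolding hp .
  have "summable (\<lambda>n. inverse (real n ^ 2))" by (rule inverse_power_summable) simp
  then have "summable (\<lambda>k. inverse (real (Suc k) ^ 2))" by (subst summable_Suc_iff)
  then show "summable (\<lambda>k. K * (1 / (real (Suc k)) ^ 2))" by (intro summable_mult) (simp add: inverse_eq_divide)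
  show "(\<lambda>w. ennreal \<bar>P.rate_defect (h k) w\<bar>) \<in> borel_measurable M" for k by measurable
 qed (use K(1) in simp)
 then show ?thesis
 proof eventually_elim
  case (elim w)
  have "summable (\<lambda>k. \<bar>P.rate_defect (h k) w\<bar>)" by (rule summable_suminf_not_top[OF _ elim]) simp
  then have "(\<lambda>k. \<bar>P.rate_defect (h k) w\<bar>) \<longlonglongrightarrow> 0" by (rule summable_LIMSEQ_zero)
  then have "(\<lambda>k. P.rate_defect (h k) w) \<longlonglongrightarrow> 0" by (rule tendsto_rabs_zero_cancel)
  then have "(\<lambda>k. P.rate_defect (h k) w + bm_const p * (LINT x|Iv a b. L x t w powr (p / 2))) \<longlonglongrightarrow> 0 + bm_const p * (LINT x|Iv a b. L x t w powr (p / 2))"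
   by (intro tendsto_add tendsto_const)
  then show ?case
   unfolding P.rate_defect_def
   by (simp only: diff_add_cancel add_0 P.rate_def Iv_integral[OF borel_measurable_continuous_onI[OF P.continuous_terms(3)], unfolded P.rate_def]
    Iv_integral[OF borel_measurable_continuous_onI[OF P.continuous_terms(4)]] h_def)
 qed
qed

lemma local_time_power_variation_cont:
 assumes t: "0 \<le> t" and p: "1 \<le> p"
 shows "AE w in M. \<forall>a b :: ereal. a < b \<longrightarrow>
  ((\<lambda>h::real. LBINT x=a..b. \<bar>(L (x + h) t w - L x t w) / h powr (1 / 2)\<bar> powr p)
   \<longlongrightarrow> bm_const p * (LBINT x=a..b. \<bar>L x t w\<bar> powr (p / 2))) (at_right 0)"
proof -
 define n where "n = nat \<lceil>2048 * p\<rceil> + 4"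
 define \<epsilon> where "\<epsilon> = 1 / real n"
 have n: "3 \<le> n" "2048 * p < real n" unfolding n_def by linarith+
 have n4: "4 \<le> n" unfolding n_def by simp
 have e: "0 < \<epsilon>" "\<epsilon> \<le> 1/4" unfolding \<epsilon>_def using n4 by (simp_all add: field_simps)
 have e2: "real 512 * p * \<epsilon> < 1/4" unfolding \<epsilon>_def using n by (simp add: field_simps)
 have C0: "0 \<le> bm_const p" using p unfolding bm_const_def by (intro mult_nonneg_nonneg divide_nonneg_nonneg less_imp_le[OF Gamma_real_pos]) auto
 have "AE w in M. \<forall>a\<in>\<rat>. \<forall>b\<in>\<rat>. a \<le> b \<longrightarrow> (\<lambda>k. LINT x:{a..b}|lborel. \<bar>(L (x + 1 / (real k + 1) ^ 512) t w - L x t w) / sqrt (1 / (real k + 1) ^ 512)\<bar> powr p)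
  \<longlonglongrightarrow> bm_const p * (LINT x:{a..b}|lborel. L x t w powr (p / 2))"
  by (simp only: AE_ball_countable[OF countable_rat]) (intro ballI AE_impI rate_sequence_limit[OF t p])
 with local_time_holder[OF t n(1)] show ?thesis
 proof eventually_elim
  case (elim w)
  let ?f = "\<lambda>x. L x t w"
  obtain R :: nat and K where R: "\<And>x. real R \<le> \<bar>x\<bar> \<Longrightarrow> ?f x = 0" and K: "0 \<le> K"
   and hol: "\<And>x y. \<bar>x - y\<bar> \<le> 1 \<Longrightarrow> \<bar>?f x - ?f y\<bar> \<le> K * \<bar>x - y\<bar> powr (1/2 - \<epsilon>)"
   using elim(1) unfolding \<epsilon>_def by blast
  define z where "z h x = \<bar>(?f (x + h) - ?f x) / sqrt h\<bar> powr p" for h x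
  define g where "g x = bm_const p * ?f x powr (p / 2)" for x
  have zc: "continuous_on UNIV (z h)" for h
   unfolding z_def divide_inverse using p
   by (intro continuous_on_powr' continuous_intros continuous_on_compose2[OF L_cont_x]) auto
  have z0: "0 \<le> z h x" for h x unfolding z_def by simp
  have gc: "continuous_on UNIV g" unfolding g_def using p
   by (auto intro!: continuous_intros continuous_on_powr' L_cont_x L_nonneg)
  have g0: "0 \<le> g x" for x unfolding g_def using C0 by simp
  have ig: "(LINT x:A|lborel. g x) = bm_const p * (LINT x:A|lborel. ?f x powr (p / 2))" for A
   unfolding g_def by (rule set_integral_mult_right)
  obtain \<nu> :: "real \<Rightarrow> nat" and \<kappa> :: "real \<Rightarrow> real" where nu: "filterlim \<nu> at_top (at_right 0)" and ka: "(\<kappa> \<longlongrightarrow> 0) (at_right 0)"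
   and zk: "\<And>h x. 0 < h \<Longrightarrow> h \<le> 1 \<Longrightarrow> \<bar>z h x - z (1 / (real (\<nu> h) + 1) ^ 512) x\<bar> \<le> \<kappa> h"
   unfolding z_def using rate_interpolation[OF p K e _ e2 hol] by (metis (no_types, lifting) one_le_numeral)
  have ev: "eventually (\<lambda>h::real. h \<in> {0<..<1}) (at_right 0)" by (rule eventually_at_right_real) simp
  have rat: "((\<lambda>h. LINT x:{a..b}|lborel. z h x) \<longlongrightarrow> (LINT x:{a..b}|lborel. g x)) (at_right 0)"
   if ab: "a \<in> \<rat>" "b \<in> \<rat>" "a \<le> b" for a b
  proof -
   let ?I = "\<lambda>h. LINT x:{a..b}|lborel. z h x"
   have "(\<lambda>k. ?I (1 / (real k + 1) ^ 512)) \<longlonglongrightarrow> (LINT x:{a..b}|lborel. g x)"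
    unfolding ig z_def using elim(2) ab by blast
   from filterlim_compose[OF this nu] have 1: "((\<lambda>h. ?I (1 / (real (\<nu> h) + 1) ^ 512)) \<longlongrightarrow> (LINT x:{a..b}|lborel. g x)) (at_right 0)" .
   have "((\<lambda>h. (b - a) * \<kappa> h) \<longlongrightarrow> (b - a) * 0) (at_right 0)" by (intro tendsto_intros ka)
   then have k0: "((\<lambda>h. (b - a) * \<kappa> h) \<longlongrightarrow> 0) (at_right 0)" by simp
   have 2: "((\<lambda>h. ?I h - ?I (1 / (real (\<nu> h) + 1) ^ 512)) \<longlongrightarrow> 0) (at_right 0)"
   proof (rule Lim_null_comparison[OF _ k0])
    show "eventually (\<lambda>h. norm (?I h - ?I (1 / (real (\<nu> h) + 1) ^ 512)) \<le> (b - a) * \<kappa> h) (at_right 0)"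
    using ev
    proof eventually_elim
    case (elim h)
    let ?u = "\<lambda>x. z h x - z (1 / (real (\<nu> h) + 1) ^ 512) x"
    have um: "?u \<in> borel_measurable borel" by (intro borel_measurable_continuous_onI continuous_on_diff zc)
    have "?I h - ?I (1 / (real (\<nu> h) + 1) ^ 512) = (LINT x:{a..b}|lborel. ?u x)"
    by (rule set_integral_diff(2)[symmetric]) (rule set_integrable_continuous_real[OF zc])+
    also have "\<dots> = (LINT x|Iv a b. ?u x)" by (rule Iv_integral[OF um, symmetric])
    finally show ?case
    using Iv_integral_bound[OF um _ ab(3), of "\<kappa> h"] zk[of h] elim by simp
    qed
   qed
   from tendsto_add[OF 1 2] show ?thesis by simp
  qed
  have real_lim: "((\<lambda>h. LINT x:{a..b}|lborel. z h x) \<longlongrightarrow> (LINT x:{a..b}|lborel. g x)) (at_right 0)" for a b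
   by (rule interval_limit_from_rationals[OF zc z0 gc g0 rat])
  show ?case
  proof (intro allI impI)
   fix a b :: ereal assume ab: "a < b"
   define N where "N = real R + 1"
   let ?a = "real_of_ereal (max a (- N))" and ?b = "real_of_ereal (min b N)"
   have N0: "0 \<le> N" unfolding N_def by simp
   have gz: "g x = 0" if "N \<le> \<bar>x\<bar>" for x using R[of x] that p unfolding g_def N_def by simp
   have eg: "(LBINT x=a..b. g x) = (LINT x:{?a..?b}|lborel. g x)"
    by (rule interval_lebesgue_integral_clip[OF ab N0 gz borel_measurable_continuous_onI[OF gc]])
   have ez: "(LBINT x=a..b. z h x) = (LINT x:{?a..?b}|lborel. z h x)" if "h \<in> {0<..<1}" for h
   proof (rule interval_lebesgue_integral_clip[OF ab N0 _ borel_measurable_continuous_onI[OF zc]])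
    fix x assume "N \<le> \<bar>x\<bar>"
    then have "real R \<le> \<bar>x\<bar>" "real R \<le> \<bar>x + h\<bar>" using that unfolding N_def by auto
    then show "z h x = 0" unfolding z_def using R by simp
   qed
   have t1: "((\<lambda>h. LBINT x=a..b. z h x) \<longlongrightarrow> (LBINT x=a..b. g x)) (at_right 0)"
   proof (rule Lim_transform_eventually)
    show "((\<lambda>h. LINT x:{?a..?b}|lborel. z h x) \<longlongrightarrow> (LBINT x=a..b. g x)) (at_right 0)" unfolding eg by (rule real_lim)
    show "eventually (\<lambda>h. (LINT x:{?a..?b}|lborel. z h x) = (LBINT x=a..b. z h x)) (at_right 0)"
    using ev by eventually_elim (rule ez[symmetric])
   qed
   have "(LBINT x=a..b. g x) = bm_const p * (LBINT x=a..b. \<bar>L x t w\<bar> powr (p / 2))"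
   proof -
    have "g x = bm_const p * \<bar>L x t w\<bar> powr (p / 2)" for x unfolding g_def using L_nonneg[of x t w] by simp
    then show ?thesis by simp
   qed
   with t1 have t2: "((\<lambda>h. LBINT x=a..b. z h x) \<longlongrightarrow> bm_const p * (LBINT x=a..b. \<bar>L x t w\<bar> powr (p / 2))) (at_right 0)" by simp
   show "((\<lambda>h::real. LBINT x=a..b. \<bar>(L (x + h) t w - L x t w) / h powr (1 / 2)\<bar> powr p)
    \<longlongrightarrow> bm_const p * (LBINT x=a..b. \<bar>L x t w\<bar> powr (p / 2))) (at_right 0)"
   proof (rule Lim_transform_eventually[OF t2])
    show "eventually (\<lambda>h. (LBINT x=a..b. z h x) = (LBINT x=a..b. \<bar>(L (x + h) t w - L x t w) / h powr (1 / 2)\<bar> powr p)) (at_right 0)"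
    using ev by eventually_elim (simp add: z_def powr_half_sqrt)
   qed
  qed
 qed
qed

end

section \<open>Passing to a regular version\<close>

text \<open>Independence of a finite family is a property of its joint law, which null sets do not affect.\<close>

lemma (in prob_space) indep_vars_cong_AE:
 assumes X: "indep_vars (\<lambda>_. borel) X I" and fin: "finite I"
  and Ym: "\<And>i. i \<in> I \<Longrightarrow> Y i \<in> borel_measurable M"
  and eq: "\<And>i. i \<in> I \<Longrightarrow> AE w in M. Y i w = (X i w :: real)"
 shows "indep_vars (\<lambda>_. borel) Y I"
proof (cases "I = {}")
 case True
 then show ?thesis by (simp add: indep_vars_def indep_sets_def)
next
 case False
 have Xm: "\<And>i. i \<in> I \<Longrightarrow> X i \<in> borel_measurable M" using X unfolding indep_vars_def by auto
 have "AE w in M. \<forall>i\<in>I. Y i w = X i w" using eq fin by (simp add: AE_finite_all)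
 then have "AE w in M. (\<lambda>i\<in>I. Y i w) = (\<lambda>i\<in>I. X i w)" by eventually_elim (auto simp: restrict_def)
 then have 1: "distr M (Pi\<^sub>M I (\<lambda>_. borel)) (\<lambda>w. \<lambda>i\<in>I. Y i w) = distr M (Pi\<^sub>M I (\<lambda>_. borel)) (\<lambda>w. \<lambda>i\<in>I. X i w)"
  by (intro distr_cong_AE refl measurable_restrict Xm Ym)
 have "distr M borel (Y i) = distr M borel (X i)" if "i \<in> I" for i
  by (intro distr_cong_AE refl eq[OF that] Xm[OF that] Ym[OF that])
 then have 2: "Pi\<^sub>M I (\<lambda>i. distr M borel (Y i)) = Pi\<^sub>M I (\<lambda>i. distr M borel (X i))" by (intro PiM_cong) auto
 have "distr M (Pi\<^sub>M I (\<lambda>_. borel)) (\<lambda>w. \<lambda>i\<in>I. X i w) = Pi\<^sub>M I (\<lambda>i. distr M borel (X i))"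
  using X indep_vars_iff_distr_eq_PiM'[where X=X and M'="\<lambda>_. borel", OF False Xm] by blast
 then show ?thesis using indep_vars_iff_distr_eq_PiM'[where X=Y and M'="\<lambda>_. borel", OF False Ym] unfolding 1 2 by blast
qed

text \<open>Only values near \<open>x\<close> matter, so the continuous function may be frozen outside a neighbourhood and thereby made bounded.\<close>

lemma tent_weighted_limit:
 fixes k :: "real \<Rightarrow> real"
 assumes k: "continuous_on UNIV k"
 shows "((\<lambda>\<epsilon>. LBINT y. tent \<epsilon> x y * k y) \<longlongrightarrow> k x) (at_right 0)"
proof (rule tendstoI)
 fix e :: real assume e: "0 < e"
 define k' where "k' y = k (max (x - 1) (min (x + 1) y))" for y
 have c': "continuous_on UNIV k'" unfolding k'_def
  by (rule continuous_on_compose2[OF k]) (auto intro!: continuous_intros)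
 have "compact (k ` {x - 1..x + 1})" by (intro compact_continuous_image continuous_on_subset[OF k]) auto
 then have "bounded (k ` {x - 1..x + 1})" by (rule compact_imp_bounded)
 then obtain K where K: "\<forall>y\<in>{x - 1..x + 1}. \<bar>k y\<bar> \<le> K" unfolding bounded_iff by auto
 have kb: "\<bar>k' y\<bar> \<le> K" for y unfolding k'_def using K by (auto simp: max_def min_def)
 have km: "k' \<in> borel_measurable borel" by (rule borel_measurable_continuous_onI[OF c'])
 have "isCont k x" using k by (simp add: continuous_on_eq_continuous_at)
 then obtain d where d: "0 < d" "\<And>y. \<bar>y - x\<bar> < d \<Longrightarrow> \<bar>k y - k x\<bar> < e / 2"
  unfolding continuous_at_eps_delta dist_real_def using e by (metis half_gt_zero)
 have "eventually (\<lambda>\<epsilon>::real. \<epsilon> \<in> {0<..<min d 1}) (at_right 0)" by (rule eventually_at_right_real) (use d in simp)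
 then show "eventually (\<lambda>\<epsilon>. dist (LBINT y. tent \<epsilon> x y * k y) (k x) < e) (at_right 0)"
 proof eventually_elim
  case (elim \<epsilon>)
  then have el: "0 < \<epsilon>" "\<epsilon> < d" "\<epsilon> < 1" by auto
  have "tent \<epsilon> x y * k y = tent \<epsilon> x y * k' y" for y
  proof (cases "\<epsilon> \<le> \<bar>y - x\<bar>")
   case False
   then have "max (x - 1) (min (x + 1) y) = y" using el by linarith
   then have "k' y = k y" unfolding k'_def by simp
   then show ?thesis by simp
  qed (simp add: tent_eq_0)
  then have "(LBINT y. tent \<epsilon> x y * k y) = (LBINT y. tent \<epsilon> x y * k' y)" by (simp only:)
  moreover have "\<bar>(LBINT y. tent \<epsilon> x y * k' y) - k x\<bar> \<le> e / 2"
  proof (rule tent_average[OF _ km kb])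
   show "\<bar>k' y - k x\<bar> \<le> e / 2" if "\<bar>y - x\<bar> < \<epsilon>" for y
   proof -
    have "max (x - 1) (min (x + 1) y) = y" using el that by linarith
    then have "k' y = k y" unfolding k'_def by simp
    then show ?thesis using d(2)[of y] that elim by simp
   qed
  qed (use elim in simp)
  ultimately show ?case using e unfolding dist_real_def by linarith
 qed
qed

text \<open>Changing the processes on a null set, and freezing time at 0 for negative times, makes all
 path properties hold identically, so that no exceptional sets have to be carried along.\<close>

lemma regular_version_exists:
 fixes M :: "'w measure" and B :: "real \<Rightarrow> 'w \<Rightarrow> real" and L :: "real \<Rightarrow> real \<Rightarrow> 'w \<Rightarrow> real"
 assumes "brownian_local_time M B L"
 obtains B' L' where "cont_blt M B' L'" "AE \<omega> in M. \<forall>x. \<forall>t\<ge>0. L' x t \<omega> = L x t \<omega>"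
proof -
 interpret brownian_local_time M B L by (rule assms)
 define good where "good \<omega> \<longleftrightarrow> B 0 \<omega> = 0 \<and> continuous_on {0..} (\<lambda>t. B t \<omega>) \<and> continuous_on (UNIV \<times> {0..}) (\<lambda>(x, t). L x t \<omega>) \<and>
  (\<forall>t\<ge>0. \<forall>f :: real \<Rightarrow> real. f \<in> borel_measurable borel \<longrightarrow> bounded (range f) \<longrightarrow>
    (LBINT s:{0..t}. f (B s \<omega>)) = (LBINT x. f x * L x t \<omega>))" for \<omega>
 have AEgood: "AE \<omega> in M. good \<omega>"
  using starts_at_zero continuous_paths jointly_continuous occupation_density unfolding good_def by eventually_elim blast
 obtain N where N: "{\<omega> \<in> space M. \<not> good \<omega>} \<subseteq> N" "N \<in> null_sets M"
  using AEgood by (rule AE_E) (blast intro: null_setsI)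
 define G where "G = space M - N"
 have Gs [measurable]: "G \<in> sets M" unfolding G_def using N(2) by auto
 have G: "good \<omega>" if "\<omega> \<in> G" for \<omega> using that N(1) unfolding G_def by auto
 have AEG: "AE \<omega> in M. \<omega> \<in> G" using AE_not_in[OF N(2)] AE_space unfolding G_def by eventually_elim simp
 define B' where "B' s \<omega> = indicator G \<omega> * B (max 0 s) \<omega>" for s \<omega>
 define L' where "L' x s \<omega> = indicator G \<omega> * L x (max 0 s) \<omega>" for x s \<omega>
 have B'm: "B' s \<in> borel_measurable M" for s
  unfolding B'_def using measurable_process[of "max 0 s"] by (intro borel_measurable_times borel_measurable_indicator Gs) auto
 have L'm: "L' x s \<in> borel_measurable M" for x s
  unfolding L'_def using measurable_local_time[of "max 0 s" x] by (intro borel_measurable_times borel_measurable_indicator Gs) auto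
 have inc: "AE \<omega> in M. B' t \<omega> - B' s \<omega> = B t \<omega> - B s \<omega>" if "0 \<le> s" "0 \<le> t" for s t
  using AEG by eventually_elim (use that in \<open>simp add: B'_def\<close>)
 have mono0: "0 \<le> \<tau> i" if "0 \<le> \<tau> 0" "\<And>i. i < n \<Longrightarrow> \<tau> i \<le> \<tau> (Suc i)" "i \<le> n" for \<tau> :: "nat \<Rightarrow> real" and n i :: nat
  using that(3)
 proof (induction i)
  case (Suc i)
  then show ?case using that(2)[of i] by simp
 qed (use that in simp)
 have bm: "cont_bm M B'"
 proof (intro cont_bm.intro cont_bm_axioms.intro)
  show "prob_space M" by unfold_locales
  show "B' s \<in> borel_measurable M" for s by (rule B'm)
  show "B' 0 \<omega> = 0" for \<omega> using G[of \<omega>] unfolding B'_def good_def by (cases "\<omega> \<in> G") auto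
  show "continuous_on UNIV (\<lambda>t. B' t \<omega>)" for \<omega>
  proof (cases "\<omega> \<in> G")
   case True
   then have "continuous_on {0..} (\<lambda>t. B t \<omega>)" using G unfolding good_def by blast
   then have "continuous_on UNIV (\<lambda>t. B (max 0 t) \<omega>)"
    by (rule continuous_on_compose2) (auto intro!: continuous_intros)
   then show ?thesis using True by (simp add: B'_def)
  qed (simp add: B'_def)
  show "indep_vars (\<lambda>_. borel) (\<lambda>i \<omega>. B' (\<tau> (Suc i)) \<omega> - B' (\<tau> i) \<omega>) {..<n}"
   if \<tau>: "0 \<le> \<tau> 0" "\<And>i. i < n \<Longrightarrow> \<tau> i \<le> \<tau> (Suc i)" for n :: nat and \<tau>
  proof (rule indep_vars_cong_AE[OF independent_increments[of \<tau> n]])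
   show "AE \<omega> in M. B' (\<tau> (Suc i)) \<omega> - B' (\<tau> i) \<omega> = B (\<tau> (Suc i)) \<omega> - B (\<tau> i) \<omega>" if "i \<in> {..<n}" for i
    using that by (intro inc mono0[OF \<tau>]) auto
  qed (use \<tau> B'm in auto)
  show "distributed M lborel (\<lambda>\<omega>. B' t \<omega> - B' s \<omega>) (normal_density 0 (sqrt (t - s)))" if st: "0 \<le> s" "s < t" for s t
  proof -
   have d: "distributed M lborel (\<lambda>\<omega>. B t \<omega> - B s \<omega>) (normal_density 0 (sqrt (t - s)))" by (rule gaussian_increments[OF st])
   have "distr M lborel (\<lambda>\<omega>. B' t \<omega> - B' s \<omega>) = distr M lborel (\<lambda>\<omega>. B t \<omega> - B s \<omega>)"
    by (intro distr_cong_AE refl inc) (use st d B'm in \<open>auto simp: distributed_def\<close>)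
   then show ?thesis using d B'm unfolding distributed_def by auto
  qed
 qed
 interpret X: cont_bm M B' by (rule bm)
 have lim: "((\<lambda>\<epsilon>. X.AR (tent \<epsilon> x) s \<omega>) \<longlongrightarrow> L' x s \<omega>) (at_right 0)" if w: "\<omega> \<in> G" and s: "0 \<le> s" for x s \<omega>
 proof -
  have g: "good \<omega>" by (rule G[OF w])
  have "continuous_on (UNIV \<times> {0..}) (\<lambda>(x, t). L x t \<omega>)" using g unfolding good_def by blast
  then have "continuous_on UNIV (\<lambda>y. case (y, s) of (x, t) \<Rightarrow> L x t \<omega>)"
   by (rule continuous_on_compose2) (use s in \<open>auto intro!: continuous_intros\<close>)
  then have k: "continuous_on UNIV (\<lambda>y. L y s \<omega>)" by simp
  have e: "X.AR (tent \<epsilon> x) s \<omega> = (LBINT y. tent \<epsilon> x y * L y s \<omega>)" if "\<epsilon> \<in> {0<..<1}" for \<epsilon>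
  proof -
   have "bounded (range (tent \<epsilon> x))"
    unfolding bounded_iff using tent_nonneg[of \<epsilon> x] tent_le[of \<epsilon> x] that by (intro exI[of _ "1 / \<epsilon>"]) auto
   moreover have "tent \<epsilon> x \<in> borel_measurable borel" by measurable
   ultimately have "(LBINT s:{0..s}. tent \<epsilon> x (B s \<omega>)) = (LBINT y. tent \<epsilon> x y * L y s \<omega>)"
    using g s unfolding good_def by blast
   moreover have "X.AR (tent \<epsilon> x) s \<omega> = (LBINT u:{0..s}. tent \<epsilon> x (B u \<omega>))"
    unfolding X.AR_def by (rule set_lebesgue_integral_cong) (use w in \<open>auto simp: B'_def\<close>)
   ultimately show ?thesis by simp
  qed
  have "eventually (\<lambda>\<epsilon>::real. \<epsilon> \<in> {0<..<1}) (at_right 0)" by (rule eventually_at_right_real) simp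
  then have "eventually (\<lambda>\<epsilon>. (LBINT y. tent \<epsilon> x y * L y s \<omega>) = X.AR (tent \<epsilon> x) s \<omega>) (at_right 0)"
   by eventually_elim (rule e[symmetric])
  from Lim_transform_eventually[OF tent_weighted_limit[OF k] this]
  show ?thesis using w s by (simp add: L'_def)
 qed
 have AR0: "0 \<le> X.AR (tent \<epsilon> x) s \<omega>" for \<epsilon> x s \<omega>
  unfolding X.AR_def set_lebesgue_integral_def by (rule Bochner_Integration.integral_nonneg) (simp add: tent_nonneg)
 have blt: "cont_blt M B' L'"
 proof (intro cont_blt.intro cont_blt_axioms.intro bm)
  show "L' x s \<in> borel_measurable M" for x s by (rule L'm)
  show "continuous_on UNIV (\<lambda>(x, s). L' x s \<omega>)" for \<omega>
  proof (cases "\<omega> \<in> G")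
   case True
   then have "continuous_on (UNIV \<times> {0..}) (\<lambda>(x, t). L x t \<omega>)" using G unfolding good_def by blast
   then have "continuous_on UNIV (\<lambda>q :: real \<times> real. case (fst q, max 0 (snd q)) of (x, t) \<Rightarrow> L x t \<omega>)"
    by (rule continuous_on_compose2) (auto intro!: continuous_intros)
   then show ?thesis using True by (simp add: L'_def split_def)
  qed (simp add: L'_def split_def)
  show "0 \<le> L' x s \<omega>" for x s \<omega>
  proof (cases "\<omega> \<in> G")
   case True
   have "0 \<le> L' x (max 0 s) \<omega>"
    by (rule tendsto_lowerbound[OF lim[OF True]]) (use AR0 in \<open>auto simp: trivial_limit_at_right_real\<close>)
   then show ?thesis by (simp add: L'_def)
  qed (simp add: L'_def)
  show "AE \<omega> in M. \<forall>s\<ge>0. \<forall>x. ((\<lambda>\<epsilon>. X.AR (tent \<epsilon> x) s \<omega>) \<longlongrightarrow> L' x s \<omega>) (at_right 0)"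
   using AEG by eventually_elim (blast intro: lim)
 qed
 have "AE \<omega> in M. \<forall>x. \<forall>t\<ge>0. L' x t \<omega> = L x t \<omega>"
  using AEG by eventually_elim (simp add: L'_def)
 with blt show ?thesis by (rule that)
qed

section \<open>The power variation of local time\<close>

theorem theorem1p1:
  fixes M :: "'w measure" and B :: "real \<Rightarrow> 'w \<Rightarrow> real" and L :: "real \<Rightarrow> real \<Rightarrow> 'w \<Rightarrow> real"
    and p t :: real
  assumes "brownian_local_time M B L" and "1 \<le> p" and "0 \<le> t"
  shows "AE \<omega> in M. \<forall>a b :: ereal. a < b \<longrightarrow>
    ((\<lambda>h::real. LBINT x=a..b. \<bar>(L (x + h) t \<omega> - L x t \<omega>) / h powr (1 / 2)\<bar> powr p)
      \<longlongrightarrow> 2 powr (3 * p / 2) / sqrt pi * Gamma ((p + 1) / 2)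
          * (LBINT x=a..b. \<bar>L x t \<omega>\<bar> powr (p / 2))) (at_right 0)"
proof -
 obtain B' L' where r: "cont_blt M B' L'" and eq: "AE \<omega> in M. \<forall>x. \<forall>t\<ge>0. L' x t \<omega> = L x t \<omega>"
  using regular_version_exists[OF assms(1)] by blast
 interpret X: cont_blt M B' L' by (rule r)
 from X.local_time_power_variation_cont[OF assms(3,2)] eq show ?thesis
 proof eventually_elim
  case (elim \<omega>)
  have e: "L' x t \<omega> = L x t \<omega>" for x using elim(2) assms(3) by blast
  show ?case using elim(1) unfolding e bm_const_def .
 qed
qed

end
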